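(* Let $M$ be a smooth manifold (possibly with boundary), $E\to M$ a smooth vector bundle, and let $(\mu_1,h_1)$, $(\mu_2,h_2)$ be two mutually bounded LECM-RHM pairs on $E\to M$. Then $L^2(M;E):=L^2(M;E,\mu_1,h_1)=L^2(M;E,\mu_2,h_2)$, with equality as sets and equivalence of norms. Let $D$ be a rough differential operator on $E$. An extension $D_e$ of $D$ is closed and nilpotent with respect to $\|\cdot\|_{(\mu_1,h_1)}$ if and only if it is closed and nilpotent with respect to $\|\cdot\|_{(\mu_2,h_2)}$. For such a $D_e$ (closed and nilpotent), define, for $i=1,2$, $\mathbb D_{e,i}:=D_e+D_e^{*,(\mu_i,h_i)}$ with domain $\mathrm{dom}(D_e)\cap\mathrm{dom}(D_e^{*,(\mu_i,h_i)})$, where $D_e^{*,(\mu_i,h_i)}$ is the adjoint of $D_e$ with respect to $\langle\cdot,\cdot\rangle_{(\mu_i,h_i)}$. Then the following hold. (i) $\mathbb D_{e,i}$ is self-adjoint with respect to $\langle\cdot,\cdot\rangle_{(\mu_i,h_i)}$; in particular it is densely-defined and closed. More generally, the operators $\mathbb D_{e,i}$ are bi-sectorial with respect to either norm. (ii) For all integers $k,l,k',l'\ge 1$, $\ker(\mathbb D_{e,i}^k)=\ker(\mathbb D_{e,i})$ and $\overline{\mathrm{ran}(\mathbb D_{e,i}^l)}=\overline{\mathrm{ran}(\mathbb D_{e,i})}$ for $i=1,2$, and moreover $$L^2(M;E)=\ker(\mathbb D_{e,1}^k)\oplus\overline{\mathrm{ran}(\mathbb D_{e,1}^l)}=\ker(\mathbb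 D_{e,2}^{k'})\oplus\overline{\mathrm{ran}(\mathbb D_{e,1}^{l'})},$$ where the splittings are topological (not in general orthogonal). (iii) $\ker(\mathbb D_{e,1})\cong\ker(\mathbb D_{e,2})$, where an isomorphism is given by $$\Phi:=\mathcal P_{\ker(\mathbb D_{e,1}),\overline{\mathrm{ran}(\mathbb D_{e,1})}}\big|_{\ker(\mathbb D_{e,2})}:\ker(\mathbb D_{e,2})\to\ker(\mathbb D_{e,1}),$$ with inverse $$\Phi^{-1}=\mathcal P_{\ker(\mathbb D_{e,2}),\overline{\mathrm{ran}(\mathbb D_{e,1})}}\big|_{\ker(\mathbb D_{e,1})}:\ker(\mathbb D_{e,1})\to\ker(\mathbb D_{e,2}).$$ (iv) If $E=\bigoplus_{j=1}^K E_j$ and there exists an integer $k\ge1$ such that $[\mathbb D_{e,i}^k,\mathcal P_{E_j,\oplus_{l\ne j}E_l}]=0$ for $i=1,2$ and all $j=1,\dots,K$, then for each $j$ one has $\ker(\mathbb D_{e,1}|_{E_j})\cong\ker(\mathbb D_{e,2}|_{E_j})$, where an isomorphism is given by $$\Phi_j:=\mathcal P_{\ker(\mathbb D_{e,1}),\overline{\mathrm{ran}(\mathbb D_{e,1})}}\big|_{\ker(\mathbb D_{e,2}|_{E_j})}:\ker(\mathbb D_{e,2}|_{E_j})\to\ker(\mathbb D_{e,1}|_{E_j}).$$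
   Context: $M$ is a smooth manifold of dimension $n$, possibly with boundary and possibly non-compact; $\mathscr L$ is Lebesgue measure on $\mathbb R^n$. A "measure" is an outer measure defined on all subsets; $\mathrm{Meas}(\mu)$ is the $\sigma$-algebra of Carathéodory $\mu$-measurable sets and $\mathrm{Zero}(\mu)$ the collection of $\mu$-null sets; $(\mu\llcorner A)(B)=\mu(A\cap B)$. Intrinsic measurability: $\mathrm{Meas}$ is the collection of $A\subset M$ such that $\psi(A\cap U)$ is Lebesgue measurable for every chart $(\psi,U)$; $\mathrm{Zero}$ is the collection of $A\subset M$ with $\mathscr L(\psi(A\cap U))=0$ for every chart. "Almost everywhere" refers to $\mathrm{Zero}$. A section of a bundle is measurable if its coefficients in every local trivialisation are measurable; $L^0(M;E)$ is the set of measurable sections. LECM (locally elliptic compatible measure): a Radon measure $\mu$ with $\mathrm{Meas}(\mu)=\mathrm{Meas}$, $\mathrm{Zero}(\mu)=\mathrm{Zero}$, for which there is a cover of $M$ by charts $(U_\alpha,\psi_\alpha)$ and constants $C_\alpha\ge1$ such that $C_\alpha^{-1}\le \frac{d(\mu\llcorner U_\alpha)}{d\psi_\alpha^*(\mathscr L\llcorner\psi_\alpha(U_\alpha))}\le C_\alpha$ a.e. in $U_\alpha$. RHM (rough Hermitian metric): $h\in L^0(M;\mathrm{Sym}_{\mathbb C}E^*\otimes E^* )$ (a measurable field of Hermitian symmetric forms on the fibres; real symmetric if $E$ is real) for which there is a cover of $M$ by open sets $U_\alpha$, smooth Hermitian metrics $h_\alpha^\infty$ on $E|_{U_\alpha}$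 and constants $C_\alpha\ge1$ with $C_\alpha^{-1}|u|_{h_\alpha^\infty(x)}\le|u|_{h(x)}\le C_\alpha|u|_{h_\alpha^\infty(x)}$ for a.e. $x\in U_\alpha$ and all $u\in E_x$. An LECM-RHM pair $(\mu,h)$ gives the Hilbert space $L^2(M;E,\mu,h)$ of measurable sections $u$ with $\int_M|u|_h^2\,d\mu<\infty$, with inner product $\langle\cdot,\cdot\rangle_{(\mu,h)}$ and norm $\|\cdot\|_{(\mu,h)}$. Mutually bounded: $\mu_1\sim\mu_2$ if $\frac{d\mu_1}{d\mu_2},\frac{d\mu_2}{d\mu_1}\in L^\infty(M)$; $h_1\sim h_2$ if there is $C\ge1$ with $C^{-1}|u|_{h_1(x)}\le|u|_{h_2(x)}\le C|u|_{h_1(x)}$ for a.e. $x\in M$ and all $u\in E_x$; the pairs are mutually bounded if both hold. $C^\infty_{cc}(M;E)$ is the space of smooth sections with compact support in the interior of $M$. A rough differential operator is a (linear) operator $D:C^\infty(M;E)\to L^0(M;E)$ that is local: $\mathrm{spt}\,Df\subset\mathrm{spt}\,f$. An extension of $D$ is an operator $D_e:\mathrm{dom}(D_e)\subset L^2(M;E,\mu,h)\to L^2(M;E,\mu,h)$ with $C^\infty_{cc}(M;E)\subset\mathrm{dom}(D_e)$ and $D_e=D$ on $C^\infty_{cc}(M;E)$. $D_e$ is nilpotent if $\mathrm{ran}(D_e)\subset\ker(D_e)$. $\mathcal P_{A,B}$ is the projection onto $A$ along $B$ for a splitting $A\oplus B$; $\mathcal P_{E_j,\oplus_{l\neq j}E_l}$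 acts pointwise on sections. For such a projection $P$ and an operator $T$, $[T,P]=0$ means: if $u\in\mathrm{dom}(T)$ then $Pu\in\mathrm{dom}(T)$ and $TPu=PTu$. $\ker(\mathbb D_{e,i}|_{E_j})$ denotes the set of $u\in\ker(\mathbb D_{e,i})$ with $u(x)\in E_j$ for a.e. $x$. A closed operator $T$ is bi-sectorial if for some $\omega\in[0,\pi/2)$ its spectrum lies in the closed bisector $S_\omega=\{0\}\cup\{\zeta:|\arg\zeta|\le\omega\text{ or }|\arg(-\zeta)|\le\omega\}$ and for each $\theta\in(\omega,\pi/2)$ there is $C_\theta$ with $|\zeta|\,\|(\zeta-T)^{-1}\|\le C_\theta$ for all $\zeta\notin S_\theta$. *)

theory Defs
  imports "HOL-Analysis.Analysis"
begin

section \<open>Scalars\<close>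

text \<open>
  Vector bundles may be real or complex.  The scalar field is therefore a type of the following
  class: a real normed field with an isometric homomorphism of real algebras into the complex
  numbers.  The image is a subfield containing the reals, so it is either the reals or everything;
  complex conjugation and real parts of scalars are taken after applying \<open>cplx\<close>.
\<close>

class real_or_complex = real_normed_field + euclidean_space +
  fixes cplx :: "'a \<Rightarrow> complex"
  assumes cplx_add: "cplx (x + y) = cplx x + cplx y"
    and cplx_mult: "cplx (x * y) = cplx x * cplx y"
    and cplx_one: "cplx 1 = 1"
    and cplx_scaleR: "cplx (r *\<^sub>R x) = r *\<^sub>R cplx x"
    and norm_cplx: "norm (cplx x) = norm x"

instantiation real :: real_or_complex
begin
definition cplx_real :: "real \<Rightarrow> complex" where "cplx_real = complex_of_real"
instance by standard (simp_all add: cplx_real_def scaleR_conv_of_real)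
end

instantiation complex :: real_or_complex
begin
definition cplx_complex :: "complex \<Rightarrow> complex" where "cplx_complex = (\<lambda>z. z)"
instance by standard (simp_all add: cplx_complex_def)
end


section \<open>Smooth manifolds with boundary\<close>

fun Ck_on :: "nat \<Rightarrow> 'a::real_normed_vector set \<Rightarrow> ('a \<Rightarrow> 'b::real_normed_vector) \<Rightarrow> bool" where
  "Ck_on 0 W f \<longleftrightarrow> continuous_on W f"
| "Ck_on (Suc k) W f \<longleftrightarrow>
     (\<forall>x\<in>W. f differentiable (at x)) \<and> (\<forall>v. Ck_on k W (\<lambda>x. frechet_derivative f (at x) v))"

text \<open>On a set that need not be open, smoothness means existence of local smooth extensions.\<close>

definition smooth_on :: "'a::real_normed_vector set \<Rightarrow> ('a \<Rightarrow> 'b::real_normed_vector) \<Rightarrow> bool" where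
  "smooth_on S f \<longleftrightarrow>
     (\<forall>x\<in>S. \<exists>W g. open W \<and> x \<in> W \<and> (\<forall>k. Ck_on k W g) \<and> (\<forall>y\<in>W \<inter> S. g y = f y))"

text \<open>
  A chart is a pair \<open>(U, \<psi>)\<close>; the values of \<open>\<psi>\<close> outside \<open>U\<close> are irrelevant.  The manifold is the
  whole type \<open>'m\<close>.
\<close>

type_synonym ('m, 'n) chart = "'m set \<times> ('m \<Rightarrow> real ^ 'n)"

definition is_chart :: "('m::topological_space, 'n::finite) chart \<Rightarrow> bool" where
  "is_chart = (\<lambda>(U, \<psi>). open U \<and> (\<exists>g. homeomorphism U (\<psi> ` U) \<psi> g) \<and>
     (open (\<psi> ` U) \<or> (\<exists>i. openin (top_of_set {y. 0 \<le> y $ i}) (\<psi> ` U))))"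

definition charts_compatible ::
    "('m::topological_space, 'n::finite) chart \<Rightarrow> ('m, 'n) chart \<Rightarrow> bool" where
  "charts_compatible = (\<lambda>(U, \<psi>) (V, \<phi>).
     smooth_on (\<psi> ` (U \<inter> V)) (\<phi> \<circ> inv_into U \<psi>) \<and>
     smooth_on (\<phi> ` (U \<inter> V)) (\<psi> \<circ> inv_into V \<phi>))"

definition smooth_structure ::
    "('m::{t2_space, second_countable_topology}, 'n::finite) chart set \<Rightarrow> bool" where
  "smooth_structure \<A> \<longleftrightarrow>
     (\<forall>c\<in>\<A>. is_chart c) \<and> (\<Union>(fst ` \<A>) = UNIV) \<and>
     (\<forall>c\<in>\<A>. \<forall>d\<in>\<A>. charts_compatible c d) \<and>
     (\<forall>c. is_chart c \<and> (\<forall>d\<in>\<A>. charts_compatible c d) \<longrightarrow> c \<in> \<A>)"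

definition manifold_interior :: "('m::topological_space, 'n::finite) chart set \<Rightarrow> 'm set" where
  "manifold_interior \<A> = {x. \<exists>(U, \<psi>)\<in>\<A>. x \<in> U \<and> \<psi> x \<in> interior (\<psi> ` U)}"

definition msmooth_on ::
    "('m::topological_space, 'n::finite) chart set \<Rightarrow> 'm set \<Rightarrow> ('m \<Rightarrow> 'b::real_normed_vector) \<Rightarrow> bool"
  where
  "msmooth_on \<A> W f \<longleftrightarrow> (\<forall>(U, \<psi>)\<in>\<A>. smooth_on (\<psi> ` (U \<inter> W)) (f \<circ> inv_into U \<psi>))"

definition Meas :: "('m, 'n::finite) chart set \<Rightarrow> 'm set set" where
  "Meas \<A> = {A. \<forall>(U, \<psi>)\<in>\<A>. \<psi> ` (A \<inter> U) \<in> sets lebesgue}"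

definition Zero :: "('m, 'n::finite) chart set \<Rightarrow> 'm set set" where
  "Zero \<A> = {A. \<forall>(U, \<psi>)\<in>\<A>. \<psi> ` (A \<inter> U) \<in> null_sets lebesgue}"

definition meas_space :: "('m, 'n::finite) chart set \<Rightarrow> 'm measure" where
  "meas_space \<A> = sigma UNIV (Meas \<A>)"

definition ae :: "('m, 'n::finite) chart set \<Rightarrow> ('m \<Rightarrow> bool) \<Rightarrow> bool" where
  "ae \<A> P \<longleftrightarrow> {x. \<not> P x} \<in> Zero \<A>"


section \<open>Locally elliptic compatible measures\<close>

text \<open>
  Measures are outer measures on all subsets; \<open>lambda_system UNIV UNIV \<mu>\<close> is the library's family of
  Caratheodory measurable sets.
\<close>

definition MeasO :: "('m set \<Rightarrow> ennreal) \<Rightarrow> 'm set set" where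
  "MeasO \<mu> = lambda_system UNIV UNIV \<mu>"

definition ZeroO :: "('m set \<Rightarrow> ennreal) \<Rightarrow> 'm set set" where
  "ZeroO \<mu> = {A. \<mu> A = 0}"

definition cara :: "('m set \<Rightarrow> ennreal) \<Rightarrow> 'm measure" where
  "cara \<mu> = measure_of UNIV (MeasO \<mu>) \<mu>"

definition radon_outer :: "('m::topological_space set \<Rightarrow> ennreal) \<Rightarrow> bool" where
  "radon_outer \<mu> \<longleftrightarrow> outer_measure_space UNIV \<mu> \<and> sets borel \<subseteq> MeasO \<mu> \<and>
     (\<forall>A. \<exists>B\<in>sets borel. A \<subseteq> B \<and> \<mu> B = \<mu> A) \<and> (\<forall>K. compact K \<longrightarrow> \<mu> K < \<infinity>)"

definition restr :: "('m set \<Rightarrow> ennreal) \<Rightarrow> 'm set \<Rightarrow> 'm set \<Rightarrow> ennreal" where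
  "restr \<mu> U = (\<lambda>B. \<mu> (U \<inter> B))"

text \<open>The pull-back under \<open>\<psi>\<close> of Lebesgue (outer) measure restricted to \<open>\<psi>(U)\<close>.\<close>

definition chart_measure :: "('m, 'n::finite) chart \<Rightarrow> 'm set \<Rightarrow> ennreal" where
  "chart_measure = (\<lambda>(U, \<psi>) B. outer_measure_of lebesgue (\<psi> ` (B \<inter> U)))"

text \<open>
  \<open>RN_deriv M N\<close> is the derivative of \<open>N\<close> with respect to \<open>M\<close>, and is \<open>0\<close> if there is no
  derivative; so the lower bound below includes its existence.
\<close>

definition LECM ::
    "('m::topological_space, 'n::finite) chart set \<Rightarrow> ('m set \<Rightarrow> ennreal) \<Rightarrow> bool" where
  "LECM \<A> \<mu> \<longleftrightarrow> radon_outer \<mu> \<and> MeasO \<mu> = Meas \<A> \<and> ZeroO \<mu> = Zero \<A> \<and>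
     (\<forall>p. \<exists>(U, \<psi>)\<in>\<A>. p \<in> U \<and> (\<exists>C\<ge>1::real.
        ae \<A> (\<lambda>x. x \<in> U \<longrightarrow>
          ennreal (1 / C) \<le> RN_deriv (cara (chart_measure (U, \<psi>))) (cara (restr \<mu> U)) x \<and>
          RN_deriv (cara (chart_measure (U, \<psi>))) (cara (restr \<mu> U)) x \<le> ennreal C)))"

text \<open>
  For measures with the same measurable and null sets, as here, both derivatives exist, so the
  default value \<open>0\<close> does not interfere.
\<close>

definition measures_mutually_bounded ::
    "('m, 'n::finite) chart set \<Rightarrow> ('m set \<Rightarrow> ennreal) \<Rightarrow> ('m set \<Rightarrow> ennreal) \<Rightarrow> bool" where
  "measures_mutually_bounded \<A> \<mu> \<nu> \<longleftrightarrow>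
     (\<exists>C::real. ae \<A> (\<lambda>x. RN_deriv (cara \<nu>) (cara \<mu>) x \<le> ennreal C)) \<and>
     (\<exists>C::real. ae \<A> (\<lambda>x. RN_deriv (cara \<mu>) (cara \<nu>) x \<le> ennreal C))"


section \<open>Smooth vector bundles\<close>

text \<open>
  The fibres \<open>fibre B x\<close> are vector subspaces of an ambient vector space \<open>'v\<close> (which may be large,
  e.g. the direct sum of all fibres, so this is no restriction; fibres over distinct points need not
  be disjoint, since a vector always comes with its base point).  A local trivialisation \<open>(U, \<tau>)\<close>
  consists of linear isomorphisms \<open>\<tau> x\<close> from the fibre over \<open>x \<in> U\<close> to \<open>'k ^ 'r\<close>; these determine
  the topology and smooth structure of the total space.
\<close>

type_synonym ('m, 'k, 'r, 'v) triv = "'m set \<times> ('m \<Rightarrow> 'v \<Rightarrow> 'k ^ 'r)"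

record ('m, 'n, 'k, 'r, 'v) vbundle =
  atlas :: "('m, 'n::finite) chart set"
  vscale :: "'k \<Rightarrow> 'v \<Rightarrow> 'v"
  fibre :: "'m \<Rightarrow> 'v set"
  trivs :: "('m, 'k, 'r::finite, 'v) triv set"

definition is_triv ::
    "('m::topological_space, 'n::finite, 'k::real_or_complex, 'r::finite, 'v::ab_group_add) vbundle
      \<Rightarrow> ('m, 'k, 'r, 'v) triv \<Rightarrow> bool" where
  "is_triv B = (\<lambda>(U, \<tau>). open U \<and> (\<forall>x\<in>U. bij_betw (\<tau> x) (fibre B x) UNIV \<and>
     (\<forall>v\<in>fibre B x. \<forall>w\<in>fibre B x. \<tau> x (v + w) = \<tau> x v + \<tau> x w) \<and>
     (\<forall>c. \<forall>v\<in>fibre B x. \<tau> x (vscale B c v) = c *s \<tau> x v)))"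

definition frame ::
    "('m, 'n::finite, 'k::real_or_complex, 'r::finite, 'v) vbundle
      \<Rightarrow> ('m \<Rightarrow> 'v \<Rightarrow> 'k ^ 'r) \<Rightarrow> 'r \<Rightarrow> 'm \<Rightarrow> 'v" where
  "frame B \<tau> i x = inv_into (fibre B x) (\<tau> x) (axis i 1)"

definition trivs_compatible ::
    "('m::topological_space, 'n::finite, 'k::real_or_complex, 'r::finite, 'v::ab_group_add) vbundle
      \<Rightarrow> ('m, 'k, 'r, 'v) triv \<Rightarrow> ('m, 'k, 'r, 'v) triv \<Rightarrow> bool" where
  "trivs_compatible B = (\<lambda>(U, \<tau>) (V, \<sigma>). \<forall>i.
     msmooth_on (atlas B) (U \<inter> V) (\<lambda>x. \<sigma> x (frame B \<tau> i x)) \<and>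
     msmooth_on (atlas B) (U \<inter> V) (\<lambda>x. \<tau> x (frame B \<sigma> i x)))"

definition smooth_bundle ::
    "('m::{t2_space, second_countable_topology}, 'n::finite, 'k::real_or_complex, 'r::finite,
      'v::ab_group_add) vbundle \<Rightarrow> bool" where
  "smooth_bundle B \<longleftrightarrow> smooth_structure (atlas B) \<and> vector_space (vscale B) \<and>
     (\<forall>x. module.subspace (vscale B) (fibre B x)) \<and>
     (\<forall>t\<in>trivs B. is_triv B t) \<and> \<Union>(fst ` trivs B) = UNIV \<and>
     (\<forall>t\<in>trivs B. \<forall>s\<in>trivs B. trivs_compatible B t s) \<and>
     (\<forall>t. is_triv B t \<and> (\<forall>s\<in>trivs B. trivs_compatible B t s) \<longrightarrow> t \<in> trivs B)"

definition smooth_sections ::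
    "('m::topological_space, 'n::finite, 'k::real_or_complex, 'r::finite, 'v) vbundle
      \<Rightarrow> ('m \<Rightarrow> 'v) set" where
  "smooth_sections B = {u. (\<forall>x. u x \<in> fibre B x) \<and>
     (\<forall>(U, \<tau>)\<in>trivs B. msmooth_on (atlas B) U (\<lambda>x. \<tau> x (u x)))}"

definition spt :: "('m::topological_space \<Rightarrow> 'v::zero) \<Rightarrow> 'm set" where
  "spt u = closure {x. u x \<noteq> 0}"

definition Ccc ::
    "('m::topological_space, 'n::finite, 'k::real_or_complex, 'r::finite, 'v::zero) vbundle
      \<Rightarrow> ('m \<Rightarrow> 'v) set" where
  "Ccc B = {u \<in> smooth_sections B. compact (spt u) \<and> spt u \<subseteq> manifold_interior (atlas B)}"

definition L0 ::
    "('m, 'n::finite, 'k::real_or_complex, 'r::finite, 'v) vbundle \<Rightarrow> ('m \<Rightarrow> 'v) set" where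
  "L0 B = {u. (\<forall>x. u x \<in> fibre B x) \<and> (\<forall>(U, \<tau>)\<in>trivs B. \<forall>i.
     (\<lambda>x. \<tau> x (u x) $ i) \<in> borel_measurable (restrict_space (meas_space (atlas B)) U))}"

text \<open>Smooth subbundles, described by adapted local trivialisations.\<close>

definition subbundle ::
    "('m, 'n::finite, 'k::real_or_complex, 'r::finite, 'v) vbundle \<Rightarrow> ('m \<Rightarrow> 'v set) \<Rightarrow> bool" where
  "subbundle B F \<longleftrightarrow> (\<forall>p. \<exists>(U, \<tau>)\<in>trivs B. p \<in> U \<and>
     (\<exists>S. \<forall>x\<in>U. F x = {v \<in> fibre B x. \<forall>i. i \<notin> S \<longrightarrow> \<tau> x v $ i = 0}))"

definition bundle_direct_sum ::
    "('m, 'n::finite, 'k::real_or_complex, 'r::finite, 'v::ab_group_add) vbundle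
      \<Rightarrow> nat \<Rightarrow> (nat \<Rightarrow> 'm \<Rightarrow> 'v set) \<Rightarrow> bool" where
  "bundle_direct_sum B K F \<longleftrightarrow> (\<forall>j\<in>{1..K}. subbundle B (F j)) \<and>
     (\<forall>x. \<forall>v\<in>fibre B x. \<exists>!g. g \<in> (\<Pi>\<^sub>E j\<in>{1..K}. F j x) \<and> v = (\<Sum>j\<in>{1..K}. g j))"

text \<open>The projection in a fibre onto \<open>F j x\<close> along the sum of the \<open>F l x\<close>, \<open>l \<noteq> j\<close>.\<close>

definition fibre_proj ::
    "nat \<Rightarrow> (nat \<Rightarrow> 'm \<Rightarrow> 'v::ab_group_add set) \<Rightarrow> nat \<Rightarrow> 'm \<Rightarrow> 'v \<Rightarrow> 'v" where
  "fibre_proj K F j x v = (THE a. a \<in> F j x \<and>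
     (\<exists>g. (\<forall>l\<in>{1..K} - {j}. g l \<in> F l x) \<and> v = a + (\<Sum>l\<in>{1..K} - {j}. g l)))"


section \<open>Rough Hermitian metrics\<close>

text \<open>\<open>h x u v\<close> is linear in \<open>u\<close> and conjugate-linear in \<open>v\<close>.\<close>

definition hermitian_form ::
    "('m, 'n::finite, 'k::real_or_complex, 'r::finite, 'v::ab_group_add) vbundle
      \<Rightarrow> 'm \<Rightarrow> ('v \<Rightarrow> 'v \<Rightarrow> 'k) \<Rightarrow> bool" where
  "hermitian_form B x b \<longleftrightarrow>
     (\<forall>u\<in>fibre B x. \<forall>v\<in>fibre B x. \<forall>w\<in>fibre B x. b (u + v) w = b u w + b v w) \<and>
     (\<forall>c. \<forall>u\<in>fibre B x. \<forall>w\<in>fibre B x. b (vscale B c u) w = c * b u w) \<and>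
     (\<forall>u\<in>fibre B x. \<forall>w\<in>fibre B x. cplx (b w u) = cnj (cplx (b u w)))"

definition fibre_norm :: "('m \<Rightarrow> 'v \<Rightarrow> 'v \<Rightarrow> 'k::real_or_complex) \<Rightarrow> 'm \<Rightarrow> 'v \<Rightarrow> real" where
  "fibre_norm h x u = sqrt (Re (cplx (h x u u)))"

definition smooth_hermitian_metric_on ::
    "('m::topological_space, 'n::finite, 'k::real_or_complex, 'r::finite, 'v::ab_group_add) vbundle
      \<Rightarrow> 'm set \<Rightarrow> ('m \<Rightarrow> 'v \<Rightarrow> 'v \<Rightarrow> 'k) \<Rightarrow> bool" where
  "smooth_hermitian_metric_on B W g \<longleftrightarrow>
     (\<forall>x\<in>W. hermitian_form B x (g x) \<and>
        (\<forall>u\<in>fibre B x. u \<noteq> 0 \<longrightarrow> Re (cplx (g x u u)) > 0)) \<and>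
     (\<forall>(U, \<tau>)\<in>trivs B. \<forall>i j.
        msmooth_on (atlas B) (U \<inter> W) (\<lambda>x. g x (frame B \<tau> i x) (frame B \<tau> j x)))"

definition RHM ::
    "('m::topological_space, 'n::finite, 'k::real_or_complex, 'r::finite, 'v::ab_group_add) vbundle
      \<Rightarrow> ('m \<Rightarrow> 'v \<Rightarrow> 'v \<Rightarrow> 'k) \<Rightarrow> bool" where
  "RHM B h \<longleftrightarrow> (\<forall>x. hermitian_form B x (h x)) \<and>
     (\<forall>(U, \<tau>)\<in>trivs B. \<forall>i j. (\<lambda>x. h x (frame B \<tau> i x) (frame B \<tau> j x))
        \<in> borel_measurable (restrict_space (meas_space (atlas B)) U)) \<and>
     (\<forall>p. \<exists>U g. open U \<and> p \<in> U \<and> smooth_hermitian_metric_on B U g \<and> (\<exists>C\<ge>1::real.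
        ae (atlas B) (\<lambda>x. x \<in> U \<longrightarrow> (\<forall>u\<in>fibre B x.
          fibre_norm g x u / C \<le> fibre_norm h x u \<and> fibre_norm h x u \<le> C * fibre_norm g x u))))"

definition metrics_mutually_bounded ::
    "('m, 'n::finite, 'k::real_or_complex, 'r::finite, 'v) vbundle
      \<Rightarrow> ('m \<Rightarrow> 'v \<Rightarrow> 'v \<Rightarrow> 'k) \<Rightarrow> ('m \<Rightarrow> 'v \<Rightarrow> 'v \<Rightarrow> 'k) \<Rightarrow> bool" where
  "metrics_mutually_bounded B h g \<longleftrightarrow> (\<exists>C\<ge>1::real. ae (atlas B) (\<lambda>x. \<forall>u\<in>fibre B x.
     fibre_norm h x u / C \<le> fibre_norm g x u \<and> fibre_norm g x u \<le> C * fibre_norm h x u))"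


section \<open>Unbounded operators in inner product spaces\<close>

record ('k, 'h) ipspace =
  vecs :: "'h set"
  zer :: 'h
  add :: "'h \<Rightarrow> 'h \<Rightarrow> 'h"
  scl :: "'k \<Rightarrow> 'h \<Rightarrow> 'h"
  ip :: "'h \<Rightarrow> 'h \<Rightarrow> 'k"

definition nrm :: "('k::real_or_complex, 'h) ipspace \<Rightarrow> 'h \<Rightarrow> real" where
  "nrm H u = sqrt (Re (cplx (ip H u u)))"

definition sub :: "('k::real_or_complex, 'h) ipspace \<Rightarrow> 'h \<Rightarrow> 'h \<Rightarrow> 'h" where
  "sub H u v = add H u (scl H (- 1) v)"

definition tends :: "('k::real_or_complex, 'h) ipspace \<Rightarrow> (nat \<Rightarrow> 'h) \<Rightarrow> 'h \<Rightarrow> bool" where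
  "tends H s u \<longleftrightarrow> (\<lambda>n. nrm H (sub H (s n) u)) \<longlonglongrightarrow> 0"

definition cl :: "('k::real_or_complex, 'h) ipspace \<Rightarrow> 'h set \<Rightarrow> 'h set" where
  "cl H A = {u \<in> vecs H. \<exists>s. (\<forall>n. s n \<in> A) \<and> tends H s u}"

definition lin_subspace :: "('k::real_or_complex, 'h) ipspace \<Rightarrow> 'h set \<Rightarrow> bool" where
  "lin_subspace H A \<longleftrightarrow> A \<subseteq> vecs H \<and> zer H \<in> A \<and>
     (\<forall>u\<in>A. \<forall>v\<in>A. add H u v \<in> A) \<and> (\<forall>c. \<forall>u\<in>A. scl H c u \<in> A)"

text \<open>
  Operators are identified with their graphs.  Thus \<open>Domain T\<close> and \<open>Range T\<close> are domain and range,
  and the relation power \<open>T ^^ k\<close> is the \<open>k\<close>-th power on its maximal domain.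
\<close>

definition lin_op :: "('k::real_or_complex, 'h) ipspace \<Rightarrow> ('h \<times> 'h) set \<Rightarrow> bool" where
  "lin_op H T \<longleftrightarrow> T \<subseteq> vecs H \<times> vecs H \<and> single_valued T \<and> (zer H, zer H) \<in> T \<and>
     (\<forall>(u, a)\<in>T. \<forall>(v, b)\<in>T. (add H u v, add H a b) \<in> T) \<and>
     (\<forall>c. \<forall>(u, a)\<in>T. (scl H c u, scl H c a) \<in> T)"

definition closed_op :: "('k::real_or_complex, 'h) ipspace \<Rightarrow> ('h \<times> 'h) set \<Rightarrow> bool" where
  "closed_op H T \<longleftrightarrow> lin_op H T \<and>
     (\<forall>s t u a. (\<forall>n. (s n, t n) \<in> T) \<and> u \<in> vecs H \<and> a \<in> vecs H \<and> tends H s u \<and> tends H t a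
        \<longrightarrow> (u, a) \<in> T)"

definition densely_defined :: "('k::real_or_complex, 'h) ipspace \<Rightarrow> ('h \<times> 'h) set \<Rightarrow> bool" where
  "densely_defined H T \<longleftrightarrow> cl H (Domain T) = vecs H"

definition ker :: "('k, 'h) ipspace \<Rightarrow> ('h \<times> 'h) set \<Rightarrow> 'h set" where
  "ker H T = {u. (u, zer H) \<in> T}"

definition nilpotent_op :: "('k, 'h) ipspace \<Rightarrow> ('h \<times> 'h) set \<Rightarrow> bool" where
  "nilpotent_op H T \<longleftrightarrow> Range T \<subseteq> ker H T"

definition adj :: "('k, 'h) ipspace \<Rightarrow> ('h \<times> 'h) set \<Rightarrow> ('h \<times> 'h) set" where
  "adj H T = {(v, w). v \<in> vecs H \<and> w \<in> vecs H \<and> (\<forall>(u, a)\<in>T. ip H a v = ip H u w)}"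

definition op_sum :: "('k, 'h) ipspace \<Rightarrow> ('h \<times> 'h) set \<Rightarrow> ('h \<times> 'h) set \<Rightarrow> ('h \<times> 'h) set" where
  "op_sum H S T = {(u, add H a b) | u a b. (u, a) \<in> S \<and> (u, b) \<in> T}"

definition dirac :: "('k, 'h) ipspace \<Rightarrow> ('h \<times> 'h) set \<Rightarrow> ('h \<times> 'h) set" where
  "dirac H T = op_sum H T (adj H T)"

definition self_adjoint_op :: "('k::real_or_complex, 'h) ipspace \<Rightarrow> ('h \<times> 'h) set \<Rightarrow> bool" where
  "self_adjoint_op H T \<longleftrightarrow> lin_op H T \<and> densely_defined H T \<and> adj H T = T"

definition top_splitting ::
    "('k::real_or_complex, 'h) ipspace \<Rightarrow> 'h set \<Rightarrow> 'h set \<Rightarrow> bool" where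
  "top_splitting H A B \<longleftrightarrow> lin_subspace H A \<and> lin_subspace H B \<and> cl H A = A \<and> cl H B = B \<and>
     (\<forall>u\<in>vecs H. \<exists>!(a, b). a \<in> A \<and> b \<in> B \<and> u = add H a b) \<and>
     (\<exists>C. \<forall>a\<in>A. \<forall>b\<in>B. nrm H a \<le> C * nrm H (add H a b) \<and> nrm H b \<le> C * nrm H (add H a b))"

definition proj_along :: "('k, 'h) ipspace \<Rightarrow> 'h set \<Rightarrow> 'h set \<Rightarrow> 'h \<Rightarrow> 'h" where
  "proj_along H A B u = (THE a. a \<in> A \<and> (\<exists>b\<in>B. u = add H a b))"

definition top_iso ::
    "('k::real_or_complex, 'h) ipspace \<Rightarrow> 'h set \<Rightarrow> 'h set \<Rightarrow> ('h \<Rightarrow> 'h) \<Rightarrow> bool" where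
  "top_iso H A B f \<longleftrightarrow> lin_subspace H A \<and> lin_subspace H B \<and> bij_betw f A B \<and>
     (\<forall>u\<in>A. \<forall>v\<in>A. f (add H u v) = add H (f u) (f v)) \<and>
     (\<forall>c. \<forall>u\<in>A. f (scl H c u) = scl H c (f u)) \<and>
     (\<exists>C. \<forall>u\<in>A. nrm H (f u) \<le> C * nrm H u) \<and> (\<exists>C. \<forall>u\<in>A. nrm H u \<le> C * nrm H (f u))"


subsection \<open>Spectrum and bi-sectoriality\<close>

definition resolvent :: "(complex, 'h) ipspace \<Rightarrow> ('h \<times> 'h) set \<Rightarrow> complex \<Rightarrow> ('h \<times> 'h) set" where
  "resolvent H T \<zeta> = {(u, sub H (scl H \<zeta> u) a) | u a. (u, a) \<in> T}\<inverse>"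

definition spectrum :: "(complex, 'h) ipspace \<Rightarrow> ('h \<times> 'h) set \<Rightarrow> complex set" where
  "spectrum H T = - {\<zeta>. single_valued (resolvent H T \<zeta>) \<and> Domain (resolvent H T \<zeta>) = vecs H \<and>
     (\<exists>C. \<forall>(f, u)\<in>resolvent H T \<zeta>. nrm H u \<le> C * nrm H f)}"

definition op_norm :: "('k::real_or_complex, 'h) ipspace \<Rightarrow> ('h \<times> 'h) set \<Rightarrow> real" where
  "op_norm H T = Sup {nrm H a | u a. (u, a) \<in> T \<and> nrm H u \<le> 1}"

definition bisector :: "real \<Rightarrow> complex set" where
  "bisector \<omega> = {0} \<union> {\<zeta>. \<bar>Arg \<zeta>\<bar> \<le> \<omega> \<or> \<bar>Arg (- \<zeta>)\<bar> \<le> \<omega>}"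

definition bisectorial_complex :: "(complex, 'h) ipspace \<Rightarrow> ('h \<times> 'h) set \<Rightarrow> bool" where
  "bisectorial_complex H T \<longleftrightarrow> closed_op H T \<and> (\<exists>\<omega>\<in>{0..<pi / 2}. spectrum H T \<subseteq> bisector \<omega> \<and>
     (\<forall>\<theta>\<in>{\<omega><..<pi / 2}. \<exists>C. \<forall>\<zeta>. \<zeta> \<notin> bisector \<theta> \<longrightarrow> cmod \<zeta> * op_norm H (resolvent H T \<zeta>) \<le> C))"

definition as_complex :: "('k::real_or_complex, 'h) ipspace \<Rightarrow> (complex, 'h) ipspace" where
  "as_complex H = \<lparr>vecs = vecs H, zer = zer H, add = add H,
     scl = (\<lambda>z. scl H (inv cplx z)), ip = (\<lambda>u v. cplx (ip H u v))\<rparr>"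

text \<open>The pair \<open>(u, v)\<close> stands for \<open>u + iv\<close>.\<close>

definition complexification :: "('k::real_or_complex, 'h) ipspace \<Rightarrow> (complex, 'h \<times> 'h) ipspace" where
  "complexification H = \<lparr>vecs = vecs H \<times> vecs H, zer = (zer H, zer H),
     add = (\<lambda>(u, v) (u', v'). (add H u u', add H v v')),
     scl = (\<lambda>z (u, v). (sub H (scl H (of_real (Re z)) u) (scl H (of_real (Im z)) v),
                        add H (scl H (of_real (Im z)) u) (scl H (of_real (Re z)) v))),
     ip = (\<lambda>(u, v) (u', v'). cplx (ip H u u') + cplx (ip H v v')
                             + \<i> * (cplx (ip H v u') - cplx (ip H u v')))\<rparr>"

definition op_complexification :: "('h \<times> 'h) set \<Rightarrow> (('h \<times> 'h) \<times> ('h \<times> 'h)) set" where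
  "op_complexification T = {((u, v), (a, b)) | u v a b. (u, a) \<in> T \<and> (v, b) \<in> T}"

text \<open>Over the reals, spectrum and resolvents are those of the complexified operator.\<close>

definition bisectorial :: "('k::real_or_complex, 'h) ipspace \<Rightarrow> ('h \<times> 'h) set \<Rightarrow> bool" where
  "bisectorial H T \<longleftrightarrow>
     (if surj (cplx :: 'k \<Rightarrow> complex) then bisectorial_complex (as_complex H) T
      else bisectorial_complex (complexification H) (op_complexification T))"


section \<open>The space of square integrable sections\<close>

text \<open>
  Sections are identified when they agree almost everywhere.  The classes are taken among all
  measurable sections with respect to the intrinsic null sets, so they do not depend on a measure or
  a metric.
\<close>

definition aecls ::
    "('m, 'n::finite, 'k::real_or_complex, 'r::finite, 'v) vbundle \<Rightarrow> ('m \<Rightarrow> 'v) \<Rightarrow> ('m \<Rightarrow> 'v) set" where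
  "aecls B u = {v \<in> L0 B. ae (atlas B) (\<lambda>x. v x = u x)}"

definition rep :: "('m \<Rightarrow> 'v) set \<Rightarrow> 'm \<Rightarrow> 'v" where
  "rep A = (SOME u. u \<in> A)"

definition cls_add ::
    "('m, 'n::finite, 'k::real_or_complex, 'r::finite, 'v::ab_group_add) vbundle
      \<Rightarrow> ('m \<Rightarrow> 'v) set \<Rightarrow> ('m \<Rightarrow> 'v) set \<Rightarrow> ('m \<Rightarrow> 'v) set" where
  "cls_add B u v = aecls B (\<lambda>x. rep u x + rep v x)"

definition cls_scale ::
    "('m, 'n::finite, 'k::real_or_complex, 'r::finite, 'v) vbundle
      \<Rightarrow> 'k \<Rightarrow> ('m \<Rightarrow> 'v) set \<Rightarrow> ('m \<Rightarrow> 'v) set" where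
  "cls_scale B c u = aecls B (\<lambda>x. vscale B c (rep u x))"

definition L2 ::
    "('m, 'n::finite, 'k::real_or_complex, 'r::finite, 'v::ab_group_add) vbundle
      \<Rightarrow> ('m set \<Rightarrow> ennreal) \<Rightarrow> ('m \<Rightarrow> 'v \<Rightarrow> 'v \<Rightarrow> 'k) \<Rightarrow> ('k, ('m \<Rightarrow> 'v) set) ipspace" where
  "L2 B \<mu> h = \<lparr>vecs = aecls B ` {u \<in> L0 B. (\<integral>\<^sup>+ x. ennreal ((fibre_norm h x (u x))\<^sup>2) \<partial>cara \<mu>) < \<infinity>},
     zer = aecls B (\<lambda>x. 0),
     add = cls_add B,
     scl = cls_scale B,
     ip = (\<lambda>u v. \<integral>x. h x (rep u x) (rep v x) \<partial>cara \<mu>)\<rparr>"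


section \<open>Rough differential operators\<close>

definition ess_spt ::
    "('m::topological_space, 'n::finite, 'k::real_or_complex, 'r::finite, 'v::zero) vbundle
      \<Rightarrow> ('m \<Rightarrow> 'v) set \<Rightarrow> 'm set" where
  "ess_spt B u = {p. \<forall>W. open W \<and> p \<in> W \<longrightarrow> \<not> ae (atlas B) (\<lambda>x. x \<in> W \<longrightarrow> rep u x = 0)}"

definition rough_diffop ::
    "('m::topological_space, 'n::finite, 'k::real_or_complex, 'r::finite, 'v::ab_group_add) vbundle
      \<Rightarrow> (('m \<Rightarrow> 'v) \<Rightarrow> ('m \<Rightarrow> 'v) set) \<Rightarrow> bool" where
  "rough_diffop B D \<longleftrightarrow>
     (\<forall>f\<in>smooth_sections B. D f \<in> aecls B ` L0 B \<and> ess_spt B (D f) \<subseteq> spt f) \<and>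
     (\<forall>f\<in>smooth_sections B. \<forall>g\<in>smooth_sections B. D (\<lambda>x. f x + g x) = cls_add B (D f) (D g)) \<and>
     (\<forall>c. \<forall>f\<in>smooth_sections B. D (\<lambda>x. vscale B c (f x)) = cls_scale B c (D f))"

definition extension ::
    "('m::topological_space, 'n::finite, 'k::real_or_complex, 'r::finite, 'v::ab_group_add) vbundle
      \<Rightarrow> ('k, ('m \<Rightarrow> 'v) set) ipspace \<Rightarrow> (('m \<Rightarrow> 'v) \<Rightarrow> ('m \<Rightarrow> 'v) set)
      \<Rightarrow> (('m \<Rightarrow> 'v) set \<times> ('m \<Rightarrow> 'v) set) set \<Rightarrow> bool" where
  "extension B H D T \<longleftrightarrow> lin_op H T \<and> (\<forall>f\<in>Ccc B. (aecls B f, D f) \<in> T)"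

definition bundle_proj ::
    "('m, 'n::finite, 'k::real_or_complex, 'r::finite, 'v::ab_group_add) vbundle
      \<Rightarrow> nat \<Rightarrow> (nat \<Rightarrow> 'm \<Rightarrow> 'v set) \<Rightarrow> nat \<Rightarrow> ('m \<Rightarrow> 'v) set \<Rightarrow> ('m \<Rightarrow> 'v) set" where
  "bundle_proj B K F j u = aecls B (\<lambda>x. fibre_proj K F j x (rep u x))"

text \<open>
  \<open>T P u = P T u\<close> for all \<open>u\<close> in the domain of \<open>T\<close>, including that \<open>P u\<close> lies in the domain.
\<close>

definition commutes_with :: "('h \<times> 'h) set \<Rightarrow> ('h \<Rightarrow> 'h) \<Rightarrow> bool" where
  "commutes_with T P \<longleftrightarrow> (\<forall>(u, a)\<in>T. (P u, P a) \<in> T)"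

definition ker_in ::
    "('m, 'n::finite, 'k::real_or_complex, 'r::finite, 'v) vbundle
      \<Rightarrow> ('k, ('m \<Rightarrow> 'v) set) ipspace \<Rightarrow> (('m \<Rightarrow> 'v) set \<times> ('m \<Rightarrow> 'v) set) set
      \<Rightarrow> ('m \<Rightarrow> 'v set) \<Rightarrow> ('m \<Rightarrow> 'v) set set" where
  "ker_in B H T F = {u \<in> ker H T. ae (atlas B) (\<lambda>x. rep u x \<in> F x)}"

end

theory Submission
  imports Defs
begin

text \<open>
  Write \<open>G\<close> for the extension and \<open>\<DD>\<^sub>i = G + G\<^sup>*\<^sup>i\<close>.  Nilpotency makes \<open>cl (ran G)\<close> and \<open>cl (ran G\<^sup>*\<^sup>i)\<close>
  orthogonal, and on the Hodge splitting \<open>ker \<DD>\<^sub>i \<oplus> cl (ran G) \<oplus> cl (ran G\<^sup>*\<^sup>i)\<close> self-adjointness of \<open>\<DD>\<^sub>i\<close> reduces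
  to \<open>G\<^sup>*\<^sup>* = G\<close>.  Since \<open>ker G\<close> and \<open>cl (ran G)\<close> do not depend on the inner product, \<open>cl (ran G)\<close> and
  \<open>cl (ran G\<^sup>*\<^sup>1)\<close> together form a common complement of \<open>ker \<DD>\<^sub>1\<close> and \<open>ker \<DD>\<^sub>2\<close>; projecting along it
  gives the isomorphism.  A projection onto a subbundle that commutes with \<open>\<DD>\<^sub>i\<^sup>k\<close> commutes with
  the resolvents of \<open>\<DD>\<^sub>i\<^sup>2\<^sup>k\<close>, hence preserves kernels and closed ranges, although it is only known
  to be closed.  Analytically one needs that \<open>L\<^sup>2\<close> is complete and that the extension is densely
  defined: a section orthogonal to all smooth compactly supported ones is tested against bump functions
  times a local frame, which approximate boxes in charts; the boundary is a null set.
\<close>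

section \<open>Hilbert spaces given by a carrier\<close>

text \<open>The spaces of sections depend on the chosen pair and are sets of classes rather than
  types, so Hilbert space theory is carried out in records with a carrier. Two constraints shape it.
  The scalars are real or complex and have no conjugation of their own, hence the preference for the
  real part of the inner product. And no spectral theorem is used: the operators (1 + s T^2)^(-1)
  with s > 0, which make sense over the reals as well, are read off from the orthogonal projection
  onto the graph of T in a weighted product. They give self-adjointness of all powers and, as s
  grows, the projection onto the kernel. A projection onto a subbundle cannot be taken as bounded in
  advance, since on a non-compact manifold the angles between the subbundles may degenerate. Its
  closedness is a fibrewise matter: linear subspaces of a finite-dimensional fibre are closed, and
  convergence in the space of sections is convergence in almost every fibre along a
  subsequence.\<close>

lemma cplx_0 [simp]: "cplx 0 = 0"
  using cplx_scaleR[of 0 0] by simp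

lemma cplx_minus [simp]: "cplx (- x) = - cplx x"
  using cplx_scaleR[of "-1" x] by simp

lemma cplx_diff: "cplx (x - y) = cplx x - cplx y"
  using cplx_add[of x "- y"] by simp

lemma cplx_of_real [simp]: "cplx (of_real t) = of_real t"
  unfolding of_real_def by (simp add: cplx_scaleR cplx_one)

lemma cplx_inj: "cplx x = cplx y \<longleftrightarrow> x = y"
  using norm_cplx[of "x - y"] by (auto simp: cplx_diff)

lemma cplx_eq_0 [simp]: "cplx x = 0 \<longleftrightarrow> x = 0"
  using cplx_inj[of x 0] by simp

text \<open>A real inner product over either scalar field, with the same norm as \<open>ip\<close>.
  It is symmetric, so vectors can change slots without a conjugation, which the scalar class does
  not provide.\<close>

definition rip :: "('k::real_or_complex, 'h) ipspace \<Rightarrow> 'h \<Rightarrow> 'h \<Rightarrow> real" where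
  "rip H u v = Re (cplx (ip H u v))"

definition rscl :: "('k::real_or_complex, 'h) ipspace \<Rightarrow> real \<Rightarrow> 'h \<Rightarrow> 'h" where
  "rscl H t u = scl H (of_real t) u"

text \<open>No vector space laws for \<open>add\<close> and \<open>scl\<close> are assumed. On the
  carrier they follow from linearity of \<open>ip\<close> in its first slot and from
  \<open>nrm_sub_0\<close>, which identifies vectors with the same inner products.\<close>

locale hilb =
  fixes H :: "('k::real_or_complex, 'h) ipspace"
  assumes zer_in [simp]: "zer H \<in> vecs H"
    and add_in [simp]: "\<And>u v. u \<in> vecs H \<Longrightarrow> v \<in> vecs H \<Longrightarrow> add H u v \<in> vecs H"
    and scl_in [simp]: "\<And>u c. u \<in> vecs H \<Longrightarrow> scl H c u \<in> vecs H"
    and ip_zer_left [simp]: "\<And>w. w \<in> vecs H \<Longrightarrow> ip H (zer H) w = 0"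
    and ip_add_left: "\<And>u v w. u \<in> vecs H \<Longrightarrow> v \<in> vecs H \<Longrightarrow> w \<in> vecs H \<Longrightarrow>
        ip H (add H u v) w = ip H u w + ip H v w"
    and ip_scl_left: "\<And>u c w. u \<in> vecs H \<Longrightarrow> w \<in> vecs H \<Longrightarrow> ip H (scl H c u) w = c * ip H u w"
    and ip_cnj: "\<And>u v. u \<in> vecs H \<Longrightarrow> v \<in> vecs H \<Longrightarrow> cplx (ip H v u) = cnj (cplx (ip H u v))"
    and rip_nonneg [simp]: "\<And>u. u \<in> vecs H \<Longrightarrow> 0 \<le> rip H u u"
    and nrm_sub_0: "\<And>u v. u \<in> vecs H \<Longrightarrow> v \<in> vecs H \<Longrightarrow> nrm H (sub H u v) = 0 \<Longrightarrow> u = v"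
    and complete: "\<And>s. (\<And>n. s n \<in> vecs H) \<Longrightarrow>
        (\<And>e. e > 0 \<Longrightarrow> \<exists>N. \<forall>m\<ge>N. \<forall>n\<ge>N. nrm H (sub H (s m) (s n)) < e) \<Longrightarrow>
        \<exists>u\<in>vecs H. tends H s u"
begin

lemma sub_in [simp]: "u \<in> vecs H \<Longrightarrow> v \<in> vecs H \<Longrightarrow> sub H u v \<in> vecs H"
  by (simp add: sub_def)

lemma rscl_in [simp]: "u \<in> vecs H \<Longrightarrow> rscl H t u \<in> vecs H"
  by (simp add: rscl_def)

lemma ip_sub_left: "u \<in> vecs H \<Longrightarrow> v \<in> vecs H \<Longrightarrow> w \<in> vecs H \<Longrightarrow>
    ip H (sub H u v) w = ip H u w - ip H v w"
  by (simp add: sub_def ip_add_left ip_scl_left)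

lemma ip_rscl_left: "u \<in> vecs H \<Longrightarrow> w \<in> vecs H \<Longrightarrow> ip H (rscl H t u) w = of_real t * ip H u w"
  by (simp add: rscl_def ip_scl_left)

lemmas ip_left = ip_add_left ip_scl_left ip_sub_left ip_rscl_left

lemma rip_commute: "u \<in> vecs H \<Longrightarrow> v \<in> vecs H \<Longrightarrow> rip H u v = rip H v u"
  by (simp add: rip_def ip_cnj[of u v])

lemma ip_eq_0_commute: "u \<in> vecs H \<Longrightarrow> v \<in> vecs H \<Longrightarrow> ip H u v = 0 \<longleftrightarrow> ip H v u = 0"
  by (metis ip_cnj cplx_eq_0 complex_cnj_zero)

lemma rip_zer_left [simp]: "w \<in> vecs H \<Longrightarrow> rip H (zer H) w = 0"
  by (simp add: rip_def)

lemma rip_add_left: "u \<in> vecs H \<Longrightarrow> v \<in> vecs H \<Longrightarrow> w \<in> vecs H \<Longrightarrow>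
    rip H (add H u v) w = rip H u w + rip H v w"
  by (simp add: rip_def ip_add_left cplx_add)

lemma rip_sub_left: "u \<in> vecs H \<Longrightarrow> v \<in> vecs H \<Longrightarrow> w \<in> vecs H \<Longrightarrow>
    rip H (sub H u v) w = rip H u w - rip H v w"
  by (simp add: rip_def ip_sub_left cplx_diff)

lemma rip_rscl_left: "u \<in> vecs H \<Longrightarrow> w \<in> vecs H \<Longrightarrow> rip H (rscl H t u) w = t * rip H u w"
  by (simp add: rip_def ip_rscl_left cplx_mult)

lemma rip_zer_right [simp]: "w \<in> vecs H \<Longrightarrow> rip H w (zer H) = 0"
  by (subst rip_commute) auto

lemma rip_add_right: "u \<in> vecs H \<Longrightarrow> v \<in> vecs H \<Longrightarrow> w \<in> vecs H \<Longrightarrow>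
    rip H w (add H u v) = rip H w u + rip H w v"
  by (simp add: rip_commute[of w] rip_add_left)

lemma rip_sub_right: "u \<in> vecs H \<Longrightarrow> v \<in> vecs H \<Longrightarrow> w \<in> vecs H \<Longrightarrow>
    rip H w (sub H u v) = rip H w u - rip H w v"
  by (simp add: rip_commute[of w] rip_sub_left)

lemma rip_rscl_right: "u \<in> vecs H \<Longrightarrow> w \<in> vecs H \<Longrightarrow> rip H w (rscl H t u) = t * rip H w u"
  by (simp add: rip_commute[of w] rip_rscl_left)

lemmas rip_simps = rip_add_left rip_sub_left rip_rscl_left rip_add_right rip_sub_right rip_rscl_right

lemma nrm_sq: "u \<in> vecs H \<Longrightarrow> (nrm H u)\<^sup>2 = rip H u u"
  using rip_nonneg[of u] by (simp add: nrm_def rip_def)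

lemma nrm_nonneg [simp]: "u \<in> vecs H \<Longrightarrow> 0 \<le> nrm H u"
  using rip_nonneg[of u] by (simp add: nrm_def rip_def)

lemma rip_eqI:
  assumes "u \<in> vecs H" "v \<in> vecs H" "\<And>w. w \<in> vecs H \<Longrightarrow> rip H u w = rip H v w"
  shows "u = v"
proof (rule nrm_sub_0)
  have "(nrm H (sub H u v))\<^sup>2 = 0"
    using assms by (simp add: nrm_sq rip_sub_left)
  then show "nrm H (sub H u v) = 0" by simp
qed (use assms in auto)

lemma ip_eqI:
  assumes "u \<in> vecs H" "v \<in> vecs H" "\<And>w. w \<in> vecs H \<Longrightarrow> ip H u w = ip H v w"
  shows "u = v"
  by (rule rip_eqI) (use assms in \<open>auto simp: rip_def\<close>)

lemma nrm_eq_0: "u \<in> vecs H \<Longrightarrow> nrm H u = 0 \<longleftrightarrow> u = zer H"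
proof
  assume u: "u \<in> vecs H" "nrm H u = 0"
  have "(nrm H (sub H u (zer H)))\<^sup>2 = (nrm H u)\<^sup>2"
    using u(1) by (simp add: nrm_sq rip_simps)
  with u show "u = zer H" by (intro nrm_sub_0) auto
qed (simp add: nrm_def)

lemma nrm_zer [simp]: "nrm H (zer H) = 0"
  by (simp add: nrm_eq_0)

lemma rip_self_0: "u \<in> vecs H \<Longrightarrow> rip H u u = 0 \<longleftrightarrow> u = zer H"
  by (metis nrm_eq_0 nrm_sq power_eq_0_iff zero_power2)

text \<open>Identities between vectors are verified by testing them against an arbitrary vector.\<close>

lemma add_commute: "u \<in> vecs H \<Longrightarrow> v \<in> vecs H \<Longrightarrow> add H u v = add H v u"
  by (rule ip_eqI) (auto simp: ip_left)

lemma sub_eq_iff: "u \<in> vecs H \<Longrightarrow> v \<in> vecs H \<Longrightarrow> w \<in> vecs H \<Longrightarrow> sub H u v = w \<longleftrightarrow> u = add H v w"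
  by (auto intro!: ip_eqI simp: ip_left)

lemma add_zer [simp]: "u \<in> vecs H \<Longrightarrow> add H u (zer H) = u" "u \<in> vecs H \<Longrightarrow> add H (zer H) u = u"
  by (auto intro!: ip_eqI simp: ip_left)

lemma sub_zer [simp]: "u \<in> vecs H \<Longrightarrow> sub H u (zer H) = u"
  by (auto intro!: ip_eqI simp: ip_left)

lemma sub_self [simp]: "u \<in> vecs H \<Longrightarrow> sub H u u = zer H"
  by (auto intro!: ip_eqI simp: ip_left)

lemma scl_zer [simp]: "scl H c (zer H) = zer H"
  by (auto intro!: ip_eqI simp: ip_left)

lemma sub_eq_zer: "u \<in> vecs H \<Longrightarrow> v \<in> vecs H \<Longrightarrow> sub H u v = zer H \<longleftrightarrow> u = v"
  by (metis sub_eq_iff add_zer(1) zer_in)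

lemma cauchy_schwarz: "u \<in> vecs H \<Longrightarrow> v \<in> vecs H \<Longrightarrow> \<bar>rip H u v\<bar> \<le> nrm H u * nrm H v"
proof -
  assume u: "u \<in> vecs H" and v: "v \<in> vecs H"
  have *: "0 \<le> rip H u u - 2 * t * rip H u v + t\<^sup>2 * rip H v v" for t
    using rip_nonneg[of "sub H u (rscl H t v)"] u v
    by (simp add: rip_simps rip_commute[OF v u] power2_eq_square algebra_simps)
  have "(rip H u v)\<^sup>2 \<le> rip H u u * rip H v v"
  proof (cases "rip H v v = 0")
    case True
    then have "v = zer H" using v by (simp add: rip_self_0)
    then show ?thesis using u by simp
  next
    case False
    then have p: "rip H v v > 0" using rip_nonneg[OF v] by linarith
    have "0 \<le> rip H u u - (rip H u v)\<^sup>2 / rip H v v"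
      using *[of "rip H u v / rip H v v"] p by (simp add: power2_eq_square field_simps)
    then show ?thesis using p by (simp add: field_simps)
  qed
  then have "(rip H u v)\<^sup>2 \<le> (nrm H u * nrm H v)\<^sup>2"
    using u v by (simp add: power_mult_distrib nrm_sq)
  then show ?thesis using u v by (metis abs_le_square_iff abs_of_nonneg mult_nonneg_nonneg nrm_nonneg)
qed

lemma nrm_add_le: "u \<in> vecs H \<Longrightarrow> v \<in> vecs H \<Longrightarrow> nrm H (add H u v) \<le> nrm H u + nrm H v"
proof -
  assume u: "u \<in> vecs H" and v: "v \<in> vecs H"
  have "(nrm H (add H u v))\<^sup>2 = (nrm H u)\<^sup>2 + 2 * rip H u v + (nrm H v)\<^sup>2"
    using u v by (simp add: nrm_sq rip_simps rip_commute[OF v u])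
  also have "\<dots> \<le> (nrm H u + nrm H v)\<^sup>2"
    using cauchy_schwarz[OF u v] by (simp add: power2_sum)
  finally show ?thesis using u v by (meson add_nonneg_nonneg nrm_nonneg power2_le_imp_le)
qed

lemma nrm_scl: "u \<in> vecs H \<Longrightarrow> nrm H (scl H c u) = norm c * nrm H u"
proof -
  assume u: "u \<in> vecs H"
  have "cplx (ip H (scl H c u) (scl H c u)) = cplx c * cnj (cplx c) * cplx (ip H u u)"
    using u ip_cnj[of "scl H c u" u] ip_cnj[of u u] by (simp add: ip_left cplx_mult)
  also have "cplx c * cnj (cplx c) = of_real ((norm c)\<^sup>2)"
    by (metis complex_norm_square norm_cplx)
  finally have "rip H (scl H c u) (scl H c u) = (norm c)\<^sup>2 * rip H u u"
    by (simp add: rip_def del: of_real_power)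
  then have "(nrm H (scl H c u))\<^sup>2 = (norm c * nrm H u)\<^sup>2"
    using u by (simp add: nrm_sq power_mult_distrib)
  then show ?thesis using u by (metis mult_nonneg_nonneg norm_ge_zero nrm_nonneg power2_eq_iff_nonneg scl_in)
qed

lemma nrm_sub_commute: "u \<in> vecs H \<Longrightarrow> v \<in> vecs H \<Longrightarrow> nrm H (sub H u v) = nrm H (sub H v u)"
proof -
  assume u: "u \<in> vecs H" and v: "v \<in> vecs H"
  have "(nrm H (sub H u v))\<^sup>2 = (nrm H (sub H v u))\<^sup>2"
    using u v by (simp add: nrm_sq rip_simps)
  then show ?thesis using u v by simp
qed

lemma nrm_sub_triangle: "u \<in> vecs H \<Longrightarrow> v \<in> vecs H \<Longrightarrow> w \<in> vecs H \<Longrightarrow>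
   nrm H (sub H u w) \<le> nrm H (sub H u v) + nrm H (sub H v w)"
proof -
  assume a: "u \<in> vecs H" "v \<in> vecs H" "w \<in> vecs H"
  have "sub H u w = add H (sub H u v) (sub H v w)"
    by (rule ip_eqI) (use a in \<open>auto simp: ip_left\<close>)
  then show ?thesis using a by (simp add: nrm_add_le)
qed

lemma nrm_sub_le: "u \<in> vecs H \<Longrightarrow> v \<in> vecs H \<Longrightarrow> nrm H (sub H u v) \<le> nrm H u + nrm H v"
  using nrm_sub_triangle[of u "zer H" v] nrm_sub_commute[of v "zer H"] by simp

lemma tends_rip:
  assumes "tends H s u" "\<And>n. s n \<in> vecs H" "u \<in> vecs H" "w \<in> vecs H"
  shows "(\<lambda>n. rip H (s n) w) \<longlonglongrightarrow> rip H u w"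
proof -
  have "(\<lambda>n. nrm H (sub H (s n) u) * nrm H w) \<longlonglongrightarrow> 0"
    using assms(1) tendsto_mult_right[of _ 0 _ "nrm H w"] unfolding tends_def by fastforce
  moreover have "norm (rip H (s n) w - rip H u w) \<le> nrm H (sub H (s n) u) * nrm H w" for n
    using cauchy_schwarz[of "sub H (s n) u" w] assms by (simp add: rip_sub_left)
  ultimately have "(\<lambda>n. rip H (s n) w - rip H u w) \<longlonglongrightarrow> 0"
    by (metis (mono_tags, lifting) Lim_null_comparison always_eventually)
  then show ?thesis by (simp add: LIM_zero_iff)
qed

lemma tends_const: "u \<in> vecs H \<Longrightarrow> tends H (\<lambda>n. u) u"
  by (simp add: tends_def)

lemma tends_add:
  assumes "tends H s u" "tends H t v" "\<And>n. s n \<in> vecs H" "\<And>n. t n \<in> vecs H" "u \<in> vecs H" "v \<in> vecs H"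
  shows "tends H (\<lambda>n. add H (s n) (t n)) (add H u v)"
proof -
  have "sub H (add H (s n) (t n)) (add H u v) = add H (sub H (s n) u) (sub H (t n) v)" for n
    by (rule ip_eqI) (use assms in \<open>auto simp: ip_left\<close>)
  then have "norm (nrm H (sub H (add H (s n) (t n)) (add H u v)))
      \<le> nrm H (sub H (s n) u) + nrm H (sub H (t n) v)" for n
    using assms by (simp add: nrm_add_le)
  moreover have "(\<lambda>n. nrm H (sub H (s n) u) + nrm H (sub H (t n) v)) \<longlonglongrightarrow> 0"
    using tendsto_add[OF assms(1,2)[unfolded tends_def]] by simp
  ultimately show ?thesis unfolding tends_def
    by (metis (mono_tags, lifting) Lim_null_comparison always_eventually)
qed

lemma tends_scl:
  assumes "tends H s u" "\<And>n. s n \<in> vecs H" "u \<in> vecs H"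
  shows "tends H (\<lambda>n. scl H c (s n)) (scl H c u)"
proof -
  have "sub H (scl H c (s n)) (scl H c u) = scl H c (sub H (s n) u)" for n
    by (rule ip_eqI) (use assms in \<open>auto simp: ip_left algebra_simps\<close>)
  then have "nrm H (sub H (scl H c (s n)) (scl H c u)) = norm c * nrm H (sub H (s n) u)" for n
    using assms(2,3) by (simp add: nrm_scl)
  then show ?thesis using tendsto_mult_left[OF assms(1)[unfolded tends_def], of "norm c"]
    by (simp add: tends_def)
qed

lemma tends_sub:
  assumes "tends H s u" "tends H t v" "\<And>n. s n \<in> vecs H" "\<And>n. t n \<in> vecs H" "u \<in> vecs H" "v \<in> vecs H"
  shows "tends H (\<lambda>n. sub H (s n) (t n)) (sub H u v)"
  unfolding sub_def by (rule tends_add[OF assms(1) tends_scl[OF assms(2,4,6)]]) (use assms in auto)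

lemma clE:
  assumes "u \<in> cl H A"
  obtains s where "u \<in> vecs H" "\<And>n. s n \<in> A" "tends H s u"
  using assms by (auto simp: cl_def)

lemma clI: "u \<in> vecs H \<Longrightarrow> (\<And>n. s n \<in> A) \<Longrightarrow> tends H s u \<Longrightarrow> u \<in> cl H A"
  unfolding cl_def by blast

lemma cl_iff: "A \<subseteq> vecs H \<Longrightarrow> u \<in> cl H A \<longleftrightarrow> u \<in> vecs H \<and> (\<forall>e>0. \<exists>a\<in>A. nrm H (sub H a u) < e)"
proof
  assume A: "A \<subseteq> vecs H" and "u \<in> cl H A"
  then obtain s where s: "u \<in> vecs H" "\<And>n. s n \<in> A" "tends H s u" by (meson clE)
  have "\<exists>a\<in>A. nrm H (sub H a u) < e" if "e > 0" for e
  proof -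
    have "eventually (\<lambda>n. nrm H (sub H (s n) u) < e) sequentially"
      using s(3) that unfolding tends_def by (simp add: order_tendstoD(2))
    then show ?thesis using s(2) eventually_sequentially by auto
  qed
  then show "u \<in> vecs H \<and> (\<forall>e>0. \<exists>a\<in>A. nrm H (sub H a u) < e)" using s by auto
next
  assume A: "A \<subseteq> vecs H" and u: "u \<in> vecs H \<and> (\<forall>e>0. \<exists>a\<in>A. nrm H (sub H a u) < e)"
  then have "\<forall>n. \<exists>a\<in>A. nrm H (sub H a u) < 1 / real (Suc n)" by auto
  then obtain s where s: "\<And>n. s n \<in> A" "\<And>n. nrm H (sub H (s n) u) < 1 / real (Suc n)" by metis
  have "(\<lambda>n. nrm H (sub H (s n) u)) \<longlonglongrightarrow> 0"
  proof (rule Lim_null_comparison)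
    show "\<forall>\<^sub>F n in sequentially. norm (nrm H (sub H (s n) u)) \<le> 1 / real (Suc n)"
      using s A u by (intro always_eventually allI) (metis abs_of_nonneg less_imp_le nrm_nonneg real_norm_def sub_in subsetD)
    show "(\<lambda>n. 1 / real (Suc n)) \<longlonglongrightarrow> 0" using LIMSEQ_inverse_real_of_nat by (simp add: field_simps)
  qed
  then show "u \<in> cl H A" unfolding cl_def tends_def using s u by auto
qed

lemma cl_sub_vecs: "cl H A \<subseteq> vecs H"
  by (auto simp: cl_def)

lemma subset_cl: "A \<subseteq> vecs H \<Longrightarrow> A \<subseteq> cl H A"
  by (rule subsetI, rule clI[of _ "\<lambda>n. _"]) (auto intro: tends_const)

lemma cl_mono: "A \<subseteq> A' \<Longrightarrow> cl H A \<subseteq> cl H A'"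
  unfolding cl_def by blast

lemma cl_cl: "A \<subseteq> vecs H \<Longrightarrow> cl H (cl H A) = cl H A"
proof
  assume A: "A \<subseteq> vecs H"
  show "cl H (cl H A) \<subseteq> cl H A"
  proof
    fix u assume u: "u \<in> cl H (cl H A)"
    have "\<exists>a\<in>A. nrm H (sub H a u) < e" if e: "e > 0" for e
    proof -
      obtain b where b: "b \<in> cl H A" "nrm H (sub H b u) < e / 2"
        using u e cl_iff[OF cl_sub_vecs, of u A] by (meson half_gt_zero)
      then obtain a where a: "a \<in> A" "nrm H (sub H a b) < e / 2"
        using e cl_iff[OF A, of b] by (meson half_gt_zero)
      have "u \<in> vecs H" "b \<in> vecs H" "a \<in> vecs H" using u b a A cl_sub_vecs by auto
      then have "nrm H (sub H a u) < e" using nrm_sub_triangle[of a b u] a b by linarith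
      then show ?thesis using a by auto
    qed
    then show "u \<in> cl H A" using u cl_sub_vecs A by (auto simp: cl_iff)
  qed
qed (simp add: subset_cl cl_sub_vecs)

lemma lin_subspace_cl:
  assumes "lin_subspace H A" shows "lin_subspace H (cl H A)"
proof -
  have A: "A \<subseteq> vecs H" using assms by (simp add: lin_subspace_def)
  have "add H u v \<in> cl H A" if uA: "u \<in> cl H A" and vA: "v \<in> cl H A" for u v
  proof -
    obtain s where s: "u \<in> vecs H" "\<And>n. s n \<in> A" "tends H s u" by (rule clE[OF uA]) blast
    obtain t where t: "v \<in> vecs H" "\<And>n. t n \<in> A" "tends H t v" by (rule clE[OF vA]) blast
    have "tends H (\<lambda>n. add H (s n) (t n)) (add H u v)"
      using s t A by (intro tends_add) auto
    then show ?thesis by (rule clI[rotated 2]) (use s t assms in \<open>auto simp: lin_subspace_def\<close>)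
  qed
  moreover have "scl H c u \<in> cl H A" if uA: "u \<in> cl H A" for u c
  proof -
    obtain s where s: "u \<in> vecs H" "\<And>n. s n \<in> A" "tends H s u" by (rule clE[OF uA]) blast
    have "tends H (\<lambda>n. scl H c (s n)) (scl H c u)"
      using s A by (intro tends_scl) auto
    then show ?thesis by (rule clI[rotated 2]) (use s assms in \<open>auto simp: lin_subspace_def\<close>)
  qed
  moreover have "zer H \<in> cl H A" using assms subset_cl[OF A] by (auto simp: lin_subspace_def)
  ultimately show ?thesis using cl_sub_vecs by (auto simp: lin_subspace_def)
qed

lemma lin_subspace_sub: "lin_subspace H A \<Longrightarrow> u \<in> A \<Longrightarrow> v \<in> A \<Longrightarrow> sub H u v \<in> A"
  by (auto simp: lin_subspace_def sub_def)

lemma lin_subspace_rscl: "lin_subspace H A \<Longrightarrow> u \<in> A \<Longrightarrow> rscl H t u \<in> A"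
  by (auto simp: lin_subspace_def rscl_def)

text \<open>Scaling \<open>a\<close> by the inverse of a nonzero \<open>ip H a u\<close> stays in
  the subspace and makes the inner product 1, whose real part does not vanish.\<close>

lemma rip_orth_imp_ip_orth:
  assumes "lin_subspace H A" "u \<in> vecs H" "\<And>a. a \<in> A \<Longrightarrow> rip H a u = 0" "a \<in> A"
  shows "ip H a u = 0"
proof (rule ccontr)
  assume n: "ip H a u \<noteq> 0"
  have a: "a \<in> vecs H" using assms by (auto simp: lin_subspace_def)
  have "scl H (inverse (ip H a u)) a \<in> A" using assms by (auto simp: lin_subspace_def)
  then have "rip H (scl H (inverse (ip H a u)) a) u = 0" by (rule assms)
  then show False using n a assms(2) by (simp add: rip_def ip_left cplx_one)
qed

end

section \<open>Orthogonal complements and the projection theorem\<close>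

definition orth :: "('k::real_or_complex, 'h) ipspace \<Rightarrow> 'h set \<Rightarrow> 'h set" where
  "orth H A = {u \<in> vecs H. \<forall>a\<in>A. ip H a u = 0}"

context hilb begin

lemma orth_iff: "lin_subspace H A \<Longrightarrow> u \<in> orth H A \<longleftrightarrow> u \<in> vecs H \<and> (\<forall>a\<in>A. rip H a u = 0)"
  unfolding orth_def using rip_orth_imp_ip_orth by (auto simp: rip_def)

lemma orth_sub_vecs: "orth H A \<subseteq> vecs H"
  by (auto simp: orth_def)

text \<open>Along a minimising sequence the vectors u - s n become nearly orthogonal to every b in
  \<open>A\<close>, with a bound proportional to the norm of b. Taking b = s m - s n makes the
  sequence Cauchy, and in the limit the same bound gives exact orthogonality.\<close>

theorem projection:
  assumes A: "lin_subspace H A" and clA: "cl H A = A" and u: "u \<in> vecs H"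
  obtains a b where "a \<in> A" "b \<in> orth H A" "u = add H a b"
proof -
  have Av: "\<And>a. a \<in> A \<Longrightarrow> a \<in> vecs H" using A by (auto simp: lin_subspace_def)
  define S where "S = (\<lambda>a. (nrm H (sub H u a))\<^sup>2) ` A"
  define d where "d = Inf S"
  have ne: "S \<noteq> {}" using A by (auto simp: S_def lin_subspace_def)
  have bdd: "bdd_below S" unfolding S_def by (rule bdd_belowI[of _ 0]) auto
  have d_le: "d \<le> rip H (sub H u a) (sub H u a)" if "a \<in> A" for a
    unfolding d_def using that bdd Av[OF that] u
    by (intro cInf_lower) (auto simp: S_def nrm_sq intro!: image_eqI[of _ _ a])
  have "\<exists>a\<in>A. rip H (sub H u a) (sub H u a) < d + 1 / real (Suc n)" for n
  proof -
    have "Inf S < d + 1 / real (Suc n)" by (simp add: d_def)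
    then obtain y where "y \<in> S" "y < d + 1 / real (Suc n)" using cInf_lessD[OF ne] by blast
    then show ?thesis using Av u by (auto simp: S_def nrm_sq)
  qed
  then obtain s where s: "\<And>n. s n \<in> A"
    and sd: "\<And>n. rip H (sub H u (s n)) (sub H u (s n)) < d + 1 / real (Suc n)" by metis
  have sv: "s n \<in> vecs H" for n using s Av by auto
  have est: "(rip H (sub H u (s n)) b)\<^sup>2 \<le> rip H b b / real (Suc n)" if b: "b \<in> A" for n b
  proof -
    have bv: "b \<in> vecs H" using b Av by auto
    \<comment> \<open>The point s n + t b of \<open>A\<close> has squared distance at least d from
      u, while that of s n exceeds d by less than 1 / (n + 1). Below, t is chosen to minimise the
      quadratic polynomial.\<close>
    have q: "0 \<le> 1 / real (Suc n) - 2 * t * rip H (sub H u (s n)) b + t\<^sup>2 * rip H b b" for t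
    proof -
      have "add H (s n) (rscl H t b) \<in> A" using A s b lin_subspace_rscl by (auto simp: lin_subspace_def)
      from d_le[OF this] have "d \<le> rip H (sub H u (s n)) (sub H u (s n))
          - 2 * t * rip H (sub H u (s n)) b + t\<^sup>2 * rip H b b"
        using u sv[of n] bv rip_commute[of b u] rip_commute[of b "s n"]
        by (simp add: rip_simps power2_eq_square algebra_simps)
      with sd[of n] show ?thesis by linarith
    qed
    show ?thesis
    proof (cases "rip H b b = 0")
      case True
      then have "b = zer H" using bv by (simp add: rip_self_0)
      then show ?thesis using u sv by simp
    next
      case False
      then have p: "rip H b b > 0" using rip_nonneg[OF bv] by linarith
      let ?x = "rip H (sub H u (s n)) b"
      have "(?x / rip H b b)\<^sup>2 * rip H b b = ?x\<^sup>2 / rip H b b"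
        "2 * (?x / rip H b b) * ?x = 2 * (?x\<^sup>2 / rip H b b)"
        using p by (simp_all add: power2_eq_square)
      then have "?x\<^sup>2 / rip H b b \<le> 1 / real (Suc n)"
        using q[of "?x / rip H b b"] by linarith
      then show ?thesis using p by (simp only: pos_divide_le_eq times_divide_eq_left mult_1)
    qed
  qed
  have est': "\<bar>rip H (sub H u (s n)) b\<bar> \<le> nrm H b * sqrt (1 / real (Suc n))" if b: "b \<in> A" for n b
    using real_sqrt_le_mono[OF est[OF b, of n]] Av[OF b]
    by (simp add: real_sqrt_divide nrm_sq[symmetric] real_sqrt_mult)
  have cau: "nrm H (sub H (s m) (s n)) \<le> sqrt (1 / real (Suc m)) + sqrt (1 / real (Suc n))" for m n
  proof -
    let ?b = "sub H (s m) (s n)"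
    have b: "?b \<in> A" "?b \<in> vecs H" using s A lin_subspace_sub Av by auto
    have "(nrm H ?b)\<^sup>2 = rip H (sub H u (s n)) ?b - rip H (sub H u (s m)) ?b"
      using u sv by (simp add: nrm_sq rip_simps)
    also have "\<dots> \<le> nrm H ?b * (sqrt (1 / real (Suc m)) + sqrt (1 / real (Suc n)))"
      using est'[OF b(1), of n] est'[OF b(1), of m] by (simp add: algebra_simps)
    finally have "nrm H ?b * nrm H ?b \<le> nrm H ?b * (sqrt (1 / real (Suc m)) + sqrt (1 / real (Suc n)))"
      by (simp add: power2_eq_square)
    then show ?thesis using nrm_nonneg[OF b(2)]
      by (cases "nrm H ?b = 0") (auto simp: mult_le_cancel_left)
  qed
  have lim0: "(\<lambda>n. sqrt (1 / real (Suc n))) \<longlonglongrightarrow> 0"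
    using tendsto_real_sqrt[OF LIMSEQ_inverse_real_of_nat] by (simp add: field_simps)
  have "\<exists>a\<in>vecs H. tends H s a"
  proof (rule complete)
    fix e :: real assume "e > 0"
    then have "eventually (\<lambda>n. sqrt (1 / real (Suc n)) < e / 2) sequentially"
      by (intro order_tendstoD(2)[OF lim0]) simp
    then obtain N where "\<And>n. n \<ge> N \<Longrightarrow> sqrt (1 / real (Suc n)) < e / 2"
      by (auto simp: eventually_sequentially)
    then have "nrm H (sub H (s m) (s n)) < e" if "m \<ge> N" "n \<ge> N" for m n
      using cau[of m n] that by (smt (verit) field_sum_of_halves)
    then show "\<exists>N. \<forall>m\<ge>N. \<forall>n\<ge>N. nrm H (sub H (s m) (s n)) < e" by blast
  qed (rule sv)
  then obtain a where a: "a \<in> vecs H" "tends H s a" by auto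
  then have aA: "a \<in> A" using s clA by (auto simp: cl_def)
  have "rip H b (sub H u a) = 0" if b: "b \<in> A" for b
  proof -
    have bv: "b \<in> vecs H" using b Av by auto
    have "(\<lambda>n. rip H (sub H u (s n)) b) \<longlonglongrightarrow> rip H (sub H u a) b"
      by (rule tends_rip) (use u a sv bv in \<open>auto intro!: tends_sub tends_const\<close>)
    moreover have "(\<lambda>n. rip H (sub H u (s n)) b) \<longlonglongrightarrow> 0"
    proof (rule Lim_null_comparison)
      show "\<forall>\<^sub>F n in sequentially. norm (rip H (sub H u (s n)) b) \<le> nrm H b * sqrt (1 / real (Suc n))"
        using est'[OF b] by simp
      show "(\<lambda>n. nrm H b * sqrt (1 / real (Suc n))) \<longlonglongrightarrow> 0"
        using tendsto_mult_left[OF lim0, of "nrm H b"] by simp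
    qed
    ultimately have "rip H (sub H u a) b = 0" by (rule LIMSEQ_unique)
    then show ?thesis using u a bv by (simp add: rip_commute)
  qed
  then have "sub H u a \<in> orth H A" using u a by (simp add: orth_iff[OF A])
  moreover have "u = add H a (sub H u a)" using u a by (metis sub_eq_iff sub_in)
  ultimately show ?thesis using that aA by blast
qed

lemma orth_cl:
  assumes "lin_subspace H A" shows "orth H (cl H A) = orth H A"
proof
  have A: "A \<subseteq> vecs H" using assms by (simp add: lin_subspace_def)
  show "orth H (cl H A) \<subseteq> orth H A" using subset_cl[OF A] by (auto simp: orth_def)
  show "orth H A \<subseteq> orth H (cl H A)"
  proof
    fix u assume u: "u \<in> orth H A"
    have "rip H a u = 0" if aA: "a \<in> cl H A" for a
    proof -
      obtain s where s: "a \<in> vecs H" "\<And>n. s n \<in> A" "tends H s a" by (rule clE[OF aA]) blast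
      have "(\<lambda>n. rip H (s n) u) \<longlonglongrightarrow> rip H a u"
        using s A u orth_sub_vecs by (intro tends_rip) auto
      moreover have "rip H (s n) u = 0" for n using s(2)[of n] u by (auto simp: orth_def rip_def)
      ultimately show ?thesis by (simp add: LIMSEQ_const_iff)
    qed
    then show "u \<in> orth H (cl H A)"
      using u orth_sub_vecs by (auto simp: orth_iff lin_subspace_cl assms)
  qed
qed

lemma orth_inter:
  assumes "u \<in> A" "u \<in> orth H A" shows "u = zer H"
proof -
  have "u \<in> vecs H" "ip H u u = 0" using assms by (auto simp: orth_def)
  then show ?thesis by (simp add: rip_self_0[symmetric]) (simp add: rip_def)
qed

lemma orth_orth:
  assumes "lin_subspace H A" shows "orth H (orth H A) = cl H A"
proof
  have A: "A \<subseteq> vecs H" using assms by (simp add: lin_subspace_def)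
  show "orth H (orth H A) \<subseteq> cl H A"
  proof
    fix u assume u: "u \<in> orth H (orth H A)"
    then have uv: "u \<in> vecs H" using orth_sub_vecs by auto
    obtain a b where ab: "a \<in> cl H A" "b \<in> orth H (cl H A)" "u = add H a b"
      using projection[OF lin_subspace_cl[OF assms] cl_cl[OF A] uv] by blast
    have v: "a \<in> vecs H" "b \<in> vecs H" using ab cl_sub_vecs orth_sub_vecs by auto
    have "b \<in> orth H A" using ab orth_cl assms by auto
    then have "rip H b u = 0" using u by (auto simp: orth_def rip_def)
    moreover have "rip H a b = 0" using ab(1,2) by (auto simp: orth_def rip_def)
    then have "rip H b a = 0" using v by (simp add: rip_commute)
    ultimately have "rip H b b = 0" using v by (simp add: ab(3) rip_add_right)
    then have "b = zer H" using v rip_self_0 by auto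
    then show "u \<in> cl H A" using ab v by simp
  qed
  show "cl H A \<subseteq> orth H (orth H A)"
  proof
    fix c assume c: "c \<in> cl H A"
    then have cv: "c \<in> vecs H" using cl_sub_vecs by auto
    have "ip H b c = 0" if "b \<in> orth H (cl H A)" for b
    proof -
      have "b \<in> vecs H" "ip H c b = 0" using that c by (auto simp: orth_def)
      then show ?thesis using cv by (simp add: ip_eq_0_commute)
    qed
    then show "c \<in> orth H (orth H A)"
      unfolding orth_cl[OF assms, symmetric] using cv by (simp add: orth_def[of H "orth H _"])
  qed
qed

lemma dense_iff_orth:
  assumes "lin_subspace H A" shows "cl H A = vecs H \<longleftrightarrow> orth H A \<subseteq> {zer H}"
proof
  assume d: "cl H A = vecs H"
  have "u = zer H" if "u \<in> orth H A" for u
    by (rule orth_inter[of _ "vecs H"]) (use that d orth_cl[OF assms] orth_sub_vecs in auto)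
  then show "orth H A \<subseteq> {zer H}" by blast
next
  assume "orth H A \<subseteq> {zer H}"
  then have "vecs H \<subseteq> orth H (orth H A)"
    unfolding orth_def[of H "orth H A"] by auto
  then show "cl H A = vecs H" unfolding orth_orth[OF assms] using cl_sub_vecs by (rule antisym[rotated])
qed

end

section \<open>Weighted graph spaces, closed operators and adjoints\<close>

definition graph_space :: "real \<Rightarrow> ('k::real_or_complex, 'h) ipspace \<Rightarrow> ('k, 'h \<times> 'h) ipspace" where
  "graph_space s H = \<lparr>vecs = vecs H \<times> vecs H, zer = (zer H, zer H),
     add = (\<lambda>(u, a) (v, b). (add H u v, add H a b)),
     scl = (\<lambda>c (u, a). (scl H c u, scl H c a)),
     ip = (\<lambda>(u, a) (v, b). ip H u v + of_real s * ip H a b)\<rparr>"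

context hilb begin

lemma rip_graph_space:
  "rip (graph_space s H) (u, a) (v, b) = rip H u v + s * rip H a b"
  by (simp add: rip_def graph_space_def cplx_add cplx_mult)

lemma sub_graph_space: "sub (graph_space s H) (u, a) (v, b) = (sub H u v, sub H a b)"
  by (simp add: sub_def graph_space_def)

lemma nrm_graph_space:
  "u \<in> vecs H \<Longrightarrow> a \<in> vecs H \<Longrightarrow> nrm (graph_space s H) (u, a) = sqrt ((nrm H u)\<^sup>2 + s * (nrm H a)\<^sup>2)"
  using rip_graph_space[of s u a u a] by (simp add: nrm_sq nrm_def[of "graph_space s H"] rip_def)

lemma nrm_graph_space_ge:
  assumes "u \<in> vecs H" "a \<in> vecs H" "s > 0"
  shows "nrm H u \<le> nrm (graph_space s H) (u, a)" "sqrt s * nrm H a \<le> nrm (graph_space s H) (u, a)"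
proof -
  show "nrm H u \<le> nrm (graph_space s H) (u, a)"
    unfolding nrm_graph_space[OF assms(1,2)] using assms by (intro real_le_rsqrt) simp
  show "sqrt s * nrm H a \<le> nrm (graph_space s H) (u, a)"
    unfolding nrm_graph_space[OF assms(1,2)] using assms
    by (intro real_le_rsqrt) (simp add: power_mult_distrib)
qed

lemma tends_graph_space:
  assumes "s > 0" "\<And>n. p n \<in> vecs H" "\<And>n. q n \<in> vecs H" "u \<in> vecs H" "a \<in> vecs H"
  shows "tends (graph_space s H) (\<lambda>n. (p n, q n)) (u, a) \<longleftrightarrow> tends H p u \<and> tends H q a"
proof
  assume t: "tends (graph_space s H) (\<lambda>n. (p n, q n)) (u, a)"
  then have t: "(\<lambda>n. nrm (graph_space s H) (sub H (p n) u, sub H (q n) a)) \<longlonglongrightarrow> 0"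
    by (simp add: tends_def sub_graph_space)
  have "tends H p u" unfolding tends_def
    by (rule Lim_null_comparison[OF _ t]) (use assms nrm_graph_space_ge(1) in auto)
  moreover have "(\<lambda>n. sqrt s * nrm H (sub H (q n) a)) \<longlonglongrightarrow> 0"
    by (rule Lim_null_comparison[OF _ t]) (use assms nrm_graph_space_ge(2) in \<open>auto simp: abs_mult\<close>)
  then have "tends H q a" unfolding tends_def
    using tendsto_mult_left[of _ 0 _ "1 / sqrt s"] assms(1) by fastforce
  ultimately show "tends H p u \<and> tends H q a" by simp
next
  assume t: "tends H p u \<and> tends H q a"
  then have "(\<lambda>n. sqrt ((nrm H (sub H (p n) u))\<^sup>2 + s * (nrm H (sub H (q n) a))\<^sup>2)) \<longlonglongrightarrow> sqrt (0\<^sup>2 + s * 0\<^sup>2)"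
    unfolding tends_def by (intro tendsto_intros) auto
  then show "tends (graph_space s H) (\<lambda>n. (p n, q n)) (u, a)"
    using assms by (simp add: tends_def sub_graph_space nrm_graph_space)
qed

lemma hilb_graph_space:
  assumes s: "s > 0" shows "hilb (graph_space s H)"
proof
  let ?G = "graph_space s H"
  have vecs: "vecs ?G = vecs H \<times> vecs H" by (simp add: graph_space_def)
  show "zer ?G \<in> vecs ?G" by (simp add: graph_space_def)
  show "\<And>u v. u \<in> vecs ?G \<Longrightarrow> v \<in> vecs ?G \<Longrightarrow> add ?G u v \<in> vecs ?G"
    by (auto simp: graph_space_def)
  show "\<And>u c. u \<in> vecs ?G \<Longrightarrow> scl ?G c u \<in> vecs ?G"
    by (auto simp: graph_space_def)
  show "\<And>w. w \<in> vecs ?G \<Longrightarrow> ip ?G (zer ?G) w = 0"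
    by (auto simp: graph_space_def)
  show "\<And>u v w. u \<in> vecs ?G \<Longrightarrow> v \<in> vecs ?G \<Longrightarrow> w \<in> vecs ?G \<Longrightarrow>
        ip ?G (add ?G u v) w = ip ?G u w + ip ?G v w"
    by (auto simp: graph_space_def ip_left algebra_simps)
  show "\<And>u c w. u \<in> vecs ?G \<Longrightarrow> w \<in> vecs ?G \<Longrightarrow> ip ?G (scl ?G c u) w = c * ip ?G u w"
    by (auto simp: graph_space_def ip_left algebra_simps)
  show "cplx (ip ?G v u) = cnj (cplx (ip ?G u v))" if uv: "u \<in> vecs ?G" "v \<in> vecs ?G" for u v
  proof -
    obtain p q p' q' where "u = (p, q)" "v = (p', q')" "p \<in> vecs H" "q \<in> vecs H" "p' \<in> vecs H" "q' \<in> vecs H"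
      using uv vecs by (cases u, cases v) auto
    then show ?thesis
      using ip_cnj[of p p'] ip_cnj[of q q'] by (simp add: graph_space_def cplx_add cplx_mult)
  qed
  show "\<And>u. u \<in> vecs ?G \<Longrightarrow> 0 \<le> rip ?G u u"
    using s by (auto simp: vecs rip_graph_space)
  show "u = v" if uv: "u \<in> vecs ?G" "v \<in> vecs ?G" and n: "nrm ?G (sub ?G u v) = 0" for u v
  proof -
    obtain p q p' q' where *: "u = (p, q)" "v = (p', q')" "p \<in> vecs H" "q \<in> vecs H" "p' \<in> vecs H" "q' \<in> vecs H"
      using uv vecs by (cases u, cases v) auto
    then have "nrm H (sub H p p') \<le> 0" "sqrt s * nrm H (sub H q q') \<le> 0"
      using nrm_graph_space_ge[of "sub H p p'" "sub H q q'" s] s n by (auto simp: sub_graph_space)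
    then have "nrm H (sub H p p') \<le> 0" "nrm H (sub H q q') \<le> 0"
      using s by (auto simp: mult_le_0_iff)
    then have "nrm H (sub H p p') = 0" "nrm H (sub H q q') = 0"
      using * by (auto intro!: antisym)
    then show ?thesis using * nrm_sub_0 by auto
  qed
  show "\<exists>u\<in>vecs ?G. tends ?G w u" if wv: "\<And>n. w n \<in> vecs ?G"
    and cau: "\<And>e. e > 0 \<Longrightarrow> \<exists>N. \<forall>m\<ge>N. \<forall>n\<ge>N. nrm ?G (sub ?G (w m) (w n)) < e" for w
  proof -
    define p q where "p n = fst (w n)" and "q n = snd (w n)" for n
    have w: "w = (\<lambda>n. (p n, q n))" by (simp add: p_def q_def)
    have v: "p n \<in> vecs H" "q n \<in> vecs H" for n using wv[of n] by (auto simp: vecs p_def q_def)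
    have "\<exists>u\<in>vecs H. tends H p u"
    proof (rule complete)
      fix e :: real assume "e > 0"
      from cau[OF this] obtain N where N: "\<And>m n. m \<ge> N \<Longrightarrow> n \<ge> N \<Longrightarrow> nrm ?G (sub ?G (w m) (w n)) < e" by blast
      have "nrm H (sub H (p m) (p n)) < e" if "m \<ge> N" "n \<ge> N" for m n
        using N[OF that] nrm_graph_space_ge(1)[of "sub H (p m) (p n)" "sub H (q m) (q n)" s] s v
        by (simp add: w sub_graph_space)
      then show "\<exists>N. \<forall>m\<ge>N. \<forall>n\<ge>N. nrm H (sub H (p m) (p n)) < e" by blast
    qed (rule v)
    moreover have "\<exists>u\<in>vecs H. tends H q u"
    proof (rule complete)
      fix e :: real assume "e > 0"
      then have "sqrt s * e > 0" using s by simp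
      from cau[OF this] obtain N where N: "\<And>m n. m \<ge> N \<Longrightarrow> n \<ge> N \<Longrightarrow> nrm ?G (sub ?G (w m) (w n)) < sqrt s * e" by blast
      have "nrm H (sub H (q m) (q n)) < e" if "m \<ge> N" "n \<ge> N" for m n
      proof -
        have "sqrt s * nrm H (sub H (q m) (q n)) \<le> nrm ?G (sub ?G (w m) (w n))"
          using nrm_graph_space_ge(2)[of "sub H (p m) (p n)" "sub H (q m) (q n)" s] s v
          by (simp add: w sub_graph_space)
        also have "\<dots> < sqrt s * e" by (rule N[OF that])
        finally show ?thesis by (rule mult_left_less_imp_less) (use s in simp)
      qed
      then show "\<exists>N. \<forall>m\<ge>N. \<forall>n\<ge>N. nrm H (sub H (q m) (q n)) < e" by blast
    qed (rule v)
    ultimately obtain u a where "u \<in> vecs H" "a \<in> vecs H" "tends H p u" "tends H q a" by blast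
    then have "tends ?G w (u, a)" "(u, a) \<in> vecs ?G"
      unfolding w using s v by (auto simp: tends_graph_space vecs)
    then show ?thesis by blast
  qed
qed

lemma lin_opD:
  assumes "lin_op H T"
  shows "(u, a) \<in> T \<Longrightarrow> u \<in> vecs H" "(u, a) \<in> T \<Longrightarrow> a \<in> vecs H"
    "(u, a) \<in> T \<Longrightarrow> (u, b) \<in> T \<Longrightarrow> a = b" "(zer H, zer H) \<in> T"
    "(u, a) \<in> T \<Longrightarrow> (v, b) \<in> T \<Longrightarrow> (add H u v, add H a b) \<in> T"
    "(u, a) \<in> T \<Longrightarrow> (scl H c u, scl H c a) \<in> T"
    "(u, a) \<in> T \<Longrightarrow> (v, b) \<in> T \<Longrightarrow> (sub H u v, sub H a b) \<in> T"
    "(u, a) \<in> T \<Longrightarrow> (rscl H t u, rscl H t a) \<in> T"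
proof -
  show "(u, a) \<in> T \<Longrightarrow> u \<in> vecs H" "(u, a) \<in> T \<Longrightarrow> a \<in> vecs H"
    "(u, a) \<in> T \<Longrightarrow> (u, b) \<in> T \<Longrightarrow> a = b" "(zer H, zer H) \<in> T"
    using assms by (auto simp: lin_op_def single_valued_def)
  have a: "(add H u v, add H a b) \<in> T" if "(u, a) \<in> T" "(v, b) \<in> T" for u a v b
    using assms that unfolding lin_op_def by blast
  have c: "(scl H c u, scl H c a) \<in> T" if "(u, a) \<in> T" for u a c
    using assms that unfolding lin_op_def by blast
  show "(u, a) \<in> T \<Longrightarrow> (v, b) \<in> T \<Longrightarrow> (add H u v, add H a b) \<in> T" by (rule a)
  show "(u, a) \<in> T \<Longrightarrow> (scl H c u, scl H c a) \<in> T" by (rule c)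
  show "(u, a) \<in> T \<Longrightarrow> (v, b) \<in> T \<Longrightarrow> (sub H u v, sub H a b) \<in> T"
    unfolding sub_def by (rule a, assumption, rule c)
  show "(u, a) \<in> T \<Longrightarrow> (rscl H t u, rscl H t a) \<in> T"
    unfolding rscl_def by (rule c)
qed

lemma lin_opI:
  assumes "\<And>u a. (u, a) \<in> T \<Longrightarrow> u \<in> vecs H" "\<And>u a. (u, a) \<in> T \<Longrightarrow> a \<in> vecs H"
    "\<And>u a b. (u, a) \<in> T \<Longrightarrow> (u, b) \<in> T \<Longrightarrow> a = b" "(zer H, zer H) \<in> T"
    "\<And>u a v b. (u, a) \<in> T \<Longrightarrow> (v, b) \<in> T \<Longrightarrow> (add H u v, add H a b) \<in> T"
    "\<And>u a c. (u, a) \<in> T \<Longrightarrow> (scl H c u, scl H c a) \<in> T"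
  shows "lin_op H T"
  using assms unfolding lin_op_def by (auto simp: single_valued_def)

lemma lin_subspace_Domain: "lin_op H T \<Longrightarrow> lin_subspace H (Domain T)"
proof -
  assume T: "lin_op H T"
  have "add H u v \<in> Domain T" if "u \<in> Domain T" "v \<in> Domain T" for u v
    using that by (auto dest: lin_opD(5)[OF T])
  moreover have "scl H c u \<in> Domain T" if "u \<in> Domain T" for c u
    using that by (auto dest: lin_opD(6)[OF T])
  moreover have "Domain T \<subseteq> vecs H" "zer H \<in> Domain T"
    using lin_opD(1,4)[OF T] by auto
  ultimately show ?thesis unfolding lin_subspace_def by blast
qed

lemma lin_subspace_Range: "lin_op H T \<Longrightarrow> lin_subspace H (Range T)"
proof -
  assume T: "lin_op H T"
  have "add H u v \<in> Range T" if "u \<in> Range T" "v \<in> Range T" for u v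
    using that by (auto dest: lin_opD(5)[OF T])
  moreover have "scl H c u \<in> Range T" if "u \<in> Range T" for c u
    using that by (auto dest: lin_opD(6)[OF T])
  moreover have "Range T \<subseteq> vecs H" "zer H \<in> Range T"
    using lin_opD(2,4)[OF T] by auto
  ultimately show ?thesis unfolding lin_subspace_def by blast
qed

lemma lin_subspace_ker: "lin_op H T \<Longrightarrow> lin_subspace H (ker H T)"
proof -
  assume T: "lin_op H T"
  have "(add H u v, zer H) \<in> T" if "(u, zer H) \<in> T" "(v, zer H) \<in> T" for u v
    using lin_opD(5)[OF T that] by simp
  moreover have "(scl H c u, zer H) \<in> T" if "(u, zer H) \<in> T" for c u
    using lin_opD(6)[OF T that, of c] by simp
  ultimately show ?thesis
    using lin_opD(1,4)[OF T] unfolding lin_subspace_def ker_def by auto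
qed

lemma closed_opD:
  assumes "closed_op H T" "\<And>n. (s n, t n) \<in> T" "u \<in> vecs H" "a \<in> vecs H" "tends H s u" "tends H t a"
  shows "(u, a) \<in> T"
  using assms unfolding closed_op_def by blast

lemma closed_op_lin: "closed_op H T \<Longrightarrow> lin_op H T"
  by (simp add: closed_op_def)

lemma cl_ker:
  assumes "closed_op H T" shows "cl H (ker H T) = ker H T"
proof
  have l: "lin_op H T" using assms by (rule closed_op_lin)
  show "cl H (ker H T) \<subseteq> ker H T"
  proof
    fix u assume u: "u \<in> cl H (ker H T)"
    obtain s where s: "u \<in> vecs H" "\<And>n. s n \<in> ker H T" "tends H s u" by (rule clE[OF u]) blast
    have "(u, zer H) \<in> T"
      by (rule closed_opD[OF assms, of s "\<lambda>n. zer H"]) (use s in \<open>auto simp: ker_def intro: tends_const\<close>)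
    then show "u \<in> ker H T" by (simp add: ker_def)
  qed
  show "ker H T \<subseteq> cl H (ker H T)"
    using lin_subspace_ker[OF l] by (intro subset_cl) (simp add: lin_subspace_def)
qed

text \<open>Real parts suffice because the graph is closed under scalars: multiplying (u, a) by the
  inverse of the discrepancy would turn the discrepancy into 1.\<close>

lemma adj_iff:
  assumes "lin_op H T"
  shows "(v, w) \<in> adj H T \<longleftrightarrow> v \<in> vecs H \<and> w \<in> vecs H \<and> (\<forall>u a. (u, a) \<in> T \<longrightarrow> rip H a v = rip H u w)"
proof
  assume r: "v \<in> vecs H \<and> w \<in> vecs H \<and> (\<forall>u a. (u, a) \<in> T \<longrightarrow> rip H a v = rip H u w)"
  have "ip H a v = ip H u w" if ua: "(u, a) \<in> T" for u a
  proof (rule ccontr)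
    assume n: "ip H a v \<noteq> ip H u w"
    let ?z = "ip H a v - ip H u w"
    have "(scl H (inverse ?z) u, scl H (inverse ?z) a) \<in> T" using lin_opD(6)[OF assms ua] .
    then have "rip H (scl H (inverse ?z) a) v = rip H (scl H (inverse ?z) u) w" using r by blast
    then have "Re (cplx (inverse ?z * ip H a v)) = Re (cplx (inverse ?z * ip H u w))"
      using lin_opD(1,2)[OF assms ua] r by (simp add: rip_def ip_left)
    then have "Re (cplx (inverse ?z * ?z)) = 0"
      by (simp only: right_diff_distrib cplx_diff minus_complex.simps)
    then show False using n by (simp add: cplx_one)
  qed
  then show "(v, w) \<in> adj H T" using r by (auto simp: adj_def)
qed (auto simp: adj_def rip_def)

lemma adjD:
  assumes "(v, w) \<in> adj H T"
  shows "v \<in> vecs H" "w \<in> vecs H" "(u, a) \<in> T \<Longrightarrow> rip H a v = rip H u w"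
  using assms by (auto simp: adj_def rip_def)

lemma lin_op_adj:
  assumes T: "lin_op H T" and d: "densely_defined H T"
  shows "lin_op H (adj H T)"
proof (rule lin_opI)
  note i = adj_iff[OF T]
  show "a = b" if ab: "(u, a) \<in> adj H T" "(u, b) \<in> adj H T" for u a b
  proof -
    have "sub H a b \<in> orth H (Domain T)"
      using ab lin_opD(1,2)[OF T] adjD[OF ab(1)] adjD[OF ab(2)]
      by (auto simp: orth_iff lin_subspace_Domain T rip_simps)
    then have "sub H a b = zer H"
      using d dense_iff_orth[OF lin_subspace_Domain[OF T]] by (auto simp: densely_defined_def)
    then show ?thesis using adjD[OF ab(1)] adjD[OF ab(2)] by (simp add: sub_eq_zer)
  qed
  show "(zer H, zer H) \<in> adj H T"
    using lin_opD(1,2)[OF T] by (auto simp: i)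
  show "(add H u v, add H a b) \<in> adj H T" if ab: "(u, a) \<in> adj H T" "(v, b) \<in> adj H T" for u a v b
    using ab lin_opD(1,2)[OF T] by (auto simp: i rip_simps)
  show "(scl H c u, scl H c a) \<in> adj H T" if ab: "(u, a) \<in> adj H T" for u a c
  proof -
    \<comment> \<open>The conjugate of \<open>c\<close> is formed in the complex numbers;
      injectivity of \<open>cplx\<close> brings the resulting identity back to the scalar
      field.\<close>
    have "cplx (ip H y (scl H c u)) = cnj (cplx c) * cplx (ip H y u)" if "y \<in> vecs H" "u \<in> vecs H" for y u
      using that ip_cnj[of "scl H c u" y] ip_cnj[of u y] by (simp add: ip_left cplx_mult)
    then have "ip H y (scl H c u) = ip H x (scl H c a)" if "(x, y) \<in> T" for x y
      using that ab lin_opD(1,2)[OF T that] adjD(1,2)[OF ab]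
      by (subst cplx_inj[symmetric]) (auto simp: adj_def)
    then show ?thesis using adjD(1,2)[OF ab] by (auto simp: adj_def)
  qed
qed (auto simp: adj_def)

lemma closed_op_adj:
  assumes T: "lin_op H T" and d: "densely_defined H T"
  shows "closed_op H (adj H T)"
  unfolding closed_op_def
proof (intro conjI allI impI lin_op_adj T d)
  fix s t u a
  assume *: "(\<forall>n. (s n, t n) \<in> adj H T) \<and> u \<in> vecs H \<and> a \<in> vecs H \<and> tends H s u \<and> tends H t a"
  then have st: "(s n, t n) \<in> adj H T" for n by blast
  have "rip H y u = rip H x a" if xy: "(x, y) \<in> T" for x y
  proof -
    note v = lin_opD(1,2)[OF T xy] and w = adjD(1,2)[OF st]
    have "(\<lambda>n. rip H (s n) y) \<longlonglongrightarrow> rip H u y" using * v w by (intro tends_rip) auto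
    moreover have "(\<lambda>n. rip H (t n) x) \<longlonglongrightarrow> rip H a x" using * v w by (intro tends_rip) auto
    moreover have "rip H (s n) y = rip H (t n) x" for n
      using adjD(3)[OF st xy] v w rip_commute[of "s n" y] rip_commute[of "t n" x] by simp
    ultimately have "rip H u y = rip H a x" by (simp add: LIMSEQ_unique)
    then show ?thesis using * v rip_commute[of u y] rip_commute[of a x] by simp
  qed
  then show "(u, a) \<in> adj H T" using * by (simp add: adj_iff[OF T])
qed

text \<open>Von Neumann's decomposition: (p', q) is orthogonal to the graph for the weight s iff the
  adjoint maps q to - p' / s. For y = 0 one has q = - a, and x becomes g plus s times the adjoint
  applied to T g. This is why the weight sits on the second component.\<close>

lemma graph_decomp:
  assumes T: "closed_op H T" and s: "s > 0" and x: "x \<in> vecs H" and y: "y \<in> vecs H"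
  obtains g a q p where "(g, a) \<in> T" "(q, p) \<in> adj H T" "x = sub H g (rscl H s p)" "y = add H a q"
proof -
  let ?G = "graph_space s H"
  interpret G: hilb ?G by (rule hilb_graph_space[OF s])
  have l: "lin_op H T" using T by (rule closed_op_lin)
  have vecs: "vecs ?G = vecs H \<times> vecs H" by (simp add: graph_space_def)
  have sub: "lin_subspace ?G T"
    using l unfolding lin_subspace_def lin_op_def graph_space_def by auto
  have "cl ?G T \<subseteq> T"
  proof
    fix z assume z: "z \<in> cl ?G T"
    obtain w where w: "z \<in> vecs ?G" "\<And>n. w n \<in> T" "tends ?G w z" by (rule G.clE[OF z]) blast
    define p q where "p n = fst (w n)" and "q n = snd (w n)" for n
    have pq: "(p n, q n) \<in> T" for n using w(2) by (simp add: p_def q_def)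
    have w': "w = (\<lambda>n. (p n, q n))" by (simp add: p_def q_def)
    obtain u a where z: "z = (u, a)" "u \<in> vecs H" "a \<in> vecs H" using w(1) by (auto simp: vecs)
    have "tends H p u \<and> tends H q a"
      using w(3) tends_graph_space[OF s, of p q u a] lin_opD(1,2)[OF l pq] z unfolding w' by simp
    then show "z \<in> T" using closed_opD[OF T, of p q u a] pq z by blast
  qed
  then have cl: "cl ?G T = T" using G.subset_cl[of T] sub by (auto simp: lin_subspace_def)
  obtain c d where cd: "c \<in> T" "d \<in> orth ?G T" "(x, y) = add ?G c d"
    by (rule G.projection[OF sub cl, of "(x, y)"]) (use x y vecs in auto)
  obtain g a p' q where e: "c = (g, a)" "d = (p', q)" by (cases c, cases d)
  have v: "p' \<in> vecs H" "q \<in> vecs H" using cd e G.orth_sub_vecs by (auto simp: vecs)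
  have gv: "g \<in> vecs H" "a \<in> vecs H" using cd e lin_opD(1,2)[OF l] by auto
  define p where "p = rscl H (- 1 / s) p'"
  have "(q, p) \<in> adj H T"
  proof -
    have "rip H b q = rip H u p" if ub: "(u, b) \<in> T" for u b
    proof -
      have "rip ?G (u, b) (p', q) = 0" using cd(2) e ub by (auto simp: orth_def rip_def)
      then have "rip H u p' + s * rip H b q = 0" by (simp add: rip_graph_space)
      then show ?thesis
        using s v lin_opD(1,2)[OF l ub] by (simp add: p_def rip_simps field_simps)
    qed
    then show ?thesis using v by (simp add: adj_iff[OF l] p_def)
  qed
  moreover have "x = sub H g (rscl H s p)" "y = add H a q"
  proof -
    have "x = add H g p'" "y = add H a q" using cd e by (auto simp: graph_space_def)
    moreover have "sub H g (rscl H s p) = add H g p'"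
      by (rule rip_eqI) (use gv v s in \<open>auto simp: p_def rip_simps\<close>)
    ultimately show "x = sub H g (rscl H s p)" "y = add H a q" by auto
  qed
  ultimately show ?thesis using that cd e by blast
qed

text \<open>Split (0, w) along the graph with s = 1, so that g = p and w = a + q. If w is orthogonal
  to the domain of the adjoint, pairing it with q gives |q|^2 + |p|^2 = 0. Then g = 0, and a = 0
  because T is single-valued.\<close>

lemma densely_defined_adj:
  assumes T: "closed_op H T" and d: "densely_defined H T"
  shows "densely_defined H (adj H T)"
proof -
  have l: "lin_op H T" using T by (rule closed_op_lin)
  have la: "lin_op H (adj H T)" using lin_op_adj[OF l d] .
  have "w = zer H" if w: "w \<in> orth H (Domain (adj H T))" for w
  proof -
    have wv: "w \<in> vecs H" using w orth_sub_vecs by auto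
    obtain g a q p where *: "(g, a) \<in> T" "(q, p) \<in> adj H T" "zer H = sub H g (rscl H 1 p)" "w = add H a q"
      by (rule graph_decomp[OF T zero_less_one zer_in wv])
    note v = lin_opD(1,2)[OF l *(1)] adjD(1,2)[OF *(2)]
    have g: "g = p"
      by (rule rip_eqI) (use v sub_eq_zer[of g "rscl H 1 p"] *(3) in \<open>auto simp: rip_simps\<close>)
    have "q \<in> Domain (adj H T)" using *(2) by auto
    then have "rip H q w = 0" using w by (simp add: orth_def rip_def)
    then have "rip H q a + rip H q q = 0" using v by (simp add: *(4) rip_simps)
    moreover have "rip H q a = rip H p p"
      using adjD(3)[OF *(2) *(1)] v g rip_commute[of q a] by simp
    ultimately have "rip H q q = 0" "rip H p p = 0" using rip_nonneg[of q] rip_nonneg[of p] v by linarith+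
    then have "q = zer H" "p = zer H" using v by (auto simp: rip_self_0)
    then have "(zer H, a) \<in> T" using *(1) g by simp
    then have "a = zer H" using lin_opD(3)[OF l] lin_opD(4)[OF l] by blast
    then show ?thesis using *(4) \<open>q = zer H\<close> by simp
  qed
  then show ?thesis unfolding densely_defined_def dense_iff_orth[OF lin_subspace_Domain[OF la]] by blast
qed

text \<open>A pair of the double adjoint is split along the graph with s = 1. Testing it with the
  pair (q, p) of the adjoint that forms the remainder yields |q|^2 + |p|^2 = 0, so only the graph
  part is left.\<close>

lemma adj_adj:
  assumes T: "closed_op H T" and d: "densely_defined H T"
  shows "adj H (adj H T) = T"
proof
  have l: "lin_op H T" using T by (rule closed_op_lin)
  have la: "lin_op H (adj H T)" using lin_op_adj[OF l d] .
  have laa: "lin_op H (adj H (adj H T))"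
    using lin_op_adj[OF la densely_defined_adj[OF T d]] .
  show TT: "T \<subseteq> adj H (adj H T)"
  proof clarify
    fix g a assume ga: "(g, a) \<in> T"
    have "rip H p g = rip H q a" if qp: "(q, p) \<in> adj H T" for q p
      using adjD[OF qp] adjD(3)[OF qp ga] lin_opD(1,2)[OF l ga] rip_commute[of p g] rip_commute[of q a] by simp
    then show "(g, a) \<in> adj H (adj H T)" using lin_opD(1,2)[OF l ga] by (simp add: adj_iff[OF la])
  qed
  show "adj H (adj H T) \<subseteq> T"
  proof clarify
    fix v w assume vw: "(v, w) \<in> adj H (adj H T)"
    obtain g a q p where *: "(g, a) \<in> T" "(q, p) \<in> adj H T" "v = sub H g (rscl H 1 p)" "w = add H a q"
      by (rule graph_decomp[OF T zero_less_one adjD(1,2)[OF vw]])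
    note v = lin_opD(1,2)[OF l *(1)] adjD(1,2)[OF *(2)]
    have "rip H p v = rip H q w" using adjD(3)[OF vw *(2)] .
    then have "rip H p g - rip H p p = rip H q a + rip H q q" using v by (simp add: * rip_simps)
    moreover have "rip H q a = rip H p g"
      using adjD(3)[OF *(2) *(1)] v rip_commute[of q a] rip_commute[of p g] by simp
    ultimately have "rip H q q = 0" "rip H p p = 0" using rip_nonneg[of q] rip_nonneg[of p] v by linarith+
    then have "q = zer H" "p = zer H" using v by (auto simp: rip_self_0)
    then have "v = g" "w = a" using *(3,4) v by (simp_all add: rscl_def)
    then show "(v, w) \<in> T" using *(1) by simp
  qed
qed

lemma orth_Range: "lin_op H T \<Longrightarrow> orth H (Range T) = ker H (adj H T)"
proof -
  assume l: "lin_op H T"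
  have "\<And>u. u \<in> orth H (Range T) \<longleftrightarrow> u \<in> ker H (adj H T)"
    unfolding ker_def mem_Collect_eq adj_iff[OF l] orth_iff[OF lin_subspace_Range[OF l]]
    using lin_opD(1)[OF l] by auto
  then show ?thesis by blast
qed

end

section \<open>Resolvents and powers of self-adjoint operators\<close>

text \<open>For self-adjoint \<open>T\<close> this is (1 + s T^2)^(-1). Unlike a resolvent of
  \<open>T\<close> at a non-real point it exists over real scalars too.\<close>

definition res :: "('k::real_or_complex, 'h) ipspace \<Rightarrow> ('h \<times> 'h) set \<Rightarrow> real \<Rightarrow> 'h \<Rightarrow> 'h" where
  "res H T s f = (SOME g. \<exists>a c. (g, a) \<in> T \<and> (a, c) \<in> T \<and> f = add H g (rscl H s c))"

context hilb begin

lemma lin_op_relcomp: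
  assumes S: "lin_op H S" and T: "lin_op H T"
  shows "lin_op H (S O T)"
proof (rule lin_opI)
  show "(zer H, zer H) \<in> S O T" using lin_opD(4)[OF S] lin_opD(4)[OF T] by blast
  show "a = b" if ab: "(u, a) \<in> S O T" "(u, b) \<in> S O T" for u a b
  proof -
    obtain y z where "(u, y) \<in> S" "(y, a) \<in> T" "(u, z) \<in> S" "(z, b) \<in> T" using ab by blast
    then show ?thesis using lin_opD(3)[OF S] lin_opD(3)[OF T] by metis
  qed
  show "(add H u v, add H a b) \<in> S O T" if ab: "(u, a) \<in> S O T" "(v, b) \<in> S O T" for u a v b
  proof -
    obtain y z where "(u, y) \<in> S" "(y, a) \<in> T" "(v, z) \<in> S" "(z, b) \<in> T" using ab by blast
    then have "(add H u v, add H y z) \<in> S" "(add H y z, add H a b) \<in> T"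
      using lin_opD(5)[OF S] lin_opD(5)[OF T] by blast+
    then show ?thesis by blast
  qed
  show "(scl H c u, scl H c a) \<in> S O T" if ab: "(u, a) \<in> S O T" for u a c
  proof -
    obtain y where "(u, y) \<in> S" "(y, a) \<in> T" using ab by blast
    then have "(scl H c u, scl H c y) \<in> S" "(scl H c y, scl H c a) \<in> T"
      using lin_opD(6)[OF S] lin_opD(6)[OF T] by blast+
    then show ?thesis by blast
  qed
qed (use lin_opD(1)[OF S] lin_opD(2)[OF T] in blast)+

lemma lin_op_relpow:
  assumes T: "lin_op H T" and "k \<ge> 1"
  shows "lin_op H (T ^^ k)"
  using assms(2)
proof (induction k rule: dec_induct)
  case base
  then show ?case using T by simp
next
  case (step n)
  then show ?case using lin_op_relcomp[OF step.IH T] by simp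
qed

lemma rscl_rscl: "u \<in> vecs H \<Longrightarrow> s \<noteq> 0 \<Longrightarrow> rscl H (1 / s) (rscl H s u) = u"
  by (rule rip_eqI) (auto simp: rip_simps)

end

locale selfadj = hilb +
  fixes T :: "('b \<times> 'b) set"
  assumes sa: "self_adjoint_op H T"
begin

lemma lin: "lin_op H T" and dd: "densely_defined H T" and adj_eq: "adj H T = T"
  using sa by (auto simp: self_adjoint_op_def)

lemma cls: "closed_op H T"
  using closed_op_adj[OF lin dd] adj_eq by simp

lemmas in_vecs = lin_opD(1,2)[OF lin]

lemma sym: "(u, a) \<in> T \<Longrightarrow> (v, b) \<in> T \<Longrightarrow> rip H a v = rip H u b"
  using adjD(3)[of v b T u a] adj_eq by simp

lemma symI: "v \<in> vecs H \<Longrightarrow> w \<in> vecs H \<Longrightarrow> (\<And>u a. (u, a) \<in> T \<Longrightarrow> rip H a v = rip H u w) \<Longrightarrow> (v, w) \<in> T"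
  using adj_iff[OF lin, of v w] adj_eq by simp

lemma orth_Range_ker: "orth H (Range T) = ker H T"
  using orth_Range[OF lin] adj_eq by simp

lemma cl_Range: "cl H (Range T) = orth H (ker H T)"
  using orth_orth[OF lin_subspace_Range[OF lin]] orth_Range_ker by simp

lemma ker_in_vecs: "u \<in> ker H T \<Longrightarrow> u \<in> vecs H"
  using in_vecs(1) by (auto simp: ker_def)

text \<open>Decompose (f, 0) along the graph: a = - q, so T a = - p, and f = g - s p reads f = g + s
  T (T g).\<close>

lemma res_ex:
  assumes s: "s > 0" and f: "f \<in> vecs H"
  obtains a c where "(res H T s f, a) \<in> T" "(a, c) \<in> T" "f = add H (res H T s f) (rscl H s c)"
proof -
  obtain g a q p where *: "(g, a) \<in> T" "(q, p) \<in> adj H T" "f = sub H g (rscl H s p)" "zer H = add H a q"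
    by (rule graph_decomp[OF cls s f zer_in])
  have qp: "(q, p) \<in> T" using * adj_eq by simp
  note v = in_vecs[OF *(1)] in_vecs[OF qp]
  have eq: "rip H a w = - rip H q w" if "w \<in> vecs H" for w
  proof -
    have "rip H (add H a q) w = 0" using that by (simp flip: *(4))
    then show ?thesis using v that by (simp add: rip_simps)
  qed
  have "a = scl H (- 1) q"
    by (rule rip_eqI) (use v eq in \<open>auto simp: rip_rscl_left[of q _ "-1", unfolded rscl_def, simplified]\<close>)
  then have ac: "(a, scl H (- 1) p) \<in> T" using lin_opD(6)[OF lin qp] by simp
  have "f = add H g (rscl H s (scl H (- 1) p))"
    by (rule ip_eqI) (use v in \<open>auto simp: *(3) ip_left\<close>)
  then have "\<exists>g a c. (g, a) \<in> T \<and> (a, c) \<in> T \<and> f = add H g (rscl H s c)" using *(1) ac by blast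
  then have "\<exists>a c. (res H T s f, a) \<in> T \<and> (a, c) \<in> T \<and> f = add H (res H T s f) (rscl H s c)"
    unfolding res_def by (rule someI_ex)
  then show thesis using that by blast
qed

text \<open>By symmetry, pairing g + s T^2 g with g gives |g|^2 + s |T g|^2; Cauchy-Schwarz then
  removes one factor |g|.\<close>

lemma res_bound:
  assumes s: "s > 0" and "(g, a) \<in> T" "(a, c) \<in> T"
  shows "nrm H g \<le> nrm H (add H g (rscl H s c))"
proof -
  note v = in_vecs[OF assms(2)] in_vecs[OF assms(3)]
  have "(nrm H g)\<^sup>2 \<le> rip H g g + s * rip H a a" using s v by (simp add: nrm_sq)
  also have "\<dots> = rip H g (add H g (rscl H s c))"
    using sym[OF assms(2,3)] v by (simp add: rip_simps)
  also have "\<dots> \<le> nrm H g * nrm H (add H g (rscl H s c))"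
    using cauchy_schwarz[of g "add H g (rscl H s c)"] v by simp
  finally have "nrm H g * nrm H g \<le> nrm H g * nrm H (add H g (rscl H s c))"
    by (simp add: power2_eq_square)
  then show ?thesis using nrm_nonneg[OF v(1)] nrm_nonneg[of "add H g (rscl H s c)"] v
    by (cases "nrm H g = 0") (auto simp: mult_le_cancel_left)
qed

lemma res_eqI:
  assumes s: "s > 0" and ga: "(g, a) \<in> T" and ac: "(a, c) \<in> T" and f: "f = add H g (rscl H s c)"
  shows "res H T s f = g"
proof -
  note v = in_vecs[OF ga] in_vecs[OF ac]
  have fv: "f \<in> vecs H" using f v by simp
  obtain a' c' where *: "(res H T s f, a') \<in> T" "(a', c') \<in> T" "f = add H (res H T s f) (rscl H s c')"
    by (rule res_ex[OF s fv])
  let ?g = "res H T s f"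
  note w = in_vecs[OF *(1)] in_vecs[OF *(2)]
  have "add H (sub H ?g g) (rscl H s (sub H c' c)) = sub H (add H ?g (rscl H s c')) (add H g (rscl H s c))"
    by (rule rip_eqI) (use v w in \<open>auto simp: rip_simps algebra_simps\<close>)
  also have "\<dots> = zer H" using fv by (simp flip: f *(3))
  finally have z: "add H (sub H ?g g) (rscl H s (sub H c' c)) = zer H" .
  have "nrm H (sub H ?g g) \<le> nrm H (add H (sub H ?g g) (rscl H s (sub H c' c)))"
    by (rule res_bound[OF s lin_opD(7)[OF lin *(1) ga] lin_opD(7)[OF lin *(2) ac]])
  then have "nrm H (sub H ?g g) \<le> 0" by (simp only: z nrm_zer)
  then show ?thesis using v w by (intro nrm_sub_0 antisym) auto
qed

lemma res_in: "s > 0 \<Longrightarrow> f \<in> vecs H \<Longrightarrow> res H T s f \<in> vecs H"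
  using res_ex in_vecs by metis

lemma res_le: assumes "s > 0" "f \<in> vecs H" shows "nrm H (res H T s f) \<le> nrm H f"
proof -
  obtain a c where *: "(res H T s f, a) \<in> T" "(a, c) \<in> T" "f = add H (res H T s f) (rscl H s c)"
    by (rule res_ex[OF assms])
  have "nrm H (res H T s f) \<le> nrm H (add H (res H T s f) (rscl H s c))"
    by (rule res_bound[OF assms(1) *(1,2)])
  also have "add H (res H T s f) (rscl H s c) = f" by (rule *(3)[symmetric])
  finally show ?thesis .
qed

lemma res_add:
  assumes s: "s > 0" and f: "f \<in> vecs H" "f' \<in> vecs H"
  shows "res H T s (add H f f') = add H (res H T s f) (res H T s f')"
proof -
  obtain a c where *: "(res H T s f, a) \<in> T" "(a, c) \<in> T" "f = add H (res H T s f) (rscl H s c)"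
    by (rule res_ex[OF s f(1)])
  obtain a' c' where **: "(res H T s f', a') \<in> T" "(a', c') \<in> T" "f' = add H (res H T s f') (rscl H s c')"
    by (rule res_ex[OF s f(2)])
  note v = in_vecs[OF *(1)] in_vecs[OF *(2)] in_vecs[OF **(1)] in_vecs[OF **(2)]
  have "add H (add H (res H T s f) (rscl H s c)) (add H (res H T s f') (rscl H s c'))
      = add H (add H (res H T s f) (res H T s f')) (rscl H s (add H c c'))"
    by (rule rip_eqI) (use v in \<open>auto simp: rip_simps algebra_simps\<close>)
  then have "add H f f' = add H (add H (res H T s f) (res H T s f')) (rscl H s (add H c c'))"
    by (simp flip: *(3) **(3))
  then show ?thesis
    by (rule res_eqI[OF s lin_opD(5)[OF lin *(1) **(1)] lin_opD(5)[OF lin *(2) **(2)]])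
qed

lemma res_ker: assumes "s > 0" "f \<in> ker H T" shows "res H T s f = f"
proof (rule res_eqI[OF assms(1)])
  show "(f, zer H) \<in> T" "(zer H, zer H) \<in> T" using assms lin_opD(4)[OF lin] by (auto simp: ker_def)
  show "f = add H f (rscl H s (zer H))" using assms ker_in_vecs by (simp add: rscl_def)
qed

lemma res_sym:
  assumes s: "s > 0" and f: "f \<in> vecs H" "f' \<in> vecs H"
  shows "rip H (res H T s f) f' = rip H f (res H T s f')"
proof -
  obtain a c where *: "(res H T s f, a) \<in> T" "(a, c) \<in> T" "f = add H (res H T s f) (rscl H s c)"
    by (rule res_ex[OF s f(1)])
  obtain a' c' where **: "(res H T s f', a') \<in> T" "(a', c') \<in> T" "f' = add H (res H T s f') (rscl H s c')"
    by (rule res_ex[OF s f(2)])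
  note v = in_vecs[OF *(1)] in_vecs[OF *(2)] in_vecs[OF **(1)] in_vecs[OF **(2)]
  have "rip H (res H T s f) (add H (res H T s f') (rscl H s c'))
      = rip H (add H (res H T s f) (rscl H s c)) (res H T s f')"
    using v sym[OF *(1) **(2)] sym[OF *(2) **(1)] by (simp add: rip_simps)
  then show ?thesis by (simp flip: *(3) **(3))
qed

lemma res_inj: assumes s: "s > 0" and f: "f \<in> vecs H" and z: "res H T s f = zer H" shows "f = zer H"
proof -
  obtain a c where *: "(res H T s f, a) \<in> T" "(a, c) \<in> T" "f = add H (res H T s f) (rscl H s c)"
    by (rule res_ex[OF s f])
  have "a = zer H" using *(1) z lin_opD(3,4)[OF lin] by metis
  then have "c = zer H" using *(2) lin_opD(3,4)[OF lin] by metis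
  then show ?thesis using *(3) z by (simp add: rscl_def)
qed

lemma res_zer: "s > 0 \<Longrightarrow> res H T s (zer H) = zer H"
  by (rule res_ker) (use lin_opD(4)[OF lin] in \<open>auto simp: ker_def\<close>)

lemma res_sub:
  assumes s: "s > 0" and f: "f \<in> vecs H" "f' \<in> vecs H"
  shows "res H T s (sub H f f') = sub H (res H T s f) (res H T s f')"
  by (rule rip_eqI) (use assms in \<open>auto simp: rip_simps res_sym res_in\<close>)

lemma res_eq_imp: assumes "s > 0" "f \<in> vecs H" "f' \<in> vecs H" "res H T s f = res H T s f'" shows "f = f'"
proof -
  have "res H T s (sub H f f') = zer H" using assms by (simp add: res_sub res_in)
  then have "sub H f f' = zer H" by (rule res_inj[OF assms(1) sub_in[OF assms(2,3)]])
  then show ?thesis using sub_eq_zer[OF assms(2,3)] by blast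
qed

text \<open>The vector \<open>s c = u - x\<close> lies in the domain, because both \<open>u\<close> and \<open>x\<close> do.\<close>

lemma res_commute:
  assumes s: "s > 0" and ua: "(u, a) \<in> T"
  shows "(res H T s u, res H T s a) \<in> T"
proof -
  have uv: "u \<in> vecs H" using in_vecs ua by blast
  let ?x = "res H T s u"
  obtain p q where *: "(?x, p) \<in> T" "(p, q) \<in> T" "u = add H ?x (rscl H s q)"
    by (rule res_ex[OF s uv])
  note v = in_vecs[OF *(1)] in_vecs[OF *(2)] in_vecs[OF ua]
  have "(sub H u ?x, sub H a p) \<in> T" by (rule lin_opD(7)[OF lin ua *(1)])
  moreover have "sub H u ?x = rscl H s q" using v *(3) by (simp add: sub_eq_iff)
  ultimately have "(rscl H (1 / s) (rscl H s q), rscl H (1 / s) (sub H a p)) \<in> T"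
    using lin_opD(8)[OF lin] by metis
  then have q: "(q, rscl H (1 / s) (sub H a p)) \<in> T" using s v by (simp add: rscl_rscl)
  have "a = add H p (rscl H s (rscl H (1 / s) (sub H a p)))"
    by (rule rip_eqI) (use v s in \<open>auto simp: rip_simps\<close>)
  then have "res H T s a = p" by (rule res_eqI[OF s *(2) q])
  then show ?thesis using *(1) by simp
qed

lemma res_relpow:
  assumes "s > 0" "(u, a) \<in> T ^^ k"
  shows "(res H T s u, res H T s a) \<in> T ^^ k"
  using assms(2)
proof (induction k arbitrary: a)
  case (Suc k)
  then obtain y where "(u, y) \<in> T ^^ k" "(y, a) \<in> T" by auto
  then show ?case using Suc.IH res_commute[OF assms(1)] by auto
qed auto

lemma relpow_sym: "(u, a) \<in> T ^^ k \<Longrightarrow> (v, b) \<in> T ^^ k \<Longrightarrow> rip H a v = rip H u b"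
proof (induction k arbitrary: u a v b)
  case (Suc k)
  obtain y where y: "(u, y) \<in> T ^^ k" "(y, a) \<in> T" using Suc.prems(1) by auto
  obtain z where z: "(v, z) \<in> T" "(z, b) \<in> T ^^ k" using Suc.prems(2) by (meson relpow_Suc_E2)
  have "rip H a v = rip H y z" by (rule sym[OF y(2) z(1)])
  also have "\<dots> = rip H u b" by (rule Suc.IH[OF y(1) z(2)])
  finally show ?case .
qed auto

lemma lin_pow: "k \<ge> 1 \<Longrightarrow> lin_op H (T ^^ k)"
  using lin_op_relpow[OF lin] .

text \<open>Let x be the image of f. Then s T^2 x = f - x, and x lies in the domain of T^k along
  with f because the resolvent commutes with T^k. So T^2 x lies there as well, and x gains two
  powers.\<close>

lemma res_Domain_relpow:
  assumes s: "s > 0" and f: "f \<in> vecs H" and d: "f \<in> Domain (T ^^ k)"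
  shows "res H T s f \<in> Domain (T ^^ Suc (Suc k))"
proof -
  let ?x = "res H T s f"
  obtain a c where *: "(?x, a) \<in> T" "(a, c) \<in> T" "f = add H ?x (rscl H s c)"
    by (rule res_ex[OF s f])
  note v = in_vecs[OF *(1)] in_vecs[OF *(2)]
  have "c \<in> Domain (T ^^ k)"
  \<comment> \<open>For k = 0 the power is the identity relation on the whole type, not an operator
    on the carrier, so \<open>lin_pow\<close> covers only positive powers.\<close>
  proof (cases "k = 0")
    case False
    obtain b where b: "(f, b) \<in> T ^^ k" using d by blast
    have l: "lin_op H (T ^^ k)" using lin_pow False by simp
    have "(sub H f ?x, sub H b (res H T s b)) \<in> T ^^ k"
      by (rule lin_opD(7)[OF l b res_relpow[OF s b]])
    moreover have "sub H f ?x = rscl H s c" using v f *(3) by (simp add: sub_eq_iff)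
    ultimately have "(rscl H (1 / s) (rscl H s c), rscl H (1 / s) (sub H b (res H T s b))) \<in> T ^^ k"
      using lin_opD(8)[OF l] by metis
    then show ?thesis using s v by (auto simp: rscl_rscl)
  qed auto
  then obtain e where "(c, e) \<in> T ^^ k" by blast
  then have "(?x, e) \<in> T ^^ Suc (Suc k)" using *(1,2) by (meson relpow_Suc_I2)
  then show ?thesis by blast
qed

lemma relpow_Domain_mono: "u \<in> Domain (T ^^ (m + n)) \<Longrightarrow> u \<in> Domain (T ^^ m)"
  by (auto simp: relpow_add)

lemma funpow_res:
  assumes s: "s > 0" and f: "f \<in> vecs H"
  shows "(res H T s ^^ n) f \<in> vecs H \<and> (res H T s ^^ n) f \<in> Domain (T ^^ n)"
proof (induction n)
  case (Suc n)
  then have "res H T s ((res H T s ^^ n) f) \<in> Domain (T ^^ Suc (Suc n))"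
    using res_Domain_relpow[OF s] by blast
  then have "res H T s ((res H T s ^^ n) f) \<in> Domain (T ^^ (Suc n + 1))" by simp
  then have "res H T s ((res H T s ^^ n) f) \<in> Domain (T ^^ Suc n)" by (rule relpow_Domain_mono)
  then show ?case using Suc s by (simp add: res_in)
qed (use f in auto)

lemma funpow_res_sym:
  assumes s: "s > 0" and f: "f \<in> vecs H" "f' \<in> vecs H"
  shows "rip H ((res H T s ^^ n) f) f' = rip H f ((res H T s ^^ n) f')"
  using f(2)
proof (induction n arbitrary: f')
  case (Suc n)
  have "rip H ((res H T s ^^ Suc n) f) f' = rip H ((res H T s ^^ n) f) (res H T s f')"
    using Suc.prems funpow_res[OF s f(1), of n] by (simp add: res_sym[OF s])
  also have "\<dots> = rip H f ((res H T s ^^ n) (res H T s f'))"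
    using Suc res_in[OF s] by simp
  finally show ?case by (simp add: funpow_swap1)
qed auto

lemma funpow_res_eq_imp:
  assumes s: "s > 0" and f: "f \<in> vecs H" "f' \<in> vecs H" and e: "(res H T s ^^ n) f = (res H T s ^^ n) f'"
  shows "f = f'"
  using e
proof (induction n)
  case (Suc n)
  then show ?case using res_eq_imp[OF s] funpow_res[OF s f(1), of n] funpow_res[OF s f(2), of n] by simp
qed auto

lemma funpow_res_relpow:
  assumes "s > 0" "(u, a) \<in> T ^^ k"
  shows "((res H T s ^^ n) u, (res H T s ^^ n) a) \<in> T ^^ k"
  by (induction n) (use assms res_relpow in auto)

text \<open>With R the resolvent and T^k R x = R y, applying T twice more and regrouping T^(k+2)
  gives T^k (T^2 R x) = T^2 R y. Since x = R x + s T^2 R x, and likewise for y, linearity of T^k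
  yields T^k x = y.\<close>

lemma res_relpow_reflect:
  assumes s: "s > 0" and k: "k \<ge> 1" and x: "x \<in> vecs H" and y: "y \<in> vecs H"
    and xy: "(res H T s x, res H T s y) \<in> T ^^ k"
  shows "(x, y) \<in> T ^^ k"
proof -
  have l: "lin_op H (T ^^ k)" using lin_pow k .
  obtain a c where *: "(res H T s x, a) \<in> T" "(a, c) \<in> T" "x = add H (res H T s x) (rscl H s c)"
    by (rule res_ex[OF s x])
  obtain a' c' where **: "(res H T s y, a') \<in> T" "(a', c') \<in> T" "y = add H (res H T s y) (rscl H s c')"
    by (rule res_ex[OF s y])
  have "(res H T s x, c') \<in> T ^^ Suc (Suc k)" using xy ** by auto
  then obtain p q where pq: "(res H T s x, p) \<in> T" "(p, q) \<in> T" "(q, c') \<in> T ^^ k"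
    by (meson relpow_Suc_E2)
  have "p = a" by (rule lin_opD(3)[OF lin pq(1) *(1)])
  then have "q = c" using lin_opD(3)[OF lin pq(2)] *(2) by blast
  then have "(c, c') \<in> T ^^ k" using pq(3) by simp
  then have "(add H (res H T s x) (rscl H s c), add H (res H T s y) (rscl H s c')) \<in> T ^^ k"
    by (rule lin_opD(5)[OF l xy lin_opD(8)[OF l]])
  then show ?thesis by (simp flip: *(3) **(3))
qed

text \<open>The k-th power of the resolvent maps into the domain of T^k and is symmetric, so it
  kills every vector orthogonal to that domain; it is also injective.\<close>

lemma densely_defined_relpow: assumes k: "k \<ge> 1" shows "densely_defined H (T ^^ k)"
proof -
  have l: "lin_op H (T ^^ k)" using lin_pow k .
  let ?R = "res H T 1 ^^ k"
  have "u = zer H" if u: "u \<in> orth H (Domain (T ^^ k))" for u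
  proof -
    have uv: "u \<in> vecs H" using u orth_sub_vecs by auto
    have "rip H (?R u) w = rip H (zer H) w" if w: "w \<in> vecs H" for w
    proof -
      have "?R w \<in> Domain (T ^^ k)" "?R w \<in> vecs H" using funpow_res[OF zero_less_one w] by auto
      then have "rip H (?R w) u = 0" using u by (simp add: orth_def rip_def)
      then have "rip H w (?R u) = 0" using funpow_res_sym[OF zero_less_one w uv] by simp
      then show ?thesis using w rip_commute[of w "?R u"] funpow_res[OF zero_less_one uv] by simp
    qed
    then have "?R u = zer H" using funpow_res[OF zero_less_one uv] by (intro rip_eqI) auto
    also have "\<dots> = ?R (zer H)" by (induction k) (auto simp: res_zer)
    finally show ?thesis using funpow_res_eq_imp[OF zero_less_one uv zer_in] by blast
  qed
  then show ?thesis unfolding densely_defined_def dense_iff_orth[OF lin_subspace_Domain[OF l]] by blast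
qed

text \<open>For (v, w) in the adjoint of T^k, let R be the k-th power of the resolvent. Then R v
  lies in the domain of T^k, and moving R across the inner product shows T^k R v = R w. The
  resolvents are then stripped off one by one with \<open>res_relpow_reflect\<close>.\<close>

theorem self_adjoint_relpow: assumes k: "k \<ge> 1" shows "self_adjoint_op H (T ^^ k)"
proof -
  have l: "lin_op H (T ^^ k)" using lin_pow k .
  let ?R = "\<lambda>n. res H T 1 ^^ n"
  have "(v, w) \<in> T ^^ k" if vw: "(v, w) \<in> adj H (T ^^ k)" for v w
  proof -
    note vv = adjD(1,2)[OF vw]
    note R = funpow_res[OF zero_less_one]
    obtain z where z: "(?R k v, z) \<in> T ^^ k" using R[OF vv(1), of k] by blast
    have zv: "z \<in> vecs H" using lin_opD(2)[OF l z] .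
    \<comment> \<open>The test vector is smoothed twice: once so that T^k can be applied to it, and
      once more because the definition of the adjoint must be applied to a vector of the domain
      after a resolvent has been moved off v.\<close>
    have "rip H (?R k z) x = rip H (?R k (?R k w)) x" if x: "x \<in> vecs H" for x
    proof -
      obtain y where y: "(?R k x, y) \<in> T ^^ k" using R[OF x, of k] by blast
      have yv: "y \<in> vecs H" using lin_opD(2)[OF l y] .
      have "rip H x (?R k z) = rip H (?R k x) z"
        by (rule funpow_res_sym[OF zero_less_one x zv, symmetric])
      also have "\<dots> = rip H y (?R k v)"
        by (rule relpow_sym[OF y z, symmetric])
      also have "\<dots> = rip H (?R k y) v"
        by (rule funpow_res_sym[OF zero_less_one yv vv(1), symmetric])
      also have "\<dots> = rip H (?R k (?R k x)) w"
        by (rule adjD(3)[OF vw funpow_res_relpow[OF zero_less_one y]])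
      also have "\<dots> = rip H (?R k x) (?R k w)"
        using R[OF x] vv by (simp add: funpow_res_sym[OF zero_less_one])
      also have "\<dots> = rip H x (?R k (?R k w))"
        using R[OF vv(2)] x by (simp add: funpow_res_sym[OF zero_less_one])
      finally show ?thesis
        using x R[OF zv, of k] R[of "?R k w" k] R[OF vv(2), of k]
          rip_commute[of x "?R k z"] rip_commute[of x "?R k (?R k w)"] by simp
    qed
    then have "?R k z = ?R k (?R k w)"
      using R[OF zv] R[OF vv(2)] R by (intro rip_eqI) auto
    then have "z = ?R k w"
      using funpow_res_eq_imp[OF zero_less_one zv] R[OF vv(2)] by blast
    then have "(?R k v, ?R k w) \<in> T ^^ k" using z by simp
    moreover have "(?R n v, ?R n w) \<in> T ^^ k \<Longrightarrow> (v, w) \<in> T ^^ k" for n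
    proof (induction n)
      case (Suc n)
      then show ?case
        using res_relpow_reflect[OF zero_less_one k, of "?R n v" "?R n w"] R[OF vv(1), of n] R[OF vv(2), of n]
        by simp
    qed simp
    ultimately show ?thesis by blast
  qed
  moreover have "(v, w) \<in> adj H (T ^^ k)" if vw: "(v, w) \<in> T ^^ k" for v w
    using lin_opD(1,2)[OF l vw] relpow_sym[OF _ vw] by (simp add: adj_iff[OF l])
  ultimately have "adj H (T ^^ k) = T ^^ k" by (intro set_eqI) auto
  then show ?thesis using l densely_defined_relpow[OF k] by (simp add: self_adjoint_op_def)
qed

text \<open>If T^(n+1) u = 0 with n positive, then T^n u lies both in the range and in the kernel of
  T, which are orthogonal; so T^n u = 0.\<close>

lemma ker_relpow: assumes "k \<ge> 1" shows "ker H (T ^^ k) = ker H T"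
  using assms
proof (induction k rule: dec_induct)
  case (step n)
  have "u \<in> ker H T" if u: "u \<in> ker H (T ^^ Suc n)" for u
  proof -
    obtain y where y: "(u, y) \<in> T ^^ n" "(y, zer H) \<in> T" using u by (auto simp: ker_def)
    obtain m where m: "n = Suc m" using step by (cases n) auto
    obtain x where x: "(x, y) \<in> T" using y(1) m by auto
    note v = in_vecs[OF x]
    have "rip H y y = rip H x (zer H)" by (rule sym[OF x y(2)])
    then have "y = zer H" using v by (simp add: rip_self_0)
    then have "u \<in> ker H (T ^^ n)" using y by (simp add: ker_def)
    then show ?thesis using step by simp
  qed
  moreover have "u \<in> ker H (T ^^ Suc n)" if u: "u \<in> ker H T" for u
  proof -
    have "u \<in> ker H (T ^^ n)" using step u by simp
    then show ?thesis using lin_opD(4)[OF lin] by (auto simp: ker_def)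
  qed
  ultimately show ?case by blast
qed simp

lemma selfadj_relpow: "k \<ge> 1 \<Longrightarrow> selfadj H (T ^^ k)"
  by (simp add: selfadj_def selfadj_axioms_def self_adjoint_relpow hilb_axioms)

lemma cl_Range_relpow: "k \<ge> 1 \<Longrightarrow> cl H (Range (T ^^ k)) = cl H (Range T)"
  using selfadj.cl_Range[OF selfadj_relpow] by (simp add: cl_Range ker_relpow)

text \<open>Let g be the image of a = T u and p = T g. Pairing a = g + s T p with g gives |g|^2 + s
  |p|^2 = (u, p). Completing the square in |p| absorbs s |p|^2 and leaves |u|^2 / (4 s), the square
  of the bound.\<close>

lemma res_Range_le:
  assumes s: "s > 0" and ua: "(u, a) \<in> T"
  shows "nrm H (res H T s a) \<le> nrm H u / (2 * sqrt s)"
proof -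
  note v = in_vecs[OF ua]
  let ?g = "res H T s a"
  obtain p q where *: "(?g, p) \<in> T" "(p, q) \<in> T" "a = add H ?g (rscl H s q)"
    by (rule res_ex[OF s v(2)])
  note w = in_vecs[OF *(1)] in_vecs[OF *(2)]
  have "rip H (add H ?g (rscl H s q)) ?g = rip H ?g ?g + s * rip H p p"
    using w sym[OF *(2) *(1)] by (simp add: rip_simps)
  then have "rip H ?g ?g + s * rip H p p = rip H a ?g" by (simp flip: *(3))
  also have "\<dots> = rip H u p" by (rule sym[OF ua *(1)])
  also have "\<dots> \<le> nrm H u * nrm H p" using cauchy_schwarz[OF v(1) w(2)] by simp
  finally have 1: "(nrm H ?g)\<^sup>2 + s * (nrm H p)\<^sup>2 \<le> nrm H u * nrm H p" using w by (simp add: nrm_sq)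
  have "nrm H u * nrm H p \<le> (nrm H u)\<^sup>2 / (4 * s) + s * (nrm H p)\<^sup>2"
  proof -
    have "0 \<le> (nrm H u / (2 * sqrt s) - sqrt s * nrm H p)\<^sup>2" by simp
    also have "\<dots> = (nrm H u)\<^sup>2 / (4 * s) + s * (nrm H p)\<^sup>2 - nrm H u * nrm H p"
      using s by (simp add: power2_diff power_divide power_mult_distrib)
    finally show ?thesis by simp
  qed
  with 1 have "(nrm H ?g)\<^sup>2 \<le> (nrm H u / (2 * sqrt s))\<^sup>2"
    using s by (simp add: power_divide power_mult_distrib)
  then show ?thesis using s v by (intro power2_le_imp_le[of "nrm H ?g"]) auto
qed

text \<open>On the range the decay is of order 1 / sqrt s; since the resolvents are contractions for
  every s, it passes to the closure without a rate.\<close>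

lemma res_tends_zer:
  assumes b: "b \<in> cl H (Range T)"
  shows "tends H (\<lambda>n. res H T (real (Suc n)) b) (zer H)"
  unfolding tends_def
proof (rule LIMSEQ_I)
  fix e :: real assume e: "e > 0"
  have Rv: "Range T \<subseteq> vecs H" using in_vecs(2) by blast
  have bv: "b \<in> vecs H" using b cl_sub_vecs by auto
  obtain a where a: "a \<in> Range T" "nrm H (sub H a b) < e / 2"
    using b cl_iff[OF Rv, of b] e by (meson half_gt_zero)
  then obtain u where ua: "(u, a) \<in> T" by blast
  note v = in_vecs[OF ua]
  have "(\<lambda>n. nrm H u / (2 * sqrt (real (Suc n)))) \<longlonglongrightarrow> 0"
  proof -
    have "(\<lambda>n. sqrt (1 / real (Suc n)) * (nrm H u / 2)) \<longlonglongrightarrow> sqrt 0 * (nrm H u / 2)"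
      using LIMSEQ_inverse_real_of_nat by (intro tendsto_intros) (simp add: field_simps)
    then show ?thesis by (simp add: real_sqrt_divide field_simps)
  qed
  then have "eventually (\<lambda>n. nrm H u / (2 * sqrt (real (Suc n))) < e / 2) sequentially"
    using e by (intro order_tendstoD(2)) auto
  then obtain N where N: "\<And>n. n \<ge> N \<Longrightarrow> nrm H u / (2 * sqrt (real (Suc n))) < e / 2"
    by (auto simp: eventually_sequentially)
  have "norm (nrm H (sub H (res H T (real (Suc n)) b) (zer H)) - 0) < e" if n: "n \<ge> N" for n
  proof -
    let ?R = "res H T (real (Suc n))"
    have s: "real (Suc n) > 0" by simp
    have R: "?R b \<in> vecs H" "?R a \<in> vecs H" using res_in[OF s] bv v by auto
    have "nrm H (?R b) = nrm H (add H (?R (sub H b a)) (?R a))"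
      using v bv by (simp add: res_add[OF s, symmetric] del: of_nat_Suc)
         (metis sub_eq_iff sub_in add_commute)
    also have "\<dots> \<le> nrm H (?R (sub H b a)) + nrm H (?R a)"
      using v bv res_in[OF s] by (intro nrm_add_le) auto
    also have "\<dots> < e / 2 + e / 2"
    proof (rule add_strict_mono)
      show "nrm H (?R (sub H b a)) < e / 2"
        using res_le[OF s, of "sub H b a"] a(2) v bv nrm_sub_commute[of a b] by simp
      show "nrm H (?R a) < e / 2"
        using res_Range_le[OF s ua] N[OF n] by simp
    qed
    finally show ?thesis using R by simp
  qed
  then show "\<exists>N. \<forall>n\<ge>N. norm (nrm H (sub H (res H T (real (Suc n)) b) (zer H)) - 0) < e" by blast
qed

end

context selfadj begin

text \<open>
  \<open>P\<close> commutes with the resolvents \<open>R\<^sub>s = (1 + s T\<^sup>2\<^sup>k)\<^sup>-\<^sup>1\<close>.  As \<open>s\<close> grows, \<open>R\<^sub>s\<close> tends to the projection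
  onto the kernel, so closedness of \<open>P\<close> replaces boundedness.
\<close>

lemma commutes_with_preserves:
  assumes k: "k \<ge> 1" and comm: "commutes_with (T ^^ k) P"
    and Padd: "\<And>u v. u \<in> vecs H \<Longrightarrow> v \<in> vecs H \<Longrightarrow> P u \<in> vecs H \<Longrightarrow> P v \<in> vecs H \<Longrightarrow>
      P (add H u v) = add H (P u) (P v)"
    and Pscl: "\<And>c u. u \<in> vecs H \<Longrightarrow> P u \<in> vecs H \<Longrightarrow> P (scl H c u) = scl H c (P u)"
    and Pcl: "\<And>s u w. (\<And>n. s n \<in> vecs H) \<Longrightarrow> (\<And>n. P (s n) \<in> vecs H) \<Longrightarrow> u \<in> vecs H \<Longrightarrow> w \<in> vecs H \<Longrightarrow>
      tends H s u \<Longrightarrow> tends H (\<lambda>n. P (s n)) w \<Longrightarrow> P u = w"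
  shows "f \<in> vecs H \<Longrightarrow> P f \<in> vecs H"
    and "b \<in> cl H (Range T) \<Longrightarrow> P b \<in> cl H (Range T)"
    and "u \<in> ker H T \<Longrightarrow> P u \<in> ker H T"
proof -
  interpret A: selfadj H "T ^^ k" using selfadj_relpow[OF k] .
  have c: "(P u, P a) \<in> T ^^ k" if "(u, a) \<in> T ^^ k" for u a
    using comm that by (auto simp: commutes_with_def)
  \<comment> \<open>In f = g + s e the vectors g and e belong to pairs of T^k, so commutation
    already tells that P g and P e are vectors. Additivity then shows the same for P f, although
    nothing was assumed about P off the domain.\<close>
  have main: "P f \<in> vecs H \<and> res H (T ^^ k) s (P f) = P (res H (T ^^ k) s f)"
    if s: "s > 0" and f: "f \<in> vecs H" for f s
  proof -
    let ?g = "res H (T ^^ k) s f"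
    obtain a e where *: "(?g, a) \<in> T ^^ k" "(a, e) \<in> T ^^ k" "f = add H ?g (rscl H s e)"
      by (rule A.res_ex[OF s f])
    note v = A.in_vecs[OF *(1)] A.in_vecs[OF *(2)] A.in_vecs[OF c[OF *(1)]] A.in_vecs[OF c[OF *(2)]]
    have "P (add H ?g (rscl H s e)) = add H (P ?g) (rscl H s (P e))"
      using v by (simp add: Padd Pscl rscl_def)
    then have e: "P f = add H (P ?g) (rscl H s (P e))" by (simp flip: *(3))
    have "res H (T ^^ k) s (P f) = P ?g"
      by (rule A.res_eqI[OF s c[OF *(1)] c[OF *(2)] e])
    then show ?thesis using e v by simp
  qed
  show Pv: "P f \<in> vecs H" if "f \<in> vecs H" for f using main[OF zero_less_one that] by blast
  have Pz: "P (zer H) = zer H"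
  proof -
    have "P (scl H 0 (zer H)) = scl H 0 (P (zer H))" by (rule Pscl[OF zer_in Pv[OF zer_in]])
    moreover have "scl H 0 (P (zer H)) = zer H" by (rule ip_eqI) (use Pv in \<open>auto simp: ip_left\<close>)
    ultimately show ?thesis by simp
  qed
  show "P u \<in> ker H T" if "u \<in> ker H T" for u
  proof -
    have "(u, zer H) \<in> T ^^ k" using that ker_relpow[OF k] by (simp add: ker_def set_eq_iff)
    then have "(P u, zer H) \<in> T ^^ k" using c Pz by force
    then have "P u \<in> ker H (T ^^ k)" by (simp add: ker_def)
    then show ?thesis using ker_relpow[OF k] by simp
  qed
  show "P b \<in> cl H (Range T)" if b: "b \<in> cl H (Range T)" for b
  proof -
    have bv: "b \<in> vecs H" using b cl_sub_vecs by auto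
    let ?R = "\<lambda>n. res H (T ^^ k) (real (Suc n))"
    have s: "real (Suc n) > 0" for n by simp
    \<comment> \<open>\<alpha> is the kernel part of P b and has to vanish. The resolvents fix
      \<alpha> and send b and \<beta> to 0, so the vectors \<open>?R n b\<close> tend to 0 while
      their images under P tend to \<alpha>; closedness gives \<alpha> = P 0 = 0.\<close>
    obtain \<alpha> \<beta> where ab: "\<alpha> \<in> ker H T" "\<beta> \<in> orth H (ker H T)" "P b = add H \<alpha> \<beta>"
      by (rule projection[OF lin_subspace_ker[OF lin] cl_ker[OF cls] Pv[OF bv]])
    have v: "\<alpha> \<in> vecs H" "\<beta> \<in> vecs H" using ab(1,2) ker_in_vecs orth_sub_vecs by auto
    have \<beta>: "\<beta> \<in> cl H (Range T)" using ab(2) by (simp add: cl_Range)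
    have t0: "tends H (\<lambda>n. ?R n b) (zer H)" "tends H (\<lambda>n. ?R n \<beta>) (zer H)"
      using A.res_tends_zer b \<beta> cl_Range_relpow[OF k] by auto
    have "?R n (P b) = add H \<alpha> (?R n \<beta>)" for n
    proof -
      have "?R n \<alpha> = \<alpha>" using A.res_ker[OF s, of \<alpha> n] ab(1) ker_relpow[OF k] by simp
      then show ?thesis unfolding ab(3) using A.res_add[OF s v, of n] by simp
    qed
    moreover have "tends H (\<lambda>n. add H \<alpha> (?R n \<beta>)) (add H \<alpha> (zer H))"
      by (rule tends_add[OF tends_const[OF v(1)] t0(2)]) (use v A.res_in[OF s] in auto)
    ultimately have "tends H (\<lambda>n. P (?R n b)) \<alpha>"
      using main[OF s bv] v by simp
    then have "P (zer H) = \<alpha>"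
      by (intro Pcl[OF _ _ zer_in v(1) t0(1)]) (use A.res_in[OF s bv] Pv in auto)
    then have "\<alpha> = zer H" using Pz by simp
    then have "P b = \<beta>" using ab(3) v by simp
    then show ?thesis using \<beta> by simp
  qed
qed

end

section \<open>Nilpotent operators\<close>

locale nilpotent_closed = hilb +
  fixes G :: "('b \<times> 'b) set"
  assumes cG: "closed_op H G" and dG: "densely_defined H G" and nG: "nilpotent_op H G"
begin

abbreviation "A \<equiv> adj H G"

lemma lG: "lin_op H G" using cG by (rule closed_op_lin)
lemma lA: "lin_op H A" using lin_op_adj[OF lG dG] .
lemma cA: "closed_op H A" using closed_op_adj[OF lG dG] .

lemma G2: "(u, a) \<in> G \<Longrightarrow> (a, zer H) \<in> G"
  using nG by (auto simp: nilpotent_op_def ker_def)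

lemma A2: assumes "(v, w) \<in> A" shows "(w, zer H) \<in> A"
proof -
  have "rip H a w = rip H u (zer H)" if ua: "(u, a) \<in> G" for u a
    using adjD(3)[OF assms G2[OF ua]] adjD[OF assms] lin_opD(1)[OF lG ua] by simp
  then show ?thesis using adjD(1,2)[OF assms] by (simp add: adj_iff[OF lG])
qed

lemma kerG: "ker H G = orth H (Range A)"
  using orth_Range[OF lA] adj_adj[OF cG dG] by simp

lemma kerA: "ker H A = orth H (Range G)"
  using orth_Range[OF lG] by simp

lemma clG_ker: "cl H (Range G) \<subseteq> ker H G"
  using cl_mono[OF nG[unfolded nilpotent_op_def]] cl_ker[OF cG] by simp

lemma clA_ker: "cl H (Range A) \<subseteq> ker H A"
proof -
  have "Range A \<subseteq> ker H A" using A2 by (auto simp: ker_def)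
  then show ?thesis using cl_mono[of "Range A" "ker H A"] cl_ker[OF cA] by simp
qed

lemma rip_kerG: "k \<in> ker H G \<Longrightarrow> r \<in> cl H (Range A) \<Longrightarrow> rip H r k = 0 \<and> rip H k r = 0"
proof -
  assume k: "k \<in> ker H G" and r: "r \<in> cl H (Range A)"
  then have "k \<in> orth H (cl H (Range A))" using kerG orth_cl[OF lin_subspace_Range[OF lA]] by simp
  then have "rip H r k = 0" "k \<in> vecs H" using r by (auto simp: orth_def rip_def)
  then show ?thesis using r cl_sub_vecs[of "Range A"] rip_commute[of k r] by auto
qed

lemma rip_kerA: "k \<in> ker H A \<Longrightarrow> r \<in> cl H (Range G) \<Longrightarrow> rip H r k = 0 \<and> rip H k r = 0"
proof -
  assume k: "k \<in> ker H A" and r: "r \<in> cl H (Range G)"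
  then have "k \<in> orth H (cl H (Range G))" using kerA orth_cl[OF lin_subspace_Range[OF lG]] by simp
  then have "rip H r k = 0" "k \<in> vecs H" using r by (auto simp: orth_def rip_def)
  then show ?thesis using r cl_sub_vecs[of "Range G"] rip_commute[of k r] by auto
qed

lemma Range_cl: "(u, a) \<in> G \<Longrightarrow> a \<in> cl H (Range G)" "(u, b) \<in> A \<Longrightarrow> b \<in> cl H (Range A)"
  using subset_cl[of "Range G"] subset_cl[of "Range A"] lin_opD(2)[OF lG] lin_opD(2)[OF lA] by blast+

lemma vecs_subs:
  "u \<in> ker H G \<Longrightarrow> u \<in> vecs H" "u \<in> ker H A \<Longrightarrow> u \<in> vecs H"
  "u \<in> cl H (Range G) \<Longrightarrow> u \<in> vecs H" "u \<in> cl H (Range A) \<Longrightarrow> u \<in> vecs H"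
  using lin_opD(1)[OF lG] lin_opD(1)[OF lA] cl_sub_vecs[of "Range G"] cl_sub_vecs[of "Range A"]
  by (auto simp: ker_def)

text \<open>As cl (ran G) lies in ker G, subtracting the component of k in it leaves a vector of ker
  G. That vector is orthogonal to ran G, hence also in the kernel of the adjoint.\<close>

lemma kerG_decomp:
  assumes k: "k \<in> ker H G"
  obtains n p where "n \<in> ker H G" "n \<in> ker H A" "p \<in> cl H (Range G)" "k = add H n p"
proof -
  have lin: "lin_subspace H (Range G)" "lin_subspace H (cl H (Range G))"
    using lin_subspace_Range[OF lG] lin_subspace_cl by auto
  have "Range G \<subseteq> vecs H" using lin_opD(2)[OF lG] by blast
  then obtain p n where pn: "p \<in> cl H (Range G)" "n \<in> orth H (cl H (Range G))" "k = add H p n"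
    by (rule projection[OF lin(2) cl_cl vecs_subs(1)[OF k]])
  have nA: "n \<in> ker H A" using pn(2) orth_cl[OF lin(1)] kerA by simp
  have v: "p \<in> vecs H" "n \<in> vecs H" using pn nA vecs_subs by auto
  have kv: "k \<in> vecs H" using vecs_subs k by auto
  have "sub H k p = n" using sub_eq_iff[OF kv v] pn(3) by simp
  moreover have "sub H k p \<in> ker H G"
    using lin_subspace_sub[OF lin_subspace_ker[OF lG] k] pn(1) clG_ker by blast
  ultimately have "n \<in> ker H G" by simp
  moreover have "k = add H n p" using pn(3) add_commute[OF v] by simp
  ultimately show thesis using that nA pn(1) by blast
qed

lemma ker_split:
  assumes x: "x \<in> vecs H"
  obtains k r where "k \<in> ker H G" "r \<in> cl H (Range A)" "x = add H k r"
proof -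
  obtain k r where kr: "k \<in> ker H G" "r \<in> orth H (ker H G)" "x = add H k r"
    by (rule projection[OF lin_subspace_ker[OF lG] cl_ker[OF cG] x])
  moreover have "r \<in> cl H (Range A)"
    using kr(2) kerG orth_orth[OF lin_subspace_Range[OF lA]] by simp
  ultimately show thesis using that by blast
qed

lemma hodge:
  assumes x: "x \<in> vecs H"
  obtains n p r where "n \<in> ker H G" "n \<in> ker H A" "p \<in> cl H (Range G)" "r \<in> cl H (Range A)"
    "x = add H (add H n p) r"
proof -
  obtain k r where kr: "k \<in> ker H G" "r \<in> cl H (Range A)" "x = add H k r" by (rule ker_split[OF x])
  obtain n p where np: "n \<in> ker H G" "n \<in> ker H A" "p \<in> cl H (Range G)" "k = add H n p"
    by (rule kerG_decomp[OF kr(1)])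
  show thesis using that[OF np(1-3) kr(2)] kr(3) np(4) by simp
qed

lemma dirac_iff: "(u, c) \<in> dirac H G \<longleftrightarrow> (\<exists>a b. (u, a) \<in> G \<and> (u, b) \<in> A \<and> c = add H a b)"
  by (auto simp: dirac_def op_sum_def)

lemma diracI: "(u, a) \<in> G \<Longrightarrow> (u, b) \<in> A \<Longrightarrow> (u, add H a b) \<in> dirac H G"
  by (auto simp: dirac_iff)

lemma lin_dirac: "lin_op H (dirac H G)"
proof (rule lin_opI)
  show "u \<in> vecs H" if "(u, a) \<in> dirac H G" for u a
    using that lin_opD(1)[OF lG] by (auto simp: dirac_iff)
  show "a \<in> vecs H" if "(u, a) \<in> dirac H G" for u a
    using that lin_opD(2)[OF lG] lin_opD(2)[OF lA] by (auto simp: dirac_iff)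
  show "a = b" if "(u, a) \<in> dirac H G" "(u, b) \<in> dirac H G" for u a b
    using that lin_opD(3)[OF lG] lin_opD(3)[OF lA] unfolding dirac_iff by metis
  show "(zer H, zer H) \<in> dirac H G"
    using diracI[OF lin_opD(4)[OF lG] lin_opD(4)[OF lA]] by simp
  show "(add H u v, add H a b) \<in> dirac H G" if ab: "(u, a) \<in> dirac H G" "(v, b) \<in> dirac H G" for u a v b
  proof -
    obtain a1 a2 b1 b2 where *: "(u, a1) \<in> G" "(u, a2) \<in> A" "a = add H a1 a2"
      "(v, b1) \<in> G" "(v, b2) \<in> A" "b = add H b1 b2" using ab unfolding dirac_iff by blast
    note w = lin_opD(2)[OF lG *(1)] lin_opD(2)[OF lG *(4)] lin_opD(2)[OF lA *(2)] lin_opD(2)[OF lA *(5)]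
    have "add H a b = add H (add H a1 b1) (add H a2 b2)"
      unfolding *(3,6) by (rule ip_eqI) (use w in \<open>auto simp: ip_left\<close>)
    then show ?thesis
      using diracI[OF lin_opD(5)[OF lG *(1,4)] lin_opD(5)[OF lA *(2,5)]] by simp
  qed
  show "(scl H c u, scl H c a) \<in> dirac H G" if ab: "(u, a) \<in> dirac H G" for u a c
  proof -
    obtain a1 a2 where *: "(u, a1) \<in> G" "(u, a2) \<in> A" "a = add H a1 a2" using ab unfolding dirac_iff by blast
    note w = lin_opD(2)[OF lG *(1)] lin_opD(2)[OF lA *(2)]
    have "scl H c a = add H (scl H c a1) (scl H c a2)"
      unfolding *(3) by (rule ip_eqI) (use w in \<open>auto simp: ip_left algebra_simps\<close>)
    then show ?thesis
      using diracI[OF lin_opD(6)[OF lG *(1)] lin_opD(6)[OF lA *(2)]] by simp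
  qed
qed

text \<open>The images of u under G and its adjoint are orthogonal to each other by nilpotency, so
  their sum vanishes only if both do.\<close>

lemma ker_dirac: "ker H (dirac H G) = ker H G \<inter> ker H A"
proof
  show "ker H G \<inter> ker H A \<subseteq> ker H (dirac H G)"
    using diracI[of _ "zer H" "zer H"] by (auto simp: ker_def)
  show "ker H (dirac H G) \<subseteq> ker H G \<inter> ker H A"
  proof
    fix u assume "u \<in> ker H (dirac H G)"
    then obtain a b where *: "(u, a) \<in> G" "(u, b) \<in> A" "zer H = add H a b"
      unfolding ker_def dirac_iff by blast
    note w = lin_opD(2)[OF lG *(1)] lin_opD(2)[OF lA *(2)]
    have "(b, zer H) \<in> A" by (rule A2[OF *(2)])
    then have o: "rip H a b = 0" "rip H b a = 0" using rip_kerA[of b a] Range_cl(1)[OF *(1)] by (auto simp: ker_def)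
    have "rip H (add H a b) a = 0" "rip H (add H a b) b = 0" using w by (simp_all flip: *(3))
    then have "rip H a a = 0" "rip H b b = 0" using w o by (simp_all add: rip_simps)
    then have "a = zer H" "b = zer H" using w by (simp_all add: rip_self_0)
    then show "u \<in> ker H G \<inter> ker H A" using *(1,2) by (simp add: ker_def)
  qed
qed

text \<open>Of the three Hodge components of u only the one in the closed range of the adjoint is
  seen by G. By \<open>dirac_G\<close> that component lies in the domain of the Dirac operator, so
  with \<open>A_part\<close> and \<open>dirac_A\<close> this is the supply of test vectors for
  density and self-adjointness.\<close>

lemma G_part:
  assumes ua: "(u, a) \<in> G" and u: "u = add H (add H m q) t" and m: "m \<in> ker H G" "q \<in> ker H G"
    and t: "t \<in> vecs H"
  shows "(t, a) \<in> G"
proof -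
  have mq: "add H m q \<in> ker H G" using lin_subspace_ker[OF lG] m by (auto simp: lin_subspace_def)
  have "sub H u (add H m q) = t"
    using mq vecs_subs(1)[OF mq] t lin_opD(1)[OF lG ua] u by (subst sub_eq_iff) auto
  moreover have "(sub H u (add H m q), sub H a (zer H)) \<in> G"
    using lin_opD(7)[OF lG ua] mq by (auto simp: ker_def)
  ultimately show ?thesis using lin_opD(2)[OF lG ua] by simp
qed

lemma A_part:
  assumes ua: "(u, a) \<in> A" and u: "u = add H (add H m q) t" and m: "m \<in> ker H A" "t \<in> ker H A"
    and q: "q \<in> vecs H"
  shows "(q, a) \<in> A"
proof -
  have mq: "add H m t \<in> ker H A" using lin_subspace_ker[OF lA] m by (auto simp: lin_subspace_def)
  have mv: "m \<in> vecs H" "t \<in> vecs H" using m vecs_subs by auto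
  have "u = add H (add H m t) q" unfolding u
    by (rule ip_eqI) (use mv q in \<open>auto simp: ip_left\<close>)
  then have "sub H u (add H m t) = q"
    using mv q lin_opD(1)[OF lA ua] by (subst sub_eq_iff) auto
  moreover have "(sub H u (add H m t), sub H a (zer H)) \<in> A"
    using lin_opD(7)[OF lA ua] mq by (auto simp: ker_def)
  ultimately show ?thesis using lin_opD(2)[OF lA ua] by simp
qed

lemma dirac_G: "t \<in> cl H (Range A) \<Longrightarrow> (t, a) \<in> G \<Longrightarrow> (t, a) \<in> dirac H G"
  using diracI[of t a "zer H"] clA_ker lin_opD(2)[OF lG] by (auto simp: ker_def)

lemma dirac_A: "q \<in> cl H (Range G) \<Longrightarrow> (q, a) \<in> A \<Longrightarrow> (q, a) \<in> dirac H G"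
  using diracI[of q "zer H" a] clG_ker lin_opD(2)[OF lA] by (auto simp: ker_def)

text \<open>A vector orthogonal to the domain is killed component by component: the harmonic part is
  itself in the domain, and the two range parts are orthogonal to the dense domains of G and of its
  adjoint, since Hodge components of vectors there are admissible tests.\<close>

lemma densely_defined_dirac: "densely_defined H (dirac H G)"
proof -
  let ?D = "dirac H G"
  have "z = zer H" if z: "z \<in> orth H (Domain ?D)" for z
  proof -
    have zv: "z \<in> vecs H" using z orth_sub_vecs by auto
    have z0: "rip H u z = 0" if "(u, c) \<in> ?D" for u c
    proof -
      have "u \<in> Domain ?D" using that by blast
      then show ?thesis using z by (simp add: orth_def rip_def)
    qed
    obtain n p r where h: "n \<in> ker H G" "n \<in> ker H A" "p \<in> cl H (Range G)" "r \<in> cl H (Range A)"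
      "z = add H (add H n p) r" by (rule hodge[OF zv])
    have v: "n \<in> vecs H" "p \<in> vecs H" "r \<in> vecs H" using h vecs_subs by auto
    have pk: "p \<in> ker H G" and rk: "r \<in> ker H A" using h clG_ker clA_ker by auto
    have "(n, zer H) \<in> ?D" using h(1,2) ker_dirac by (auto simp: ker_def)
    then have "rip H n z = 0" by (rule z0)
    then have "rip H n n = 0"
      using v rip_kerA[OF h(2,3)] rip_kerG[OF h(1,4)] by (simp add: h(5) rip_simps)
    then have n: "n = zer H" using v by (simp add: rip_self_0)
    have "r \<in> orth H (Domain G)"
      unfolding orth_iff[OF lin_subspace_Domain[OF lG]]
    proof (intro conjI ballI)
      fix u assume "u \<in> Domain G"
      then obtain a where ua: "(u, a) \<in> G" by blast
      obtain m q t where g: "m \<in> ker H G" "m \<in> ker H A" "q \<in> cl H (Range G)" "t \<in> cl H (Range A)"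
        "u = add H (add H m q) t" by (rule hodge[OF lin_opD(1)[OF lG ua]])
      have w: "m \<in> vecs H" "q \<in> vecs H" "t \<in> vecs H" "q \<in> ker H G" using g vecs_subs clG_ker by auto
      have "rip H t z = 0"
        by (rule z0[OF dirac_G[OF g(4) G_part[OF ua g(5) g(1) w(4) w(3)]]])
      then have "rip H t r = 0"
        using v w rip_kerG[OF h(1) g(4)] rip_kerG[OF pk g(4)] by (simp add: h(5) rip_simps)
      then show "rip H u r = 0"
        using v w rip_kerG[OF g(1) h(4)] rip_kerG[OF w(4) h(4)] by (simp add: g(5) rip_simps)
    qed (rule v)
    then have r: "r = zer H"
      using dG dense_iff_orth[OF lin_subspace_Domain[OF lG]] by (auto simp: densely_defined_def)
    have "p \<in> orth H (Domain A)"
      unfolding orth_iff[OF lin_subspace_Domain[OF lA]]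
    proof (intro conjI ballI)
      fix u assume "u \<in> Domain A"
      then obtain a where ua: "(u, a) \<in> A" by blast
      obtain m q t where g: "m \<in> ker H G" "m \<in> ker H A" "q \<in> cl H (Range G)" "t \<in> cl H (Range A)"
        "u = add H (add H m q) t" by (rule hodge[OF lin_opD(1)[OF lA ua]])
      have w: "m \<in> vecs H" "q \<in> vecs H" "t \<in> vecs H" "t \<in> ker H A" using g vecs_subs clA_ker by auto
      have "rip H q z = 0"
        by (rule z0[OF dirac_A[OF g(3) A_part[OF ua g(5) g(2) w(4) w(2)]]])
      then have "rip H q p = 0"
        using v w rip_kerA[OF h(2) g(3)] rip_kerA[OF rk g(3)] by (simp add: h(5) rip_simps)
      then show "rip H u p = 0"
        using v w rip_kerA[OF g(2) h(3)] rip_kerA[OF w(4) h(3)] by (simp add: g(5) rip_simps)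
    qed (rule v)
    then have "p = zer H"
      using densely_defined_adj[OF cG dG] dense_iff_orth[OF lin_subspace_Domain[OF lA]]
      by (auto simp: densely_defined_def)
    then show ?thesis using h(5) n r by simp
  qed
  then show ?thesis unfolding densely_defined_def dense_iff_orth[OF lin_subspace_Domain[OF lin_dirac]] by blast
qed

text \<open>For (v, w) in the adjoint, with components n, p, r of v and n', p', r' of w, tests from
  the domain of G give that the adjoint of G maps p to r', tests from the domain of the adjoint give
  that its own adjoint, which is G, maps r to p', and harmonic tests give n' = 0. Since G kills n
  and p, and the adjoint kills n and r, this makes w the Dirac image of v.\<close>

theorem self_adjoint_dirac: "self_adjoint_op H (dirac H G)"
proof -
  let ?D = "dirac H G"
  have "(v, w) \<in> adj H ?D" if vw: "(v, w) \<in> ?D" for v w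
  proof -
    obtain a' b' where *: "(v, a') \<in> G" "(v, b') \<in> A" "w = add H a' b'" using vw unfolding dirac_iff by blast
    note x = lin_opD(1,2)[OF lG *(1)] lin_opD(2)[OF lA *(2)]
    have "rip H c v = rip H u w" if "(u, c) \<in> ?D" for u c
    proof -
      obtain a b where ab: "(u, a) \<in> G" "(u, b) \<in> A" "c = add H a b"
        using \<open>(u, c) \<in> ?D\<close> unfolding dirac_iff by blast
      note y = lin_opD(1,2)[OF lG ab(1)] lin_opD(2)[OF lA ab(2)]
      have "rip H b v = rip H u a'"
        using adjD(3)[OF ab(2) *(1)] x y rip_commute[of b v] rip_commute[of u a'] by simp
      then show ?thesis using adjD(3)[OF *(2) ab(1)] x y by (simp add: ab(3) *(3) rip_simps)
    qed
    then show ?thesis using x *(3) by (simp add: adj_iff[OF lin_dirac])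
  qed
  moreover have "(v, w) \<in> ?D" if vw: "(v, w) \<in> adj H ?D" for v w
  proof -
    note vv = adjD(1,2)[OF vw]
    note d = adjD(3)[OF vw]
    obtain n p r where h: "n \<in> ker H G" "n \<in> ker H A" "p \<in> cl H (Range G)" "r \<in> cl H (Range A)"
      "v = add H (add H n p) r" by (rule hodge[OF vv(1)])
    obtain n' p' r' where h': "n' \<in> ker H G" "n' \<in> ker H A" "p' \<in> cl H (Range G)" "r' \<in> cl H (Range A)"
      "w = add H (add H n' p') r'" by (rule hodge[OF vv(2)])
    have x: "n \<in> vecs H" "p \<in> vecs H" "r \<in> vecs H" "n' \<in> vecs H" "p' \<in> vecs H" "r' \<in> vecs H"
      using h h' vecs_subs by auto
    have k: "p \<in> ker H G" "p' \<in> ker H G" "r \<in> ker H A" "r' \<in> ker H A" using h h' clG_ker clA_ker by auto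
    have pr: "(p, r') \<in> A"
      unfolding adj_iff[OF lG]
    proof (intro conjI allI impI x)
      fix u a assume ua: "(u, a) \<in> G"
      obtain m q t where g: "m \<in> ker H G" "m \<in> ker H A" "q \<in> cl H (Range G)" "t \<in> cl H (Range A)"
        "u = add H (add H m q) t" by (rule hodge[OF lin_opD(1)[OF lG ua]])
      have y: "m \<in> vecs H" "q \<in> vecs H" "t \<in> vecs H" "q \<in> ker H G" using g vecs_subs clG_ker by auto
      have av: "a \<in> vecs H" using lin_opD(2)[OF lG ua] .
      note ac = Range_cl(1)[OF ua]
      have "rip H a v = rip H t w"
        by (rule d[OF dirac_G[OF g(4) G_part[OF ua g(5) g(1) y(4) y(3)]]])
      moreover have "rip H a v = rip H a p"
        using x av rip_kerA[OF h(2) ac] rip_kerA[OF k(3) ac] by (simp add: h(5) rip_simps)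
      moreover have "rip H t w = rip H t r'"
        using x y rip_kerG[OF h'(1) g(4)] rip_kerG[OF k(2) g(4)] by (simp add: h'(5) rip_simps)
      moreover have "rip H u r' = rip H t r'"
        using x y rip_kerG[OF g(1) h'(4)] rip_kerG[OF y(4) h'(4)] by (simp add: g(5) rip_simps)
      ultimately show "rip H a p = rip H u r'" by simp
    qed
    have rp: "(r, p') \<in> adj H A"
      unfolding adj_iff[OF lA]
    proof (intro conjI allI impI x)
      fix u a assume ua: "(u, a) \<in> A"
      obtain m q t where g: "m \<in> ker H G" "m \<in> ker H A" "q \<in> cl H (Range G)" "t \<in> cl H (Range A)"
        "u = add H (add H m q) t" by (rule hodge[OF lin_opD(1)[OF lA ua]])
      have y: "m \<in> vecs H" "q \<in> vecs H" "t \<in> vecs H" "t \<in> ker H A" using g vecs_subs clA_ker by auto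
      have av: "a \<in> vecs H" using lin_opD(2)[OF lA ua] .
      note ac = Range_cl(2)[OF ua]
      have "rip H a v = rip H q w"
        by (rule d[OF dirac_A[OF g(3) A_part[OF ua g(5) g(2) y(4) y(2)]]])
      moreover have "rip H a v = rip H a r"
        using x av rip_kerG[OF h(1) ac] rip_kerG[OF k(1) ac] by (simp add: h(5) rip_simps)
      moreover have "rip H q w = rip H q p'"
        using x y rip_kerA[OF h'(2) g(3)] rip_kerA[OF k(4) g(3)] by (simp add: h'(5) rip_simps)
      moreover have "rip H u p' = rip H q p'"
        using x y rip_kerA[OF g(2) h'(3)] rip_kerA[OF y(4) h'(3)] by (simp add: g(5) rip_simps)
      ultimately show "rip H a r = rip H u p'" by simp
    qed
    then have rp: "(r, p') \<in> G" using adj_adj[OF cG dG] by simp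
    have "(n', zer H) \<in> ?D" using h'(1,2) ker_dirac by (auto simp: ker_def)
    then have "rip H (zer H) v = rip H n' w" by (rule d)
    then have "rip H n' n' = 0"
      using x vv rip_kerA[OF h'(2,3)] rip_kerG[OF h'(1,4)] by (simp add: h'(5) rip_simps)
    then have n': "n' = zer H" using x by (simp add: rip_self_0)
    have "(n, zer H) \<in> G" "(p, zer H) \<in> G" "(n, zer H) \<in> A" "(r, zer H) \<in> A"
      using h(1,2) k by (auto simp: ker_def)
    then have "(add H (add H n p) r, add H (add H (zer H) (zer H)) p') \<in> G"
      "(add H (add H n p) r, add H (add H (zer H) r') (zer H)) \<in> A"
      using rp pr lin_opD(5)[OF lG] lin_opD(5)[OF lA] by metis+
    then have "(v, p') \<in> G" "(v, r') \<in> A" using x h(5) by simp_all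
    then have "(v, add H p' r') \<in> ?D" by (rule diracI)
    then show ?thesis using h'(5) n' x by simp
  qed
  ultimately have "adj H ?D = ?D" by (intro set_eqI) auto
  then show ?thesis using lin_dirac densely_defined_dirac by (simp add: self_adjoint_op_def)
qed

lemma selfadj_dirac: "selfadj H (dirac H G)"
  by (simp add: selfadj_def selfadj_axioms_def self_adjoint_dirac hilb_axioms)

end

section \<open>Equivalent inner products\<close>

definition equiv_ip :: "('k::real_or_complex, 'h) ipspace \<Rightarrow> ('k, 'h) ipspace \<Rightarrow> bool" where
  "equiv_ip H K \<longleftrightarrow> vecs K = vecs H \<and> zer K = zer H \<and> add K = add H \<and> scl K = scl H \<and>
     (\<exists>C\<ge>1::real. \<forall>u\<in>vecs H. nrm H u / C \<le> nrm K u \<and> nrm K u \<le> C * nrm H u)"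

lemma equiv_ip_refl: "equiv_ip H H"
  unfolding equiv_ip_def by (auto intro!: exI[of _ 1])

lemma equiv_ip_sym: "equiv_ip H K \<Longrightarrow> equiv_ip K H"
proof -
  assume e: "equiv_ip H K"
  then obtain C where C: "C \<ge> 1" "\<And>u. u \<in> vecs H \<Longrightarrow> nrm H u / C \<le> nrm K u \<and> nrm K u \<le> C * nrm H u"
    unfolding equiv_ip_def by blast
  have "nrm K u / C \<le> nrm H u \<and> nrm H u \<le> C * nrm K u" if "u \<in> vecs H" for u
    using C(2)[OF that] C(1) by (simp add: field_simps)
  then show ?thesis using e C(1) unfolding equiv_ip_def by auto
qed

locale equiv_hilb = hilb H + K: hilb K for H K :: "('k::real_or_complex, 'h) ipspace" +
  assumes equiv: "equiv_ip H K"
begin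

lemma same [simp]: "vecs K = vecs H" "zer K = zer H" "add K = add H" "scl K = scl H"
  using equiv by (auto simp: equiv_ip_def)

lemma sub_same [simp]: "sub K = sub H" and rscl_same [simp]: "rscl K = rscl H"
  by (auto simp: sub_def rscl_def fun_eq_iff)

lemma equiv_hilb_sym: "equiv_hilb K H"
  by (simp add: equiv_hilb_def equiv_hilb_axioms_def hilb_axioms K.hilb_axioms equiv_ip_sym equiv)

lemma norm_le: obtains C where "C \<ge> 1" "\<And>u. u \<in> vecs H \<Longrightarrow> nrm H u \<le> C * nrm K u"
  "\<And>u. u \<in> vecs H \<Longrightarrow> nrm K u \<le> C * nrm H u"
proof -
  obtain C where C: "C \<ge> 1" "\<And>u. u \<in> vecs H \<Longrightarrow> nrm H u / C \<le> nrm K u \<and> nrm K u \<le> C * nrm H u"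
    using equiv unfolding equiv_ip_def by blast
  have "nrm H u \<le> C * nrm K u" "nrm K u \<le> C * nrm H u" if "u \<in> vecs H" for u
    using C(2)[OF that] C(1) by (simp_all add: field_simps)
  then show thesis using that C(1) by blast
qed

lemma tends_imp:
  assumes "\<And>n. s n \<in> vecs H" "u \<in> vecs H" "tends H s u" shows "tends K s u"
proof -
  obtain C where C: "C \<ge> 1" "\<And>u. u \<in> vecs H \<Longrightarrow> nrm K u \<le> C * nrm H u" by (rule norm_le) blast
  have "(\<lambda>n. C * nrm H (sub H (s n) u)) \<longlonglongrightarrow> 0"
    using tendsto_mult_left[OF assms(3)[unfolded tends_def], of C] by simp
  moreover have "norm (nrm K (sub K (s n) u)) \<le> C * nrm H (sub H (s n) u)" for n
    using C(2)[of "sub H (s n) u"] K.nrm_nonneg[of "sub H (s n) u"] assms by simp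
  ultimately show ?thesis unfolding tends_def
    by (metis (mono_tags, lifting) Lim_null_comparison always_eventually)
qed

lemma tends_same: "(\<And>n. s n \<in> vecs H) \<Longrightarrow> u \<in> vecs H \<Longrightarrow> tends K s u \<longleftrightarrow> tends H s u"
  using tends_imp equiv_hilb.tends_imp[OF equiv_hilb_sym] by (metis same(1))

lemma cl_same: assumes "X \<subseteq> vecs H" shows "cl K X = cl H X"
proof -
  have "(\<exists>s. (\<forall>n. s n \<in> X) \<and> tends K s u) \<longleftrightarrow> (\<exists>s. (\<forall>n. s n \<in> X) \<and> tends H s u)" if "u \<in> vecs H" for u
    using tends_same[OF _ that] assms by (metis subsetD)
  then show ?thesis unfolding cl_def by auto
qed

lemma lin_subspace_same: "lin_subspace K X = lin_subspace H X"
  by (simp add: lin_subspace_def)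

lemma lin_op_same: "lin_op K T = lin_op H T"
  by (simp add: lin_op_def)

lemma ker_same: "ker K = ker H"
  by (simp add: ker_def fun_eq_iff)

lemma closed_op_imp: assumes "closed_op H T" shows "closed_op K T"
  unfolding closed_op_def
proof (intro conjI allI impI)
  have l: "lin_op H T" using assms by (rule closed_op_lin)
  then show "lin_op K T" by (simp add: lin_op_same)
  fix s t u a
  assume *: "(\<forall>n. (s n, t n) \<in> T) \<and> u \<in> vecs K \<and> a \<in> vecs K \<and> tends K s u \<and> tends K t a"
  then have st: "\<And>n. (s n, t n) \<in> T" and ua: "u \<in> vecs H" "a \<in> vecs H" by auto
  have "tends H s u" "tends H t a"
    using * tends_same[of s u] tends_same[of t a] lin_opD(1,2)[OF l st] ua by blast+
  then show "(u, a) \<in> T" by (rule closed_opD[OF assms st ua])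
qed

lemma nilpotent_op_same: "nilpotent_op K T = nilpotent_op H T"
  by (simp add: nilpotent_op_def ker_same)

lemma proj_along_same: "proj_along K = proj_along H"
  by (simp add: proj_along_def fun_eq_iff)

lemma top_splitting_imp:
  assumes "top_splitting H X Y" shows "top_splitting K X Y"
proof -
  have X: "lin_subspace H X" and Y: "lin_subspace H Y" and c: "cl H X = X" "cl H Y = Y"
    and ex: "\<forall>u\<in>vecs H. \<exists>!(a, b). a \<in> X \<and> b \<in> Y \<and> u = add H a b"
    and bd: "\<exists>C. \<forall>a\<in>X. \<forall>b\<in>Y. nrm H a \<le> C * nrm H (add H a b) \<and> nrm H b \<le> C * nrm H (add H a b)"
    using assms unfolding top_splitting_def by auto
  have XY: "X \<subseteq> vecs H" "Y \<subseteq> vecs H" using X Y by (auto simp: lin_subspace_def)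
  obtain C where C: "C \<ge> 1" "\<And>u. u \<in> vecs H \<Longrightarrow> nrm H u \<le> C * nrm K u"
    "\<And>u. u \<in> vecs H \<Longrightarrow> nrm K u \<le> C * nrm H u" by (rule norm_le) blast
  obtain D where D: "\<And>a b. a \<in> X \<Longrightarrow> b \<in> Y \<Longrightarrow> nrm H a \<le> D * nrm H (add H a b) \<and> nrm H b \<le> D * nrm H (add H a b)"
    using bd by blast
  have D': "nrm K c \<le> (C * \<bar>D\<bar> * C) * nrm K u" if "c \<in> vecs H" "u \<in> vecs H" "nrm H c \<le> D * nrm H u" for c u
  proof -
    have "nrm K c \<le> C * nrm H c" by (rule C(3)[OF that(1)])
    also have "\<dots> \<le> C * (\<bar>D\<bar> * nrm H u)"
      using that(3) C(1) nrm_nonneg[OF that(2)]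
      by (intro mult_left_mono) (auto intro: order_trans[OF _ mult_right_mono])
    also have "\<dots> \<le> C * (\<bar>D\<bar> * (C * nrm K u))"
      using C(1,2) that(2) by (intro mult_left_mono) auto
    finally show ?thesis by (simp add: mult.assoc)
  qed
  have "nrm K a \<le> (C * \<bar>D\<bar> * C) * nrm K (add K a b) \<and> nrm K b \<le> (C * \<bar>D\<bar> * C) * nrm K (add K a b)"
    if "a \<in> X" "b \<in> Y" for a b
    using D'[of a "add H a b"] D'[of b "add H a b"] D[OF that] XY that by (auto simp: subset_iff)
  then show ?thesis
    unfolding top_splitting_def using X Y c ex XY by (simp add: lin_subspace_same cl_same) blast
qed

lemma top_iso_imp:
  assumes "top_iso H X Y f" shows "top_iso K X Y f"
proof -
  have X: "lin_subspace H X" and Y: "lin_subspace H Y" and f: "bij_betw f X Y"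
    and l: "\<forall>u\<in>X. \<forall>v\<in>X. f (add H u v) = add H (f u) (f v)" "\<forall>c. \<forall>u\<in>X. f (scl H c u) = scl H c (f u)"
    and bd: "\<exists>C. \<forall>u\<in>X. nrm H (f u) \<le> C * nrm H u" "\<exists>C. \<forall>u\<in>X. nrm H u \<le> C * nrm H (f u)"
    using assms unfolding top_iso_def by auto
  have XY: "u \<in> vecs H" "f u \<in> vecs H" if "u \<in> X" for u
    using X Y that f by (auto simp: lin_subspace_def bij_betw_def)
  obtain C where C: "C \<ge> 1" "\<And>u. u \<in> vecs H \<Longrightarrow> nrm H u \<le> C * nrm K u"
    "\<And>u. u \<in> vecs H \<Longrightarrow> nrm K u \<le> C * nrm H u" by (rule norm_le) blast
  have D': "nrm K c \<le> (C * \<bar>D\<bar> * C) * nrm K u" if "c \<in> vecs H" "u \<in> vecs H" "nrm H c \<le> D * nrm H u" for c u D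
  proof -
    have "nrm K c \<le> C * nrm H c" by (rule C(3)[OF that(1)])
    also have "\<dots> \<le> C * (\<bar>D\<bar> * nrm H u)"
      using that(3) C(1) nrm_nonneg[OF that(2)]
      by (intro mult_left_mono) (auto intro: order_trans[OF _ mult_right_mono])
    also have "\<dots> \<le> C * (\<bar>D\<bar> * (C * nrm K u))"
      using C(1,2) that(2) by (intro mult_left_mono) auto
    finally show ?thesis by (simp add: mult.assoc)
  qed
  obtain D1 D2 where D: "\<And>u. u \<in> X \<Longrightarrow> nrm H (f u) \<le> D1 * nrm H u" "\<And>u. u \<in> X \<Longrightarrow> nrm H u \<le> D2 * nrm H (f u)"
    using bd by blast
  have "\<exists>C. \<forall>u\<in>X. nrm K (f u) \<le> C * nrm K u" "\<exists>C. \<forall>u\<in>X. nrm K u \<le> C * nrm K (f u)"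
    using D'[OF XY(2) XY(1) D(1)] D'[OF XY(1) XY(2) D(2)] by blast+
  then show ?thesis
    unfolding top_iso_def using X Y f l by (simp add: lin_subspace_same)
qed

end

section \<open>Topological splittings and projections along a common complement\<close>

context hilb begin

lemma nrm_le_of_orth:
  assumes "k \<in> vecs H" "r \<in> vecs H" "rip H k r = 0"
  shows "nrm H k \<le> nrm H (add H k r)"
proof (rule power2_le_imp_le)
  show "(nrm H k)\<^sup>2 \<le> (nrm H (add H k r))\<^sup>2"
    using assms rip_commute[of r k] by (simp add: nrm_sq rip_simps)
qed (use assms in simp)

text \<open>It is enough to bound the first component of one decomposition of each vector. Trivial
  intersection makes the decomposition unique, and the second component is a difference, which costs
  the extra 1 in C + 1.\<close>

lemma top_splittingI:
  assumes X: "lin_subspace H X" and Y: "lin_subspace H Y" and c: "cl H X = X" "cl H Y = Y"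
    and inter: "\<And>u. u \<in> X \<Longrightarrow> u \<in> Y \<Longrightarrow> u = zer H"
    and ex: "\<And>u. u \<in> vecs H \<Longrightarrow> \<exists>a\<in>X. \<exists>b\<in>Y. u = add H a b \<and> nrm H a \<le> C * nrm H u"
  shows "top_splitting H X Y"
proof -
  have XY: "\<And>u. u \<in> X \<Longrightarrow> u \<in> vecs H" "\<And>u. u \<in> Y \<Longrightarrow> u \<in> vecs H" using X Y by (auto simp: lin_subspace_def)
  have uniq: "a = a' \<and> b = b'"
    if ab: "a \<in> X" "b \<in> Y" "a' \<in> X" "b' \<in> Y" "add H a b = add H a' b'" for a b a' b'
  proof -
    note v = XY(1)[OF ab(1)] XY(2)[OF ab(2)] XY(1)[OF ab(3)] XY(2)[OF ab(4)]
    have r: "rip H a w + rip H b w = rip H a' w + rip H b' w" if "w \<in> vecs H" for w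
      using arg_cong[OF ab(5), of "\<lambda>x. rip H x w"] v that by (simp add: rip_simps)
    have e: "sub H a a' = sub H b' b"
      by (rule rip_eqI) (use v r in \<open>auto simp: rip_simps algebra_simps\<close>)
    have "sub H a a' \<in> X" "sub H a a' \<in> Y"
      using lin_subspace_sub[OF X ab(1,3)] lin_subspace_sub[OF Y ab(4,2)] e by auto
    then have "sub H a a' = zer H" by (rule inter)
    then show ?thesis using e v by (metis sub_eq_zer)
  qed
  have "\<exists>!(a, b). a \<in> X \<and> b \<in> Y \<and> u = add H a b" if "u \<in> vecs H" for u
  proof -
    obtain a b where "a \<in> X" "b \<in> Y" "u = add H a b" using ex[OF \<open>u \<in> vecs H\<close>] by blast
    then show ?thesis using uniq by (intro ex1I[of _ "(a, b)"]) auto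
  qed
  moreover have "nrm H a \<le> (C + 1) * nrm H (add H a b) \<and> nrm H b \<le> (C + 1) * nrm H (add H a b)"
    if ab: "a \<in> X" "b \<in> Y" for a b
  proof -
    note v = XY(1)[OF ab(1)] XY(2)[OF ab(2)]
    have "add H a b \<in> vecs H" using v by simp
    from ex[OF this] obtain a' b' where *: "a' \<in> X" "b' \<in> Y" "add H a b = add H a' b'"
      "nrm H a' \<le> C * nrm H (add H a b)" by blast
    then have 1: "nrm H a \<le> C * nrm H (add H a b)" using uniq[OF ab *(1-3)] by simp
    have "b = sub H (add H a b) a"
      by (rule ip_eqI) (use v in \<open>auto simp: ip_left\<close>)
    then have "nrm H b \<le> nrm H (add H a b) + nrm H a"
      using nrm_sub_le[of "add H a b" a] v by simp
    moreover have "0 \<le> nrm H (add H a b)" using v by simp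
    ultimately show ?thesis using 1 by (simp only: distrib_right mult_1) linarith
  qed
  ultimately show ?thesis unfolding top_splitting_def using X Y c by blast
qed

lemma top_splittingD:
  assumes "top_splitting H X Y"
  shows "a \<in> X \<Longrightarrow> b \<in> Y \<Longrightarrow> proj_along H X Y (add H a b) = a"
    and "u \<in> vecs H \<Longrightarrow> \<exists>a\<in>X. \<exists>b\<in>Y. u = add H a b"
    and "a \<in> X \<Longrightarrow> a \<in> vecs H" "b \<in> Y \<Longrightarrow> b \<in> vecs H"
proof -
  have ex: "\<forall>u\<in>vecs H. \<exists>!(a, b). a \<in> X \<and> b \<in> Y \<and> u = add H a b"
    and l: "lin_subspace H X" "lin_subspace H Y"
    using assms unfolding top_splitting_def by auto
  show v: "a \<in> X \<Longrightarrow> a \<in> vecs H" "b \<in> Y \<Longrightarrow> b \<in> vecs H" for a b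
    using l by (auto simp: lin_subspace_def)
  show "u \<in> vecs H \<Longrightarrow> \<exists>a\<in>X. \<exists>b\<in>Y. u = add H a b" using ex by blast
  show "proj_along H X Y (add H a b) = a" if ab: "a \<in> X" "b \<in> Y"
    unfolding proj_along_def
  proof (rule the_equality)
    have "add H a b \<in> vecs H" using v ab by simp
    then have ex1: "\<exists>!(c, d). c \<in> X \<and> d \<in> Y \<and> add H a b = add H c d" using ex by blast
    show "c = a" if "c \<in> X \<and> (\<exists>d\<in>Y. add H a b = add H c d)" for c
    proof -
      obtain d where d: "c \<in> X" "d \<in> Y" "add H a b = add H c d"
        using \<open>c \<in> X \<and> (\<exists>d\<in>Y. add H a b = add H c d)\<close> by blast
      obtain z where z: "\<And>y. (case y of (c, d) \<Rightarrow> c \<in> X \<and> d \<in> Y \<and> add H a b = add H c d) \<Longrightarrow> y = z"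
        using ex1 by (auto simp: Ex1_def)
      have "(c, d) = z" "(a, b) = z" using d ab by (auto intro!: z)
      then have "(c, d) = (a, b)" by (rule trans[OF _ sym])
      then show ?thesis by (rule Pair_inject)
    qed
  qed (use ab in blast)
qed


text \<open>Both projections run along the same \<open>Z\<close>, so u and its image in
  \<open>Y\<close> differ by an element of \<open>Z\<close>, and projecting the image back along
  \<open>Z\<close> must return u.\<close>

lemma proj_along_inverse:
  assumes X: "top_splitting H X Z" and Y: "top_splitting H Y Z" and u: "u \<in> X"
  shows "proj_along H X Z (proj_along H Y Z u) = u" "proj_along H Y Z u \<in> Y"
    "\<exists>b\<in>Z. u = add H (proj_along H Y Z u) b"
proof -
  have uv: "u \<in> vecs H" using top_splittingD(3)[OF X u] .
  obtain y z where yz: "y \<in> Y" "z \<in> Z" "u = add H y z" using top_splittingD(2)[OF Y uv] by blast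
  have p: "proj_along H Y Z u = y" using top_splittingD(1)[OF Y yz(1,2)] yz(3) by simp
  have v: "y \<in> vecs H" "z \<in> vecs H" using top_splittingD(3,4)[OF Y] yz by auto
  have "scl H (- 1) z \<in> Z" using X yz(2) by (auto simp: top_splitting_def lin_subspace_def)
  moreover have "y = add H u (scl H (- 1) z)"
    unfolding yz(3) by (rule ip_eqI) (use v in \<open>auto simp: ip_left\<close>)
  ultimately have "proj_along H X Z y = u" using top_splittingD(1)[OF X u, of "scl H (- 1) z"] by simp
  then show "proj_along H X Z (proj_along H Y Z u) = u" using p by simp
  show "proj_along H Y Z u \<in> Y" "\<exists>b\<in>Z. u = add H (proj_along H Y Z u) b" using p yz by auto
qed

text \<open>The subspaces X' and Y' allow one statement to serve both for the full kernels and for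
  their parts in a subbundle.\<close>

lemma top_iso_proj_along:
  assumes X: "top_splitting H X Z" and Y: "top_splitting H Y Z"
    and X': "lin_subspace H X'" "X' \<subseteq> X" and Y': "lin_subspace H Y'" "Y' \<subseteq> Y"
    and XY: "\<And>u. u \<in> X' \<Longrightarrow> proj_along H Y Z u \<in> Y'"
    and YX: "\<And>u. u \<in> Y' \<Longrightarrow> proj_along H X Z u \<in> X'"
  shows "top_iso H X' Y' (proj_along H Y Z)"
proof -
  let ?f = "proj_along H Y Z" and ?g = "proj_along H X Z"
  have gf: "?g (?f u) = u" if "u \<in> X'" for u using proj_along_inverse(1)[OF X Y] that X' by blast
  have fg: "?f (?g u) = u" if "u \<in> Y'" for u using proj_along_inverse(1)[OF Y X] that Y' by blast
  have "bij_betw ?f X' Y'" by (rule bij_betw_byWitness[of _ ?g]) (use gf fg XY YX in auto)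
  have Z: "lin_subspace H Z" using X by (simp add: top_splitting_def)
  have Yl: "lin_subspace H Y" using Y by (simp add: top_splitting_def)
  have dec: "\<exists>b\<in>Z. u = add H (?f u) b \<and> ?f u \<in> Y" if "u \<in> X" for u
    using proj_along_inverse(2,3)[OF X Y that] by blast
  have "?f (add H u v) = add H (?f u) (?f v)" if uv: "u \<in> X" "v \<in> X" for u v
  proof -
    obtain b where b: "b \<in> Z" "u = add H (?f u) b" "?f u \<in> Y" using dec[OF uv(1)] by blast
    obtain c where c: "c \<in> Z" "v = add H (?f v) c" "?f v \<in> Y" using dec[OF uv(2)] by blast
    have w: "?f u \<in> vecs H" "?f v \<in> vecs H" "b \<in> vecs H" "c \<in> vecs H"
      using b c Z Yl by (auto simp: lin_subspace_def)
    have "add H (add H (?f u) b) (add H (?f v) c) = add H (add H (?f u) (?f v)) (add H b c)"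
      by (rule ip_eqI) (use w in \<open>auto simp: ip_left\<close>)
    then have "add H u v = add H (add H (?f u) (?f v)) (add H b c)" by (simp flip: b(2) c(2))
    moreover have "?f (add H (add H (?f u) (?f v)) (add H b c)) = add H (?f u) (?f v)"
      by (rule top_splittingD(1)[OF Y]) (use b c Z Yl in \<open>auto simp: lin_subspace_def\<close>)
    ultimately show ?thesis by simp
  qed
  moreover have "?f (scl H c u) = scl H c (?f u)" if u: "u \<in> X" for c u
  proof -
    obtain b where b: "b \<in> Z" "u = add H (?f u) b" "?f u \<in> Y" using dec[OF u] by blast
    have w: "?f u \<in> vecs H" "b \<in> vecs H"
      using b Z Yl by (auto simp: lin_subspace_def)
    have "scl H c (add H (?f u) b) = add H (scl H c (?f u)) (scl H c b)"
      by (rule ip_eqI) (use w in \<open>auto simp: ip_left algebra_simps\<close>)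
    then have "scl H c u = add H (scl H c (?f u)) (scl H c b)" by (simp flip: b(2))
    moreover have "?f (add H (scl H c (?f u)) (scl H c b)) = scl H c (?f u)"
      by (rule top_splittingD(1)[OF Y]) (use b Z Yl in \<open>auto simp: lin_subspace_def\<close>)
    ultimately show ?thesis by simp
  qed
  moreover have bound: "\<exists>C. \<forall>u\<in>X1. nrm H (proj_along H Y1 Z u) \<le> C * nrm H u"
    if X1: "top_splitting H X1 Z" and Y1: "top_splitting H Y1 Z" for X1 Y1
  proof -
    obtain C where C: "\<And>a b. a \<in> Y1 \<Longrightarrow> b \<in> Z \<Longrightarrow> nrm H a \<le> C * nrm H (add H a b)"
      using Y1 unfolding top_splitting_def by blast
    have "nrm H (proj_along H Y1 Z u) \<le> C * nrm H u" if "u \<in> X1" for u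
      using proj_along_inverse(2,3)[OF X1 Y1 that] C by metis
    then show ?thesis by blast
  qed
  moreover have "\<exists>C. \<forall>u\<in>X'. nrm H u \<le> C * nrm H (?f u)"
  proof -
    obtain C where C: "\<forall>u\<in>Y. nrm H (?g u) \<le> C * nrm H u" using bound[OF Y X] by blast
    have "nrm H u \<le> C * nrm H (?f u)" if "u \<in> X'" for u
      using C gf[OF that] XY[OF that] Y' by (metis subsetD)
    then show ?thesis by blast
  qed
  moreover have "\<exists>C. \<forall>u\<in>X'. nrm H (?f u) \<le> C * nrm H u"
    using bound[OF X Y] X'(2) by blast
  ultimately show ?thesis
    unfolding top_iso_def using X' Y'(1) \<open>bij_betw ?f X' Y'\<close> by blast
qed

end

text \<open>
  Here \<open>L\<^sup>2 = ker G \<oplus> (ker G)\<^sup>\<bottom>\<close> with respect to the first inner product, while \<open>ker G\<close> splits as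
  \<open>ker \<DD>\<^sub>2 \<oplus> cl (ran G)\<close> with respect to the second; the last two summands make up \<open>cl (ran \<DD>\<^sub>1)\<close>.
\<close>

lemma (in equiv_hilb) dirac_splitting:
  assumes n: "nilpotent_closed H G"
  shows "top_splitting H (ker H (dirac K G)) (cl H (Range (dirac H G)))"
proof -
  interpret N: nilpotent_closed H G by (rule n)
  have dK: "densely_defined K G"
    using N.dG lin_opD(1)[OF N.lG] cl_same[of "Domain G"] by (auto simp: densely_defined_def)
  interpret M: nilpotent_closed K G
    using closed_op_imp[OF N.cG] dK N.nG
    by (simp add: nilpotent_closed_def nilpotent_closed_axioms_def K.hilb_axioms nilpotent_op_same)
  interpret S: selfadj H "dirac H G" by (rule N.selfadj_dirac)
  interpret S2: selfadj K "dirac K G" by (rule M.selfadj_dirac)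
  let ?X = "ker H (dirac K G)" and ?Y = "cl H (Range (dirac H G))"
  obtain C where C: "C \<ge> 1" "\<And>u. u \<in> vecs H \<Longrightarrow> nrm H u \<le> C * nrm K u"
    "\<And>u. u \<in> vecs H \<Longrightarrow> nrm K u \<le> C * nrm H u" by (rule norm_le) blast
  have X: "lin_subspace H ?X"
    using K.lin_subspace_ker[OF M.lin_dirac] by (simp add: lin_subspace_same ker_same)
  have Xv: "?X \<subseteq> vecs H" using X by (simp add: lin_subspace_def)
  have X_eq: "?X = ker H G \<inter> ker K M.A" using M.ker_dirac by (simp add: ker_same)
  have Y_eq: "?Y = orth H (ker H G \<inter> ker H N.A)" using S.cl_Range N.ker_dirac by simp
  have clG: "cl K (Range G) = cl H (Range G)" using lin_opD(2)[OF N.lG] by (intro cl_same) blast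
  have kl: "lin_subspace H (ker H G \<inter> ker H N.A)"
    using lin_subspace_ker[OF N.lin_dirac] N.ker_dirac by simp
  have Y_I: "y \<in> ?Y" if "y \<in> vecs H" "\<And>k. k \<in> ker H G \<Longrightarrow> k \<in> ker H N.A \<Longrightarrow> rip H k y = 0" for y
    using that unfolding Y_eq orth_iff[OF kl] by blast
  show ?thesis
  proof (rule top_splittingI[where C = "C * C"])
    show "lin_subspace H ?X" by (rule X)
    show Yl: "lin_subspace H ?Y" using lin_subspace_cl[OF lin_subspace_Range[OF N.lin_dirac]] .
    show "cl H ?X = ?X" using K.cl_ker[OF S2.cls] cl_same[OF Xv] by (simp add: ker_same)
    show "cl H ?Y = ?Y" using lin_opD(2)[OF N.lin_dirac] by (intro cl_cl) blast
    show "u = zer H" if u: "u \<in> ?X" "u \<in> ?Y" for u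
    proof -
      have uG: "u \<in> ker H G" "u \<in> ker K M.A" using u X_eq by auto
      obtain n p where np: "n \<in> ker H G" "n \<in> ker H N.A" "p \<in> cl H (Range G)" "u = add H n p"
        by (rule N.kerG_decomp[OF uG(1)])
      have v: "n \<in> vecs H" "p \<in> vecs H" using np N.vecs_subs by auto
      \<comment> \<open>Membership in \<open>?Y\<close> makes u orthogonal for H to its own harmonic
        part n, so n = 0 and u lies in cl (ran G). For K, however, u is harmonic and therefore
        orthogonal to cl (ran G), that is, to itself.\<close>
      have "rip H n u = 0" using u(2) np(1,2) unfolding Y_eq by (auto simp: orth_def rip_def)
      then have "rip H n n = 0" using v N.rip_kerA[OF np(2,3)] by (simp add: np(4) rip_simps)
      then have "u = p" using v np(4) by (simp add: rip_self_0)
      then have "rip K u u = 0" using M.rip_kerA[OF uG(2), of p] np(3) clG by simp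
      then show ?thesis using K.rip_self_0[of u] Xv u by auto
    qed
    show "\<exists>a\<in>?X. \<exists>b\<in>?Y. u = add H a b \<and> nrm H a \<le> (C * C) * nrm H u" if u: "u \<in> vecs H" for u
    proof -
      obtain k r where kr: "k \<in> ker H G" "r \<in> cl H (Range N.A)" "u = add H k r" by (rule N.ker_split[OF u])
      have "k \<in> ker K G" using kr(1) by (simp add: ker_same)
      then obtain n p where np: "n \<in> ker K G" "n \<in> ker K M.A" "p \<in> cl K (Range G)" "k = add K n p"
        by (rule M.kerG_decomp)
      have v: "n \<in> vecs H" "p \<in> vecs H" "r \<in> vecs H" "k \<in> vecs H"
        using kr np N.vecs_subs M.vecs_subs by auto
      have pH: "p \<in> cl H (Range G)" using np(3) clG by simp
      have "add H p r \<in> ?Y"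
      proof (rule Y_I)
        fix m assume m: "m \<in> ker H G" "m \<in> ker H N.A"
        show "rip H m (add H p r) = 0"
          using v N.vecs_subs(1)[OF m(1)] N.rip_kerG[OF m(1) kr(2)] N.rip_kerA[OF m(2) pH]
          by (simp add: rip_simps)
      qed (use v in simp)
      moreover have "n \<in> ?X" using np X_eq by (simp add: ker_same)
      moreover have "u = add H n (add H p r)"
        unfolding kr(3) np(4) same by (rule ip_eqI) (use v in \<open>auto simp: ip_left\<close>)
      \<comment> \<open>The step from u to k is an orthogonal projection for H, the one from k to n
        an orthogonal projection for K. Neither increases its norm, so only the two changes of norm
        contribute.\<close>
      moreover have "nrm H n \<le> C * C * nrm H u"
      proof -
        have "nrm H n \<le> C * nrm K n" by (rule C(2)[OF v(1)])
        also have "nrm K n \<le> nrm K (add K n p)"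
          using v M.rip_kerA[OF np(2,3)] by (intro K.nrm_le_of_orth) auto
        also have "add K n p = k" using np(4) by simp
        also have "nrm K k \<le> C * nrm H k" by (rule C(3)[OF v(4)])
        also have "nrm H k \<le> nrm H (add H k r)"
          using v N.rip_kerG[OF kr(1,2)] by (intro nrm_le_of_orth) auto
        also have "add H k r = u" using kr(3) by simp
        finally show ?thesis using C(1) by (simp add: mult.assoc)
      qed
      ultimately show ?thesis by blast
    qed
  qed
qed

section \<open>Bi-sectoriality\<close>

lemma cplx_complex [simp]: "cplx (z :: complex) = z"
  by (simp add: cplx_complex_def)

lemma mem_bisector_0: "Im \<zeta> = 0 \<Longrightarrow> \<zeta> \<in> bisector 0"
proof -
  assume "Im \<zeta> = 0"
  then have z: "\<zeta> = of_real (Re \<zeta>)" by (simp add: complex_eq_iff)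
  consider "Re \<zeta> = 0" | "Re \<zeta> > 0" | "Re \<zeta> < 0" by linarith
  then show ?thesis
  proof cases
    case 1
    then have "\<zeta> = 0" using z by simp
    then show ?thesis by (simp add: bisector_def)
  next
    case 2
    then have "Arg \<zeta> = 0" by (subst z) (rule Arg_of_real[THEN trans], simp)
    then show ?thesis by (simp add: bisector_def)
  next
    case 3
    then have "Arg (- \<zeta>) = 0"
      by (subst z, subst of_real_minus[symmetric]) (rule Arg_of_real[THEN trans], simp)
    then show ?thesis by (simp add: bisector_def)
  qed
qed

text \<open>Outside the bisector the absolute value of the argument lies strictly between \<theta>
  and pi - \<theta>, where the sine is at least sin \<theta>, and Im \<zeta> is the modulus times
  the sine of the argument.\<close>

lemma not_mem_bisector:
  assumes t: "0 < \<theta>" "\<theta> < pi / 2" and z: "\<zeta> \<notin> bisector \<theta>"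
  shows "\<zeta> \<noteq> 0" "sin \<theta> * cmod \<zeta> \<le> \<bar>Im \<zeta>\<bar>"
proof -
  show nz: "\<zeta> \<noteq> 0" using z by (auto simp: bisector_def)
  have a: "\<bar>Arg \<zeta>\<bar> > \<theta>" "\<bar>Arg (- \<zeta>)\<bar> > \<theta>" using z by (auto simp: bisector_def)
  have Ar: "- pi < Arg \<zeta>" "Arg \<zeta> \<le> pi" using Arg_bounded[of \<zeta>] by auto
  have m: "Arg (- \<zeta>) = (if Arg \<zeta> \<le> 0 then Arg \<zeta> + pi else Arg \<zeta> - pi)"
    using nz by (rule Arg_minus)
  have "sin \<theta> \<le> sin \<bar>Arg \<zeta>\<bar>"
  proof (cases "\<bar>Arg \<zeta>\<bar> \<le> pi / 2")
    case True
    then show ?thesis using a t by (intro sin_monotone_2pi_le) auto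
  next
    case False
    have "\<theta> \<le> pi - \<bar>Arg \<zeta>\<bar>" using a(2) m Ar by (auto split: if_splits)
    then have "sin \<theta> \<le> sin (pi - \<bar>Arg \<zeta>\<bar>)" using False t by (intro sin_monotone_2pi_le) auto
    then show ?thesis by simp
  qed
  also have "\<dots> = \<bar>sin (Arg \<zeta>)\<bar>"
    using Ar sin_ge_zero[of "Arg \<zeta>"] sin_ge_zero[of "- Arg \<zeta>"] by (cases "Arg \<zeta> \<ge> 0") auto
  finally have "sin \<theta> * cmod \<zeta> \<le> \<bar>sin (Arg \<zeta>)\<bar> * cmod \<zeta>" by (rule mult_right_mono) simp
  also have "\<dots> = \<bar>Im \<zeta>\<bar>"
  proof -
    have "\<zeta> = rcis (cmod \<zeta>) (Arg \<zeta>)" by (simp add: rcis_cmod_Arg)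
    then have "Im \<zeta> = cmod \<zeta> * sin (Arg \<zeta>)" by (metis Im_rcis)
    then show ?thesis by (simp add: abs_mult)
  qed
  finally show "sin \<theta> * cmod \<zeta> \<le> \<bar>Im \<zeta>\<bar>" .
qed

context
  fixes H :: "(complex, 'h) ipspace" and T
  assumes sT: "selfadj H T"
begin

interpretation selfadj H T by (rule sT)

text \<open>For symmetric T the number (T u, u) is real, so the imaginary part of ((\<zeta> - T) u,
  u) is Im \<zeta> |u|^2. The factor - i turns this imaginary part into a real one, to which
  Cauchy-Schwarz for \<open>rip\<close> applies.\<close>

lemma resolvent_estimate:
  assumes ua: "(u, a) \<in> T" shows "\<bar>Im \<zeta>\<bar> * nrm H u \<le> nrm H (sub H (scl H \<zeta> u) a)"
proof -
  note v = in_vecs[OF ua]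
  let ?f = "sub H (scl H \<zeta> u) a"
  have "(u, a) \<in> adj H T" using ua adj_eq by simp
  then have "ip H a u = ip H u a" using ua unfolding adj_def by blast
  then have "Im (ip H a u) = 0" using ip_cnj[OF v(1) v(2)] by (simp add: complex_eq_iff)
  moreover have "Im (ip H u u) = 0" using ip_cnj[OF v(1) v(1)] by (simp add: complex_eq_iff)
  ultimately have "Im (ip H ?f u) = Im \<zeta> * (nrm H u)\<^sup>2"
    using v by (simp add: ip_left nrm_sq rip_def)
  moreover have "Im (ip H ?f u) = rip H (scl H (- \<i>) ?f) u"
    using v by (simp add: ip_left(2) rip_def del: ip_sub_left)
  moreover have "\<bar>rip H (scl H (- \<i>) ?f) u\<bar> \<le> nrm H (scl H (- \<i>) ?f) * nrm H u"
    using v by (intro cauchy_schwarz) auto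
  moreover have "nrm H (scl H (- \<i>) ?f) = nrm H ?f" using v by (simp add: nrm_scl)
  ultimately have "\<bar>Im \<zeta>\<bar> * (nrm H u)\<^sup>2 \<le> nrm H ?f * nrm H u" by (simp add: abs_mult)
  then have "(\<bar>Im \<zeta>\<bar> * nrm H u) * nrm H u \<le> nrm H ?f * nrm H u" by (simp add: power2_eq_square mult.assoc)
  then show ?thesis using v nrm_nonneg[OF v(1)] nrm_nonneg[of ?f]
    by (cases "nrm H u = 0") (auto simp: mult_le_cancel_right)
qed

text \<open>The range of \<zeta> - T is dense, as a vector orthogonal to it would be an eigenvector
  of T for the non-real number cnj \<zeta>. It is also closed: by \<open>resolvent_estimate\<close>
  preimages of a convergent sequence are Cauchy, and T is closed.\<close>

lemma resolvent_Range:
  assumes z: "Im \<zeta> \<noteq> 0" and f: "f \<in> vecs H"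
  obtains u a where "(u, a) \<in> T" "f = sub H (scl H \<zeta> u) a"
proof -
  define S where "S = {(u, sub H (scl H \<zeta> u) a) | u a. (u, a) \<in> T}"
  define R where "R = Range S"
  have S: "(u, f) \<in> S \<longleftrightarrow> (\<exists>a. (u, a) \<in> T \<and> f = sub H (scl H \<zeta> u) a)" for u f by (auto simp: S_def)
  have lS: "lin_op H S"
  proof (rule lin_opI)
    show "(zer H, zer H) \<in> S" using lin_opD(4)[OF lin] by (auto simp: S intro!: exI[of _ "zer H"])
    show "(add H u v, add H f g) \<in> S" if uv: "(u, f) \<in> S" "(v, g) \<in> S" for u f v g
    proof -
      obtain a b where *: "(u, a) \<in> T" "f = sub H (scl H \<zeta> u) a" "(v, b) \<in> T" "g = sub H (scl H \<zeta> v) b"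
        using uv by (auto simp: S)
      note w = in_vecs[OF *(1)] in_vecs[OF *(3)]
      have "add H f g = sub H (scl H \<zeta> (add H u v)) (add H a b)"
        unfolding * by (rule ip_eqI) (use w in \<open>auto simp: ip_left algebra_simps\<close>)
      then show ?thesis using lin_opD(5)[OF lin *(1,3)] by (auto simp: S)
    qed
    show "(scl H c u, scl H c f) \<in> S" if uf: "(u, f) \<in> S" for u f c
    proof -
      obtain a where *: "(u, a) \<in> T" "f = sub H (scl H \<zeta> u) a" using uf by (auto simp: S)
      note w = in_vecs[OF *(1)]
      have "scl H c f = sub H (scl H \<zeta> (scl H c u)) (scl H c a)"
        unfolding * by (rule ip_eqI) (use w in \<open>auto simp: ip_left algebra_simps\<close>)
      then show ?thesis using lin_opD(6)[OF lin *(1)] by (auto simp: S)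
    qed
    show "a = b" if "(u, a) \<in> S" "(u, b) \<in> S" for u a b
      using that lin_opD(3)[OF lin] by (auto simp: S)
  qed (use in_vecs in \<open>auto simp: S\<close>)
  have lR: "lin_subspace H R" unfolding R_def by (rule lin_subspace_Range[OF lS])
  have "w = zer H" if w: "w \<in> orth H R" for w
  proof -
    have wv: "w \<in> vecs H" using w orth_sub_vecs by auto
    have "ip H a w = ip H u (scl H (cnj \<zeta>) w)" if ua: "(u, a) \<in> T" for u a
    proof -
      note v = in_vecs[OF ua]
      have "sub H (scl H \<zeta> u) a \<in> R" using ua S by (auto simp: R_def)
      then have "ip H (sub H (scl H \<zeta> u) a) w = 0" using w by (simp add: orth_def)
      then have "ip H a w = \<zeta> * ip H u w" using v wv by (simp add: ip_left)
      also have "\<dots> = ip H u (scl H (cnj \<zeta>) w)"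
        using ip_cnj[of "scl H (cnj \<zeta>) w" u] ip_cnj[of w u] v wv by (simp add: ip_left)
      finally show ?thesis .
    qed
    then have "(w, scl H (cnj \<zeta>) w) \<in> adj H T" using wv by (auto simp: adj_def)
    then have "(w, scl H (cnj \<zeta>) w) \<in> T" using adj_eq by simp
    from resolvent_estimate[OF this, of "cnj \<zeta>"] have "\<bar>Im \<zeta>\<bar> * nrm H w \<le> 0" using wv by simp
    then have "nrm H w \<le> 0" using z by (simp add: mult_le_0_iff)
    then have "nrm H w = 0" using nrm_nonneg[OF wv] by simp
    then show ?thesis using wv by (simp add: nrm_eq_0)
  qed
  then have "cl H R = vecs H" using dense_iff_orth[OF lR] by blast
  then have "f \<in> cl H R" using f by simp
  then obtain s where s: "\<And>n. s n \<in> R" "tends H s f" by (meson clE)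
  have "\<forall>n. \<exists>u a. (u, a) \<in> T \<and> s n = sub H (scl H \<zeta> u) a"
  proof
    fix n
    obtain u where "(u, s n) \<in> S" using s(1)[of n] unfolding R_def by blast
    then show "\<exists>u a. (u, a) \<in> T \<and> s n = sub H (scl H \<zeta> u) a" using S by blast
  qed
  then obtain p q where pq: "\<And>n. (p n, q n) \<in> T" "\<And>n. s n = sub H (scl H \<zeta> (p n)) (q n)" by metis
  note v = in_vecs[OF pq(1)]
  have sv: "s n \<in> vecs H" for n using s(1) lR by (auto simp: lin_subspace_def)
  have est: "\<bar>Im \<zeta>\<bar> * nrm H (sub H (p m) (p n)) \<le> nrm H (sub H (s m) f) + nrm H (sub H (s n) f)" for m n
  proof -
    have "sub H (scl H \<zeta> (sub H (p m) (p n))) (sub H (q m) (q n)) = sub H (s m) (s n)"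
      unfolding pq(2) by (rule ip_eqI) (use v in \<open>auto simp: ip_left algebra_simps\<close>)
    then have "\<bar>Im \<zeta>\<bar> * nrm H (sub H (p m) (p n)) \<le> nrm H (sub H (s m) (s n))"
      using resolvent_estimate[OF lin_opD(7)[OF lin pq(1)[of m] pq(1)[of n]], of \<zeta>] by simp
    also have "\<dots> \<le> nrm H (sub H (s m) f) + nrm H (sub H f (s n))"
      by (rule nrm_sub_triangle[OF sv f sv])
    finally show ?thesis using nrm_sub_commute[OF f sv] by simp
  qed
  have "\<exists>u\<in>vecs H. tends H p u"
  proof (rule complete)
    fix e :: real assume "e > 0"
    then have "\<bar>Im \<zeta>\<bar> * e / 2 > 0" using z by simp
    then have "eventually (\<lambda>n. nrm H (sub H (s n) f) < \<bar>Im \<zeta>\<bar> * e / 2) sequentially"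
      by (rule order_tendstoD(2)[OF s(2)[unfolded tends_def]])
    then obtain N where N: "\<And>n. n \<ge> N \<Longrightarrow> nrm H (sub H (s n) f) < \<bar>Im \<zeta>\<bar> * e / 2"
      by (auto simp: eventually_sequentially)
    have "nrm H (sub H (p m) (p n)) < e" if "m \<ge> N" "n \<ge> N" for m n
    proof -
      have "\<bar>Im \<zeta>\<bar> * nrm H (sub H (p m) (p n)) < \<bar>Im \<zeta>\<bar> * e"
        using est[of m n] N[OF that(1)] N[OF that(2)] by linarith
      then show ?thesis by (rule mult_left_less_imp_less) simp
    qed
    then show "\<exists>N. \<forall>m\<ge>N. \<forall>n\<ge>N. nrm H (sub H (p m) (p n)) < e" by blast
  qed (rule v)
  then obtain u where u: "u \<in> vecs H" "tends H p u" by blast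
  have "tends H (\<lambda>n. sub H (scl H \<zeta> (p n)) (s n)) (sub H (scl H \<zeta> u) f)"
    by (rule tends_sub[OF tends_scl[OF u(2) v(1) u(1)] s(2)]) (use v sv u f in auto)
  moreover have "sub H (scl H \<zeta> (p n)) (s n) = q n" for n
    unfolding pq(2) by (rule ip_eqI) (use v in \<open>auto simp: ip_left\<close>)
  ultimately have "tends H q (sub H (scl H \<zeta> u) f)" by simp
  then have "(u, sub H (scl H \<zeta> u) f) \<in> T"
    by (intro closed_opD[OF cls pq(1) u(1) _ u(2)]) (use u f in auto)
  moreover have "f = sub H (scl H \<zeta> u) (sub H (scl H \<zeta> u) f)"
    by (rule ip_eqI) (use u f in \<open>auto simp: ip_left\<close>)
  ultimately show thesis using that by blast
qed

text \<open>T is self-adjoint for H, whereas closedness, spectrum and operator norms are taken in K.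
  The resolvents are the same relations in both, so their bounds only pick up a factor C for each
  change of norm. The spectrum is real, and the angle 0 works.\<close>

lemma bisectorial_complex_selfadj:
  assumes cK: "closed_op K T" and K: "vecs K = vecs H" "add K = add H" "scl K = scl H"
    and C: "C \<ge> 1" "\<And>u. u \<in> vecs H \<Longrightarrow> nrm H u \<le> C * nrm K u" "\<And>u. u \<in> vecs H \<Longrightarrow> nrm K u \<le> C * nrm H u"
  shows "bisectorial_complex K T"
proof -
  have subK: "sub K = sub H" using K by (simp add: sub_def fun_eq_iff)
  have r_iff: "(f, u) \<in> resolvent K T \<zeta> \<longleftrightarrow> (\<exists>a. (u, a) \<in> T \<and> f = sub H (scl H \<zeta> u) a)" for f u \<zeta>
    by (auto simp: resolvent_def subK K)
  have est: "\<bar>Im \<zeta>\<bar> * nrm K u \<le> C * C * nrm K f" if fu: "(f, u) \<in> resolvent K T \<zeta>" for f u \<zeta>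
  proof -
    obtain a where a: "(u, a) \<in> T" "f = sub H (scl H \<zeta> u) a" using fu r_iff by blast
    have v: "u \<in> vecs H" "f \<in> vecs H" using a in_vecs[OF a(1)] by auto
    have "\<bar>Im \<zeta>\<bar> * nrm K u \<le> \<bar>Im \<zeta>\<bar> * (C * nrm H u)" by (intro mult_left_mono C(3) v) simp
    also have "\<dots> = C * (\<bar>Im \<zeta>\<bar> * nrm H u)" by simp
    also have "\<dots> \<le> C * nrm H f" using C(1) resolvent_estimate[OF a(1), of \<zeta>] a(2) by (intro mult_left_mono) auto
    also have "\<dots> \<le> C * (C * nrm K f)" using C(1) by (intro mult_left_mono C(2) v) auto
    finally show ?thesis by (simp add: mult.assoc)
  qed
  have "Im \<zeta> = 0" if sp: "\<zeta> \<in> spectrum K T" for \<zeta>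
  proof (rule ccontr)
    assume z: "Im \<zeta> \<noteq> 0"
    have "single_valued (resolvent K T \<zeta>)"
    proof (rule single_valuedI)
      fix f u u' assume "(f, u) \<in> resolvent K T \<zeta>" "(f, u') \<in> resolvent K T \<zeta>"
      then obtain a a' where *: "(u, a) \<in> T" "f = sub H (scl H \<zeta> u) a" "(u', a') \<in> T" "f = sub H (scl H \<zeta> u') a'"
        unfolding r_iff by blast
      note v = in_vecs[OF *(1)] in_vecs[OF *(3)]
      have "sub H (scl H \<zeta> (sub H u u')) (sub H a a') = sub H (sub H (scl H \<zeta> u) a) (sub H (scl H \<zeta> u') a')"
        by (rule ip_eqI) (use v in \<open>auto simp: ip_left algebra_simps\<close>)
      also have "\<dots> = sub H f f" using *(2,4) by simp
      also have "\<dots> = zer H" using v *(2) by simp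
      finally have "\<bar>Im \<zeta>\<bar> * nrm H (sub H u u') \<le> 0"
        using resolvent_estimate[OF lin_opD(7)[OF lin *(1,3)], of \<zeta>] by simp
      then have "nrm H (sub H u u') \<le> 0" using z by (simp add: mult_le_0_iff)
      then show "u = u'" using v by (intro nrm_sub_0 antisym) auto
    qed
    moreover have "Domain (resolvent K T \<zeta>) = vecs K"
    proof
      show "Domain (resolvent K T \<zeta>) \<subseteq> vecs K" using in_vecs by (auto simp: r_iff K)
      show "vecs K \<subseteq> Domain (resolvent K T \<zeta>)"
      proof
        fix f assume "f \<in> vecs K"
        then have "f \<in> vecs H" by (simp add: K)
        then obtain u a where "(u, a) \<in> T" "f = sub H (scl H \<zeta> u) a" by (rule resolvent_Range[OF z])
        then have "(f, u) \<in> resolvent K T \<zeta>" using r_iff by blast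
        then show "f \<in> Domain (resolvent K T \<zeta>)" by blast
      qed
    qed
    moreover have "\<exists>D. \<forall>(f, u)\<in>resolvent K T \<zeta>. nrm K u \<le> D * nrm K f"
    proof (intro exI ballI, clarify)
      fix f u assume "(f, u) \<in> resolvent K T \<zeta>"
      from est[OF this] show "nrm K u \<le> (C * C / \<bar>Im \<zeta>\<bar>) * nrm K f"
        using z by (simp add: field_simps)
    qed
    ultimately show False using sp by (simp add: spectrum_def)
  qed
  then have "spectrum K T \<subseteq> bisector 0" using mem_bisector_0 by blast
  moreover have "\<exists>D. \<forall>\<zeta>. \<zeta> \<notin> bisector \<theta> \<longrightarrow> cmod \<zeta> * op_norm K (resolvent K T \<zeta>) \<le> D"
    if t: "\<theta> \<in> {0<..<pi / 2}" for \<theta>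
  proof (intro exI allI impI)
    fix \<zeta> assume nb: "\<zeta> \<notin> bisector \<theta>"
    have sp: "sin \<theta> > 0" using t by (intro sin_gt_zero) auto
    have z: "\<zeta> \<noteq> 0" "sin \<theta> * cmod \<zeta> \<le> \<bar>Im \<zeta>\<bar>" using not_mem_bisector[OF _ _ nb] t by auto
    then have im: "\<bar>Im \<zeta>\<bar> > 0" using sp by (smt (verit) mult_pos_pos zero_less_norm_iff)
    have "op_norm K (resolvent K T \<zeta>) \<le> C * C / \<bar>Im \<zeta>\<bar>"
      unfolding op_norm_def
    proof (rule cSup_least)
      \<comment> \<open>\<open>op_norm\<close> is a supremum of reals, so it is bounded by an upper
        bound of the set only if the set is nonempty.\<close>
      have "(zer H, zer H) \<in> resolvent K T \<zeta>"
        unfolding r_iff using lin_opD(4)[OF lin] by (intro exI[of _ "zer H"]) simp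
      moreover have "nrm K (zer H) \<le> 1" using C(3)[OF zer_in] by simp
      ultimately show "{nrm K a |u a. (u, a) \<in> resolvent K T \<zeta> \<and> nrm K u \<le> 1} \<noteq> {}" by blast
      fix x assume "x \<in> {nrm K a |u a. (u, a) \<in> resolvent K T \<zeta> \<and> nrm K u \<le> 1}"
      then obtain f u where fu: "x = nrm K u" "(f, u) \<in> resolvent K T \<zeta>" "nrm K f \<le> 1" by blast
      have "\<bar>Im \<zeta>\<bar> * nrm K u \<le> C * C * nrm K f" by (rule est[OF fu(2)])
      also have "\<dots> \<le> C * C * 1" using C(1) by (intro mult_left_mono fu(3)) auto
      finally show "x \<le> C * C / \<bar>Im \<zeta>\<bar>" using im fu(1) by (simp add: field_simps)
    qed
    then have "cmod \<zeta> * op_norm K (resolvent K T \<zeta>) \<le> cmod \<zeta> * (C * C / \<bar>Im \<zeta>\<bar>)"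
      by (rule mult_left_mono) simp
    also have "\<dots> \<le> C * C / sin \<theta>"
    proof -
      have "C * C * (sin \<theta> * cmod \<zeta>) \<le> C * C * \<bar>Im \<zeta>\<bar>" using C(1) by (intro mult_left_mono z) auto
      then show ?thesis using im sp by (simp add: field_simps)
    qed
    finally show "cmod \<zeta> * op_norm K (resolvent K T \<zeta>) \<le> C * C / sin \<theta>" .
  qed
  ultimately show ?thesis
    unfolding bisectorial_complex_def using cK pi_gt_zero by (intro conjI bexI[of _ 0]) auto
qed

end

text \<open>A single non-real value of \<open>cplx\<close> spans the complex numbers over the reals
  together with 1, and the image is a real subspace containing 1.\<close>

lemma cplx_real_or_surj:
  assumes "\<not> surj (cplx :: 'k::real_or_complex \<Rightarrow> complex)"
  shows "Im (cplx (x :: 'k)) = 0"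
proof (rule ccontr)
  assume n: "Im (cplx x) \<noteq> 0"
  have "z \<in> range (cplx :: 'k \<Rightarrow> complex)" for z
  proof -
    let ?b = "Im z / Im (cplx x)"
    let ?a = "Re z - ?b * Re (cplx x)"
    have "cplx (of_real ?a + of_real ?b * x) = z"
      using n by (simp add: cplx_add cplx_mult complex_eq_iff del: of_real_diff of_real_divide)
    then show ?thesis by (metis rangeI)
  qed
  then show False using assms by blast
qed

section \<open>Passing to complex scalars\<close>

context hilb begin

lemma rip_as_complex: "rip (as_complex H) = rip H"
  by (simp add: rip_def as_complex_def fun_eq_iff)

lemma nrm_as_complex: "nrm (as_complex H) = nrm H"
  by (simp add: nrm_def as_complex_def fun_eq_iff)

lemma hilb_as_complex:
  assumes s: "surj (cplx :: 'k \<Rightarrow> complex)"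
  shows "hilb (as_complex H)" "sub (as_complex H) = sub H"
proof -
  have c: "cplx (inv cplx z :: 'k) = z" for z using s by (simp add: surj_f_inv_f)
  have m: "inv cplx (- 1) = (- 1 :: 'k)"
    by (subst cplx_inj[symmetric]) (simp add: c cplx_one)
  show sub: "sub (as_complex H) = sub H"
    by (simp add: sub_def fun_eq_iff as_complex_def m)
  have vecs: "vecs (as_complex H) = vecs H" by (simp add: as_complex_def)
  show "hilb (as_complex H)"
  proof
    fix s :: "nat \<Rightarrow> 'h" assume s: "\<And>n. s n \<in> vecs (as_complex H)"
      and cau: "\<And>e. e > 0 \<Longrightarrow> \<exists>N. \<forall>m\<ge>N. \<forall>n\<ge>N. nrm (as_complex H) (sub (as_complex H) (s m) (s n)) < e"
    have "\<exists>u\<in>vecs H. tends H s u"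
      by (rule complete) (use s cau in \<open>simp_all add: sub nrm_as_complex vecs\<close>)
    then show "\<exists>u\<in>vecs (as_complex H). tends (as_complex H) s u"
      by (simp add: tends_def sub nrm_as_complex) (simp add: as_complex_def)
  next
    show "\<And>u v. u \<in> vecs (as_complex H) \<Longrightarrow> v \<in> vecs (as_complex H) \<Longrightarrow>
       nrm (as_complex H) (sub (as_complex H) u v) = 0 \<Longrightarrow> u = v"
      using nrm_sub_0 by (simp add: sub nrm_as_complex) (simp add: as_complex_def)
    show "\<And>u. u \<in> vecs (as_complex H) \<Longrightarrow> 0 \<le> rip (as_complex H) u u"
      by (simp add: rip_as_complex) (simp add: as_complex_def)
    show "cplx (ip (as_complex H) v u) = cnj (cplx (ip (as_complex H) u v))"
      if "u \<in> vecs (as_complex H)" "v \<in> vecs (as_complex H)" for u v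
      using that ip_cnj[of u v] unfolding vecs by (simp add: as_complex_def)
  qed (auto simp: as_complex_def ip_left cplx_add cplx_mult c)
qed


lemma closed_op_as_complex:
  assumes s: "surj (cplx :: 'k \<Rightarrow> complex)" and T: "closed_op H T"
  shows "closed_op (as_complex H) T"
proof -
  have "tends (as_complex H) = tends H"
    by (simp add: tends_def hilb_as_complex(2)[OF s] nrm_as_complex fun_eq_iff)
  moreover have "vecs (as_complex H) = vecs H" by (simp add: as_complex_def)
  moreover have "lin_op (as_complex H) T"
    using closed_op_lin[OF T] by (simp add: lin_op_def as_complex_def)
  ultimately show ?thesis using T unfolding closed_op_def by metis
qed

lemma selfadj_as_complex:
  assumes s: "surj (cplx :: 'k \<Rightarrow> complex)" and T: "self_adjoint_op H T"
  shows "selfadj (as_complex H) T"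
proof -
  interpret selfadj H T using T hilb_axioms by (simp add: selfadj_def selfadj_axioms_def)
  interpret C: hilb "as_complex H" by (rule hilb_as_complex[OF s])
  have "lin_op (as_complex H) T"
    using lin by (simp add: lin_op_def as_complex_def)
  moreover have "cl (as_complex H) = cl H"
    by (simp add: cl_def fun_eq_iff tends_def hilb_as_complex(2)[OF s] nrm_as_complex) (simp add: as_complex_def)
  then have "densely_defined (as_complex H) T"
    using dd by (simp add: densely_defined_def) (simp add: as_complex_def)
  moreover have "adj (as_complex H) T = T"
    using adj_eq by (simp add: adj_def as_complex_def cplx_inj)
  ultimately show ?thesis by (simp add: selfadj_def selfadj_axioms_def self_adjoint_op_def C.hilb_axioms)
qed

lemma complexification_simps:
  "vecs (complexification H) = vecs H \<times> vecs H" "zer (complexification H) = (zer H, zer H)"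
  "add (complexification H) (u, v) (u', v') = (add H u u', add H v v')"
  "scl (complexification H) z (u, v) = (sub H (rscl H (Re z) u) (rscl H (Im z) v), add H (rscl H (Im z) u) (rscl H (Re z) v))"
  by (simp_all add: complexification_def rscl_def)

lemma sub_complexification:
  assumes "u \<in> vecs H" "v \<in> vecs H" "u' \<in> vecs H" "v' \<in> vecs H"
  shows "sub (complexification H) (u, v) (u', v') = (sub H u u', sub H v v')"
proof -
  have "add H u (sub H (rscl H (Re (- 1)) u') (rscl H (Im (- 1)) v')) = sub H u u'"
    "add H v (add H (rscl H (Im (- 1)) u') (rscl H (Re (- 1)) v')) = sub H v v'"
    by (rule rip_eqI; use assms in \<open>auto simp: rip_simps\<close>)+
  then show ?thesis unfolding sub_def[of "complexification H"] complexification_simps by simp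
qed

end

locale real_hilb = hilb H for H :: "('k::real_or_complex, 'h) ipspace" +
  assumes nsurj: "\<not> surj (cplx :: 'k \<Rightarrow> complex)"
begin

abbreviation "C \<equiv> complexification H"

lemma cplx_ip: "cplx (ip H u v) = of_real (rip H u v)"
  using cplx_real_or_surj[OF nsurj, of "ip H u v"] by (simp add: rip_def complex_eq_iff)

lemma ip_C: "ip C (u, v) (u', v') = Complex (rip H u u' + rip H v v') (rip H v u' - rip H u v')"
  by (simp add: complexification_def cplx_ip complex_eq_iff)

text \<open>Norm and convergence of the complexification are those of the product with weight 1,
  whose completeness is already known.\<close>

lemma nrm_C: "u \<in> vecs H \<Longrightarrow> v \<in> vecs H \<Longrightarrow> nrm C (u, v) = nrm (graph_space 1 H) (u, v)"
  by (simp add: nrm_def[of C] ip_C nrm_graph_space nrm_sq)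

lemma nrm_sub_C:
  assumes "p \<in> vecs C" "q \<in> vecs C"
  shows "nrm C (sub C p q) = nrm (graph_space 1 H) (sub (graph_space 1 H) p q)"
proof -
  obtain u v u' v' where "p = (u, v)" "q = (u', v')" "u \<in> vecs H" "v \<in> vecs H" "u' \<in> vecs H" "v' \<in> vecs H"
    using assms by (cases p, cases q) (auto simp: complexification_simps)
  then show ?thesis by (simp add: sub_complexification sub_graph_space nrm_C)
qed

lemma tends_C:
  assumes "\<And>n. s n \<in> vecs C" "u \<in> vecs C"
  shows "tends C s u = tends (graph_space 1 H) s u"
  using assms by (simp add: tends_def nrm_sub_C)

lemma hilb_C: "hilb C"
proof -
  have vG: "vecs (graph_space 1 H) = vecs C" by (simp add: graph_space_def complexification_simps)
  interpret G: hilb "graph_space 1 H" by (rule hilb_graph_space) simp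
  show ?thesis
  proof
    fix s :: "nat \<Rightarrow> 'h \<times> 'h" assume s: "\<And>n. s n \<in> vecs C"
      and cau: "\<And>e. e > 0 \<Longrightarrow> \<exists>N. \<forall>m\<ge>N. \<forall>n\<ge>N. nrm C (sub C (s m) (s n)) < e"
    have "\<exists>u\<in>vecs (graph_space 1 H). tends (graph_space 1 H) s u"
      by (rule G.complete) (use s cau in \<open>simp_all add: vG nrm_sub_C\<close>)
    then show "\<exists>u\<in>vecs C. tends C s u" using tends_C s by (simp add: vG)
  next
    fix u v assume "u \<in> vecs C" "v \<in> vecs C" "nrm C (sub C u v) = 0"
    then show "u = v" using G.nrm_sub_0[of u v] by (simp add: vG nrm_sub_C)
  next
    fix u v assume "u \<in> vecs C" "v \<in> vecs C"
    then show "cplx (ip C v u) = cnj (cplx (ip C u v))"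
      by (cases u, cases v) (auto simp: ip_C complexification_simps complex_eq_iff rip_commute)
  next
    fix u assume "u \<in> vecs C"
    then show "0 \<le> rip C u u" unfolding rip_def[of C]
      by (cases u) (auto simp: ip_C complexification_simps)
  qed (auto simp: ip_C complexification_simps rip_simps complex_eq_iff algebra_simps)
qed

lemma mem_op_complexification: "((u, v), (a, b)) \<in> op_complexification T \<longleftrightarrow> (u, a) \<in> T \<and> (v, b) \<in> T"
  by (auto simp: op_complexification_def)

lemma selfadj_C:
  assumes T: "self_adjoint_op H T"
  shows "selfadj C (op_complexification T)"
proof -
  interpret selfadj H T using T hilb_axioms by (simp add: selfadj_def selfadj_axioms_def)
  interpret C: hilb C by (rule hilb_C)
  let ?T = "op_complexification T"
  have "lin_op C ?T"
  proof (rule C.lin_opI)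
    fix u a assume ua: "(u, a) \<in> ?T"
    obtain p q b c where *: "u = (p, q)" "a = (b, c)" by (cases u, cases a) blast
    then have **: "(p, b) \<in> T" "(q, c) \<in> T" using ua by (simp_all add: mem_op_complexification)
    show "u \<in> vecs C" "a \<in> vecs C" using * in_vecs[OF **(1)] in_vecs[OF **(2)] by (simp_all add: complexification_simps)
    show "(scl C z u, scl C z a) \<in> ?T" for z
      unfolding * complexification_simps mem_op_complexification
      using ** by (intro conjI lin_opD(5,7)[OF lin] lin_opD(8)[OF lin])
    show "a = b'" if ub: "(u, b') \<in> ?T" for b'
    proof -
      obtain d e where "b' = (d, e)" by (cases b')
      then show ?thesis using ub ** lin_opD(3)[OF lin] unfolding * by (auto simp: mem_op_complexification)
    qed
    show "(add C u v, add C a b') \<in> ?T" if ub: "(v, b') \<in> ?T" for v b'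
    proof -
      obtain d e f g where e: "b' = (d, e)" "v = (f, g)" by (cases b', cases v)
      then show ?thesis using ub ** lin_opD(5)[OF lin] unfolding * e complexification_simps mem_op_complexification by blast
    qed
  next
    show "(zer C, zer C) \<in> ?T" using lin_opD(4)[OF lin] by (simp add: complexification_simps mem_op_complexification)
  qed
  moreover have "densely_defined C ?T"
  proof -
    have "p \<in> cl C (Domain ?T)" if p: "p \<in> vecs C" for p
    proof -
      obtain u v where uv: "p = (u, v)" "u \<in> vecs H" "v \<in> vecs H"
        using p by (cases p) (auto simp: complexification_simps)
      have "u \<in> cl H (Domain T)" "v \<in> cl H (Domain T)" using dd uv by (simp_all add: densely_defined_def)
      then obtain s t where s: "\<And>n. s n \<in> Domain T" "tends H s u" and t: "\<And>n. t n \<in> Domain T" "tends H t v"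
        by (meson clE)
      have w: "s n \<in> vecs H" "t n \<in> vecs H" for n using s(1)[of n] t(1)[of n] in_vecs(1) by blast+
      have "tends (graph_space 1 H) (\<lambda>n. (s n, t n)) (u, v)"
        using tends_graph_space[OF zero_less_one, of s t u v] w uv s(2) t(2) by simp
      then have "tends C (\<lambda>n. (s n, t n)) p"
        using tends_C[of "\<lambda>n. (s n, t n)" p] w uv by (simp add: complexification_simps)
      moreover have "(s n, t n) \<in> Domain ?T" for n
      proof -
        obtain a b where "(s n, a) \<in> T" "(t n, b) \<in> T" using s(1) t(1) by blast
        then have "((s n, t n), (a, b)) \<in> ?T" by (simp add: mem_op_complexification)
        then show ?thesis by blast
      qed
      ultimately show ?thesis using p by (intro C.clI) auto
    qed
    then show ?thesis using C.cl_sub_vecs by (auto simp: densely_defined_def)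
  qed
  moreover have "adj C ?T = ?T"
  proof (intro set_eqI iffI)
    fix x assume x: "x \<in> adj C ?T"
    obtain v v' w w' where e: "x = ((v, v'), (w, w'))" by (metis surj_pair)
    have vv: "v \<in> vecs H" "v' \<in> vecs H" "w \<in> vecs H" "w' \<in> vecs H"
      using x e by (auto simp: adj_def complexification_simps)
    have "rip H a v = rip H u w \<and> rip H a v' = rip H u w'" if ua: "(u, a) \<in> T" for u a
    proof -
      \<comment> \<open>Pairs with vanishing second entries suffice: the real part of the identity
        then concerns v and w, the imaginary part v' and w'.\<close>
      have "((u, zer H), (a, zer H)) \<in> ?T" using ua lin_opD(4)[OF lin] by (simp add: mem_op_complexification)
      then have "ip C (a, zer H) (v, v') = ip C (u, zer H) (w, w')" using x unfolding e adj_def by blast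
      then show ?thesis using vv by (simp add: ip_C)
    qed
    then have "(v, w) \<in> T" "(v', w') \<in> T" using vv by (auto intro: symI)
    then show "x \<in> ?T" by (simp add: e mem_op_complexification)
  next
    fix x assume x: "x \<in> ?T"
    obtain v v' w w' where e: "x = ((v, v'), (w, w'))" by (metis surj_pair)
    have T: "(v, w) \<in> T" "(v', w') \<in> T" using x by (simp_all add: e mem_op_complexification)
    have "ip C p y = ip C q z" if "(q, p) \<in> ?T" "y = (v, v')" "z = (w, w')" for p q y z
    proof -
      obtain a b u u' where *: "q = (u, u')" "p = (a, b)" by (cases p, cases q) blast
      then have "(u, a) \<in> T" "(u', b) \<in> T" using that(1) by (simp_all add: mem_op_complexification)
      then show ?thesis unfolding * that(2,3) ip_C using T sym by simp
    qed
    then show "x \<in> adj C ?T"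
      using in_vecs[OF T(1)] in_vecs[OF T(2)] unfolding e adj_def by (auto simp: complexification_simps)
  qed
  ultimately show ?thesis by (simp add: selfadj_def selfadj_axioms_def self_adjoint_op_def C.hilb_axioms)
qed

end

lemma (in equiv_hilb) bisectorial_selfadj:
  assumes T: "self_adjoint_op H T"
  shows "bisectorial K T"
proof -
  interpret selfadj H T using T hilb_axioms by (simp add: selfadj_def selfadj_axioms_def)
  obtain C where C: "C \<ge> 1" "\<And>u. u \<in> vecs H \<Longrightarrow> nrm H u \<le> C * nrm K u"
    "\<And>u. u \<in> vecs H \<Longrightarrow> nrm K u \<le> C * nrm H u" by (rule norm_le) blast
  show ?thesis
  proof (cases "surj (cplx :: 'k \<Rightarrow> complex)")
    case True
    have vc: "vecs (as_complex H) = vecs H" "vecs (as_complex K) = vecs H" by (simp_all add: as_complex_def)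
    have "closed_op (as_complex K) T"
      by (rule K.closed_op_as_complex[OF True closed_op_imp[OF cls]])
    then have "bisectorial_complex (as_complex K) T"
      by (rule bisectorial_complex_selfadj[OF selfadj_as_complex[OF True T]])
         (use C in \<open>auto simp: K.nrm_as_complex nrm_as_complex vc, simp_all add: as_complex_def\<close>)
    then show ?thesis using True by (simp add: bisectorial_def)
  next
    case False
    interpret R: real_hilb H using False hilb_axioms by (simp add: real_hilb_def real_hilb_axioms_def)
    interpret RK: real_hilb K using False K.hilb_axioms by (simp add: real_hilb_def real_hilb_axioms_def)
    have vc: "vecs (complexification H) = vecs H \<times> vecs H" "vecs (complexification K) = vecs H \<times> vecs H"
      by (simp_all add: complexification_def)
    have nrmC: "nrm R.C (u, v) \<le> C * nrm RK.C (u, v)" "nrm RK.C (u, v) \<le> C * nrm R.C (u, v)"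
      if "u \<in> vecs H" "v \<in> vecs H" for u v
    proof -
      \<comment> \<open>The norm in a complexification is the Euclidean norm of the two component
        norms, so the constant C carries over unchanged.\<close>
      have mono: "sqrt (x\<^sup>2 + 1 * y\<^sup>2) \<le> C * sqrt (x'\<^sup>2 + 1 * y'\<^sup>2)"
        if "0 \<le> x" "0 \<le> y" "x \<le> C * x'" "y \<le> C * y'" for x y x' y' :: real
      proof -
        have "x\<^sup>2 \<le> (C * x')\<^sup>2" "y\<^sup>2 \<le> (C * y')\<^sup>2" using that by (auto intro: power_mono)
        then have "sqrt (x\<^sup>2 + 1 * y\<^sup>2) \<le> sqrt (C\<^sup>2 * (x'\<^sup>2 + y'\<^sup>2))"
          by (intro real_sqrt_le_mono) (simp add: power_mult_distrib distrib_left)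
        then show ?thesis using C(1) by (simp add: real_sqrt_mult)
      qed
      have uK: "u \<in> vecs K" "v \<in> vecs K" using that by simp_all
      note n = R.nrm_C[OF that] RK.nrm_C[OF uK] nrm_graph_space[OF that] K.nrm_graph_space[OF uK]
      note m = C(2,3)[OF that(1)] C(2,3)[OF that(2)] nrm_nonneg[OF that(1)] nrm_nonneg[OF that(2)]
        K.nrm_nonneg[OF uK(1)] K.nrm_nonneg[OF uK(2)]
      show "nrm R.C (u, v) \<le> C * nrm RK.C (u, v)" unfolding n by (rule mono) (rule m)+
      show "nrm RK.C (u, v) \<le> C * nrm R.C (u, v)" unfolding n by (rule mono) (rule m)+
    qed
    have eqs: "vecs R.C = vecs RK.C" "zer R.C = zer RK.C" "add R.C = add RK.C" "scl R.C = scl RK.C"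
      by (simp_all add: complexification_def)
    have "equiv_ip R.C RK.C"
    proof -
      have "nrm R.C u / C \<le> nrm RK.C u \<and> nrm RK.C u \<le> C * nrm R.C u" if "u \<in> vecs R.C" for u
        using nrmC[of "fst u" "snd u"] that C(1) by (auto simp: vc field_simps)
      then show ?thesis using eqs C(1) unfolding equiv_ip_def by metis
    qed
    then interpret E: equiv_hilb R.C RK.C
      by (simp add: equiv_hilb_def equiv_hilb_axioms_def R.hilb_C RK.hilb_C)
    have sC: "selfadj R.C (op_complexification T)" by (rule R.selfadj_C[OF T])
    have "bisectorial_complex RK.C (op_complexification T)"
      by (rule bisectorial_complex_selfadj[OF sC E.closed_op_imp[OF selfadj.cls[OF sC]] E.same(1,3,4) C(1)])
         (use nrmC in \<open>auto simp: vc\<close>)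
    then show ?thesis using False by (simp add: bisectorial_def)
  qed
qed


section \<open>Square integrable sections\<close>

locale vec_bundle =
  fixes B :: "('m::{t2_space, second_countable_topology}, 'n::finite, 'k::real_or_complex,
                'r::finite, 'v::ab_group_add) vbundle"
  assumes smooth: "smooth_bundle B"
begin

lemma vs: "vector_space (vscale B)"
  using smooth by (simp add: smooth_bundle_def)

interpretation vs: vector_space "vscale B" by (rule vs)

lemma fibre_add [simp]: "v \<in> fibre B x \<Longrightarrow> w \<in> fibre B x \<Longrightarrow> v + w \<in> fibre B x"
  and fibre_scale [simp]: "v \<in> fibre B x \<Longrightarrow> vscale B c v \<in> fibre B x"
  and fibre_0 [simp]: "0 \<in> fibre B x"
  using smooth vs.subspace_add vs.subspace_scale vs.subspace_0 by (auto simp: smooth_bundle_def)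

lemma vscale_neg1 [simp]: "vscale B (- 1) v = - v"
  and vscale_0 [simp]: "vscale B c 0 = 0"
  using vs.scale_minus_left[of 1 v] by simp_all

lemma fibre_minus [simp]: "v \<in> fibre B x \<Longrightarrow> - v \<in> fibre B x"
  using fibre_scale[of v x "-1"] by simp

lemma fibre_diff [simp]: "v \<in> fibre B x \<Longrightarrow> w \<in> fibre B x \<Longrightarrow> v - w \<in> fibre B x"
  using fibre_add[of v x "- w"] by simp

lemma trivD:
  assumes "(U, \<tau>) \<in> trivs B"
  shows "open U" "x \<in> U \<Longrightarrow> bij_betw (\<tau> x) (fibre B x) UNIV"
    "x \<in> U \<Longrightarrow> v \<in> fibre B x \<Longrightarrow> w \<in> fibre B x \<Longrightarrow> \<tau> x (v + w) = \<tau> x v + \<tau> x w"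
    "x \<in> U \<Longrightarrow> v \<in> fibre B x \<Longrightarrow> \<tau> x (vscale B c v) = c *s \<tau> x v"
    "x \<in> U \<Longrightarrow> v \<in> fibre B x \<Longrightarrow> w \<in> fibre B x \<Longrightarrow> \<tau> x (v - w) = \<tau> x v - \<tau> x w"
    "x \<in> U \<Longrightarrow> \<tau> x 0 = 0"
    "x \<in> U \<Longrightarrow> v \<in> fibre B x \<Longrightarrow> w \<in> fibre B x \<Longrightarrow> \<tau> x v = \<tau> x w \<longleftrightarrow> v = w"
proof -
  have t: "is_triv B (U, \<tau>)" using assms smooth unfolding smooth_bundle_def by blast
  then show "open U" and bij: "x \<in> U \<Longrightarrow> bij_betw (\<tau> x) (fibre B x) UNIV"
    and add: "\<And>v w. x \<in> U \<Longrightarrow> v \<in> fibre B x \<Longrightarrow> w \<in> fibre B x \<Longrightarrow> \<tau> x (v + w) = \<tau> x v + \<tau> x w"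
    and scl: "\<And>v c. x \<in> U \<Longrightarrow> v \<in> fibre B x \<Longrightarrow> \<tau> x (vscale B c v) = c *s \<tau> x v" for x
    by (auto simp: is_triv_def)
  show "x \<in> U \<Longrightarrow> \<tau> x 0 = 0" using add[of x 0 0] by simp
  show "x \<in> U \<Longrightarrow> v \<in> fibre B x \<Longrightarrow> w \<in> fibre B x \<Longrightarrow> \<tau> x (v - w) = \<tau> x v - \<tau> x w"
    using add[of x "v - w" w] by simp
  show "x \<in> U \<Longrightarrow> v \<in> fibre B x \<Longrightarrow> w \<in> fibre B x \<Longrightarrow> \<tau> x v = \<tau> x w \<longleftrightarrow> v = w"
    using bij by (auto simp: bij_betw_def dest: inj_onD)
qed

lemma triv_inv:
  assumes "(U, \<tau>) \<in> trivs B" "x \<in> U"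
  shows "inv_into (fibre B x) (\<tau> x) y \<in> fibre B x" "\<tau> x (inv_into (fibre B x) (\<tau> x) y) = y"
  using trivD(2)[OF assms] by (auto simp: bij_betw_def intro: inv_into_into f_inv_into_f)

lemma frame_in: "(U, \<tau>) \<in> trivs B \<Longrightarrow> x \<in> U \<Longrightarrow> frame B \<tau> i x \<in> fibre B x"
  and triv_frame: "(U, \<tau>) \<in> trivs B \<Longrightarrow> x \<in> U \<Longrightarrow> \<tau> x (frame B \<tau> i x) = axis i 1"
  by (simp_all add: frame_def triv_inv)

lemma fibre_sum: "(\<And>i. i \<in> I \<Longrightarrow> f i \<in> fibre B x) \<Longrightarrow> sum f I \<in> fibre B x"
  by (induction I rule: infinite_finite_induct) auto

lemma triv_sum:
  assumes "(U, \<tau>) \<in> trivs B" "x \<in> U" "\<And>i. i \<in> I \<Longrightarrow> f i \<in> fibre B x"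
  shows "\<tau> x (sum f I) = (\<Sum>i\<in>I. \<tau> x (f i))"
  using assms(3)
  by (induction I rule: infinite_finite_induct)
     (auto simp: trivD(3,6)[OF assms(1,2)] fibre_sum)

lemma frame_expansion:
  assumes t: "(U, \<tau>) \<in> trivs B" "x \<in> U" and v: "v \<in> fibre B x"
  shows "v = (\<Sum>i\<in>UNIV. vscale B (\<tau> x v $ i) (frame B \<tau> i x))"
proof -
  have "\<tau> x (\<Sum>i\<in>UNIV. vscale B (\<tau> x v $ i) (frame B \<tau> i x)) = (\<Sum>i\<in>UNIV. (\<tau> x v $ i) *s axis i 1)"
    using t by (simp add: triv_sum trivD(4) frame_in triv_frame)
  also have "\<dots> = \<tau> x v" by (rule basis_expansion)
  finally show ?thesis
    using trivD(7)[OF t v fibre_sum[where I = UNIV and f = "\<lambda>i. vscale B (\<tau> x v $ i) (frame B \<tau> i x)"]] frame_in[OF t] by simp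
qed

text \<open>Measurability and statements valid almost everywhere can be glued only over countably
  many pieces; second countability supplies them.\<close>

lemma countable_trivs: obtains T where "T \<subseteq> trivs B" "countable T" "\<Union>(fst ` T) = UNIV"
proof -
  have op: "\<And>U. U \<in> fst ` trivs B \<Longrightarrow> open U" using trivD(1) by auto
  obtain C where C: "C \<subseteq> fst ` trivs B" "countable C" "\<Union>C = \<Union>(fst ` trivs B)"
    by (rule Lindelof[OF op]) auto
  obtain T where T: "T \<subseteq> trivs B" "countable T" "C = fst ` T"
    using countable_subset_image[THEN iffD1, OF conjI[OF C(2,1)]] by blast
  have "\<Union>(fst ` trivs B) = UNIV" using smooth by (simp add: smooth_bundle_def)
  then show thesis using that[OF T(1,2)] C(3) T(3) by simp
qed

section \<open>Fibres as finite-dimensional inner product spaces\<close>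

lemma hermitian_form_simps:
  assumes h: "hermitian_form B x b"
  shows "u \<in> fibre B x \<Longrightarrow> v \<in> fibre B x \<Longrightarrow> w \<in> fibre B x \<Longrightarrow> b (u + v) w = b u w + b v w"
    and "u \<in> fibre B x \<Longrightarrow> w \<in> fibre B x \<Longrightarrow> b (vscale B c u) w = c * b u w"
    and "u \<in> fibre B x \<Longrightarrow> w \<in> fibre B x \<Longrightarrow> cplx (b w u) = cnj (cplx (b u w))"
    and "w \<in> fibre B x \<Longrightarrow> b 0 w = 0" and "w \<in> fibre B x \<Longrightarrow> b w 0 = 0"
    and "u \<in> fibre B x \<Longrightarrow> w \<in> fibre B x \<Longrightarrow> b (- u) w = - b u w"
    and "u \<in> fibre B x \<Longrightarrow> v \<in> fibre B x \<Longrightarrow> w \<in> fibre B x \<Longrightarrow> cplx (b w (u + v)) = cplx (b w u) + cplx (b w v)"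
    and "u \<in> fibre B x \<Longrightarrow> w \<in> fibre B x \<Longrightarrow> cplx (b w (vscale B c u)) = cnj (cplx c) * cplx (b w u)"
proof -
  show add: "u \<in> fibre B x \<Longrightarrow> v \<in> fibre B x \<Longrightarrow> w \<in> fibre B x \<Longrightarrow> b (u + v) w = b u w + b v w"
    and scl: "u \<in> fibre B x \<Longrightarrow> w \<in> fibre B x \<Longrightarrow> b (vscale B c u) w = c * b u w"
    and cnj: "u \<in> fibre B x \<Longrightarrow> w \<in> fibre B x \<Longrightarrow> cplx (b w u) = cnj (cplx (b u w))" for u v w c
    using h unfolding hermitian_form_def by blast+
  show z: "w \<in> fibre B x \<Longrightarrow> b 0 w = 0" using add[of 0 0 w] by simp
  then show "w \<in> fibre B x \<Longrightarrow> b w 0 = 0" using cnj[of 0 w] by simp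
  show "u \<in> fibre B x \<Longrightarrow> w \<in> fibre B x \<Longrightarrow> b (- u) w = - b u w" using scl[of u w "-1"] by simp
  show "u \<in> fibre B x \<Longrightarrow> v \<in> fibre B x \<Longrightarrow> w \<in> fibre B x \<Longrightarrow> cplx (b w (u + v)) = cplx (b w u) + cplx (b w v)"
    using cnj[of "u + v" w] cnj[of u w] cnj[of v w] add[of u v w] by (simp add: cplx_add)
  show "u \<in> fibre B x \<Longrightarrow> w \<in> fibre B x \<Longrightarrow> cplx (b w (vscale B c u)) = cnj (cplx c) * cplx (b w u)"
    using cnj[of "vscale B c u" w] cnj[of u w] scl[of u w c] by (simp add: cplx_mult)
qed

text \<open>A rough metric is Hermitian at every point but comparable with a smooth metric only
  almost everywhere, so positivity is a condition on the point.\<close>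

definition posdef :: "('m \<Rightarrow> 'v \<Rightarrow> 'v \<Rightarrow> 'k) \<Rightarrow> 'm \<Rightarrow> bool" where
  "posdef h x \<longleftrightarrow> hermitian_form B x (h x) \<and> (\<forall>u\<in>fibre B x. u \<noteq> 0 \<longrightarrow> Re (cplx (h x u u)) > 0)"

text \<open>This form makes the abstract inequalities of \<open>hilb\<close> available in each
  fibre.\<close>

definition fib :: "('m \<Rightarrow> 'v \<Rightarrow> 'v \<Rightarrow> 'k) \<Rightarrow> 'm \<Rightarrow> ('k, 'v) ipspace" where
  "fib h x = \<lparr>vecs = fibre B x, zer = 0, add = (+), scl = vscale B, ip = h x\<rparr>"

lemma fib_simps [simp]: "vecs (fib h x) = fibre B x" "zer (fib h x) = 0" "add (fib h x) = (+)"
  "scl (fib h x) = vscale B" "ip (fib h x) = h x" "sub (fib h x) u v = u - v" "nrm (fib h x) u = fibre_norm h x u"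
  by (simp_all add: fib_def sub_def nrm_def fibre_norm_def)

text \<open>In a trivialisation the squared norm is a continuous real quadratic form. Its extreme
  values on the compact unit sphere are positive, and their square roots are the constants. They
  depend on the point x.\<close>

lemma fibre_norm_equiv:
  assumes p: "posdef h x" and t: "(U, \<tau>) \<in> trivs B" "x \<in> U"
  obtains c C where "c > 0" "C > 0" "\<And>v. v \<in> fibre B x \<Longrightarrow> c * norm (\<tau> x v) \<le> fibre_norm h x v"
    "\<And>v. v \<in> fibre B x \<Longrightarrow> fibre_norm h x v \<le> C * norm (\<tau> x v)"
proof -
  have hf: "hermitian_form B x (h x)" using p by (simp add: posdef_def)
  note hs = hermitian_form_simps[OF hf]
  define \<sigma> where "\<sigma> y = inv_into (fibre B x) (\<tau> x) y" for y
  have \<sigma>_in: "\<sigma> y \<in> fibre B x" and \<tau>\<sigma>: "\<tau> x (\<sigma> y) = y" for y using triv_inv[OF t] by (simp_all add: \<sigma>_def)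
  have \<sigma>I: "v = \<sigma> y" if "v \<in> fibre B x" "\<tau> x v = y" for v y
    by (rule trivD(7)[OF t that(1) \<sigma>_in, THEN iffD1]) (simp add: that(2) \<tau>\<sigma>)
  have \<sigma>_add: "\<sigma> (y + z) = \<sigma> y + \<sigma> z" for y z
    by (rule \<sigma>I[symmetric]) (use \<sigma>_in in \<open>simp_all add: trivD(3)[OF t] \<tau>\<sigma>\<close>)
  have sc: "of_real r *s y = r *\<^sub>R y" for r and y :: "'k^'r"
    by (simp add: vec_eq_iff scaleR_conv_of_real[where 'a = 'k])
  have \<sigma>_scl: "\<sigma> (r *\<^sub>R y) = vscale B (of_real r) (\<sigma> y)" for y r
    by (rule \<sigma>I[symmetric]) (use \<sigma>_in in \<open>simp_all add: trivD(4)[OF t] \<tau>\<sigma> sc\<close>)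
  define b where "b y z = Re (cplx (h x (\<sigma> y) (\<sigma> z)))" for y z
  \<comment> \<open>Only real linearity is claimed, and for real factors the conjugation in the
    second slot disappears.\<close>
  have "bilinear b" unfolding bilinear_def
    by (intro conjI allI linearI) (use \<sigma>_in in \<open>simp_all add: b_def \<sigma>_add \<sigma>_scl hs(1,2,7,8) cplx_add cplx_mult\<close>)
  then have bb: "bounded_bilinear b" by (simp add: bilinear_conv_bounded_bilinear)
  have cont: "continuous_on S (\<lambda>y. b y y)" for S
    by (rule bounded_bilinear.continuous_on[OF bb]) auto
  have cpt: "compact (sphere (0 :: 'k^'r) 1)" by simp
  have ne: "sphere (0 :: 'k^'r) 1 \<noteq> {}" by simp
  obtain y0 where y0: "norm y0 = 1" "\<And>y. norm y = 1 \<Longrightarrow> b y0 y0 \<le> b y y"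
    using continuous_attains_inf[OF cpt ne cont] by auto
  obtain y1 where y1: "norm y1 = 1" "\<And>y. norm y = 1 \<Longrightarrow> b y y \<le> b y1 y1"
    using continuous_attains_sup[OF cpt ne cont] by auto
  have "\<sigma> y0 \<noteq> 0" using y0(1) \<tau>\<sigma>[of y0] trivD(6)[OF t] by auto
  then have pos: "b y0 y0 > 0" using p \<sigma>_in by (simp add: posdef_def b_def)
  have pos1: "b y1 y1 > 0" using y0(2)[OF y1(1)] pos by simp
  have sq: "b y0 y0 * (norm y)\<^sup>2 \<le> b y y \<and> b y y \<le> b y1 y1 * (norm y)\<^sup>2" for y
  proof (cases "y = 0")
    case True
    then show ?thesis using bounded_bilinear.zero_left[OF bb] by simp
  next
    case False
    let ?s = "y /\<^sub>R norm y"
    have n: "norm ?s = 1" using False by simp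
    have "b y y = b (norm y *\<^sub>R ?s) (norm y *\<^sub>R ?s)" using False by simp
    also have "\<dots> = (norm y)\<^sup>2 * b ?s ?s"
      by (simp add: bounded_bilinear.scaleR_left[OF bb] bounded_bilinear.scaleR_right[OF bb] power2_eq_square)
    finally show ?thesis
      using mult_right_mono[OF y0(2)[OF n], of "(norm y)\<^sup>2"] mult_right_mono[OF y1(2)[OF n], of "(norm y)\<^sup>2"]
      by (simp add: mult.commute)
  qed
  have nb: "fibre_norm h x v = sqrt (b (\<tau> x v) (\<tau> x v))" if "v \<in> fibre B x" for v
    using \<sigma>I[OF that refl] by (simp add: b_def fibre_norm_def)
  show thesis
  proof
    show "sqrt (b y0 y0) > 0" "sqrt (b y1 y1) > 0" using pos pos1 by auto
    fix v assume v: "v \<in> fibre B x"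
    have "sqrt (b y0 y0 * (norm (\<tau> x v))\<^sup>2) \<le> fibre_norm h x v"
      "fibre_norm h x v \<le> sqrt (b y1 y1 * (norm (\<tau> x v))\<^sup>2)"
      unfolding nb[OF v] using sq by (simp_all del: real_sqrt_mult)
    then show "sqrt (b y0 y0) * norm (\<tau> x v) \<le> fibre_norm h x v"
      "fibre_norm h x v \<le> sqrt (b y1 y1) * norm (\<tau> x v)" by (simp_all add: real_sqrt_mult)
  qed
qed

lemma ex_triv: obtains U \<tau> where "(U, \<tau>) \<in> trivs B" "x \<in> U"
proof -
  have "x \<in> \<Union>(fst ` trivs B)" using smooth by (simp add: smooth_bundle_def)
  then show thesis using that by auto
qed

lemma fibre_tends_iff:
  assumes p: "posdef h x" and t: "(U, \<tau>) \<in> trivs B" "x \<in> U"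
    and s: "\<And>n. s n \<in> fibre B x" and u: "u \<in> fibre B x"
  shows "(\<lambda>n. fibre_norm h x (s n - u)) \<longlonglongrightarrow> 0 \<longleftrightarrow> (\<lambda>n. \<tau> x (s n)) \<longlonglongrightarrow> \<tau> x u"
proof -
  obtain c C where cC: "c > 0" "C > 0" "\<And>v. v \<in> fibre B x \<Longrightarrow> c * norm (\<tau> x v) \<le> fibre_norm h x v"
    "\<And>v. v \<in> fibre B x \<Longrightarrow> fibre_norm h x v \<le> C * norm (\<tau> x v)" by (rule fibre_norm_equiv[OF p t]) blast
  have d: "\<tau> x (s n - u) = \<tau> x (s n) - \<tau> x u" "s n - u \<in> fibre B x" for n
    using s u by (simp_all add: trivD(5)[OF t])
  have b: "c * norm (\<tau> x (s n) - \<tau> x u) \<le> fibre_norm h x (s n - u)"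
    "fibre_norm h x (s n - u) \<le> C * norm (\<tau> x (s n) - \<tau> x u)" for n
    using cC(3,4)[OF d(2)] by (simp_all add: d(1))
  have "0 \<le> c * norm (\<tau> x (s n) - \<tau> x u)" for n using cC(1) by simp
  then have nn: "0 \<le> fibre_norm h x (s n - u)" for n using b(1) order_trans by blast
  have "(\<lambda>n. fibre_norm h x (s n - u)) \<longlonglongrightarrow> 0 \<longleftrightarrow> (\<lambda>n. norm (\<tau> x (s n) - \<tau> x u)) \<longlonglongrightarrow> 0"
  proof
    assume l: "(\<lambda>n. fibre_norm h x (s n - u)) \<longlonglongrightarrow> 0"
    have "norm (norm (\<tau> x (s n) - \<tau> x u)) \<le> inverse c * fibre_norm h x (s n - u)" for n
      using b(1)[of n] cC(1) by (simp add: field_simps)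
    moreover have "(\<lambda>n. inverse c * fibre_norm h x (s n - u)) \<longlonglongrightarrow> 0"
      using tendsto_mult_left[OF l, of "inverse c"] by simp
    ultimately show "(\<lambda>n. norm (\<tau> x (s n) - \<tau> x u)) \<longlonglongrightarrow> 0"
      by (metis (mono_tags, lifting) Lim_null_comparison always_eventually)
  next
    assume l: "(\<lambda>n. norm (\<tau> x (s n) - \<tau> x u)) \<longlonglongrightarrow> 0"
    have "norm (fibre_norm h x (s n - u)) \<le> C * norm (\<tau> x (s n) - \<tau> x u)" for n
      using b(2)[of n] nn by simp
    moreover have "(\<lambda>n. C * norm (\<tau> x (s n) - \<tau> x u)) \<longlonglongrightarrow> 0"
      using tendsto_mult_left[OF l, of C] by simp
    ultimately show "(\<lambda>n. fibre_norm h x (s n - u)) \<longlonglongrightarrow> 0"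
      by (metis (mono_tags, lifting) Lim_null_comparison always_eventually)
  qed
  then show ?thesis by (simp add: tendsto_norm_zero_iff LIM_zero_iff)
qed

lemma hilb_fib: assumes p: "posdef h x" shows "hilb (fib h x)"
proof -
  have hf: "hermitian_form B x (h x)" using p by (simp add: posdef_def)
  note hs = hermitian_form_simps[OF hf]
  obtain U \<tau> where t: "(U, \<tau>) \<in> trivs B" "x \<in> U" by (rule ex_triv)
  obtain c C where cC: "c > 0" "C > 0" "\<And>v. v \<in> fibre B x \<Longrightarrow> c * norm (\<tau> x v) \<le> fibre_norm h x v"
    "\<And>v. v \<in> fibre B x \<Longrightarrow> fibre_norm h x v \<le> C * norm (\<tau> x v)" by (rule fibre_norm_equiv[OF p t]) blast
  show ?thesis
  proof
    show "cplx (ip (fib h x) v u) = cnj (cplx (ip (fib h x) u v))" if "u \<in> vecs (fib h x)" "v \<in> vecs (fib h x)" for u v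
      using that unfolding fib_simps by (intro hs(3))
    show "0 \<le> rip (fib h x) u u" if "u \<in> vecs (fib h x)" for u
      using that p hs(4)[of u] by (cases "u = 0") (auto simp: rip_def posdef_def less_imp_le)
    show "u = v" if "u \<in> vecs (fib h x)" "v \<in> vecs (fib h x)" "nrm (fib h x) (sub (fib h x) u v) = 0" for u v
      using that p by (cases "u - v = 0") (auto simp: posdef_def fibre_norm_def dest: bspec[of _ _ "u - v"])
    show "\<exists>u\<in>vecs (fib h x). tends (fib h x) s u" if s: "\<And>n. s n \<in> vecs (fib h x)"
      and cau: "\<And>e. e > 0 \<Longrightarrow> \<exists>N. \<forall>m\<ge>N. \<forall>n\<ge>N. nrm (fib h x) (sub (fib h x) (s m) (s n)) < e" for s
    proof -
      have "Cauchy (\<lambda>n. \<tau> x (s n))"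
      proof (rule CauchyI)
        fix e :: real assume "e > 0"
        then obtain N where N: "\<forall>m\<ge>N. \<forall>n\<ge>N. fibre_norm h x (s m - s n) < c * e"
          using cau[of "c * e"] cC(1) by auto
        have "norm (\<tau> x (s m) - \<tau> x (s n)) < e" if "m \<ge> N" "n \<ge> N" for m n
        proof -
          have "c * norm (\<tau> x (s m - s n)) < c * e" using cC(3)[of "s m - s n"] N that s by force
          then show ?thesis using cC(1) s by (simp add: trivD(5)[OF t])
        qed
        then show "\<exists>M. \<forall>m\<ge>M. \<forall>n\<ge>M. norm (\<tau> x (s m) - \<tau> x (s n)) < e" by blast
      qed
      then obtain y where "(\<lambda>n. \<tau> x (s n)) \<longlonglongrightarrow> y" using Cauchy_convergent convergent_def by blast
      then have "(\<lambda>n. fibre_norm h x (s n - inv_into (fibre B x) (\<tau> x) y)) \<longlonglongrightarrow> 0"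
        using fibre_tends_iff[OF p t _ triv_inv(1)[OF t], of s y] s triv_inv(2)[OF t] by simp
      then show ?thesis using triv_inv(1)[OF t] by (auto simp: tends_def)
    qed
  qed (use hs(1,2,4) in auto)
qed

end


lemma ex_kcnj:
  fixes z :: "'k::real_or_complex"
  shows "\<exists>w::'k. cplx w = cnj (cplx z)"
proof (cases "surj (cplx :: 'k \<Rightarrow> complex)")
  case True
  then show ?thesis by (metis surjD)
next
  case False
  then show ?thesis using cplx_real_or_surj[OF False, of z] by (intro exI[of _ z]) (simp add: complex_eq_iff)
qed

text \<open>The image of the scalars is the real line or the whole plane, so conjugation exists
  inside \<open>'k\<close>. It is needed as a measurable map there to treat the conjugate-linear
  slot of a metric.\<close>

definition kcnj :: "'k::real_or_complex \<Rightarrow> 'k" where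
  "kcnj z = (SOME w. cplx w = cnj (cplx z))"

lemma cplx_kcnj [simp]: "cplx (kcnj z) = cnj (cplx z)"
  unfolding kcnj_def by (rule someI_ex[OF ex_kcnj])

lemma continuous_on_isometry:
  fixes f :: "'a::real_normed_vector \<Rightarrow> 'b::real_normed_vector"
  assumes "\<And>x y. norm (f x - f y) = norm (x - y)"
  shows "continuous_on S f"
  unfolding continuous_on_iff dist_norm assms by blast

lemma kcnj_measurable [measurable]: "(kcnj :: 'k::real_or_complex \<Rightarrow> 'k) \<in> borel_measurable borel"
proof (intro borel_measurable_continuous_onI continuous_on_isometry)
  fix x y :: 'k
  have "norm (cplx (kcnj x - kcnj y)) = norm (cplx (x - y))"
    by (simp add: cplx_diff flip: complex_cnj_diff)
  then show "norm (kcnj x - kcnj y) = norm (x - y)" by (simp only: norm_cplx)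
qed

lemma cplx_measurable [measurable]: "(cplx :: 'k::real_or_complex \<Rightarrow> complex) \<in> borel_measurable borel"
  by (intro borel_measurable_continuous_onI continuous_on_isometry) (simp flip: cplx_diff add: norm_cplx)

section \<open>Measure space and measurable sections of a pair\<close>

locale l2_bundle = vec_bundle B
  for B :: "('m::{t2_space, second_countable_topology}, 'n::finite, 'k::real_or_complex,
                'r::finite, 'v::ab_group_add) vbundle" +
  fixes \<mu> :: "'m set \<Rightarrow> ennreal" and h :: "'m \<Rightarrow> 'v \<Rightarrow> 'v \<Rightarrow> 'k"
  assumes lecm: "LECM (atlas B) \<mu>" and rhm: "RHM B h"
begin

abbreviation "M \<equiv> cara \<mu>"

lemma measure_space_MeasO: "measure_space UNIV (MeasO \<mu>) \<mu>"
proof -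
  have "outer_measure_space UNIV \<mu>" using lecm by (simp add: LECM_def radon_outer_def)
  then show ?thesis
    using sigma_algebra.caratheodory_lemma[OF sigma_algebra_Pow, of UNIV \<mu>] by (simp add: MeasO_def)
qed

lemma space_M [simp]: "space M = UNIV"
  by (simp add: cara_def space_measure_of_conv)

lemma sets_M: "sets M = MeasO \<mu>"
  using measure_space_MeasO sigma_algebra.sets_measure_of_eq[of UNIV "MeasO \<mu>" \<mu>]
  by (simp add: cara_def measure_space_def)

lemma sets_M_Meas: "sets M = Meas (atlas B)"
  using lecm by (simp add: sets_M LECM_def)

lemma emeasure_M: "A \<in> sets M \<Longrightarrow> emeasure M A = \<mu> A"
proof -
  assume A: "A \<in> sets M"
  show ?thesis unfolding cara_def
  proof (rule emeasure_measure_of_sigma)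
    show "sigma_algebra UNIV (MeasO \<mu>)" "positive (MeasO \<mu>) \<mu>" "countably_additive (MeasO \<mu>) \<mu>"
      using measure_space_MeasO by (simp_all add: measure_space_def)
    show "A \<in> MeasO \<mu>" using A by (simp add: sets_M)
  qed
qed

lemma null_sets_M: "null_sets M = Zero (atlas B)"
proof -
  have "Zero (atlas B) \<subseteq> Meas (atlas B)" by (auto simp: Zero_def Meas_def null_sets_def)
  then have "Zero (atlas B) \<subseteq> sets M" by (simp add: sets_M_Meas)
  moreover have "\<mu> A = 0 \<longleftrightarrow> A \<in> Zero (atlas B)" for A using lecm by (auto simp: LECM_def ZeroO_def)
  ultimately show ?thesis by (auto simp: null_sets_def emeasure_M)
qed

text \<open>The null sets are exactly the sets of outer measure 0, and the outer measure is
  monotone. This completeness lets sections be changed on null sets without losing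
  measurability.\<close>

lemma null_sets_M_subset: "N \<in> null_sets M \<Longrightarrow> N' \<subseteq> N \<Longrightarrow> N' \<in> null_sets M"
proof -
  assume N: "N \<in> null_sets M" "N' \<subseteq> N"
  have eq: "A \<in> null_sets M \<longleftrightarrow> \<mu> A = 0" for A
    using lecm by (auto simp: null_sets_M LECM_def ZeroO_def)
  have "increasing UNIV \<mu>" using lecm by (simp add: LECM_def radon_outer_def outer_measure_space_def)
  then have "\<mu> N' \<le> \<mu> N" using N(2) by (simp add: increasing_def)
  then show ?thesis using N(1) by (simp add: eq)
qed

lemma ae_iff: "ae (atlas B) P \<longleftrightarrow> (AE x in M. P x)"
proof
  assume "ae (atlas B) P"
  then show "AE x in M. P x" by (intro AE_I'[of "{x. \<not> P x}"]) (auto simp: ae_def null_sets_M)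
next
  assume "AE x in M. P x"
  then obtain N where "{x \<in> space M. \<not> P x} \<subseteq> N" "N \<in> null_sets M" by (auto simp: eventually_ae_filter)
  then show "ae (atlas B) P" using null_sets_M_subset by (auto simp: ae_def null_sets_M)
qed

lemma borel_sets_M: "A \<in> sets borel \<Longrightarrow> A \<in> sets M"
  using lecm by (auto simp: LECM_def radon_outer_def sets_M)

lemma open_sets_M: "open A \<Longrightarrow> A \<in> sets M"
  by (intro borel_sets_M) simp

lemma sets_meas_space: "sets (meas_space (atlas B)) = sets M"
  using sets.sigma_sets_eq[of M] by (simp add: meas_space_def flip: sets_M_Meas)

lemma L0_iff: "u \<in> L0 B \<longleftrightarrow> (\<forall>x. u x \<in> fibre B x) \<and>
   (\<forall>(U, \<tau>)\<in>trivs B. \<forall>i. (\<lambda>x. \<tau> x (u x) $ i) \<in> borel_measurable (restrict_space M U))"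
proof -
  have "sets (restrict_space (meas_space (atlas B)) U) = sets (restrict_space M U)" for U
    by (intro sets_restrict_space_cong sets_meas_space)
  then have "borel_measurable (restrict_space (meas_space (atlas B)) U)
      = (borel_measurable (restrict_space M U) :: ('m \<Rightarrow> 'k) set)" for U
    by (intro measurable_cong_sets) auto
  then show ?thesis by (simp add: L0_def)
qed

lemma L0_fibre: "u \<in> L0 B \<Longrightarrow> u x \<in> fibre B x"
  by (simp add: L0_iff)

lemma L0_triv: "u \<in> L0 B \<Longrightarrow> (U, \<tau>) \<in> trivs B \<Longrightarrow> (\<lambda>x. \<tau> x (u x) $ i) \<in> borel_measurable (restrict_space M U)"
  by (auto simp: L0_iff)

lemma measurable_AE_cong:
  fixes f g :: "'m \<Rightarrow> 'b::topological_space"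
  assumes f: "f \<in> borel_measurable M" and fg: "AE x in M. f x = g x"
  shows "g \<in> borel_measurable M"
proof (rule measurableI)
  fix S :: "'b set" assume S: "S \<in> sets borel"
  have N: "{x. f x \<noteq> g x} \<in> null_sets M"
    using fg by (simp add: null_sets_M ae_def flip: ae_iff)
  have "g -` S \<inter> space M = (f -` S \<inter> space M - {x. f x \<noteq> g x}) \<union> (g -` S \<inter> {x. f x \<noteq> g x})" by auto
  moreover have "f -` S \<inter> space M - {x. f x \<noteq> g x} \<in> sets M"
    using measurable_sets[OF f S] N by auto
  moreover have "g -` S \<inter> {x. f x \<noteq> g x} \<in> sets M" by (rule null_setsD2[OF null_sets_M_subset[OF N]]) blast
  ultimately show "g -` S \<inter> space M \<in> sets M" by (simp only: sets.Un)
qed simp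

lemma measurable_restrict_AE_cong:
  fixes f g :: "'m \<Rightarrow> 'b::real_normed_vector"
  assumes U: "open U" and f: "f \<in> borel_measurable (restrict_space M U)"
    and fg: "AE x in M. x \<in> U \<longrightarrow> f x = g x"
  shows "g \<in> borel_measurable (restrict_space M U)"
proof -
  have Us: "U \<inter> space M \<in> sets M" using open_sets_M[OF U] by simp
  have "(\<lambda>x. indicator U x *\<^sub>R g x) \<in> borel_measurable M"
    by (rule measurable_AE_cong[OF f[unfolded borel_measurable_restrict_space_iff[OF Us]]])
       (use fg in \<open>auto simp: indicator_def elim: eventually_mono\<close>)
  then show ?thesis by (simp add: borel_measurable_restrict_space_iff[OF Us])
qed

lemma measurable_from_trivs:
  assumes "\<And>U \<tau>. (U, \<tau>) \<in> trivs B \<Longrightarrow> f \<in> measurable (restrict_space M U) N"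
  shows "f \<in> measurable M N"
proof -
  obtain T where T: "T \<subseteq> trivs B" "countable T" "\<Union>(fst ` T) = UNIV" by (rule countable_trivs)
  show ?thesis
  proof (rule measurable_piecewise_restrict[of "fst ` T"])
    show "\<And>\<Omega>. \<Omega> \<in> fst ` T \<Longrightarrow> \<Omega> \<inter> space M \<in> sets M"
      using T(1) trivD(1) open_sets_M by fastforce
  qed (use T assms in auto)
qed

text \<open>Near each point the comparison with a smooth metric forces positivity off a null set;
  the Lindelof property reduces the union of these exceptional sets to a countable one.\<close>

lemma AE_posdef: "AE x in M. posdef h x"
proof -
  have "\<forall>p. \<exists>U. open U \<and> p \<in> U \<and> (AE x in M. x \<in> U \<longrightarrow> posdef h x)"
  proof
    fix p
    obtain U g C where U: "open U" "p \<in> U" "smooth_hermitian_metric_on B U g" "C \<ge> 1"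
      and ae: "ae (atlas B) (\<lambda>x. x \<in> U \<longrightarrow> (\<forall>u\<in>fibre B x.
          fibre_norm g x u / C \<le> fibre_norm h x u \<and> fibre_norm h x u \<le> C * fibre_norm g x u))"
      using rhm unfolding RHM_def by blast
    have "posdef h x" if x: "x \<in> U" and le: "\<forall>u\<in>fibre B x. fibre_norm g x u / C \<le> fibre_norm h x u" for x
      unfolding posdef_def
    proof (intro conjI ballI impI)
      show "hermitian_form B x (h x)" using rhm by (simp add: RHM_def)
      fix u assume u: "u \<in> fibre B x" "u \<noteq> 0"
      then have "Re (cplx (g x u u)) > 0" using U(3) x by (simp add: smooth_hermitian_metric_on_def)
      then have "fibre_norm g x u / C > 0" using U(4) by (simp add: fibre_norm_def)
      then have "fibre_norm h x u > 0" using le u(1) by fastforce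
      then show "Re (cplx (h x u u)) > 0" by (simp add: fibre_norm_def)
    qed
    then have "AE x in M. x \<in> U \<longrightarrow> posdef h x"
      using ae unfolding ae_iff by (auto elim!: eventually_mono)
    then show "\<exists>U. open U \<and> p \<in> U \<and> (AE x in M. x \<in> U \<longrightarrow> posdef h x)" using U(1,2) by blast
  qed
  then obtain U where U: "\<And>p. open (U p)" "\<And>p. p \<in> U p" "\<And>p. AE x in M. x \<in> U p \<longrightarrow> posdef h x" by metis
  obtain C where C: "C \<subseteq> range U" "countable C" "\<Union>C = \<Union>(range U)"
    by (rule Lindelof[of "range U"]) (use U(1) in auto)
  have "AE x in M. \<forall>W\<in>C. x \<in> W \<longrightarrow> posdef h x"
    by (rule AE_ball_countable[OF C(2), THEN iffD2]) (use C(1) U(3) in auto)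
  moreover have "x \<in> \<Union>C" for x unfolding C(3) by (rule UnionI[OF rangeI[of U x] U(2)])
  ultimately show ?thesis by (auto elim!: eventually_mono)
qed

text \<open>A chart provides a neighbourhood contained in a compact set, and a Radon measure is
  finite on compact sets. With the Lindelof property this yields \<sigma>-finiteness, which the
  Radon-Nikodym derivative requires.\<close>

lemma ex_finite_nbhd: "\<exists>W. open W \<and> p \<in> W \<and> emeasure M W < \<infinity>"
proof -
  have ss: "smooth_structure (atlas B)" using smooth by (simp add: smooth_bundle_def)
  then have "p \<in> \<Union>(fst ` atlas B)" by (simp add: smooth_structure_def)
  then obtain U \<psi> where c: "(U, \<psi>) \<in> atlas B" "p \<in> U" by auto
  then have "is_chart (U, \<psi>)" using ss unfolding smooth_structure_def by blast
  then obtain g where U: "open U" and g: "homeomorphism U (\<psi> ` U) \<psi> g"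
    and or: "open (\<psi> ` U) \<or> (\<exists>i. openin (top_of_set {y. 0 \<le> y $ i}) (\<psi> ` U))"
    by (auto simp: is_chart_def)
  \<comment> \<open>Interior and boundary charts are treated together: in both cases the image is a
    closed set intersected with an open one, so a small closed ball meets it in a compact
    set.\<close>
  obtain T O' where TO: "closed T" "open O'" "\<psi> ` U = T \<inter> O'"
  proof (cases "open (\<psi> ` U)")
    case True
    then show ?thesis using that[of UNIV "\<psi> ` U"] by simp
  next
    case False
    then obtain i where i: "openin (top_of_set {y. 0 \<le> y $ i}) (\<psi> ` U)" using or by blast
    then obtain O' where "open O'" "\<psi> ` U = {y. 0 \<le> y $ i} \<inter> O'" by (auto simp: openin_open)
    moreover have "closed {y :: real^'n. 0 \<le> y $ i}" by (rule closed_Collect_le) (auto intro: continuous_intros)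
    ultimately show ?thesis using that by blast
  qed
  have "\<psi> p \<in> O'" using TO(3) c(2) by blast
  then obtain e where e: "e > 0" "cball (\<psi> p) e \<subseteq> O'" using TO(2) open_contains_cball by blast
  have K: "compact (cball (\<psi> p) e \<inter> T)" using TO(1) by (intro compact_Int_closed) auto
  have "cball (\<psi> p) e \<inter> T \<subseteq> \<psi> ` U" using TO(3) e(2) by auto
  then have gK: "compact (g ` (cball (\<psi> p) e \<inter> T))"
    using K g by (meson compact_continuous_image continuous_on_subset homeomorphism_cont2)
  define W where "W = U \<inter> \<psi> -` ball (\<psi> p) e"
  have W: "open W" unfolding W_def
    using continuous_open_preimage[OF homeomorphism_cont1[OF g] U, of "ball (\<psi> p) e"] by simp
  have "W \<subseteq> g ` (cball (\<psi> p) e \<inter> T)"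
  proof
    fix x assume x: "x \<in> W"
    then have "x = g (\<psi> x)" using homeomorphism_apply1[OF g] by (simp add: W_def)
    moreover have "\<psi> x \<in> cball (\<psi> p) e \<inter> T" using x TO(3) by (auto simp: W_def)
    ultimately show "x \<in> g ` (cball (\<psi> p) e \<inter> T)" by blast
  qed
  then have "emeasure M W \<le> emeasure M (g ` (cball (\<psi> p) e \<inter> T))"
    by (intro emeasure_mono borel_sets_M borel_compact gK)
  also have "\<dots> = \<mu> (g ` (cball (\<psi> p) e \<inter> T))" by (intro emeasure_M borel_sets_M borel_compact gK)
  also have "\<dots> < \<infinity>" using lecm gK by (simp add: LECM_def radon_outer_def)
  finally show ?thesis using W c(2) e(1) by (intro exI[of _ W]) (auto simp: W_def)
qed

lemma sigma_finite_M: "sigma_finite_measure M"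
proof
  obtain W where W: "\<And>p. open (W p)" "\<And>p. p \<in> W p" "\<And>p. emeasure M (W p) < \<infinity>" using ex_finite_nbhd by metis
  obtain C where C: "C \<subseteq> range W" "countable C" "\<Union>C = \<Union>(range W)"
    by (rule Lindelof[of "range W"]) (use W(1) in auto)
  have "\<Union>C = UNIV" using C(3) W(2) by blast
  moreover have "a \<in> sets M \<and> emeasure M a \<noteq> \<infinity>" if a: "a \<in> C" for a
  proof -
    obtain p where "a = W p" using a C(1) by blast
    then show ?thesis using W(1,3)[of p] by (auto intro!: open_sets_M)
  qed
  ultimately show "\<exists>A. countable A \<and> A \<subseteq> sets M \<and> \<Union>A = space M \<and> (\<forall>a\<in>A. emeasure M a \<noteq> \<infinity>)"
    using C(2) by (intro exI[of _ C]) auto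
qed

lemma hermitian: "hermitian_form B x (h x)"
  using rhm by (simp add: RHM_def)

lemma hermitian_sum_left:
  assumes "\<And>i. i \<in> I \<Longrightarrow> f i \<in> fibre B x" "w \<in> fibre B x"
  shows "h x (sum f I) w = (\<Sum>i\<in>I. h x (f i) w)"
  using assms(1)
  by (induction I rule: infinite_finite_induct)
     (simp_all add: hermitian_form_simps(1,4)[OF hermitian] assms(2) fibre_sum)

lemma hermitian_frame:
  assumes t: "(U, \<tau>) \<in> trivs B" "x \<in> U" and v: "v \<in> fibre B x" and w: "w \<in> fibre B x"
  shows "h x v w = (\<Sum>i\<in>UNIV. \<tau> x v $ i * h x (frame B \<tau> i x) w)"
  by (subst frame_expansion[OF t v])
     (simp add: hermitian_sum_left frame_in[OF t] w hermitian_form_simps(2)[OF hermitian])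

lemma kcnj_hermitian: "v \<in> fibre B x \<Longrightarrow> w \<in> fibre B x \<Longrightarrow> h x v w = kcnj (h x w v)"
  by (rule cplx_inj[THEN iffD1]) (simp only: cplx_kcnj hermitian_form_simps(3)[OF hermitian, of w x v])

text \<open>The metric is measurable only through its coefficients on local frames, so both sections
  are expanded in a frame, the second one after exchanging the slots by conjugation.\<close>

lemma h_measurable:
  assumes u: "u \<in> L0 B" and v: "v \<in> L0 B"
  shows "(\<lambda>x. h x (u x) (v x)) \<in> borel_measurable M"
proof (rule measurable_from_trivs)
  fix U \<tau> assume t: "(U, \<tau>) \<in> trivs B"
  have [measurable]: "(\<lambda>x. h x (frame B \<tau> i x) (frame B \<tau> j x)) \<in> borel_measurable (restrict_space M U)" for i j
  proof -
    have "sets (restrict_space (meas_space (atlas B)) U) = sets (restrict_space M U)"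
      by (intro sets_restrict_space_cong sets_meas_space)
    then have "borel_measurable (restrict_space (meas_space (atlas B)) U)
        = (borel_measurable (restrict_space M U) :: ('m \<Rightarrow> 'k) set)"
      by (intro measurable_cong_sets) auto
    then show ?thesis using rhm t unfolding RHM_def by blast
  qed
  have [measurable]: "(\<lambda>x. \<tau> x (u x) $ i) \<in> borel_measurable (restrict_space M U)"
    "(\<lambda>x. \<tau> x (v x) $ i) \<in> borel_measurable (restrict_space M U)" for i
    using L0_triv t u v by blast+
  have eq: "h x (u x) (v x) = (\<Sum>i\<in>UNIV. \<tau> x (u x) $ i *
      kcnj (\<Sum>j\<in>UNIV. \<tau> x (v x) $ j * h x (frame B \<tau> j x) (frame B \<tau> i x)))"
    if "x \<in> space (restrict_space M U)" for x
  proof -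
    have x: "x \<in> U" using that by (simp add: space_restrict_space)
    note f = L0_fibre[OF u] L0_fibre[OF v] frame_in[OF t x]
    show ?thesis unfolding hermitian_frame[OF t x f(1,2)] kcnj_hermitian[OF f(3,2)]
      hermitian_frame[OF t x f(2,3)] ..
  qed
  show "(\<lambda>x. h x (u x) (v x)) \<in> borel_measurable (restrict_space M U)"
    by (subst measurable_cong[OF eq]) measurable
qed

lemma fibre_norm_measurable: "u \<in> L0 B \<Longrightarrow> (\<lambda>x. fibre_norm h x (u x)) \<in> borel_measurable M"
  unfolding fibre_norm_def using h_measurable[of u u] by measurable

lemma L0_zero: "(\<lambda>x. 0) \<in> L0 B"
proof -
  have "(\<lambda>x. \<tau> x 0 $ i) \<in> borel_measurable (restrict_space M U)" if t: "(U, \<tau>) \<in> trivs B" for U \<tau> i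
    by (rule measurable_cong[THEN iffD1, of _ "\<lambda>x. 0"]) (simp_all add: trivD(6)[OF t] space_restrict_space)
  then show ?thesis by (auto simp: L0_iff)
qed

lemma L0_add: assumes u: "u \<in> L0 B" and v: "v \<in> L0 B" shows "(\<lambda>x. u x + v x) \<in> L0 B"
proof -
  have "(\<lambda>x. \<tau> x (u x + v x) $ i) \<in> borel_measurable (restrict_space M U)" if t: "(U, \<tau>) \<in> trivs B" for U \<tau> i
    by (rule measurable_cong[THEN iffD1, of _ "\<lambda>x. \<tau> x (u x) $ i + \<tau> x (v x) $ i"])
       (simp_all add: trivD(3)[OF t] space_restrict_space L0_fibre u v borel_measurable_add L0_triv t)
  then show ?thesis using u v by (auto simp: L0_iff)
qed

lemma L0_scale: assumes u: "u \<in> L0 B" shows "(\<lambda>x. vscale B c (u x)) \<in> L0 B"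
proof -
  have "(\<lambda>x. \<tau> x (vscale B c (u x)) $ i) \<in> borel_measurable (restrict_space M U)" if t: "(U, \<tau>) \<in> trivs B" for U \<tau> i
    by (rule measurable_cong[THEN iffD1, of _ "\<lambda>x. c * \<tau> x (u x) $ i"])
       (simp_all add: trivD(4)[OF t] space_restrict_space L0_fibre u L0_triv t borel_measurable_times)
  then show ?thesis using u by (auto simp: L0_iff)
qed

lemma L0_diff: "u \<in> L0 B \<Longrightarrow> v \<in> L0 B \<Longrightarrow> (\<lambda>x. u x - v x) \<in> L0 B"
  using L0_add[of u "\<lambda>x. vscale B (- 1) (v x)"] L0_scale[of v "- 1"] by simp

lemma L0_AE_cong:
  assumes u: "u \<in> L0 B" and uv: "AE x in M. u x = v x" and v: "\<And>x. v x \<in> fibre B x"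
  shows "v \<in> L0 B"
proof -
  have "(\<lambda>x. \<tau> x (v x) $ i) \<in> borel_measurable (restrict_space M U)" if t: "(U, \<tau>) \<in> trivs B" for U \<tau> i
    by (rule measurable_restrict_AE_cong[OF trivD(1)[OF t] L0_triv[OF u t, of i]])
       (use uv in \<open>auto elim!: eventually_mono\<close>)
  then show ?thesis using v by (auto simp: L0_iff)
qed

lemma L0_limit:
  assumes s: "\<And>n. s n \<in> L0 B" and u: "\<And>x. u x \<in> fibre B x"
    and lim: "AE x in M. (\<lambda>n. fibre_norm h x (s n x - u x)) \<longlonglongrightarrow> 0"
  shows "u \<in> L0 B"
proof -
  have "(\<lambda>x. \<tau> x (u x) $ i) \<in> borel_measurable (restrict_space M U)" if t: "(U, \<tau>) \<in> trivs B" for U \<tau> i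
  proof -
    define G where "G = {x. (\<lambda>n. \<tau> x (s n x) $ i) \<longlonglongrightarrow> \<tau> x (u x) $ i}"
    have G: "AE x in M. x \<in> U \<longrightarrow> x \<in> G"
      using lim AE_posdef
    proof eventually_elim
      case (elim x)
      show ?case
      proof
        assume x: "x \<in> U"
        have "(\<lambda>n. \<tau> x (s n x)) \<longlonglongrightarrow> \<tau> x (u x)"
          using fibre_tends_iff[OF elim(2) t x, of "\<lambda>n. s n x" "u x"] elim(1) L0_fibre[OF s] u by simp
        then show "x \<in> G" unfolding G_def using tendsto_vec_nth by blast
      qed
    qed
    \<comment> \<open>Off the set of convergence each term is replaced by the limit itself. This
      changes it on a null set only and makes the sequence converge everywhere.\<close>
    have "(\<lambda>x. if x \<in> G then \<tau> x (s n x) $ i else \<tau> x (u x) $ i) \<in> borel_measurable (restrict_space M U)" for n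
      by (rule measurable_restrict_AE_cong[OF trivD(1)[OF t] L0_triv[OF s t, of n i]])
         (use G in \<open>auto elim!: eventually_mono\<close>)
    then show ?thesis
    proof (rule borel_measurable_LIMSEQ_metric)
      show "(\<lambda>n. if x \<in> G then \<tau> x (s n x) $ i else \<tau> x (u x) $ i) \<longlonglongrightarrow> \<tau> x (u x) $ i" for x
        by (cases "x \<in> G") (auto simp: G_def)
    qed
  qed
  then show ?thesis using u by (auto simp: L0_iff)
qed

end


text \<open>Dividing u by the inner product makes it equal to 1, so the real Cauchy-Schwarz
  inequality bounds its full modulus.\<close>

lemma (in hilb) norm_ip_le:
  assumes "u \<in> vecs H" "v \<in> vecs H"
  shows "norm (ip H u v) \<le> nrm H u * nrm H v"
proof (cases "ip H u v = 0")
  case False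
  let ?c = "inverse (ip H u v)"
  have "rip H (scl H ?c u) v = 1"
    using False assms by (simp add: rip_def ip_left cplx_one)
  then have "1 \<le> norm ?c * nrm H u * nrm H v"
    using cauchy_schwarz[of "scl H ?c u" v] assms by (simp add: nrm_scl)
  then show ?thesis using False by (simp add: norm_inverse norm_divide field_simps)
qed (use assms in simp)

lemma bounded_linear_cplx: "bounded_linear (cplx :: 'k::real_or_complex \<Rightarrow> complex)"
  by (rule bounded_linear_intro[where K = 1]) (simp_all add: cplx_add cplx_scaleR norm_cplx)

section \<open>Classes of square integrable sections\<close>

context l2_bundle begin

abbreviation "HL \<equiv> L2 B \<mu> h"

text \<open>An extended real squared norm makes sense without integrability, so limits and sums can
  be estimated before membership in the space is known.\<close>

definition sqn :: "('m \<Rightarrow> 'v) \<Rightarrow> ennreal" where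
  "sqn u = (\<integral>\<^sup>+ x. ennreal ((fibre_norm h x (u x))\<^sup>2) \<partial>M)"

definition SQ :: "('m \<Rightarrow> 'v) set" where
  "SQ = {u \<in> L0 B. sqn u < \<infinity>}"

lemma vecs_HL: "vecs HL = aecls B ` SQ"
  by (simp add: L2_def SQ_def sqn_def)

lemma HL_simps: "zer HL = aecls B (\<lambda>x. 0)" "add HL = cls_add B" "scl HL = cls_scale B"
  "ip HL U V = (\<integral>x. h x (rep U x) (rep V x) \<partial>M)"
  by (simp_all add: L2_def)

lemma aecls_cong: "AE x in M. u x = v x \<Longrightarrow> aecls B u = aecls B v"
  unfolding aecls_def ae_iff
proof (intro Collect_cong conj_cong refl)
  fix w assume uv: "AE x in M. u x = v x"
  have "AE x in M. w x = u x \<longleftrightarrow> w x = v x" using uv by eventually_elim simp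
  then show "(AE x in M. w x = u x) \<longleftrightarrow> (AE x in M. w x = v x)" by (rule eventually_subst)
qed

lemma rep_aecls:
  assumes "u \<in> L0 B" shows "rep (aecls B u) \<in> L0 B" "AE x in M. rep (aecls B u) x = u x"
proof -
  have "rep (aecls B u) \<in> aecls B u"
    unfolding rep_def by (rule someI[of _ u]) (simp add: aecls_def ae_iff assms)
  then show "rep (aecls B u) \<in> L0 B" "AE x in M. rep (aecls B u) x = u x"
    by (simp_all add: aecls_def ae_iff)
qed

lemma sqn_cong: "AE x in M. u x = v x \<Longrightarrow> sqn u = sqn v"
  unfolding sqn_def by (rule nn_integral_cong_AE) (auto elim: eventually_mono)

lemma SQ_L0: "u \<in> SQ \<Longrightarrow> u \<in> L0 B"
  by (simp add: SQ_def)

lemma vecsI: "u \<in> SQ \<Longrightarrow> aecls B u \<in> vecs HL"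
  by (simp add: vecs_HL)

lemma vecsD:
  assumes "U \<in> vecs HL" shows "rep U \<in> SQ" "aecls B (rep U) = U"
proof -
  obtain u where u: "u \<in> SQ" "U = aecls B u" using assms by (auto simp: vecs_HL)
  note r = rep_aecls[OF SQ_L0[OF u(1)]]
  show "rep U \<in> SQ" using r u sqn_cong[OF r(2)] by (simp add: SQ_def)
  show "aecls B (rep U) = U" unfolding u(2) by (rule aecls_cong[OF r(2)])
qed

lemma vecs_L0: "U \<in> vecs HL \<Longrightarrow> rep U \<in> L0 B"
  by (rule SQ_L0[OF vecsD(1)])

text \<open>Measurability of f is not presupposed: a class that is a vector contains its
  representative, which then agrees with f almost everywhere. This serves smooth sections and
  fibrewise projections, which are known only through their classes.\<close>

lemma rep_aecls_vecs: assumes "aecls B f \<in> vecs HL" shows "AE x in M. rep (aecls B f) x = f x"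
proof -
  have mem: "v \<in> aecls B u \<longleftrightarrow> v \<in> L0 B \<and> (AE x in M. v x = u x)" for u v
    by (simp add: aecls_def ae_iff)
  have "rep (aecls B f) \<in> aecls B (rep (aecls B f))" using vecs_L0[OF assms] by (simp add: mem)
  then have "rep (aecls B f) \<in> aecls B f" by (simp only: vecsD(2)[OF assms])
  then show ?thesis by (simp only: mem)
qed

lemma vecs_eqI: "U \<in> vecs HL \<Longrightarrow> V \<in> vecs HL \<Longrightarrow> AE x in M. rep U x = rep V x \<Longrightarrow> U = V"
  using aecls_cong[of "rep U" "rep V"] vecsD(2) by metis

lemma fibre_norm_facts:
  assumes p: "posdef h x"
  shows "u \<in> fibre B x \<Longrightarrow> v \<in> fibre B x \<Longrightarrow> fibre_norm h x (u + v) \<le> fibre_norm h x u + fibre_norm h x v"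
    "u \<in> fibre B x \<Longrightarrow> fibre_norm h x (vscale B c u) = norm c * fibre_norm h x u"
    "u \<in> fibre B x \<Longrightarrow> v \<in> fibre B x \<Longrightarrow> norm (h x u v) \<le> fibre_norm h x u * fibre_norm h x v"
    "u \<in> fibre B x \<Longrightarrow> (fibre_norm h x u)\<^sup>2 = Re (cplx (h x u u))"
    "u \<in> fibre B x \<Longrightarrow> 0 \<le> fibre_norm h x u"
    "u \<in> fibre B x \<Longrightarrow> v \<in> fibre B x \<Longrightarrow> fibre_norm h x (u - v) = fibre_norm h x (v - u)"
    "u \<in> fibre B x \<Longrightarrow> fibre_norm h x u = 0 \<longleftrightarrow> u = 0"
proof -
  interpret hilb "fib h x" by (rule hilb_fib[OF p])
  show "u \<in> fibre B x \<Longrightarrow> v \<in> fibre B x \<Longrightarrow> fibre_norm h x (u + v) \<le> fibre_norm h x u + fibre_norm h x v"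
    "u \<in> fibre B x \<Longrightarrow> fibre_norm h x (vscale B c u) = norm c * fibre_norm h x u"
    "u \<in> fibre B x \<Longrightarrow> v \<in> fibre B x \<Longrightarrow> norm (h x u v) \<le> fibre_norm h x u * fibre_norm h x v"
    "u \<in> fibre B x \<Longrightarrow> (fibre_norm h x u)\<^sup>2 = Re (cplx (h x u u))"
    "u \<in> fibre B x \<Longrightarrow> 0 \<le> fibre_norm h x u"
    "u \<in> fibre B x \<Longrightarrow> v \<in> fibre B x \<Longrightarrow> fibre_norm h x (u - v) = fibre_norm h x (v - u)"
    "u \<in> fibre B x \<Longrightarrow> fibre_norm h x u = 0 \<longleftrightarrow> u = 0"
    using nrm_add_le[of u v] nrm_scl[of u c] norm_ip_le[of u v] nrm_sq[of u] nrm_nonneg[of u]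
      nrm_sub_commute[of u v] nrm_eq_0[of u] by (simp_all add: rip_def)
qed

lemma fibre_norm_diff_le:
  assumes "posdef h x" "u \<in> fibre B x" "v \<in> fibre B x"
  shows "\<bar>fibre_norm h x u - fibre_norm h x v\<bar> \<le> fibre_norm h x (u - v)"
  using fibre_norm_facts(1)[OF assms(1), of "u - v" v] fibre_norm_facts(1)[OF assms(1), of "v - u" u]
    fibre_norm_facts(6)[OF assms] assms by simp

lemma sqn_measurable: "u \<in> L0 B \<Longrightarrow> (\<lambda>x. ennreal ((fibre_norm h x (u x))\<^sup>2)) \<in> borel_measurable M"
  using fibre_norm_measurable[of u] by measurable

lemma sqn_add_le:
  assumes u: "u \<in> L0 B" and v: "v \<in> L0 B"
  shows "sqn (\<lambda>x. u x + v x) \<le> 2 * sqn u + 2 * sqn v"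
proof -
  have "sqn (\<lambda>x. u x + v x) \<le> (\<integral>\<^sup>+ x. 2 * ennreal ((fibre_norm h x (u x))\<^sup>2) + 2 * ennreal ((fibre_norm h x (v x))\<^sup>2) \<partial>M)"
    unfolding sqn_def
  proof (rule nn_integral_mono_AE, use AE_posdef in eventually_elim)
    fix x assume p: "posdef h x"
    note f = L0_fibre[OF u, of x] L0_fibre[OF v, of x]
    have "(fibre_norm h x (u x + v x))\<^sup>2 \<le> (fibre_norm h x (u x) + fibre_norm h x (v x))\<^sup>2"
      using fibre_norm_facts(1)[OF p f] fibre_norm_facts(5)[OF p] f by (intro power_mono) auto
    also have "\<dots> \<le> 2 * (fibre_norm h x (u x))\<^sup>2 + 2 * (fibre_norm h x (v x))\<^sup>2"
      using sum_squares_ge_zero[of "fibre_norm h x (u x) - fibre_norm h x (v x)" 0]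
      by (simp add: power2_eq_square algebra_simps)
    finally have "ennreal ((fibre_norm h x (u x + v x))\<^sup>2)
        \<le> ennreal (2 * (fibre_norm h x (u x))\<^sup>2 + 2 * (fibre_norm h x (v x))\<^sup>2)" by (rule ennreal_leI)
    then show "ennreal ((fibre_norm h x (u x + v x))\<^sup>2)
        \<le> 2 * ennreal ((fibre_norm h x (u x))\<^sup>2) + 2 * ennreal ((fibre_norm h x (v x))\<^sup>2)"
      by (simp add: ennreal_mult)
  qed
  also have "\<dots> = 2 * sqn u + 2 * sqn v"
    unfolding sqn_def using sqn_measurable[OF u] sqn_measurable[OF v]
    by (simp add: nn_integral_add nn_integral_cmult)
  finally show ?thesis .
qed

lemma SQ_zero: "(\<lambda>x. 0) \<in> SQ"
proof -
  have "fibre_norm h x 0 = 0" for x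
    using hermitian_form_simps(4)[OF hermitian fibre_0] by (simp add: fibre_norm_def)
  then show ?thesis by (simp add: SQ_def L0_zero sqn_def)
qed

lemma SQ_add: "u \<in> SQ \<Longrightarrow> v \<in> SQ \<Longrightarrow> (\<lambda>x. u x + v x) \<in> SQ"
  using sqn_add_le[of u v] by (auto simp: SQ_def L0_add ennreal_mult_less_top elim!: order.strict_trans1)

lemma SQ_scale: assumes u: "u \<in> SQ" shows "(\<lambda>x. vscale B c (u x)) \<in> SQ"
proof -
  have "sqn (\<lambda>x. vscale B c (u x)) = (\<integral>\<^sup>+ x. ennreal ((norm c)\<^sup>2) * ennreal ((fibre_norm h x (u x))\<^sup>2) \<partial>M)"
    unfolding sqn_def
  proof (rule nn_integral_cong_AE, use AE_posdef in eventually_elim)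
    fix x assume p: "posdef h x"
    show "ennreal ((fibre_norm h x (vscale B c (u x)))\<^sup>2) = ennreal ((norm c)\<^sup>2) * ennreal ((fibre_norm h x (u x))\<^sup>2)"
      using fibre_norm_facts(2)[OF p L0_fibre[OF SQ_L0[OF u]]] by (simp add: power_mult_distrib ennreal_mult)
  qed
  also have "\<dots> = ennreal ((norm c)\<^sup>2) * sqn u"
    unfolding sqn_def by (rule nn_integral_cmult[OF sqn_measurable[OF SQ_L0[OF u]]])
  also have "\<dots> < \<infinity>" using u by (simp add: SQ_def ennreal_mult_less_top)
  finally show ?thesis using u by (simp add: SQ_def L0_scale)
qed

lemma SQ_diff: "u \<in> SQ \<Longrightarrow> v \<in> SQ \<Longrightarrow> (\<lambda>x. u x - v x) \<in> SQ"
  using SQ_add[of u "\<lambda>x. vscale B (- 1) (v x)"] SQ_scale[of v "- 1"] by simp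

lemma integrable_h:
  assumes u: "u \<in> SQ" and v: "v \<in> SQ" shows "integrable M (\<lambda>x. h x (u x) (v x))"
proof -
  note L = SQ_L0[OF u] SQ_L0[OF v]
  have "(\<integral>\<^sup>+ x. ennreal (norm (h x (u x) (v x))) \<partial>M)
      \<le> (\<integral>\<^sup>+ x. ennreal ((fibre_norm h x (u x))\<^sup>2) + ennreal ((fibre_norm h x (v x))\<^sup>2) \<partial>M)"
  proof (rule nn_integral_mono_AE, use AE_posdef in eventually_elim)
    fix x assume p: "posdef h x"
    have "norm (h x (u x) (v x)) \<le> fibre_norm h x (u x) * fibre_norm h x (v x)"
      by (intro fibre_norm_facts(3)[OF p] L0_fibre L)
    also have "\<dots> \<le> (fibre_norm h x (u x))\<^sup>2 + (fibre_norm h x (v x))\<^sup>2"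
      using sum_squares_bound[of "fibre_norm h x (u x)" "fibre_norm h x (v x)"]
        fibre_norm_facts(5)[OF p] L0_fibre[OF L(1)] L0_fibre[OF L(2)]
        mult_nonneg_nonneg[of "fibre_norm h x (u x)" "fibre_norm h x (v x)"] by fastforce
    finally show "ennreal (norm (h x (u x) (v x))) \<le> ennreal ((fibre_norm h x (u x))\<^sup>2) + ennreal ((fibre_norm h x (v x))\<^sup>2)"
      by (simp flip: ennreal_plus)
  qed
  also have "\<dots> = sqn u + sqn v"
    unfolding sqn_def by (intro nn_integral_add sqn_measurable L)
  also have "\<dots> < \<infinity>" using u v by (simp add: SQ_def)
  finally show ?thesis using h_measurable[OF L] by (simp add: integrable_iff_bounded)
qed

lemma sqn_eq_integral:
  assumes u: "u \<in> SQ"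
  shows "sqn u = ennreal (Re (cplx (\<integral>x. h x (u x) (u x) \<partial>M)))" "0 \<le> Re (cplx (\<integral>x. h x (u x) (u x) \<partial>M))"
proof -
  note L = SQ_L0[OF u]
  have bl: "bounded_linear (\<lambda>z :: 'k. Re (cplx z))"
    using bounded_linear_compose[OF bounded_linear_Re bounded_linear_cplx] .
  have i: "integrable M (\<lambda>x. Re (cplx (h x (u x) (u x))))"
    by (rule integrable_bounded_linear[OF bl integrable_h[OF u u]])
  have eq: "AE x in M. (fibre_norm h x (u x))\<^sup>2 = Re (cplx (h x (u x) (u x)))"
    using AE_posdef by eventually_elim (intro fibre_norm_facts(4) L0_fibre L)
  have nn: "AE x in M. 0 \<le> Re (cplx (h x (u x) (u x)))"
    using eq by eventually_elim (metis zero_le_power2)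
  have eq2: "Re (cplx (\<integral>x. h x (u x) (u x) \<partial>M)) = (\<integral>x. Re (cplx (h x (u x) (u x))) \<partial>M)"
    by (rule integral_bounded_linear[OF bl integrable_h[OF u u], symmetric])
  have "sqn u = (\<integral>\<^sup>+ x. ennreal (Re (cplx (h x (u x) (u x)))) \<partial>M)"
    unfolding sqn_def by (rule nn_integral_cong_AE) (use eq in eventually_elim, simp)
  also have "\<dots> = ennreal (\<integral>x. Re (cplx (h x (u x) (u x))) \<partial>M)"
    by (rule nn_integral_eq_integral[OF i nn])
  finally show "sqn u = ennreal (Re (cplx (\<integral>x. h x (u x) (u x) \<partial>M)))" using eq2 by simp
  show "0 \<le> Re (cplx (\<integral>x. h x (u x) (u x) \<partial>M))"
    unfolding eq2 by (rule integral_nonneg_AE[OF nn])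
qed

lemma nrm_HL: assumes "U \<in> vecs HL" shows "ennreal ((nrm HL U)\<^sup>2) = sqn (rep U)" "0 \<le> nrm HL U"
  using sqn_eq_integral[OF vecsD(1)[OF assms]] by (simp_all add: nrm_def HL_simps)

lemma nrm_HL_le:
  assumes "U \<in> vecs HL" "sqn (rep U) \<le> ennreal (e\<^sup>2)" "0 \<le> e"
  shows "nrm HL U \<le> e"
proof -
  have "(nrm HL U)\<^sup>2 \<le> e\<^sup>2" using assms(2) unfolding nrm_HL(1)[OF assms(1), symmetric] by simp
  then show ?thesis using assms(3) by (rule power2_le_imp_le)
qed

lemma ip_HL_cong:
  assumes "AE x in M. rep U x = u x" "AE x in M. rep V x = v x"
    and "rep U \<in> L0 B" "rep V \<in> L0 B" "u \<in> L0 B" "v \<in> L0 B"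
  shows "ip HL U V = (\<integral>x. h x (u x) (v x) \<partial>M)"
  unfolding HL_simps
proof (rule integral_cong_AE)
  show "AE x in M. h x (rep U x) (rep V x) = h x (u x) (v x)"
    using assms(1,2) by eventually_elim simp
qed (use assms in \<open>auto intro!: h_measurable\<close>)

lemma add_HL: 
  assumes "U \<in> vecs HL" "V \<in> vecs HL"
  shows "add HL U V \<in> vecs HL" "AE x in M. rep (add HL U V) x = rep U x + rep V x"
  using SQ_add[OF vecsD(1) vecsD(1), OF assms] rep_aecls(2)[OF L0_add[OF vecs_L0 vecs_L0], OF assms]
  by (simp_all add: HL_simps cls_add_def vecsI)

lemma scl_HL: 
  assumes "U \<in> vecs HL"
  shows "scl HL c U \<in> vecs HL" "AE x in M. rep (scl HL c U) x = vscale B c (rep U x)"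
  using SQ_scale[OF vecsD(1), OF assms] rep_aecls(2)[OF L0_scale[OF vecs_L0], OF assms]
  by (simp_all add: HL_simps cls_scale_def vecsI)

lemma zer_HL: "zer HL \<in> vecs HL" "AE x in M. rep (zer HL) x = 0"
  using SQ_zero rep_aecls(2)[OF L0_zero] by (simp_all add: HL_simps vecsI)

lemma sub_HL:
  assumes "U \<in> vecs HL" "V \<in> vecs HL"
  shows "sub HL U V \<in> vecs HL" "AE x in M. rep (sub HL U V) x = rep U x - rep V x"
proof -
  show "sub HL U V \<in> vecs HL" unfolding sub_def by (intro add_HL scl_HL assms)
  show "AE x in M. rep (sub HL U V) x = rep U x - rep V x"
    unfolding sub_def using add_HL(2)[OF assms(1) scl_HL(1)[OF assms(2), of "-1"]] scl_HL(2)[OF assms(2), of "-1"]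
    by eventually_elim simp
qed

lemma sqn_sub: "U \<in> vecs HL \<Longrightarrow> V \<in> vecs HL \<Longrightarrow> sqn (\<lambda>x. rep U x - rep V x) = ennreal ((nrm HL (sub HL U V))\<^sup>2)"
  by (simp add: nrm_HL(1)[OF sub_HL(1)] sqn_cong[OF sub_HL(2)])

end


section \<open>Completeness\<close>

context l2_bundle begin

lemma fibre_convergent:
  assumes p: "posdef h x" and v: "\<And>k. v k \<in> fibre B x"
    and sm: "summable (\<lambda>k. fibre_norm h x (v (Suc k) - v k))"
  shows "\<exists>w\<in>fibre B x. (\<lambda>k. fibre_norm h x (v k - w)) \<longlonglongrightarrow> 0"
proof -
  obtain U \<tau> where t: "(U, \<tau>) \<in> trivs B" "x \<in> U" by (rule ex_triv)
  obtain c C where cC: "c > 0" "C > 0" "\<And>v. v \<in> fibre B x \<Longrightarrow> c * norm (\<tau> x v) \<le> fibre_norm h x v"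
    "\<And>v. v \<in> fibre B x \<Longrightarrow> fibre_norm h x v \<le> C * norm (\<tau> x v)" by (rule fibre_norm_equiv[OF p t]) blast
  have le: "norm (\<tau> x (v (Suc k)) - \<tau> x (v k)) \<le> inverse c * fibre_norm h x (v (Suc k) - v k)" for k
    using cC(3)[of "v (Suc k) - v k"] cC(1) v by (simp add: trivD(5)[OF t] field_simps)
  have "summable (\<lambda>k. inverse c * fibre_norm h x (v (Suc k) - v k))"
    using sm by (rule summable_mult)
  then have "summable (\<lambda>k. \<tau> x (v (Suc k)) - \<tau> x (v k))"
    by (rule summable_comparison_test[rotated]) (use le in blast)
  then have "convergent (\<lambda>n. \<Sum>k<n. \<tau> x (v (Suc k)) - \<tau> x (v k))"
    by (simp add: summable_iff_convergent)
  then have "convergent (\<lambda>n. \<tau> x (v n) - \<tau> x (v 0))"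
    by (simp only: sum_lessThan_telescope[of "\<lambda>k. \<tau> x (v k)"])
  then obtain y where "(\<lambda>n. \<tau> x (v n) - \<tau> x (v 0)) \<longlonglongrightarrow> y" by (auto simp: convergent_def)
  then have "(\<lambda>n. \<tau> x (v n) - \<tau> x (v 0) + \<tau> x (v 0)) \<longlonglongrightarrow> y + \<tau> x (v 0)"
    by (intro tendsto_add tendsto_const)
  then have "(\<lambda>n. \<tau> x (v n)) \<longlonglongrightarrow> y + \<tau> x (v 0)" by simp
  then have "(\<lambda>n. fibre_norm h x (v n - inv_into (fibre B x) (\<tau> x) (y + \<tau> x (v 0)))) \<longlonglongrightarrow> 0"
    using fibre_tends_iff[OF p t v triv_inv(1)[OF t]] triv_inv(2)[OF t] by simp
  then show ?thesis using triv_inv(1)[OF t] by blast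
qed

text \<open>The weights \<open>2\<^sup>k\<close> give summability of the increments without Minkowski's inequality.\<close>

lemma AE_summable_increments:
  assumes v: "\<And>k. v k \<in> L0 B" and le: "\<And>k. sqn (\<lambda>x. v (Suc k) x - v k x) \<le> ennreal ((1 / 4) ^ k)"
  shows "AE x in M. summable (\<lambda>k. fibre_norm h x (v (Suc k) x - v k x))"
proof -
  let ?d = "\<lambda>k x. (fibre_norm h x (v (Suc k) x - v k x))\<^sup>2"
  have m [measurable]: "(\<lambda>x. ennreal (?d k x)) \<in> borel_measurable M" for k
    using sqn_measurable[OF L0_diff[OF v v]] .
  have "(\<integral>\<^sup>+ x. (\<Sum>k. ennreal (2 ^ k) * ennreal (?d k x)) \<partial>M)
      = (\<Sum>k. \<integral>\<^sup>+ x. ennreal (2 ^ k) * ennreal (?d k x) \<partial>M)"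
    by (intro nn_integral_suminf borel_measurable_times_ennreal m) simp
  also have "\<dots> = (\<Sum>k. ennreal (2 ^ k) * sqn (\<lambda>x. v (Suc k) x - v k x))"
    unfolding sqn_def by (simp add: nn_integral_cmult m)
  also have "\<dots> \<le> (\<Sum>k. ennreal ((1 / 2) ^ k))"
  proof (rule suminf_le)
    fix k
    have "ennreal (2 ^ k) * sqn (\<lambda>x. v (Suc k) x - v k x) \<le> ennreal (2 ^ k) * ennreal ((1 / 4) ^ k)"
      by (rule mult_left_mono[OF le]) simp
    also have "\<dots> = ennreal ((2 * (1 / 4)) ^ k)" by (simp only: power_mult_distrib ennreal_mult[symmetric] zero_le_power zero_le_numeral zero_le_divide_1_iff)
    finally show "ennreal (2 ^ k) * sqn (\<lambda>x. v (Suc k) x - v k x) \<le> ennreal ((1 / 2) ^ k)" by simp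
  qed auto
  also have "\<dots> = ennreal (\<Sum>k. (1 / 2) ^ k)"
    by (rule suminf_ennreal2) (auto intro: summable_geometric)
  also have "\<dots> < \<infinity>" by simp
  finally have "(\<integral>\<^sup>+ x. (\<Sum>k. ennreal (2 ^ k) * ennreal (?d k x)) \<partial>M) \<noteq> \<infinity>" by simp
  then have "AE x in M. (\<Sum>k. ennreal (2 ^ k) * ennreal (?d k x)) \<noteq> \<infinity>"
    by (intro nn_integral_PInf_AE) measurable
  then show ?thesis using AE_posdef
  proof eventually_elim
    case (elim x)
    have nn: "0 \<le> fibre_norm h x (v (Suc k) x - v k x)" for k
      by (rule fibre_norm_facts(5)[OF elim(2)]) (simp add: L0_fibre v)
    have "(\<Sum>k. ennreal (2 ^ k * ?d k x)) \<noteq> \<infinity>" using elim(1) by (simp add: ennreal_mult)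
    then have sm: "summable (\<lambda>k. 2 ^ k * ?d k x)" by (intro summable_suminf_not_top) auto
    then have "(\<lambda>k. 2 ^ k * ?d k x) \<longlonglongrightarrow> 0" by (rule summable_LIMSEQ_zero)
    then obtain K where K: "\<And>k. norm (2 ^ k * ?d k x) \<le> K" by (rule BseqE[OF convergent_imp_Bseq[OF convergentI]]) blast
    \<comment> \<open>The terms 2^k d^2 of the convergent series are bounded by K, so the increments
      d are dominated by a geometric sequence.\<close>
    have "fibre_norm h x (v (Suc k) x - v k x) \<le> sqrt K * (sqrt (1 / 2)) ^ k" for k
    proof (rule power2_le_imp_le)
      have "2 ^ k * ?d k x \<le> K" using K[of k] by simp
      then have "?d k x \<le> K * (1 / 2) ^ k" by (simp add: field_simps power_divide)
      also have "\<dots> = (sqrt K * sqrt (1 / 2) ^ k)\<^sup>2"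
        using order_trans[OF norm_ge_zero K[of 0]]
        by (simp add: power_mult_distrib real_sqrt_divide power_divide power2_eq_square flip: power_mult_distrib)
      finally show "?d k x \<le> (sqrt K * sqrt (1 / 2) ^ k)\<^sup>2" .
    qed (use order_trans[OF norm_ge_zero K[of 0]] in simp)
    moreover have "summable (\<lambda>k. sqrt K * (sqrt (1 / 2)) ^ k)"
      by (intro summable_mult summable_geometric) (simp add: real_sqrt_divide)
    ultimately show ?case using nn by (intro summable_comparison_test[OF _ \<open>summable (\<lambda>k. sqrt K * (sqrt (1 / 2)) ^ k)\<close>]) auto
  qed
qed

text \<open>Fatou's lemma: in almost every fibre the norm of w - v k tends to that of w - u.\<close>

lemma sqn_limit_le:
  assumes w: "w \<in> L0 B" and v: "\<And>k. v k \<in> L0 B" and u: "u \<in> L0 B"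
    and lim: "AE x in M. (\<lambda>k. fibre_norm h x (v k x - u x)) \<longlonglongrightarrow> 0"
    and le: "eventually (\<lambda>k. sqn (\<lambda>x. w x - v k x) \<le> C) sequentially"
  shows "sqn (\<lambda>x. w x - u x) \<le> C"
proof -
  have "sqn (\<lambda>x. w x - u x) = (\<integral>\<^sup>+ x. liminf (\<lambda>k. ennreal ((fibre_norm h x (w x - v k x))\<^sup>2)) \<partial>M)"
    unfolding sqn_def
  proof (rule nn_integral_cong_AE, use lim AE_posdef in eventually_elim)
    fix x assume l: "(\<lambda>k. fibre_norm h x (v k x - u x)) \<longlonglongrightarrow> 0" and p: "posdef h x"
    note f = L0_fibre[OF w, of x] L0_fibre[OF v, of _ x] L0_fibre[OF u, of x]
    have "\<bar>fibre_norm h x (w x - v k x) - fibre_norm h x (w x - u x)\<bar> \<le> fibre_norm h x (v k x - u x)" for k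
      using fibre_norm_diff_le[OF p fibre_diff[OF f(1,2)] fibre_diff[OF f(1,3)], of k]
        fibre_norm_facts(6)[OF p f(3,2), of k] by simp
    then have "(\<lambda>k. fibre_norm h x (w x - v k x) - fibre_norm h x (w x - u x)) \<longlonglongrightarrow> 0"
      by (intro Lim_null_comparison[OF _ l]) auto
    then have "(\<lambda>k. fibre_norm h x (w x - v k x)) \<longlonglongrightarrow> fibre_norm h x (w x - u x)" by (rule LIM_zero_cancel)
    then have "(\<lambda>k. ennreal ((fibre_norm h x (w x - v k x))\<^sup>2)) \<longlonglongrightarrow> ennreal ((fibre_norm h x (w x - u x))\<^sup>2)"
      by (intro tendsto_ennrealI tendsto_power)
    then show "ennreal ((fibre_norm h x (w x - u x))\<^sup>2) = liminf (\<lambda>k. ennreal ((fibre_norm h x (w x - v k x))\<^sup>2))"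
      by (rule lim_imp_Liminf[OF sequentially_bot, symmetric])
  qed
  also have "\<dots> \<le> liminf (\<lambda>k. sqn (\<lambda>x. w x - v k x))"
    unfolding sqn_def by (intro nn_integral_liminf sqn_measurable L0_diff w v)
  also have "\<dots> \<le> limsup (\<lambda>k. sqn (\<lambda>x. w x - v k x))" by (rule Liminf_le_Limsup) simp
  also have "\<dots> \<le> C" by (rule Limsup_bounded[OF le])
  finally show ?thesis .
qed

lemma complete_HL:
  assumes s: "\<And>n. s n \<in> vecs HL"
    and cau: "\<And>e. e > 0 \<Longrightarrow> \<exists>N. \<forall>m\<ge>N. \<forall>n\<ge>N. nrm HL (sub HL (s m) (s n)) < e"
  shows "\<exists>U\<in>vecs HL. tends HL s U"
proof -
  have "\<exists>N. \<forall>m\<ge>N. \<forall>n\<ge>N. nrm HL (sub HL (s m) (s n)) < (1 / 2) ^ k" for k :: nat by (rule cau) simp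
  then obtain N where N: "\<And>k m n. m \<ge> N k \<Longrightarrow> n \<ge> N k \<Longrightarrow> nrm HL (sub HL (s m) (s n)) < (1 / 2) ^ k" by metis
  have sq: "sqn (\<lambda>x. rep (s m) x - rep (s n) x) \<le> ennreal ((1 / 4) ^ k)" if "m \<ge> N k" "n \<ge> N k" for m n k
  proof -
    have "(nrm HL (sub HL (s m) (s n)))\<^sup>2 \<le> ((1 / 2) ^ k)\<^sup>2"
      using N[OF that] nrm_HL(2)[OF sub_HL(1)[OF s s]] by (intro power_mono) auto
    also have "((1 / 2) ^ k)\<^sup>2 = (1 / 4 :: real) ^ k"
      by (simp add: power2_eq_square flip: power_mult_distrib)
    finally show ?thesis unfolding sqn_sub[OF s s] by (rule ennreal_leI)
  qed
  \<comment> \<open>The sum is an index that dominates every N j with j \<le> k, so consecutive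
    terms are within the bound for k.\<close>
  define r where "r k = (\<Sum>i\<le>k. N i)" for k
  have rN: "N j \<le> r k" if "j \<le> k" for j k
    unfolding r_def using that by (intro member_le_sum) auto
  define v where "v k = rep (s (r k))" for k
  have v: "v k \<in> L0 B" for k unfolding v_def by (rule vecs_L0[OF s])
  have "AE x in M. summable (\<lambda>k. fibre_norm h x (v (Suc k) x - v k x))"
    by (rule AE_summable_increments[OF v]) (unfold v_def, intro sq rN, auto)
  then have conv: "AE x in M. \<exists>w\<in>fibre B x. (\<lambda>k. fibre_norm h x (v k x - w)) \<longlonglongrightarrow> 0"
    using AE_posdef by eventually_elim (rule fibre_convergent, auto intro: L0_fibre v)
  \<comment> \<open>The default 0 keeps u in the fibre at the exceptional points too, as
    \<open>L0\<close> requires at every point.\<close>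
  define u where "u x = (if \<exists>w\<in>fibre B x. (\<lambda>k. fibre_norm h x (v k x - w)) \<longlonglongrightarrow> 0
    then SOME w. w \<in> fibre B x \<and> (\<lambda>k. fibre_norm h x (v k x - w)) \<longlonglongrightarrow> 0 else 0)" for x
  have ex: "u x \<in> fibre B x \<and> (\<lambda>k. fibre_norm h x (v k x - u x)) \<longlonglongrightarrow> 0"
    if "\<exists>w\<in>fibre B x. (\<lambda>k. fibre_norm h x (v k x - w)) \<longlonglongrightarrow> 0" for x
    unfolding u_def if_P[OF that] by (rule someI_ex[OF that[unfolded Bex_def]])
  then have uf: "u x \<in> fibre B x" for x
    by (cases "\<exists>w\<in>fibre B x. (\<lambda>k. fibre_norm h x (v k x - w)) \<longlonglongrightarrow> 0")
       (rule ex[THEN conjunct1], assumption, simp only: u_def if_False fibre_0)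
  have lim: "AE x in M. (\<lambda>k. fibre_norm h x (v k x - u x)) \<longlonglongrightarrow> 0"
    using conv by eventually_elim (use ex in blast)
  have u: "u \<in> L0 B" by (rule L0_limit[OF v uf lim])
  have le: "sqn (\<lambda>x. rep (s n) x - u x) \<le> ennreal ((1 / 4) ^ j)" if n: "n \<ge> N j" for n j
  proof (rule sqn_limit_le[OF vecs_L0[OF s] v u lim])
    show "\<forall>\<^sub>F k in sequentially. sqn (\<lambda>x. rep (s n) x - v k x) \<le> ennreal ((1 / 4) ^ j)"
      using eventually_ge_at_top[of j] by eventually_elim (unfold v_def, intro sq n rN)
  qed
  have "sqn (\<lambda>x. rep (s (N 0)) x - u x) < \<infinity>" using le[of 0 "N 0"] by (auto elim!: order.strict_trans1)
  then have "(\<lambda>x. rep (s (N 0)) x - u x) \<in> SQ" by (simp add: SQ_def L0_diff vecs_L0 s u)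
  from SQ_diff[OF vecsD(1)[OF s[of "N 0"]] this] have uS: "u \<in> SQ" by simp
  let ?U = "aecls B u"
  have U: "?U \<in> vecs HL" by (rule vecsI[OF uS])
  have nle: "nrm HL (sub HL (s n) ?U) \<le> (1 / 2) ^ j" if n: "n \<ge> N j" for n j
  proof (rule nrm_HL_le[OF sub_HL(1)[OF s U]])
    have "AE x in M. rep (sub HL (s n) ?U) x = rep (s n) x - u x"
      using sub_HL(2)[OF s U] rep_aecls(2)[OF u] by eventually_elim simp
    then show "sqn (rep (sub HL (s n) ?U)) \<le> ennreal (((1 / 2) ^ j)\<^sup>2)"
      using le[OF n] by (simp add: sqn_cong power2_eq_square flip: power_mult_distrib)
  qed simp
  have "tends HL s ?U" unfolding tends_def
  proof (rule LIMSEQ_I)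
    fix e :: real assume "e > 0"
    then obtain j where j: "(1 / 2) ^ j < e" using real_arch_pow_inv[of e "1 / 2"] by auto
    have "norm (nrm HL (sub HL (s n) ?U) - 0) < e" if "n \<ge> N j" for n
      using nle[OF that] j nrm_HL(2)[OF sub_HL(1)[OF s U], of n] by simp
    then show "\<exists>no. \<forall>n\<ge>no. norm (nrm HL (sub HL (s n) ?U) - 0) < e" by blast
  qed
  then show ?thesis using U by blast
qed

lemma nrm_HL_0: assumes "U \<in> vecs HL" "V \<in> vecs HL" "nrm HL (sub HL U V) = 0" shows "U = V"
proof (rule vecs_eqI[OF assms(1,2)])
  have L: "(\<lambda>x. rep U x - rep V x) \<in> L0 B" by (intro L0_diff vecs_L0 assms)
  have "sqn (\<lambda>x. rep U x - rep V x) = 0" using assms by (simp add: sqn_sub)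
  then have "AE x in M. ennreal ((fibre_norm h x (rep U x - rep V x))\<^sup>2) = 0"
    unfolding sqn_def using nn_integral_0_iff_AE[OF sqn_measurable[OF L]] by blast
  then show "AE x in M. rep U x = rep V x" using AE_posdef
  proof eventually_elim
    case (elim x)
    then show ?case
      using fibre_norm_facts(7)[OF elim(2), of "rep U x - rep V x"] L0_fibre[OF L] by simp
  qed
qed

theorem hilb_HL: "hilb HL"
proof
  note sm = AE_mp[OF _ AE_I2]
  show "ip HL (zer HL) W = 0" if W: "W \<in> vecs HL" for W
    using ip_HL_cong[OF zer_HL(2) _ vecs_L0[OF zer_HL(1)] _ L0_zero, of W "rep W"] vecs_L0[OF W]
    by (simp add: hermitian_form_simps(4)[OF hermitian] L0_fibre)
  show "ip HL (add HL U V) W = ip HL U W + ip HL V W" if v: "U \<in> vecs HL" "V \<in> vecs HL" "W \<in> vecs HL" for U V W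
  proof -
    note L = v[THEN vecs_L0] and S = v[THEN vecsD(1)]
    have "ip HL (add HL U V) W = (\<integral>x. h x (rep U x + rep V x) (rep W x) \<partial>M)"
      by (rule ip_HL_cong[OF add_HL(2)[OF v(1,2)] _ vecs_L0[OF add_HL(1)[OF v(1,2)]] L(3) L0_add[OF L(1,2)] L(3)]) simp
    also have "\<dots> = (\<integral>x. h x (rep U x) (rep W x) + h x (rep V x) (rep W x) \<partial>M)"
      by (intro Bochner_Integration.integral_cong refl hermitian_form_simps(1)[OF hermitian] L0_fibre L)
    also have "\<dots> = ip HL U W + ip HL V W"
      unfolding HL_simps by (intro Bochner_Integration.integral_add integrable_h S)
    finally show ?thesis .
  qed
  show "ip HL (scl HL c U) W = c * ip HL U W" if v: "U \<in> vecs HL" "W \<in> vecs HL" for U W c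
  proof -
    note L = v[THEN vecs_L0] and S = v[THEN vecsD(1)]
    have "ip HL (scl HL c U) W = (\<integral>x. h x (vscale B c (rep U x)) (rep W x) \<partial>M)"
      by (rule ip_HL_cong[OF scl_HL(2)[OF v(1)] _ vecs_L0[OF scl_HL(1)[OF v(1)]] L(2) L0_scale[OF L(1)] L(2)]) simp
    also have "\<dots> = (\<integral>x. c * h x (rep U x) (rep W x) \<partial>M)"
      by (intro Bochner_Integration.integral_cong refl hermitian_form_simps(2)[OF hermitian] L0_fibre L)
    finally show ?thesis by (simp add: HL_simps)
  qed
  show "cplx (ip HL V U) = cnj (cplx (ip HL U V))" if v: "U \<in> vecs HL" "V \<in> vecs HL" for U V
  proof -
    note L = v[THEN vecs_L0] and S = v[THEN vecsD(1)]
    have i: "cplx (\<integral>x. h x (rep U x) (rep V x) \<partial>M) = (\<integral>x. cplx (h x (rep U x) (rep V x)) \<partial>M)"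
      if "U \<in> vecs HL" "V \<in> vecs HL" for U V
      by (intro integral_bounded_linear[OF bounded_linear_cplx, symmetric] integrable_h vecsD(1) that)
    have "cplx (ip HL V U) = (\<integral>x. cnj (cplx (h x (rep U x) (rep V x))) \<partial>M)"
      unfolding HL_simps i[OF v(2,1)]
      by (intro Bochner_Integration.integral_cong refl hermitian_form_simps(3)[OF hermitian] L0_fibre L)
    also have "\<dots> = cnj (\<integral>x. cplx (h x (rep U x) (rep V x)) \<partial>M)"
      by (intro integral_bounded_linear[OF bounded_linear_cnj] integrable_bounded_linear[OF bounded_linear_cplx] integrable_h S)
    finally show ?thesis unfolding HL_simps i[OF v] .
  qed
  show "0 \<le> rip HL U U" if "U \<in> vecs HL" for U
    using sqn_eq_integral(2)[OF vecsD(1)[OF that]] by (simp add: rip_def HL_simps)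
qed (fact add_HL(1) scl_HL(1) zer_HL(1) nrm_HL_0 complete_HL)+

end


text \<open>Both measures have the intrinsic measurable and null sets, so the integral for one is
  the integral for the other weighted by the Radon-Nikodym derivative. The classes themselves depend
  on neither pair, which is why the carriers can be compared by inclusion.\<close>

lemma nrm_L2_le:
  assumes l: "l2_bundle B \<mu> h" and l': "l2_bundle B \<nu> g"
    and RN: "ae (atlas B) (\<lambda>x. RN_deriv (cara \<nu>) (cara \<mu>) x \<le> ennreal C)"
    and D: "D \<ge> (1::real)" "ae (atlas B) (\<lambda>x. \<forall>u\<in>fibre B x. fibre_norm h x u \<le> D * fibre_norm g x u)"
  shows "vecs (L2 B \<nu> g) \<subseteq> vecs (L2 B \<mu> h)"
    and "\<exists>K\<ge>1. \<forall>u\<in>vecs (L2 B \<nu> g). nrm (L2 B \<mu> h) u \<le> K * nrm (L2 B \<nu> g) u"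
proof -
  interpret l2_bundle B \<mu> h by (rule l)
  interpret N: l2_bundle B \<nu> g by (rule l')
  have s: "sets M = sets N.M" by (simp add: sets_M_Meas N.sets_M_Meas)
  have ac: "absolutely_continuous N.M M" by (simp add: absolutely_continuous_def null_sets_M N.null_sets_M)
  interpret sf: sigma_finite_measure N.M by (rule N.sigma_finite_M)
  \<comment> \<open>C enters only through \<open>ennreal C\<close> and may be negative; the maximum
    gives a constant at least 1.\<close>
  let ?K = "max 1 C * D\<^sup>2"
  have sqn: "sqn u \<le> ennreal ?K * N.sqn u" if u: "u \<in> L0 B" for u
  proof -
    note [measurable] = sqn_measurable[OF u] N.sqn_measurable[OF u]
    have "sqn u \<le> (\<integral>\<^sup>+ x. ennreal (D\<^sup>2) * ennreal ((fibre_norm g x (u x))\<^sup>2) \<partial>M)"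
      unfolding sqn_def
    proof (rule nn_integral_mono_AE, use D(2)[unfolded ae_iff] AE_posdef in eventually_elim)
      fix x assume "\<forall>u\<in>fibre B x. fibre_norm h x u \<le> D * fibre_norm g x u" "posdef h x"
      then have "(fibre_norm h x (u x))\<^sup>2 \<le> (D * fibre_norm g x (u x))\<^sup>2"
        using L0_fibre[OF u] by (intro power_mono fibre_norm_facts(5)) auto
      then have "ennreal ((fibre_norm h x (u x))\<^sup>2) \<le> ennreal ((D * fibre_norm g x (u x))\<^sup>2)" by (rule ennreal_leI)
      then show "ennreal ((fibre_norm h x (u x))\<^sup>2) \<le> ennreal (D\<^sup>2) * ennreal ((fibre_norm g x (u x))\<^sup>2)"
        by (simp add: power_mult_distrib ennreal_mult)
    qed
    also have "\<dots> = (\<integral>\<^sup>+ x. RN_deriv N.M M x * (ennreal (D\<^sup>2) * ennreal ((fibre_norm g x (u x))\<^sup>2)) \<partial>N.M)"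
      by (rule sf.RN_deriv_nn_integral[OF ac s]) measurable
    also have "\<dots> \<le> (\<integral>\<^sup>+ x. ennreal ?K * ennreal ((fibre_norm g x (u x))\<^sup>2) \<partial>N.M)"
    proof (rule nn_integral_mono_AE, use RN[unfolded N.ae_iff] in eventually_elim)
      fix x assume r: "RN_deriv N.M M x \<le> ennreal C"
      have "ennreal C \<le> ennreal (max 1 C)" by (rule ennreal_leI) simp
      with r have "RN_deriv N.M M x \<le> ennreal (max 1 C)" by (rule order_trans)
      then have "RN_deriv N.M M x * (ennreal (D\<^sup>2) * ennreal ((fibre_norm g x (u x))\<^sup>2))
          \<le> ennreal (max 1 C) * (ennreal (D\<^sup>2) * ennreal ((fibre_norm g x (u x))\<^sup>2))"
        by (intro mult_right_mono) auto
      also have "\<dots> = ennreal ?K * ennreal ((fibre_norm g x (u x))\<^sup>2)"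
        by (simp add: ennreal_mult mult.assoc)
      finally show "RN_deriv N.M M x * (ennreal (D\<^sup>2) * ennreal ((fibre_norm g x (u x))\<^sup>2))
        \<le> ennreal ?K * ennreal ((fibre_norm g x (u x))\<^sup>2)" .
    qed
    also have "\<dots> = ennreal ?K * N.sqn u"
      unfolding N.sqn_def by (rule nn_integral_cmult) measurable
    finally show ?thesis .
  qed
  have K: "?K \<ge> 1" using D(1) by (simp add: mult_ge1_I)
  have SQ: "u \<in> SQ" if "u \<in> N.SQ" for u
    using sqn[of u] that by (auto simp: SQ_def N.SQ_def ennreal_mult_less_top elim!: order.strict_trans1)
  then show v: "vecs N.HL \<subseteq> vecs HL" by (auto simp: vecs_HL N.vecs_HL)
  have "nrm HL U \<le> sqrt ?K * nrm N.HL U" if U: "U \<in> vecs N.HL" for U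
  proof (rule nrm_HL_le)
    show "U \<in> vecs HL" using v U by blast
    have "sqn (rep U) \<le> ennreal ?K * ennreal ((nrm N.HL U)\<^sup>2)"
      using sqn[OF N.vecs_L0[OF U]] N.nrm_HL(1)[OF U] by simp
    also have "\<dots> = ennreal ((sqrt ?K * nrm N.HL U)\<^sup>2)"
      unfolding power_mult_distrib using K by (subst ennreal_mult[symmetric]) (auto simp del: real_sqrt_mult)
    finally show "sqn (rep U) \<le> ennreal ((sqrt ?K * nrm N.HL U)\<^sup>2)" .
    show "0 \<le> sqrt ?K * nrm N.HL U" using K N.nrm_HL(2)[OF U] by (intro mult_nonneg_nonneg) auto
  qed
  moreover have "1 \<le> sqrt ?K" using K by (rule real_sqrt_ge_one)
  ultimately show "\<exists>K\<ge>1. \<forall>u\<in>vecs N.HL. nrm HL u \<le> K * nrm N.HL u" by blast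
qed

lemma equiv_ip_L2:
  assumes l: "l2_bundle B \<mu> h" "l2_bundle B \<nu> g"
    and m: "measures_mutually_bounded (atlas B) \<mu> \<nu>" "metrics_mutually_bounded B h g"
  shows "equiv_ip (L2 B \<mu> h) (L2 B \<nu> g)"
proof -
  interpret l2_bundle B \<mu> h by (rule l)
  interpret N: l2_bundle B \<nu> g by (rule l)
  obtain C C' where RN: "ae (atlas B) (\<lambda>x. RN_deriv (cara \<nu>) (cara \<mu>) x \<le> ennreal C)"
    "ae (atlas B) (\<lambda>x. RN_deriv (cara \<mu>) (cara \<nu>) x \<le> ennreal C')"
    using m(1) unfolding measures_mutually_bounded_def by blast
  obtain D where D: "D \<ge> 1" "ae (atlas B) (\<lambda>x. \<forall>u\<in>fibre B x.
     fibre_norm h x u / D \<le> fibre_norm g x u \<and> fibre_norm g x u \<le> D * fibre_norm h x u)"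
    using m(2) unfolding metrics_mutually_bounded_def by blast
  have D1: "ae (atlas B) (\<lambda>x. \<forall>u\<in>fibre B x. fibre_norm h x u \<le> D * fibre_norm g x u)"
    using D(2) unfolding ae_iff by eventually_elim (use D(1) in \<open>simp add: field_simps\<close>)
  have D2: "ae (atlas B) (\<lambda>x. \<forall>u\<in>fibre B x. fibre_norm g x u \<le> D * fibre_norm h x u)"
    using D(2) unfolding ae_iff by eventually_elim simp
  note 1 = nrm_L2_le[OF l RN(1) D(1) D1] and 2 = nrm_L2_le[OF l(2,1) RN(2) D(1) D2]
  have v: "vecs N.HL = vecs HL" using 1(1) 2(1) by blast
  obtain K where K: "K \<ge> 1" "\<forall>u\<in>vecs HL. nrm HL u \<le> K * nrm N.HL u" using 1(2) v by auto
  obtain K' where K': "K' \<ge> 1" "\<forall>u\<in>vecs HL. nrm N.HL u \<le> K' * nrm HL u" using 2(2) by auto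
  have "nrm HL u / max K K' \<le> nrm N.HL u \<and> nrm N.HL u \<le> max K K' * nrm HL u" if u: "u \<in> vecs HL" for u
  proof
    have nn: "0 \<le> nrm N.HL u" "0 \<le> nrm HL u" using nrm_HL(2) N.nrm_HL(2) u v by auto
    have "nrm HL u \<le> K * nrm N.HL u" using K u by blast
    also have "\<dots> \<le> max K K' * nrm N.HL u" using nn by (intro mult_right_mono) auto
    finally show "nrm HL u / max K K' \<le> nrm N.HL u" using K(1) by (simp add: field_simps max_def)
    have "nrm N.HL u \<le> K' * nrm HL u" using K' u by blast
    also have "\<dots> \<le> max K K' * nrm HL u" using nn by (intro mult_right_mono) auto
    finally show "nrm N.HL u \<le> max K K' * nrm HL u" .
  qed
  moreover have "max K K' \<ge> 1" using K(1) by simp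
  ultimately show ?thesis using v by (auto simp: equiv_ip_def HL_simps N.HL_simps)
qed


section \<open>Smooth bump functions\<close>

lemma Ck_on_cong:
  assumes "open W" "\<And>x. x \<in> W \<Longrightarrow> f x = g x" "Ck_on k W f" shows "Ck_on k W g"
  using assms(2,3)
proof (induction k arbitrary: f g)
  case 0
  then show ?case using continuous_on_cong[of W W f g] by simp
next
  case (Suc k)
  have d: "g differentiable (at x)" "frechet_derivative f (at x) = frechet_derivative g (at x)" if x: "x \<in> W" for x
  proof -
    have f: "f differentiable (at x)" using Suc.prems(2) x by simp
    then obtain f' where "(f has_derivative f') (at x)" by (auto simp: differentiable_def)
    then have "(g has_derivative f') (at x)"
      by (rule has_derivative_transform_within_open[OF _ assms(1) x Suc.prems(1)])
    then show "g differentiable (at x)" by (auto simp: differentiable_def)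
    show "frechet_derivative f (at x) = frechet_derivative g (at x)"
      by (rule frechet_derivative_transform_within_open[OF f assms(1) x Suc.prems(1)])
  qed
  have "Ck_on k W (\<lambda>x. frechet_derivative g (at x) v)" for v
    by (rule Suc.IH[of "\<lambda>x. frechet_derivative f (at x) v"]) (use d(2) Suc.prems(2) in auto)
  then show ?case using d(1) by simp
qed

lemma Ck_on_SucI:
  assumes "open W" "\<And>x. x \<in> W \<Longrightarrow> (f has_derivative f' x) (at x)" "\<And>v. Ck_on k W (\<lambda>x. f' x v)"
  shows "Ck_on (Suc k) W f"
proof -
  have "f' x = frechet_derivative f (at x)" if "x \<in> W" for x
    using frechet_derivative_at[OF assms(2)[OF that]] .
  then have "Ck_on k W (\<lambda>x. frechet_derivative f (at x) v)" for v
    by (intro Ck_on_cong[OF assms(1) _ assms(3)[of v]]) simp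
  then show ?thesis using assms(2) by (auto simp: differentiable_def)
qed

lemma Ck_on_SucD:
  assumes "Ck_on (Suc k) W f"
  shows "x \<in> W \<Longrightarrow> (f has_derivative frechet_derivative f (at x)) (at x)"
    "Ck_on k W (\<lambda>x. frechet_derivative f (at x) v)"
  using assms by (simp_all add: frechet_derivative_works)

lemma Ck_on_Suc_imp: assumes "Ck_on (Suc k) W f" shows "Ck_on k W f"
  using assms
proof (induction k arbitrary: f)
  case 0
  then show ?case
    by (auto intro!: continuous_at_imp_continuous_on differentiable_imp_continuous_within)
qed (simp only: Ck_on.simps, blast)

lemma Ck_on_const: "open W \<Longrightarrow> Ck_on k W (\<lambda>x. c)"
proof (induction k arbitrary: c)
  case (Suc k)
  then show ?case by (intro Ck_on_SucI[where f' = "\<lambda>x v. 0"]) auto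
qed simp

lemma Ck_on_add: "open W \<Longrightarrow> Ck_on k W f \<Longrightarrow> Ck_on k W g \<Longrightarrow> Ck_on k W (\<lambda>x. f x + g x)"
proof (induction k arbitrary: f g)
  case (Suc k)
  show ?case
  proof (rule Ck_on_SucI[OF Suc.prems(1) has_derivative_add])
    show "Ck_on k W (\<lambda>x. frechet_derivative f (at x) v + frechet_derivative g (at x) v)" for v
      by (rule Suc.IH[OF Suc.prems(1) Ck_on_SucD(2)[OF Suc.prems(2)] Ck_on_SucD(2)[OF Suc.prems(3)]])
  qed (fact Ck_on_SucD(1)[OF Suc.prems(2)] Ck_on_SucD(1)[OF Suc.prems(3)])+
qed (simp add: continuous_on_add)

lemma Ck_on_scaleR:
  "open W \<Longrightarrow> Ck_on k W f \<Longrightarrow> Ck_on k W g \<Longrightarrow> Ck_on k W (\<lambda>x. f x *\<^sub>R g x)"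
proof (induction k arbitrary: f g)
  case (Suc k)
  show ?case
  proof (rule Ck_on_SucI[OF Suc.prems(1) has_derivative_scaleR])
    show "Ck_on k W (\<lambda>x. f x *\<^sub>R frechet_derivative g (at x) v + frechet_derivative f (at x) v *\<^sub>R g x)" for v
      by (rule Ck_on_add[OF Suc.prems(1) Suc.IH[OF Suc.prems(1) Ck_on_Suc_imp[OF Suc.prems(2)] Ck_on_SucD(2)[OF Suc.prems(3)]]
          Suc.IH[OF Suc.prems(1) Ck_on_SucD(2)[OF Suc.prems(2)] Ck_on_Suc_imp[OF Suc.prems(3)]]])
  qed (fact Ck_on_SucD(1)[OF Suc.prems(2)] Ck_on_SucD(1)[OF Suc.prems(3)])+
qed (simp add: continuous_on_scaleR)

lemma Ck_on_bounded_linear: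
  assumes L: "bounded_linear L" and W: "open W" shows "Ck_on k W f \<Longrightarrow> Ck_on k W (\<lambda>x. L (f x))"
proof (induction k arbitrary: f)
  case 0
  then show ?case using bounded_linear.continuous_on[OF L] by simp
next
  case (Suc k)
  show ?case
    by (rule Ck_on_SucI[OF W bounded_linear.has_derivative[OF L Ck_on_SucD(1)[OF Suc.prems]]])
       (auto intro: Suc.IH Ck_on_SucD(2)[OF Suc.prems])
qed

lemma Ck_on_prod:
  fixes f :: "'i \<Rightarrow> 'a::real_normed_vector \<Rightarrow> real"
  assumes "open W" "\<And>i. i \<in> I \<Longrightarrow> Ck_on k W (f i)" shows "Ck_on k W (\<lambda>x. \<Prod>i\<in>I. f i x)"
  using assms(2)
proof (induction I rule: infinite_finite_induct)
  case (insert i I)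
  have "Ck_on k W (\<lambda>x. f i x *\<^sub>R (\<Prod>i\<in>I. f i x))"
    by (rule Ck_on_scaleR[OF assms(1)]) (use insert in auto)
  then show ?case using insert by simp
qed (use assms(1) in \<open>auto intro: Ck_on_const\<close>)

text \<open>Indexing the outer functions by a family closed under differentiation, via
  \<open>d\<close>, lets one induction on k handle all derivatives at once.\<close>

lemma Ck_on_compose_real:
  fixes f :: "'a::real_normed_vector \<Rightarrow> real"
  assumes F: "\<And>p t. (F p has_real_derivative F (d p) t) (at t)" and W: "open W"
  shows "Ck_on k W f \<Longrightarrow> Ck_on k W (\<lambda>x. F p (f x))"
proof (induction k arbitrary: p)
  case 0
  have "continuous_on UNIV (F p)" using F DERIV_isCont by (blast intro: continuous_at_imp_continuous_on)
  then show ?case using 0 continuous_on_compose2[of UNIV "F p" W f] by auto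
next
  case (Suc k)
  show ?case
  proof (rule Ck_on_SucI[OF W, where f' = "\<lambda>x v. frechet_derivative f (at x) v *\<^sub>R F (d p) (f x)"])
    show "((\<lambda>x. F p (f x)) has_derivative (\<lambda>v. frechet_derivative f (at x) v *\<^sub>R F (d p) (f x))) (at x)" if x: "x \<in> W" for x
      using has_derivative_compose[OF Ck_on_SucD(1)[OF Suc.prems x] F[of p "f x", unfolded has_field_derivative_def]]
      by (simp add: mult.commute)
    show "Ck_on k W (\<lambda>x. frechet_derivative f (at x) v *\<^sub>R F (d p) (f x))" for v
      by (intro Ck_on_scaleR[OF W] Suc.IH Ck_on_SucD(2)[OF Suc.prems] Ck_on_Suc_imp[OF Suc.prems])
  qed
qed

text \<open>For p = 1 this is the classical function exp (- 1 / t) that is flat at 0. The polynomial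
  factor makes the family closed under differentiation.\<close>

definition expinv :: "real poly \<Rightarrow> real \<Rightarrow> real" where
  "expinv p t = (if t > 0 then poly p (1 / t) * exp (- (1 / t)) else 0)"

lemma poly_exp_tendsto_0: "((\<lambda>s. poly p s * exp (- s)) \<longlongrightarrow> (0::real)) at_top"
proof -
  have "((\<lambda>s. \<Sum>i\<le>degree p. coeff p i * (s ^ i / exp s)) \<longlongrightarrow> (\<Sum>i\<le>degree p. coeff p i * 0)) at_top"
    by (intro tendsto_sum tendsto_mult tendsto_const tendsto_power_div_exp_0)
  then show ?thesis by (simp add: poly_altdef sum_distrib_right exp_minus divide_inverse mult.assoc)
qed

text \<open>With s = 1 / t the chain rule gives s^2 (p - p') (s) exp (- s), and
  \<open>[:0, 0, 1:]\<close> is the polynomial s^2.\<close>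

lemma expinv_deriv: "(expinv p has_real_derivative expinv ([:0, 0, 1:] * (p - pderiv p)) t) (at t)"
proof -
  consider "t < 0" | "t = 0" | "t > 0" by linarith
  then show ?thesis
  proof cases
    case 1
    have "((\<lambda>t. 0) has_real_derivative 0) (at t)" by simp
    then have "(expinv p has_real_derivative 0) (at t)"
      by (rule has_field_derivative_transform_within_open[of _ _ _ "{..<0}"]) (use 1 in \<open>auto simp: expinv_def\<close>)
    then show ?thesis using 1 by (simp add: expinv_def)
  next
    case 3
    have "((\<lambda>t. poly p (1 / t) * exp (- (1 / t))) has_real_derivative
      (poly (pderiv p) (1 / t) * (- (1 / t\<^sup>2))) * exp (- (1 / t)) + (exp (- (1 / t)) * (1 / t\<^sup>2)) * poly p (1 / t)) (at t)"
      using 3 by (auto intro!: derivative_eq_intros DERIV_chain2[OF poly_DERIV] simp: power2_eq_square divide_simps)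
    then have "(expinv p has_real_derivative
      (poly (pderiv p) (1 / t) * (- (1 / t\<^sup>2))) * exp (- (1 / t)) + (exp (- (1 / t)) * (1 / t\<^sup>2)) * poly p (1 / t)) (at t)"
      by (rule has_field_derivative_transform_within_open[of _ _ _ "{0<..}"]) (use 3 in \<open>auto simp: expinv_def\<close>)
    then show ?thesis using 3 by (simp add: expinv_def power2_eq_square algebra_simps)
  next
    case 2
    \<comment> \<open>The substitution y = 1 / s turns the difference quotient on the right into s
      p(s) exp (- s), which tends to 0 as s grows.\<close>
    have "((\<lambda>y. expinv p y / y) \<longlongrightarrow> 0) (at_right 0)"
      unfolding filterlim_at_right_to_top
    proof (rule Lim_transform_eventually[OF poly_exp_tendsto_0[of "[:0, 1:] * p"]])
      show "\<forall>\<^sub>F s in at_top. poly ([:0, 1:] * p) s * exp (- s) = expinv p (inverse s) / inverse s"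
        using eventually_gt_at_top[of 0] by eventually_elim (simp add: expinv_def field_simps)
    qed
    moreover have "((\<lambda>y. expinv p y / y) \<longlongrightarrow> 0) (at_left 0)"
    proof (rule Lim_transform_eventually[OF tendsto_const])
      show "\<forall>\<^sub>F y in at_left 0. 0 = expinv p y / y"
        unfolding eventually_at_filter by (simp add: expinv_def)
    qed
    ultimately have "((\<lambda>y. expinv p y / y) \<longlongrightarrow> 0) (at 0)" by (rule filterlim_split_at[rotated])
    then show ?thesis using 2 by (simp add: has_field_derivative_iff expinv_def)
  qed
qed

text \<open>For c > 0 the product is positive exactly on the open box. As c grows every factor tends
  to 1 there, so the indicator of the box is a pointwise limit of smooth functions bounded by
  1.\<close>

definition bump :: "real \<Rightarrow> 'a::euclidean_space \<Rightarrow> 'a \<Rightarrow> 'a \<Rightarrow> real" where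
  "bump c a b y = (\<Prod>i\<in>Basis. expinv 1 (c * ((y - a) \<bullet> i)) * expinv 1 (c * ((b - y) \<bullet> i)))"

lemma Ck_on_bump:
  fixes f :: "'a::real_normed_vector \<Rightarrow> 'b::euclidean_space"
  assumes W: "open W" and f: "Ck_on k W f"
  shows "Ck_on k W (\<lambda>x. bump c a b (f x))"
  unfolding bump_def
proof (intro Ck_on_prod W)
  fix i :: 'b
  have E: "Ck_on k W (\<lambda>x. expinv 1 (g x))" if "Ck_on k W g" for g :: "'a \<Rightarrow> real"
    by (rule Ck_on_compose_real[where F = expinv and p = 1, OF expinv_deriv W that])
  have L: "Ck_on k W (\<lambda>x. s *\<^sub>R (f x \<bullet> i) + r)" for s r
    by (intro Ck_on_add Ck_on_scaleR Ck_on_const W Ck_on_bounded_linear[OF bounded_linear_inner_left _ f])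
  have "Ck_on k W (\<lambda>x. expinv 1 (c *\<^sub>R (f x \<bullet> i) + (- c * (a \<bullet> i))) *\<^sub>R expinv 1 ((- c) *\<^sub>R (f x \<bullet> i) + c * (b \<bullet> i)))"
    by (intro Ck_on_scaleR W E L)
  then show "Ck_on k W (\<lambda>x. expinv 1 (c * ((f x - a) \<bullet> i)) * expinv 1 (c * ((b - f x) \<bullet> i)))"
    by (simp add: inner_diff_left algebra_simps)
qed

lemma expinv_1: "expinv 1 t = (if t > 0 then exp (- (1 / t)) else 0)"
  by (simp add: expinv_def)

lemma bump_bounds: "0 \<le> bump c a b y" "bump c a b y \<le> 1"
proof -
  have e: "0 \<le> expinv 1 t" "expinv 1 t \<le> 1" for t by (simp_all add: expinv_1)
  show "0 \<le> bump c a b y" unfolding bump_def by (intro prod_nonneg) (simp add: e)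
  show "bump c a b y \<le> 1" unfolding bump_def by (intro prod_le_1) (simp add: e mult_le_one)
qed

lemma bump_eq_0_iff: "c > 0 \<Longrightarrow> bump c a b y = 0 \<longleftrightarrow> y \<notin> box a b"
proof -
  assume "c > 0"
  then have e: "expinv 1 (c * t) = 0 \<longleftrightarrow> t \<le> 0" for t
    by (auto simp: expinv_1 zero_less_mult_iff)
  have "bump c a b y = 0 \<longleftrightarrow> (\<exists>i\<in>Basis. y \<bullet> i \<le> a \<bullet> i \<or> b \<bullet> i \<le> y \<bullet> i)"
    by (simp add: bump_def e inner_diff_left)
  then show ?thesis unfolding mem_box by (meson not_less)
qed

lemma bump_tendsto: "(\<lambda>n. bump (real (Suc n)) a b y) \<longlonglongrightarrow> indicator (box a b) y"
proof (cases "y \<in> box a b")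
  case True
  have e: "(\<lambda>n. expinv 1 (real (Suc n) * t)) \<longlonglongrightarrow> 1" if t: "t > 0" for t
  proof -
    have "(\<lambda>n. exp (- ((1 / t) * inverse (real (Suc n))))) \<longlonglongrightarrow> exp (- ((1 / t) * 0))"
      by (intro tendsto_intros LIMSEQ_inverse_real_of_nat)
    moreover have "exp (- ((1 / t) * inverse (real (Suc n)))) = expinv 1 (real (Suc n) * t)" for n
      using mult_pos_pos[OF of_nat_0_less_iff[THEN iffD2, OF zero_less_Suc] t, of n]
      by (simp add: expinv_1 divide_inverse mult.commute del: of_nat_Suc)
    ultimately show ?thesis by simp
  qed
  have "(\<lambda>n. bump (real (Suc n)) a b y) \<longlonglongrightarrow> (\<Prod>i\<in>(Basis :: 'a set). 1 * 1)"
    unfolding bump_def using True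
    by (intro tendsto_prod tendsto_mult e) (auto simp: mem_box inner_diff_left)
  then show ?thesis using True by simp
next
  case False
  then have "bump (real (Suc n)) a b y = 0" for n by (simp add: bump_eq_0_iff del: of_nat_Suc)
  then show ?thesis using False by simp
qed


lemma Ck_on_subset: "W \<subseteq> W' \<Longrightarrow> Ck_on k W' f \<Longrightarrow> Ck_on k W f"
proof (induction k arbitrary: f)
  case 0
  then show ?case by (auto intro: continuous_on_subset)
next
  case (Suc k)
  show ?case unfolding Ck_on.simps
  proof (intro conjI ballI allI)
    show "f differentiable at x" if "x \<in> W" for x using Suc.prems that by auto
    show "Ck_on k W (\<lambda>x. frechet_derivative f (at x) v)" for v
      by (rule Suc.IH[OF Suc.prems(1) Ck_on_SucD(2)[OF Suc.prems(2)]])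
  qed
qed

section \<open>Smooth sections supported in a chart\<close>

context vec_bundle begin

lemma chartE:
  assumes "(U, \<psi>) \<in> atlas B"
  obtains g where "open U" "homeomorphism U (\<psi> ` U) \<psi> g"
    "open (\<psi> ` U) \<or> (\<exists>i. openin (top_of_set {y. 0 \<le> y $ i}) (\<psi> ` U))"
proof -
  have "is_chart (U, \<psi>)" using assms smooth unfolding smooth_bundle_def smooth_structure_def by blast
  then show thesis using that by (auto simp: is_chart_def)
qed

lemma inv_into_chart:
  assumes "(U, \<psi>) \<in> atlas B" "x \<in> U" shows "inv_into U \<psi> (\<psi> x) = x"
proof -
  obtain g where "homeomorphism U (\<psi> ` U) \<psi> g" by (rule chartE[OF assms(1)])
  then have "inj_on \<psi> U" by (metis homeomorphism_apply1 inj_onI)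
  then show ?thesis using assms(2) by (rule inv_into_f_f)
qed

lemma chart_image_open:
  assumes c: "(U, \<psi>) \<in> atlas B" and O: "open O'"
  obtains W where "open W" "\<psi> ` (U \<inter> O') = \<psi> ` U \<inter> W"
proof -
  obtain g where U: "open U" and g: "homeomorphism U (\<psi> ` U) \<psi> g" by (rule chartE[OF c])
  have "openin (top_of_set U) (U \<inter> O')" using O by (rule openin_open_Int)
  from homeomorphism_imp_open_map[OF g this] show thesis using that by (auto simp: openin_open)
qed

text \<open>In a boundary chart only image points on the bounding hyperplane can fail to be
  interior, and a hyperplane is negligible; the image of any other chart is open.\<close>

lemma ae_manifold_interior: "- manifold_interior (atlas B) \<in> Zero (atlas B)"
  unfolding Zero_def
proof (safe)
  fix U \<psi> assume c: "(U, \<psi>) \<in> atlas B"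
  have sub: "\<psi> ` (- manifold_interior (atlas B) \<inter> U) \<subseteq> \<psi> ` U - interior (\<psi> ` U)"
    using c by (auto simp: manifold_interior_def)
  have "negligible (\<psi> ` U - interior (\<psi> ` U))"
    using chartE[OF c]
  proof cases
    case (1 g)
    show ?thesis
    proof (cases "open (\<psi> ` U)")
      case True
      then show ?thesis by (simp add: interior_open)
    next
      case False
      then obtain i where "openin (top_of_set {y. 0 \<le> y $ i}) (\<psi> ` U)" using 1 by blast
      then obtain W where W: "open W" "\<psi> ` U = {y. 0 \<le> y $ i} \<inter> W" by (auto simp: openin_open)
      have "open {y :: real^'n. 0 < y $ i}" by (rule open_Collect_less) (auto intro: continuous_intros)
      then have "{y. 0 < y $ i} \<inter> W \<subseteq> interior (\<psi> ` U)" unfolding W(2) using W(1) by (intro interior_maximal) auto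
      then have "\<psi> ` U - interior (\<psi> ` U) \<subseteq> {y. y $ i = 0}" unfolding W(2) by (auto simp: less_le)
      then show ?thesis by (rule negligible_subset[OF negligible_standard_hyperplane_cart])
    qed
  qed
  then show "\<psi> ` (- manifold_interior (atlas B) \<inter> U) \<in> null_sets lebesgue"
    using negligible_subset[OF _ sub] by (simp add: negligible_iff_null_sets)
qed

definition chart_section ::
  "('m \<Rightarrow> real ^ 'n) \<Rightarrow> 'm set \<Rightarrow> ('m \<Rightarrow> 'v \<Rightarrow> 'k ^ 'r) \<Rightarrow> 'r \<Rightarrow> (real ^ 'n \<Rightarrow> real) \<Rightarrow> 'm \<Rightarrow> 'v" where
  "chart_section \<psi> V \<tau> i \<phi> x = (if x \<in> V then vscale B (of_real (\<phi> (\<psi> x))) (frame B \<tau> i x) else 0)"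

lemma chart_section_in_fibre:
  assumes "(V', \<tau>) \<in> trivs B" "V \<subseteq> V'"
  shows "chart_section \<psi> V \<tau> i \<phi> x \<in> fibre B x"
  using assms by (auto simp: chart_section_def intro!: fibre_scale frame_in)

text \<open>Smoothness is checked in an arbitrary chart and trivialisation on two open pieces: off
  the compact preimage of K the section vanishes, and near it it is \<phi> of a transition map times
  smooth frame coefficients. Smoothness of \<phi> is assumed in the form of stability under
  composition, the only form needed in this product.\<close>

lemma chart_section_Ccc:
  assumes c: "(U, \<psi>) \<in> atlas B" and t: "(V, \<tau>) \<in> trivs B"
    and K: "compact K" "K \<subseteq> \<psi> ` (U \<inter> V)" "K \<subseteq> interior (\<psi> ` U)" "\<And>y. y \<notin> K \<Longrightarrow> \<phi> y = 0"
    and \<phi>: "\<And>k W (G :: real^'n \<Rightarrow> real^'n). open W \<Longrightarrow> Ck_on k W G \<Longrightarrow> Ck_on k W (\<lambda>x. \<phi> (G x))"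
  shows "chart_section \<psi> (U \<inter> V) \<tau> i \<phi> \<in> Ccc B"
proof -
  let ?f = "chart_section \<psi> (U \<inter> V) \<tau> i \<phi>"
  obtain g where U: "open U" and g: "homeomorphism U (\<psi> ` U) \<psi> g" by (rule chartE[OF c])
  have V: "open V" by (rule trivD(1)[OF t])
  have gK: "compact (g ` K)"
    by (rule compact_continuous_image[OF continuous_on_subset[OF homeomorphism_cont2[OF g]] K(1)]) (use K(2) in blast)
  have gKUV: "g ` K \<subseteq> U \<inter> V" using K(2) homeomorphism_apply1[OF g] by fastforce
  have cl: "closed (g ` K)" by (rule compact_imp_closed[OF gK])
  have out: "?f x = 0" if x: "x \<notin> g ` K" for x
  proof (cases "x \<in> U \<inter> V")
    case True
    then have "\<psi> x \<notin> K" using homeomorphism_apply1[OF g, of x] x by (metis IntD1 imageI)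
    interpret vs: vector_space "vscale B" by (rule vs)
    show ?thesis using \<open>\<psi> x \<notin> K\<close> by (simp add: chart_section_def K(4))
  qed (auto simp: chart_section_def)
  have spt: "spt ?f \<subseteq> g ` K" unfolding spt_def by (rule closure_minimal[OF _ cl]) (use out in blast)
  have "g ` K \<subseteq> manifold_interior (atlas B)"
  proof
    fix x assume "x \<in> g ` K"
    then obtain y where y: "y \<in> K" "x = g y" by blast
    then have "y \<in> \<psi> ` U" using K(2) by blast
    then have "\<psi> x = y" using homeomorphism_apply2[OF g] y(2) by simp
    then have "x \<in> U" "\<psi> x \<in> interior (\<psi> ` U)" using y gKUV K(3) by auto
    then show "x \<in> manifold_interior (atlas B)" using c by (auto simp: manifold_interior_def)
  qed
  moreover have "compact (spt ?f)"
    using compact_Int_closed[OF gK, of "spt ?f"] spt by (simp add: spt_def Int_absorb1)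
  moreover have "msmooth_on (atlas B) V' (\<lambda>x. \<tau>' x (?f x))" if t': "(V', \<tau>') \<in> trivs B" for V' \<tau>'
    unfolding msmooth_on_def
  proof (safe)
    fix U' \<psi>' assume c': "(U', \<psi>') \<in> atlas B"
    let ?h = "(\<lambda>x. \<tau>' x (?f x)) \<circ> inv_into U' \<psi>'"
    show "smooth_on (\<psi>' ` (U' \<inter> V')) ?h" unfolding smooth_on_def
    proof
      fix y assume "y \<in> \<psi>' ` (U' \<inter> V')"
      then obtain x where x: "x \<in> U'" "x \<in> V'" "y = \<psi>' x" by blast
      show "\<exists>W G. open W \<and> y \<in> W \<and> (\<forall>k. Ck_on k W G) \<and> (\<forall>z\<in>W \<inter> \<psi>' ` (U' \<inter> V'). G z = ?h z)"
      proof (cases "x \<in> g ` K")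
        case False
        obtain W where W: "open W" "\<psi>' ` (U' \<inter> - g ` K) = \<psi>' ` U' \<inter> W"
          by (rule chart_image_open[OF c' open_Compl[OF cl]])
        have "y \<in> W" using W(2) x False by blast
        moreover have "0 = ?h z" if z: "z \<in> W \<inter> \<psi>' ` (U' \<inter> V')" for z
        proof -
          have "z \<in> \<psi>' ` (U' \<inter> - g ` K)" using W(2) z by blast
          then obtain a where a: "a \<in> U'" "a \<notin> g ` K" "z = \<psi>' a" by blast
          obtain b where b: "b \<in> U'" "b \<in> V'" "z = \<psi>' b" using z by blast
          have "a = b" using inv_into_chart[OF c' a(1)] inv_into_chart[OF c' b(1)] a(3) b(3) by simp
          then show ?thesis using inv_into_chart[OF c' a(1)] a(2,3) b(2) by (simp add: out trivD(6)[OF t'])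
        qed
        ultimately show ?thesis using W(1) by (intro exI[of _ W] exI[of _ "\<lambda>z. 0"]) (auto intro: Ck_on_const)
      next
        case True
        then have xUV: "x \<in> U" "x \<in> V" using gKUV by auto
        have "charts_compatible (U', \<psi>') (U, \<psi>)"
          using smooth c c' unfolding smooth_bundle_def smooth_structure_def by blast
        then have "smooth_on (\<psi>' ` (U' \<inter> U)) (\<psi> \<circ> inv_into U' \<psi>')" by (simp add: charts_compatible_def)
        moreover have "y \<in> \<psi>' ` (U' \<inter> U)" using x xUV by blast
        ultimately obtain W1 g1 where 1: "open W1" "y \<in> W1" "\<And>k. Ck_on k W1 g1"
          "\<And>z. z \<in> W1 \<inter> \<psi>' ` (U' \<inter> U) \<Longrightarrow> g1 z = (\<psi> \<circ> inv_into U' \<psi>') z"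
          unfolding smooth_on_def by metis
        have "trivs_compatible B (V, \<tau>) (V', \<tau>')"
          using smooth t t' unfolding smooth_bundle_def by blast
        then have "msmooth_on (atlas B) (V \<inter> V') (\<lambda>x. \<tau>' x (frame B \<tau> i x))" by (simp add: trivs_compatible_def)
        then have "smooth_on (\<psi>' ` (U' \<inter> (V \<inter> V'))) ((\<lambda>x. \<tau>' x (frame B \<tau> i x)) \<circ> inv_into U' \<psi>')"
          using c' unfolding msmooth_on_def by blast
        moreover have "y \<in> \<psi>' ` (U' \<inter> (V \<inter> V'))" using x xUV by blast
        ultimately obtain W2 g2 where 2: "open W2" "y \<in> W2" "\<And>k. Ck_on k W2 g2"
          "\<And>z. z \<in> W2 \<inter> \<psi>' ` (U' \<inter> (V \<inter> V')) \<Longrightarrow> g2 z = ((\<lambda>x. \<tau>' x (frame B \<tau> i x)) \<circ> inv_into U' \<psi>') z"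
          unfolding smooth_on_def by metis
        \<comment> \<open>The extensions g1 and g2 agree with the maps they extend only on chart
          points coming from the right domains; W3 restricts to those.\<close>
        obtain W3 where W3: "open W3" "\<psi>' ` (U' \<inter> (U \<inter> V \<inter> V')) = \<psi>' ` U' \<inter> W3"
          by (rule chart_image_open[OF c' open_Int[OF open_Int[OF U V] trivD(1)[OF t']]])
        let ?W = "W1 \<inter> W2 \<inter> W3"
        have W: "open ?W" using 1(1) 2(1) W3(1) by blast
        have "y \<in> \<psi>' ` (U' \<inter> (U \<inter> V \<inter> V'))" using x xUV by blast
        then have "y \<in> ?W" using 1(2) 2(2) W3(2) by blast
        moreover have "Ck_on k ?W (\<lambda>z. \<phi> (g1 z) *\<^sub>R g2 z)" for k
          by (intro Ck_on_scaleR[OF W] \<phi>[OF W] Ck_on_subset[OF _ 1(3)] Ck_on_subset[OF _ 2(3)]) auto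
        moreover have "\<phi> (g1 z) *\<^sub>R g2 z = ?h z" if z: "z \<in> ?W \<inter> \<psi>' ` (U' \<inter> V')" for z
        proof -
          have "z \<in> \<psi>' ` (U' \<inter> (U \<inter> V \<inter> V'))" using W3(2) z by blast
          then obtain a where a: "a \<in> U'" "a \<in> U" "a \<in> V" "a \<in> V'" "z = \<psi>' a" by blast
          have inv: "inv_into U' \<psi>' z = a" using inv_into_chart[OF c' a(1)] a(5) by simp
          have "g1 z = \<psi> a" using 1(4)[of z] z a inv by auto
          moreover have "g2 z = \<tau>' a (frame B \<tau> i a)" using 2(4)[of z] z a inv by auto
          moreover have "of_real s *s y = s *\<^sub>R y" for s and y :: "'k^'r"
            by (simp add: vec_eq_iff scaleR_conv_of_real[where 'a = 'k])
          ultimately show ?thesis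
            using a inv by (simp add: chart_section_def trivD(4)[OF t'] frame_in[OF t])
        qed
        ultimately show ?thesis using W by (intro exI[of _ ?W] exI[of _ "\<lambda>z. \<phi> (g1 z) *\<^sub>R g2 z"]) blast
      qed
    qed
  qed
  moreover have "?f x \<in> fibre B x" for x by (rule chart_section_in_fibre[OF t]) auto
  ultimately show ?thesis using spt unfolding Ccc_def smooth_sections_def by blast
qed

end


section \<open>Density of smooth sections with compact support\<close>

context l2_bundle begin

lemma finite_compact: "compact K \<Longrightarrow> emeasure M K < \<infinity>"
  using lecm by (simp add: emeasure_M[OF borel_sets_M[OF borel_compact]] LECM_def radon_outer_def)

text \<open>Outer regularity gives a Borel set of the same measure, and finiteness lets the measures
  be subtracted.\<close>

lemma borel_hull:
  assumes A: "A \<in> sets M" "emeasure M A < \<infinity>"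
  obtains S where "S \<in> sets borel" "A \<subseteq> S" "S - A \<in> null_sets M"
proof -
  have "\<forall>A. \<exists>S\<in>sets borel. A \<subseteq> S \<and> \<mu> S = \<mu> A" using lecm by (simp add: LECM_def radon_outer_def)
  then obtain S where S: "S \<in> sets borel" "A \<subseteq> S" "\<mu> S = \<mu> A" by metis
  have Ss: "S \<in> sets M" by (rule borel_sets_M[OF S(1)])
  have "emeasure M S = emeasure M A" using S(3) by (simp add: emeasure_M A Ss)
  then have "emeasure M (S - A) = 0"
    using emeasure_Diff[OF _ Ss A(1) S(2)] A(2) by simp
  then have "S - A \<in> null_sets M" using Ss A(1) by auto
  then show thesis using that S by blast
qed

lemma chart_vimage_borel:
  assumes c: "(U, \<psi>) \<in> atlas B" and S: "S \<in> sets borel"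
  shows "{x \<in> U. \<psi> x \<in> S} \<in> sets borel"
proof -
  obtain g where U: "open U" and g: "homeomorphism U (\<psi> ` U) \<psi> g" by (rule chartE[OF c])
  have "\<psi> \<in> borel_measurable (restrict_space borel U)"
    by (rule borel_measurable_continuous_on_restrict[OF homeomorphism_cont1[OF g]])
  from measurable_sets[OF this S] have "\<psi> -` S \<inter> U \<in> sets (restrict_space borel U)"
    by (simp add: space_restrict_space)
  then show ?thesis using U by (simp add: sets_restrict_space_iff Int_def conj_commute)
qed

text \<open>Boxes generate the Borel sets of the chart domain, so vanishing on boxes is enough.\<close>

lemma AE_zero_of_boxes:
  fixes w :: "'m \<Rightarrow> 'b::{banach, second_countable_topology}"
  assumes c: "(U, \<psi>) \<in> atlas B" and w: "integrable M w"
    and N: "cbox a0 c0 \<subseteq> \<psi> ` U" and out: "\<And>x. x \<notin> U \<or> \<psi> x \<notin> box a0 c0 \<Longrightarrow> w x = 0"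
    and box: "\<And>a c. (LINT x:{x \<in> U. \<psi> x \<in> box a c}|M. w x) = 0"
  shows "AE x in M. w x = 0"
proof -
  interpret sigma_finite_measure M by (rule sigma_finite_M)
  obtain g where U: "open U" and g: "homeomorphism U (\<psi> ` U) \<psi> g" by (rule chartE[OF c])
  let ?E = "\<lambda>S. {x \<in> U. \<psi> x \<in> S}"
  have E: "?E S \<in> sets M" if "S \<in> sets borel" for S by (rule borel_sets_M[OF chart_vimage_borel[OF c that]])
  have si: "set_integrable M A w" if "A \<in> sets M" for A
    unfolding set_integrable_def by (rule integrable_mult_indicator[OF that w])
  \<comment> \<open>The complement step of the induction needs the integral over the whole chart,
    which is not the preimage of a box. As w vanishes off the box from a0 to c0, that box does the
    job.\<close>
  have Ebox: "(LINT x:?E UNIV|M. w x) = 0"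
  proof -
    have "(LINT x:?E UNIV|M. w x) = (LINT x:?E (box a0 c0)|M. w x)"
      unfolding set_lebesgue_integral_def
      by (rule Bochner_Integration.integral_cong) (auto simp: indicator_def out)
    then show ?thesis using box by simp
  qed
  have borel: "(LINT x:?E S|M. w x) = 0" if "S \<in> sets borel" for S
  proof -
    let ?G = "range (\<lambda>(a, b). box a b :: (real^'n) set)"
    have "Int_stable ?G" by (auto simp: Int_stable_def box_Int_box)
    moreover have "?G \<subseteq> Pow UNIV" by simp
    moreover have "S \<in> sigma_sets UNIV ?G" using that by (simp add: borel_eq_box)
    ultimately show ?thesis
    proof (induction rule: sigma_sets_induct_disjoint)
      case (basic A)
      then show ?case using box by auto
    next
      case empty
      show ?case by (simp add: set_lebesgue_integral_def)
    next
      case (compl A)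
      have A: "A \<in> sets borel" using compl(1) by (simp add: borel_eq_box)
      have "(LINT x:?E A \<union> ?E (UNIV - A)|M. w x) = (LINT x:?E A|M. w x) + (LINT x:?E (UNIV - A)|M. w x)"
      proof (rule set_integral_Un)
        have "UNIV - A \<in> sets borel" using A by auto
        then show "set_integrable M (?E A) w" "set_integrable M (?E (UNIV - A)) w" using A by (intro si E; simp)+
      qed auto
      moreover have "?E A \<union> ?E (UNIV - A) = ?E UNIV" by auto
      ultimately show ?case using compl Ebox by simp
    next
      case (union A)
      have A: "A i \<in> sets borel" for i using union(2) by (auto simp: borel_eq_box)
      have eq: "?E (\<Union>i. A i) = (\<Union>i. ?E (A i))" by auto
      have "(LINT x:(\<Union>i. ?E (A i))|M. w x) = (\<Sum>i. LINT x:?E (A i)|M. w x)"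
      proof (rule lebesgue_integral_countable_add)
        show "?E (A i) \<inter> ?E (A j) = {}" if "i \<noteq> j" for i j
          using union(1) that by (auto simp: disjoint_family_on_def)
        show "set_integrable M (\<Union>i. ?E (A i)) w" by (intro si sets.countable_UN) (use A E in auto)
      qed (use A E in auto)
      then show ?case unfolding eq using union(3) by simp
    qed
  qed
  show ?thesis
  proof (rule density_zero[OF w])
    fix A assume A: "A \<in> sets M"
    let ?b = "box a0 c0"
    have Eb: "?E ?b \<in> sets M" by (rule E) simp
    have "?E ?b \<subseteq> g ` cbox a0 c0"
      using homeomorphism_apply1[OF g] box_subset_cbox[of a0 c0] by force
    moreover have cK: "compact (g ` cbox a0 c0)"
      by (rule compact_continuous_image[OF continuous_on_subset[OF homeomorphism_cont2[OF g] N]]) simp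
    ultimately have "emeasure M (A \<inter> ?E ?b) \<le> emeasure M (g ` cbox a0 c0)"
      by (intro emeasure_mono borel_sets_M borel_compact) auto
    then have fin: "emeasure M (A \<inter> ?E ?b) < \<infinity>" using finite_compact[OF cK] by (rule order.strict_trans1)
    \<comment> \<open>A is only Caratheodory measurable. Inside the box it has finite measure by
      compactness, so it is a Borel set S up to a null set, and S becomes the preimage of a Borel
      set of the coordinate space through g.\<close>
    obtain S where S: "S \<in> sets borel" "A \<inter> ?E ?b \<subseteq> S" "S - A \<inter> ?E ?b \<in> null_sets M"
      by (rule borel_hull[OF sets.Int[OF A Eb] fin])
    let ?S = "{y \<in> ?b. g y \<in> S}"
    have "g \<in> borel_measurable (restrict_space borel ?b)"
      by (rule borel_measurable_continuous_on_restrict[OF continuous_on_subset[OF homeomorphism_cont2[OF g]]])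
         (use N box_subset_cbox in blast)
    from measurable_sets[OF this S(1)] have "g -` S \<inter> ?b \<in> sets (restrict_space borel ?b)"
      by (simp add: space_restrict_space)
    then have Sb: "?S \<in> sets borel" by (simp add: sets_restrict_space_iff Int_def conj_commute)
    have ES: "?E ?S = S \<inter> ?E ?b" using homeomorphism_apply1[OF g] by auto
    have "AE x in M. x \<notin> S - A \<inter> ?E ?b" by (rule AE_not_in[OF S(3)])
    then have "AE x in M. indicator A x *\<^sub>R w x = indicator (?E ?S) x *\<^sub>R w x"
    proof eventually_elim
      case (elim x)
      show ?case
      proof (cases "x \<in> ?E ?b")
        case True
        then have "x \<in> A \<longleftrightarrow> x \<in> ?E ?S" using elim S(2) ES by blast
        then show ?thesis by (simp only: indicator_def of_bool_def)
      next
        case False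
        then show ?thesis using out[of x] by auto
      qed
    qed
    then have "(LINT x:A|M. w x) = (LINT x:?E ?S|M. w x)"
      unfolding set_lebesgue_integral_def
      by (intro integral_cong_AE borel_measurable_scaleR borel_measurable_indicator A E[OF Sb] borel_measurable_integrable[OF w])
    then show "(LINT x:A|M. w x) = 0" using borel[OF Sb] by simp
  qed
qed

text \<open>The section inherits measurability and square integrability from its class, and any
  extension has the classes of all such sections in its domain.\<close>

lemma Ccc_SQ:
  assumes f: "f \<in> Ccc B" "aecls B f \<in> vecs HL"
  shows "f \<in> SQ" "AE x in M. rep (aecls B f) x = f x"
proof -
  let ?r = "rep (aecls B f)"
  note r = vecsD[OF f(2)]
  show ae: "AE x in M. ?r x = f x" by (rule rep_aecls_vecs[OF f(2)])
  have "f \<in> L0 B" by (rule L0_AE_cong[OF SQ_L0[OF r(1)] ae]) (use f(1) in \<open>simp add: Ccc_def smooth_sections_def\<close>)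
  then show "f \<in> SQ" using r(1) sqn_cong[OF ae] by (simp add: SQ_def)
qed

text \<open>Testing u with a cutoff times a bump times a frame vector and letting the bump tend to
  the indicator of a box shows, by dominated convergence, that the pairing of u with the cut-off
  frame vector has integral 0 over every box, hence vanishes. Where the cutoff is positive, all
  frame pairings of u vanish, and positivity of the metric gives u = 0.\<close>

lemma orth_Ccc_local:
  assumes u: "u \<in> SQ" and C: "\<And>f. f \<in> Ccc B \<Longrightarrow> aecls B f \<in> vecs HL"
    and z: "\<And>f. f \<in> Ccc B \<Longrightarrow> (\<integral>x. h x (f x) (u x) \<partial>M) = 0"
    and p: "p \<in> manifold_interior (atlas B)"
  shows "\<exists>O'. open O' \<and> p \<in> O' \<and> (AE x in M. x \<in> O' \<longrightarrow> u x = 0)"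
proof -
  obtain U \<psi> where c: "(U, \<psi>) \<in> atlas B" and pU: "p \<in> U" "\<psi> p \<in> interior (\<psi> ` U)"
    using p by (auto simp: manifold_interior_def)
  obtain V \<tau> where t: "(V, \<tau>) \<in> trivs B" and pV: "p \<in> V" by (rule ex_triv)
  obtain g where U: "open U" and g: "homeomorphism U (\<psi> ` U) \<psi> g" by (rule chartE[OF c])
  obtain W where W: "open W" "\<psi> ` (U \<inter> V) = \<psi> ` U \<inter> W" by (rule chart_image_open[OF c trivD(1)[OF t]])
  have "open (interior (\<psi> ` U) \<inter> W)" using W(1) by auto
  moreover have "\<psi> p \<in> interior (\<psi> ` U) \<inter> W" using pU pV W(2) by blast
  ultimately obtain a0 c0 where K: "cbox a0 c0 \<subseteq> interior (\<psi> ` U) \<inter> W" "\<psi> p \<in> box a0 c0"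
    by (rule open_contains_cbox)
  have KU: "cbox a0 c0 \<subseteq> \<psi> ` U" using K(1) interior_subset by blast
  \<comment> \<open>This fixed cutoff confines all test sections to one compact box in the chart,
    whatever the boxes of the approximating bumps, and supplies the integrable majorant.\<close>
  let ?b0 = "bump 1 a0 c0 :: real^'n \<Rightarrow> real"
  have b0_out: "?b0 y = 0" if "y \<notin> box a0 c0" for y using that bump_eq_0_iff[of 1 a0 c0 y] by simp
  have Ccc: "chart_section \<psi> (U \<inter> V) \<tau> i \<phi> \<in> Ccc B"
    if "\<And>y. y \<notin> box a0 c0 \<Longrightarrow> \<phi> y = 0" "\<And>k W (G :: real^'n \<Rightarrow> real^'n). open W \<Longrightarrow> Ck_on k W G \<Longrightarrow> Ck_on k W (\<lambda>x. \<phi> (G x))" for i \<phi>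
  proof (rule chart_section_Ccc[OF c t compact_cbox _ _ _ that(2)])
    show "cbox a0 c0 \<subseteq> \<psi> ` (U \<inter> V)" "cbox a0 c0 \<subseteq> interior (\<psi> ` U)" using K(1) KU W(2) by auto
    show "\<phi> y = 0" if "y \<notin> cbox a0 c0" for y
      using that box_subset_cbox[of a0 c0] by (intro \<open>\<And>y. y \<notin> box a0 c0 \<Longrightarrow> \<phi> y = 0\<close>) blast
  qed
  have fin: "AE x in M. ?b0 (\<psi> x) \<noteq> 0 \<and> x \<in> U \<inter> V \<longrightarrow> h x (frame B \<tau> i x) (u x) = 0" for i
  proof -
    let ?F = "chart_section \<psi> (U \<inter> V) \<tau> i"
    define w where "w x = h x (?F ?b0 x) (u x)" for x
    have hF: "h x (?F \<phi> x) (u x) = (if x \<in> U \<inter> V then \<phi> (\<psi> x) *\<^sub>R h x (frame B \<tau> i x) (u x) else 0)" for \<phi> x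
      by (auto simp: chart_section_def hermitian_form_simps(2,4)[OF hermitian] L0_fibre[OF SQ_L0[OF u]] frame_in[OF t] scaleR_conv_of_real)
    have C0: "?F ?b0 \<in> Ccc B" by (rule Ccc[OF b0_out Ck_on_bump])
    have Cn: "?F (\<lambda>y. ?b0 y * bump (real (Suc n)) a c y) \<in> Ccc B" for n a c
    proof (rule Ccc)
      fix k W and G :: "real^'n \<Rightarrow> real^'n"
      assume "open W" "Ck_on k W G"
      then have "Ck_on k W (\<lambda>x. ?b0 (G x) *\<^sub>R bump (real (Suc n)) a c (G x))"
        by (intro Ck_on_scaleR Ck_on_bump)
      then show "Ck_on k W (\<lambda>x. ?b0 (G x) * bump (real (Suc n)) a c (G x))" by simp
    qed (simp add: b0_out)
    have wi: "integrable M w" unfolding w_def by (rule integrable_h[OF Ccc_SQ(1)[OF C0 C[OF C0]] u])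
    have w_out: "w x = 0" if "x \<notin> U \<or> \<psi> x \<notin> box a0 c0" for x
      using that by (auto simp: w_def hF b0_out)
    have box: "(LINT x:{x \<in> U. \<psi> x \<in> box a c}|M. w x) = 0" for a c
    proof -
      let ?s = "\<lambda>n x. bump (real (Suc n)) a c (\<psi> x) *\<^sub>R w x"
      let ?l = "\<lambda>x. indicator {x \<in> U. \<psi> x \<in> box a c} x *\<^sub>R w x"
      have s_eq: "?s n = (\<lambda>x. h x (?F (\<lambda>y. ?b0 y * bump (real (Suc n)) a c y) x) (u x))" for n
        by (auto simp: fun_eq_iff w_def hF)
      have l_eq: "?l x = indicator (box a c) (\<psi> x) *\<^sub>R w x" for x
        using w_out[of x] by (auto simp: indicator_def)
      have sm: "?s n \<in> borel_measurable M" for n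
        unfolding s_eq by (intro h_measurable SQ_L0 u Ccc_SQ(1)[OF Cn C[OF Cn]])
      have lim: "(\<lambda>n. ?s n x) \<longlonglongrightarrow> ?l x" for x
        unfolding l_eq by (intro tendsto_scaleR tendsto_const bump_tendsto)
      have "(\<lambda>n. integral\<^sup>L M (?s n)) \<longlonglongrightarrow> integral\<^sup>L M ?l"
      proof (rule integral_dominated_convergence[where w = "\<lambda>x. norm (w x)"])
        show "?l \<in> borel_measurable M" by (rule borel_measurable_LIMSEQ_metric[OF sm lim])
        show "AE x in M. norm (?s n x) \<le> norm (w x)" for n
          using bump_bounds[of "real (Suc n)" a c] by (intro AE_I2) (simp add: mult_left_le_one_le del: of_nat_Suc)
      qed (use sm lim wi in auto)
      moreover have "integral\<^sup>L M (?s n) = 0" for n unfolding s_eq by (rule z[OF Cn])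
      ultimately have "(\<lambda>n. 0) \<longlonglongrightarrow> integral\<^sup>L M ?l" by simp
      then show ?thesis unfolding set_lebesgue_integral_def by (rule LIMSEQ_unique[OF _ tendsto_const, symmetric, THEN sym])
    qed
    have "AE x in M. w x = 0" by (rule AE_zero_of_boxes[OF c wi KU w_out box])
    then show ?thesis by eventually_elim (auto simp: w_def hF)
  qed
  have "AE x in M. \<forall>i\<in>UNIV. ?b0 (\<psi> x) \<noteq> 0 \<and> x \<in> U \<inter> V \<longrightarrow> h x (frame B \<tau> i x) (u x) = 0"
    by (rule AE_finite_allI) (use fin in auto)
  then have ae: "AE x in M. x \<in> U \<inter> V \<inter> \<psi> -` box a0 c0 \<longrightarrow> u x = 0"
    using AE_posdef
  proof eventually_elim
    case (elim x)
    show ?case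
    proof
      assume x: "x \<in> U \<inter> V \<inter> \<psi> -` box a0 c0"
      have ux: "u x \<in> fibre B x" by (rule L0_fibre[OF SQ_L0[OF u]])
      have "?b0 (\<psi> x) \<noteq> 0" using x bump_eq_0_iff[of 1 a0 c0 "\<psi> x"] by simp
      then have "h x (frame B \<tau> i x) (u x) = 0" for i using elim(1) x by blast
      then have "h x (u x) (u x) = 0" using hermitian_frame[OF t _ ux ux] x by simp
      then show "u x = 0" using elim(2) ux by (auto simp: posdef_def)
    qed
  qed
  have "open (U \<inter> \<psi> -` box a0 c0)"
    by (rule continuous_open_preimage[OF homeomorphism_cont1[OF g] U open_box])
  then have "open (U \<inter> V \<inter> \<psi> -` box a0 c0)"
    using trivD(1)[OF t] by (metis Int_assoc Int_commute open_Int)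
  then show ?thesis using ae pU pV K(2) by (intro exI[of _ "U \<inter> V \<inter> \<psi> -` box a0 c0"]) auto
qed

lemma orth_Ccc:
  assumes U: "U \<in> vecs HL" and C: "\<And>f. f \<in> Ccc B \<Longrightarrow> aecls B f \<in> vecs HL \<and> ip HL (aecls B f) U = 0"
  shows "U = zer HL"
proof (rule vecs_eqI[OF U zer_HL(1)])
  let ?u = "rep U"
  have u: "?u \<in> SQ" by (rule vecsD(1)[OF U])
  have z: "(\<integral>x. h x (f x) (?u x) \<partial>M) = 0" if f: "f \<in> Ccc B" for f
  proof -
    note v = conjunct1[OF C[OF f]]
    note S = Ccc_SQ[OF f v]
    have "ip HL (aecls B f) U = (\<integral>x. h x (f x) (?u x) \<partial>M)"
      by (rule ip_HL_cong[OF S(2) _ vecs_L0[OF v] SQ_L0[OF u] SQ_L0[OF S(1)] SQ_L0[OF u]]) simp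
    then show ?thesis using C[OF f] by simp
  qed
  let ?I = "manifold_interior (atlas B)"
  have "\<forall>p\<in>?I. \<exists>O'. open O' \<and> p \<in> O' \<and> (AE x in M. x \<in> O' \<longrightarrow> ?u x = 0)"
    using orth_Ccc_local[OF u conjunct1[OF C] z] by blast
  from bchoice[OF this] obtain G where
    "\<forall>p\<in>?I. open (G p) \<and> p \<in> G p \<and> (AE x in M. x \<in> G p \<longrightarrow> ?u x = 0)" by (rule exE)
  then have G: "p \<in> ?I \<Longrightarrow> open (G p)" "p \<in> ?I \<Longrightarrow> p \<in> G p"
    "p \<in> ?I \<Longrightarrow> AE x in M. x \<in> G p \<longrightarrow> ?u x = 0" for p by simp_all
  obtain F where F: "F \<subseteq> G ` ?I" "countable F" "\<Union>F = \<Union>(G ` ?I)"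
    by (rule Lindelof[of "G ` ?I"]) (use G(1) in auto)
  have "AE x in M. \<forall>O'\<in>F. x \<in> O' \<longrightarrow> ?u x = 0"
  proof (rule AE_ball_countable[OF F(2), THEN iffD2], rule ballI)
    fix O' assume "O' \<in> F"
    then obtain p where "p \<in> ?I" "O' = G p" using F(1) by blast
    then show "AE x in M. x \<in> O' \<longrightarrow> ?u x = 0" using G(3) by simp
  qed
  moreover have "AE x in M. x \<in> ?I"
    using AE_not_in[of "- ?I" M] ae_manifold_interior by (simp add: null_sets_M)
  ultimately have "AE x in M. ?u x = 0"
  proof eventually_elim
    case (elim x)
    then have "x \<in> \<Union>F" unfolding F(3) using G(2)[of x] by blast
    then show ?case using elim(1) by blast
  qed
  then show "AE x in M. rep U x = rep (zer HL) x" using zer_HL(2) by eventually_elim simp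
qed

lemma extension_densely_defined:
  assumes e: "extension B HL D T" shows "densely_defined HL T"
proof -
  interpret hilb HL by (rule hilb_HL)
  have l: "lin_op HL T" and C: "\<And>f. f \<in> Ccc B \<Longrightarrow> aecls B f \<in> Domain T" using e by (auto simp: extension_def)
  have "U = zer HL" if U: "U \<in> orth HL (Domain T)" for U
  proof (rule orth_Ccc)
    show "U \<in> vecs HL" using U by (simp add: orth_def)
    show "aecls B f \<in> vecs HL \<and> ip HL (aecls B f) U = 0" if "f \<in> Ccc B" for f
      using C[OF that] U lin_opD(1)[OF l] by (auto simp: orth_def)
  qed
  then show ?thesis
    unfolding densely_defined_def using dense_iff_orth[OF lin_subspace_Domain[OF l]] by blast
qed

end


section \<open>Projections onto subbundles\<close>

text \<open>A linear map preserving X, Y and their common complement Z commutes with the projections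
  along Z, so these map fixed points to fixed points.\<close>

lemma (in hilb) top_iso_fixed_points:
  assumes X: "top_splitting H X Z" and Y: "top_splitting H Y Z"
    and P_in: "\<And>u. u \<in> vecs H \<Longrightarrow> P u \<in> vecs H"
    and P_add: "\<And>u v. u \<in> vecs H \<Longrightarrow> v \<in> vecs H \<Longrightarrow> P (add H u v) = add H (P u) (P v)"
    and P_scl: "\<And>c u. u \<in> vecs H \<Longrightarrow> P (scl H c u) = scl H c (P u)"
    and PX: "\<And>u. u \<in> X \<Longrightarrow> P u \<in> X" and PY: "\<And>u. u \<in> Y \<Longrightarrow> P u \<in> Y" and PZ: "\<And>u. u \<in> Z \<Longrightarrow> P u \<in> Z"
  shows "top_iso H {u \<in> X. P u = u} {u \<in> Y. P u = u} (proj_along H Y Z)"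
proof (rule top_iso_proj_along[OF X Y])
  have Pz: "P (zer H) = zer H"
  proof -
    have "P (scl H 0 (zer H)) = scl H 0 (P (zer H))" by (rule P_scl) simp
    moreover have "scl H 0 (P (zer H)) = zer H" by (rule ip_eqI) (use P_in in \<open>auto simp: ip_left\<close>)
    ultimately show ?thesis by simp
  qed
  have sub: "lin_subspace H {u \<in> A. P u = u}" if "top_splitting H A Z" for A
  proof -
    have "lin_subspace H A" using that by (simp add: top_splitting_def)
    then show ?thesis using Pz P_add P_scl by (auto simp: lin_subspace_def subset_iff)
  qed
  show "lin_subspace H {u \<in> X. P u = u}" "lin_subspace H {u \<in> Y. P u = u}" using sub X Y by blast+
  have fixed: "proj_along H A' Z u \<in> {u \<in> A'. P u = u}"
    if A: "top_splitting H A Z" and A': "top_splitting H A' Z" and PA': "\<And>u. u \<in> A' \<Longrightarrow> P u \<in> A'"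
      and u: "u \<in> {u \<in> A. P u = u}" for A A' u
  proof -
    have uA: "u \<in> A" "P u = u" using u by auto
    let ?f = "proj_along H A' Z u"
    obtain b where b: "b \<in> Z" "u = add H ?f b" using proj_along_inverse(3)[OF A A' uA(1)] by blast
    have f: "?f \<in> A'" by (rule proj_along_inverse(2)[OF A A' uA(1)])
    have "P (add H ?f b) = add H (P ?f) (P b)"
      by (rule P_add) (use top_splittingD(3,4)[OF A'] f b in auto)
    then have "u = add H (P ?f) (P b)" using b(2) uA(2) by simp
    then have "?f = P ?f" using top_splittingD(1)[OF A' PA'[OF f] PZ[OF b(1)]] by simp
    then show ?thesis using f by simp
  qed
  show "proj_along H Y Z u \<in> {u \<in> Y. P u = u}" if "u \<in> {u \<in> X. P u = u}" for u
    by (rule fixed[OF X Y PY that])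
  show "proj_along H X Z u \<in> {u \<in> X. P u = u}" if "u \<in> {u \<in> Y. P u = u}" for u
    by (rule fixed[OF Y X PX that])
qed auto

context vec_bundle begin

text \<open>A trivialisation carries \<open>W\<close> to a real linear subspace of a
  finite-dimensional space, and such subspaces are closed.\<close>

lemma fibre_subspace_closed:
  assumes p: "posdef h x" and W: "W \<subseteq> fibre B x" "0 \<in> W"
    "\<And>v w. v \<in> W \<Longrightarrow> w \<in> W \<Longrightarrow> v + w \<in> W" "\<And>c v. v \<in> W \<Longrightarrow> vscale B c v \<in> W"
    and s: "\<And>n. s n \<in> W" and u: "u \<in> fibre B x" and lim: "(\<lambda>n. fibre_norm h x (s n - u)) \<longlonglongrightarrow> 0"
  shows "u \<in> W"
proof -
  obtain U \<tau> where t: "(U, \<tau>) \<in> trivs B" "x \<in> U" by (rule ex_triv)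
  have "of_real r *s y = r *\<^sub>R y" for r and y :: "'k^'r"
    by (simp add: vec_eq_iff scaleR_conv_of_real[where 'a = 'k])
  then have \<tau>r: "r *\<^sub>R \<tau> x v = \<tau> x (vscale B (of_real r) v)" if "v \<in> W" for r v
    using trivD(4)[OF t] W(1) that by (simp add: subset_iff)
  have "subspace (\<tau> x ` W)"
    unfolding subspace_def
  proof (intro conjI ballI allI)
    show "0 \<in> \<tau> x ` W" using W(2) trivD(6)[OF t] by force
    show "y + z \<in> \<tau> x ` W" if yz: "y \<in> \<tau> x ` W" "z \<in> \<tau> x ` W" for y z
    proof -
      obtain v w where "v \<in> W" "w \<in> W" "y = \<tau> x v" "z = \<tau> x w" using yz by blast
      then have "y + z = \<tau> x (v + w)" using trivD(3)[OF t] W(1) by (simp add: subset_iff)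
      then show ?thesis using W(3)[OF \<open>v \<in> W\<close> \<open>w \<in> W\<close>] by blast
    qed
    show "r *\<^sub>R y \<in> \<tau> x ` W" if "y \<in> \<tau> x ` W" for r y
      using that \<tau>r W(4) by auto
  qed
  then have "closed (\<tau> x ` W)" by (rule closed_subspace)
  moreover have "\<tau> x (s n) \<in> \<tau> x ` W" for n using s by blast
  moreover have "(\<lambda>n. \<tau> x (s n)) \<longlonglongrightarrow> \<tau> x u"
    using fibre_tends_iff[OF p t subsetD[OF W(1) s] u] lim by simp
  ultimately have "\<tau> x u \<in> \<tau> x ` W" using closed_sequentially[of "\<tau> x ` W" "\<lambda>n. \<tau> x (s n)" "\<tau> x u"] by blast
  then obtain w where "w \<in> W" "\<tau> x u = \<tau> x w" by blast
  then show ?thesis using trivD(7)[OF t u] W(1) by blast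
qed

lemma subbundleD:
  assumes "subbundle B F"
  shows "F x \<subseteq> fibre B x" "0 \<in> F x" "v \<in> F x \<Longrightarrow> w \<in> F x \<Longrightarrow> v + w \<in> F x" "v \<in> F x \<Longrightarrow> vscale B c v \<in> F x"
proof -
  from assms[unfolded subbundle_def, THEN spec, of x] obtain t where
    t': "t \<in> trivs B" "case t of (U, \<tau>) \<Rightarrow> x \<in> U \<and> (\<exists>S. \<forall>x\<in>U. F x = {v \<in> fibre B x. \<forall>i. i \<notin> S \<longrightarrow> \<tau> x v $ i = 0})"
    by (rule bexE)
  obtain U \<tau> where Ut: "t = (U, \<tau>)" by (cases t)
  then have t: "(U, \<tau>) \<in> trivs B" "x \<in> U" using t' by simp_all
  from t'(2) Ut have "\<exists>S. \<forall>x\<in>U. F x = {v \<in> fibre B x. \<forall>i. i \<notin> S \<longrightarrow> \<tau> x v $ i = 0}" by simp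
  then obtain S where S: "\<forall>x\<in>U. F x = {v \<in> fibre B x. \<forall>i. i \<notin> S \<longrightarrow> \<tau> x v $ i = 0}" by (rule exE)
  have F: "F x = {v \<in> fibre B x. \<forall>i. i \<notin> S \<longrightarrow> \<tau> x v $ i = 0}" using S t(2) by blast
  show "F x \<subseteq> fibre B x" "0 \<in> F x" "v \<in> F x \<Longrightarrow> w \<in> F x \<Longrightarrow> v + w \<in> F x" "v \<in> F x \<Longrightarrow> vscale B c v \<in> F x"
    unfolding F using trivD(3,4,6)[OF t] by auto
qed

context
  fixes K :: nat and F :: "nat \<Rightarrow> 'm \<Rightarrow> 'v set" and j :: nat
  assumes ds: "bundle_direct_sum B K F" and j: "j \<in> {1..K}"
begin

lemma F_facts:
  assumes "l \<in> {1..K}"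
  shows "F l x \<subseteq> fibre B x" "0 \<in> F l x" "v \<in> F l x \<Longrightarrow> w \<in> F l x \<Longrightarrow> v + w \<in> F l x"
    "v \<in> F l x \<Longrightarrow> vscale B c v \<in> F l x"
proof -
  have "subbundle B (F l)" using ds assms by (simp add: bundle_direct_sum_def)
  note s = subbundleD[OF this]
  show "F l x \<subseteq> fibre B x" "0 \<in> F l x" "v \<in> F l x \<Longrightarrow> w \<in> F l x \<Longrightarrow> v + w \<in> F l x"
    "v \<in> F l x \<Longrightarrow> vscale B c v \<in> F l x" by (rule s; assumption)+
qed

definition complement :: "'m \<Rightarrow> 'v set" where
  "complement x = {(\<Sum>l\<in>{1..K} - {j}. g l) | g. \<forall>l\<in>{1..K} - {j}. g l \<in> F l x}"

lemma complement_facts: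
  "complement x \<subseteq> fibre B x" "0 \<in> complement x"
  "v \<in> complement x \<Longrightarrow> w \<in> complement x \<Longrightarrow> v + w \<in> complement x"
  "v \<in> complement x \<Longrightarrow> vscale B c v \<in> complement x"
proof -
  interpret vs: vector_space "vscale B" by (rule vs)
  show "complement x \<subseteq> fibre B x"
    unfolding complement_def
  proof (rule subsetI, elim CollectE exE conjE)
    fix v g assume v: "v = (\<Sum>l\<in>{1..K} - {j}. g l)" and g: "\<forall>l\<in>{1..K} - {j}. g l \<in> F l x"
    show "v \<in> fibre B x" unfolding v
    proof (rule fibre_sum)
      fix l assume l: "l \<in> {1..K} - {j}"
      show "g l \<in> fibre B x" by (rule subsetD[OF F_facts(1)[OF DiffD1[OF l]] bspec[OF g l]])
    qed
  qed
  show "0 \<in> complement x"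
    unfolding complement_def using F_facts(2) by (auto intro!: exI[of _ "\<lambda>l. 0"])
  show "v + w \<in> complement x" if vw: "v \<in> complement x" "w \<in> complement x"
  proof -
    obtain f g where fg: "v = (\<Sum>l\<in>{1..K} - {j}. f l)" "w = (\<Sum>l\<in>{1..K} - {j}. g l)"
      "\<forall>l\<in>{1..K} - {j}. f l \<in> F l x" "\<forall>l\<in>{1..K} - {j}. g l \<in> F l x"
      using vw unfolding complement_def by auto
    have "v + w = (\<Sum>l\<in>{1..K} - {j}. f l + g l)" unfolding fg(1,2) by (rule sum.distrib[symmetric])
    moreover have "f l + g l \<in> F l x" if "l \<in> {1..K} - {j}" for l
      using that fg(3,4) by (intro F_facts(3)) auto
    ultimately show ?thesis unfolding complement_def by blast
  qed
  show "vscale B c v \<in> complement x" if v: "v \<in> complement x"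
  proof -
    obtain f where f: "v = (\<Sum>l\<in>{1..K} - {j}. f l)" "\<forall>l\<in>{1..K} - {j}. f l \<in> F l x"
      using v unfolding complement_def by auto
    have "vscale B c v = (\<Sum>l\<in>{1..K} - {j}. vscale B c (f l))" unfolding f(1) by (rule vs.scale_sum_right)
    moreover have "vscale B c (f l) \<in> F l x" if "l \<in> {1..K} - {j}" for l
      using that f(2) by (intro F_facts(4)) auto
    ultimately show ?thesis unfolding complement_def by blast
  qed
qed

lemma fibre_proj_def': "fibre_proj K F j x v = (THE a. a \<in> F j x \<and> (\<exists>c\<in>complement x. v = a + c))"
  unfolding fibre_proj_def complement_def by (intro arg_cong[where f = The] ext) auto

lemma decomp_unique:
  assumes "a \<in> F j x" "c \<in> complement x" "a' \<in> F j x" "c' \<in> complement x" "a + c = a' + c'"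
  shows "a = a'"
proof -
  have "\<exists>G \<in> (\<Pi>\<^sub>E l\<in>{1..K}. F l x). G j = a \<and> a + c = (\<Sum>l\<in>{1..K}. G l)"
    if ac: "a \<in> F j x" "c \<in> complement x" for a c
  proof -
    obtain g where g: "\<forall>l\<in>{1..K} - {j}. g l \<in> F l x" "c = (\<Sum>l\<in>{1..K} - {j}. g l)"
      using ac(2) unfolding complement_def by blast
    \<comment> \<open>The restriction to the index set matters: uniqueness in a direct sum is stated
      for extensional families.\<close>
    let ?G = "\<lambda>l\<in>{1..K}. if l = j then a else g l"
    have "(\<Sum>l\<in>{1..K}. ?G l) = ?G j + (\<Sum>l\<in>{1..K} - {j}. ?G l)" using j by (intro sum.remove) auto
    also have "(\<Sum>l\<in>{1..K} - {j}. ?G l) = c" unfolding g(2) by (rule sum.cong) auto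
    finally show ?thesis using g(1) ac(1) j by (intro bexI[of _ ?G]) auto
  qed
  from this[OF assms(1,2)] this[OF assms(3,4)] obtain G G' where
    G: "G \<in> (\<Pi>\<^sub>E l\<in>{1..K}. F l x)" "G j = a" "a + c = (\<Sum>l\<in>{1..K}. G l)" and
    G': "G' \<in> (\<Pi>\<^sub>E l\<in>{1..K}. F l x)" "G' j = a'" "a' + c' = (\<Sum>l\<in>{1..K}. G' l)" by blast
  have "a + c \<in> fibre B x" by (intro fibre_add subsetD[OF F_facts(1)[OF j]] subsetD[OF complement_facts(1)] assms)
  then have "\<exists>!g. g \<in> (\<Pi>\<^sub>E l\<in>{1..K}. F l x) \<and> a + c = (\<Sum>l\<in>{1..K}. g l)"
    using ds by (simp add: bundle_direct_sum_def)
  then have "G = G'" using G G' assms(5) by metis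
  then show ?thesis using G(2) G'(2) by simp
qed

lemma fibre_projI: "a \<in> F j x \<Longrightarrow> c \<in> complement x \<Longrightarrow> fibre_proj K F j x (a + c) = a"
  unfolding fibre_proj_def' by (rule the_equality) (use decomp_unique in blast)+

lemma fibre_decomp:
  assumes "v \<in> fibre B x" obtains a c where "a \<in> F j x" "c \<in> complement x" "v = a + c"
proof -
  obtain g where g: "g \<in> (\<Pi>\<^sub>E l\<in>{1..K}. F l x)" "v = (\<Sum>l\<in>{1..K}. g l)"
    using ds assms unfolding bundle_direct_sum_def by blast
  have "v = g j + (\<Sum>l\<in>{1..K} - {j}. g l)" unfolding g(2) using j by (intro sum.remove) auto
  moreover have "g j \<in> F j x" using g(1) j by auto
  moreover have "(\<Sum>l\<in>{1..K} - {j}. g l) \<in> complement x" unfolding complement_def using g(1) by blast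
  ultimately show thesis using that by blast
qed

lemma fibre_proj_simps:
  assumes v: "v \<in> fibre B x" and w: "w \<in> fibre B x"
  shows "fibre_proj K F j x v \<in> F j x" "v - fibre_proj K F j x v \<in> complement x"
    "fibre_proj K F j x (v + w) = fibre_proj K F j x v + fibre_proj K F j x w"
    "fibre_proj K F j x (vscale B r v) = vscale B r (fibre_proj K F j x v)"
    "v \<in> F j x \<longleftrightarrow> fibre_proj K F j x v = v"
proof -
  interpret vs: vector_space "vscale B" by (rule vs)
  obtain a c where a: "a \<in> F j x" "c \<in> complement x" "v = a + c" by (rule fibre_decomp[OF v])
  obtain b d where b: "b \<in> F j x" "d \<in> complement x" "w = b + d" by (rule fibre_decomp[OF w])
  have pv: "fibre_proj K F j x v = a" and pw: "fibre_proj K F j x w = b"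
    using fibre_projI a b by auto
  show 1: "fibre_proj K F j x v \<in> F j x" using pv a by simp
  show "v - fibre_proj K F j x v \<in> complement x" using pv a by simp
  have "fibre_proj K F j x ((a + b) + (c + d)) = a + b"
    by (intro fibre_projI F_facts(3)[OF j] complement_facts(3) a b)
  then show "fibre_proj K F j x (v + w) = fibre_proj K F j x v + fibre_proj K F j x w"
    unfolding pv pw by (simp add: a(3) b(3) algebra_simps)
  have "fibre_proj K F j x (vscale B r a + vscale B r c) = vscale B r a"
    by (intro fibre_projI F_facts(4)[OF j] complement_facts(4) a)
  then show "fibre_proj K F j x (vscale B r v) = vscale B r (fibre_proj K F j x v)"
    unfolding pv by (simp add: a(3) vs.scale_right_distrib)
  show "v \<in> F j x \<longleftrightarrow> fibre_proj K F j x v = v"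
    using fibre_projI[OF _ complement_facts(2), of v x] 1 by auto
qed

text \<open>The limits w and u - w stay in the subspace and in its complement, both closed, and so
  form the decomposition of u. No bound for the projection enters; such bounds need not be uniform
  in x.\<close>

lemma fibre_proj_closed:
  assumes p: "posdef h x" and s: "\<And>n. s n \<in> fibre B x" and u: "u \<in> fibre B x" and w: "w \<in> fibre B x"
    and l: "(\<lambda>n. fibre_norm h x (s n - u)) \<longlonglongrightarrow> 0"
    and l': "(\<lambda>n. fibre_norm h x (fibre_proj K F j x (s n) - w)) \<longlonglongrightarrow> 0"
  shows "fibre_proj K F j x u = w"
proof -
  interpret hilb "fib h x" by (rule hilb_fib[OF p])
  let ?P = "fibre_proj K F j x"
  have P: "?P (s n) \<in> F j x" "?P (s n) \<in> fibre B x" "s n - ?P (s n) \<in> complement x" for n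
    using fibre_proj_simps(1,2)[OF s s] F_facts(1)[OF j] by blast+
  have "w \<in> F j x"
    by (rule fibre_subspace_closed[OF p F_facts[OF j] P(1) w l'])
  moreover have "tends (fib h x) (\<lambda>n. sub (fib h x) (s n) (?P (s n))) (sub (fib h x) u w)"
    by (rule tends_sub) (use l l' s P u w in \<open>simp_all add: tends_def\<close>)
  then have "u - w \<in> complement x"
    using fibre_subspace_closed[OF p complement_facts P(3) fibre_diff[OF u w]] by (simp add: tends_def)
  ultimately show ?thesis using fibre_projI[of w x "u - w"] by simp
qed

end

end

section \<open>Fibrewise projections acting on classes of sections\<close>

context l2_bundle begin

text \<open>The squared fibre norms of the differences converge to 0 in mean, so a subsequence
  converges almost everywhere. Only after this passage can fibrewise closedness be used.\<close>

lemma tends_AE_subseq: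
  assumes t: "tends HL s U" and s: "\<And>n. s n \<in> vecs HL" and U: "U \<in> vecs HL"
  obtains r :: "nat \<Rightarrow> nat" where "strict_mono r" "AE x in M. (\<lambda>n. fibre_norm h x (rep (s (r n)) x - rep U x)) \<longlonglongrightarrow> 0"
proof -
  let ?d = "\<lambda>n x. (fibre_norm h x (rep (s n) x - rep U x))\<^sup>2"
  have L: "(\<lambda>x. rep (s n) x - rep U x) \<in> L0 B" for n by (intro L0_diff vecs_L0 s U)
  have m: "?d n \<in> borel_measurable M" for n using fibre_norm_measurable[OF L] by measurable
  have i: "integrable M (?d n) \<and> integral\<^sup>L M (?d n) = (nrm HL (sub HL (s n) U))\<^sup>2" for n
    using nn_integral_eq_integrable[OF m, of n "(nrm HL (sub HL (s n) U))\<^sup>2"] sqn_sub[OF s U, of n]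
    by (simp add: sqn_def)
  have "(\<lambda>n. (nrm HL (sub HL (s n) U))\<^sup>2) \<longlonglongrightarrow> 0\<^sup>2" using t unfolding tends_def by (rule tendsto_power)
  then have "(\<lambda>n. \<integral>x. norm (?d n x) \<partial>M) \<longlonglongrightarrow> 0" using i by simp
  then obtain r :: "nat \<Rightarrow> nat" where r: "strict_mono r" "AE x in M. (\<lambda>n. ?d (r n) x) \<longlonglongrightarrow> 0"
    using tendsto_L1_AE_subseq[of M ?d] i by blast
  have "AE x in M. (\<lambda>n. fibre_norm h x (rep (s (r n)) x - rep U x)) \<longlonglongrightarrow> 0"
    using r(2)
  proof eventually_elim
    case (elim x)
    then have "(\<lambda>n. sqrt (?d (r n) x)) \<longlonglongrightarrow> sqrt 0" by (rule tendsto_real_sqrt)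
    then show ?case by (simp add: tendsto_rabs_zero_iff)
  qed
  then show thesis using that r(1) by blast
qed

context
  fixes K :: nat and F :: "nat \<Rightarrow> 'm \<Rightarrow> 'v set" and j :: nat
  assumes ds: "bundle_direct_sum B K F" and j: "j \<in> {1..K}"
begin

abbreviation "P \<equiv> bundle_proj B K F j"

text \<open>Projecting a square integrable section need not give a square integrable one, so
  membership of the image in the space appears as a hypothesis in the lemmas on P.\<close>

lemma rep_P: "P U \<in> vecs HL \<Longrightarrow> AE x in M. rep (P U) x = fibre_proj K F j x (rep U x)"
  unfolding bundle_proj_def by (rule rep_aecls_vecs)

lemma P_eqI:
  assumes W: "W \<in> vecs HL" and ae: "AE x in M. fibre_proj K F j x (rep U x) = rep W x"
  shows "P U = W"
  unfolding bundle_proj_def using aecls_cong[OF ae] vecsD(2)[OF W] by simp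

lemma P_add:
  assumes v: "U \<in> vecs HL" "V \<in> vecs HL" and P: "P U \<in> vecs HL" "P V \<in> vecs HL"
  shows "P (add HL U V) = add HL (P U) (P V)"
proof (rule P_eqI[OF add_HL(1)[OF P]])
  show "AE x in M. fibre_proj K F j x (rep (add HL U V) x) = rep (add HL (P U) (P V)) x"
    using add_HL(2)[OF v] add_HL(2)[OF P] rep_P[OF P(1)] rep_P[OF P(2)]
    by eventually_elim
       (simp add: fibre_proj_simps(3)[OF ds j L0_fibre[OF vecs_L0[OF v(1)]] L0_fibre[OF vecs_L0[OF v(2)]]])
qed

lemma P_scl:
  assumes v: "U \<in> vecs HL" and P: "P U \<in> vecs HL"
  shows "P (scl HL c U) = scl HL c (P U)"
proof (rule P_eqI[OF scl_HL(1)[OF P]])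
  note f = L0_fibre[OF vecs_L0[OF v]]
  show "AE x in M. fibre_proj K F j x (rep (scl HL c U) x) = rep (scl HL c (P U)) x"
    using scl_HL(2)[OF v, of c] scl_HL(2)[OF P, of c] rep_P[OF P]
    by eventually_elim (simp add: fibre_proj_simps(4)[OF ds j f f])
qed

lemma P_closed:
  assumes s: "\<And>n. s n \<in> vecs HL" and P: "\<And>n. P (s n) \<in> vecs HL" and v: "U \<in> vecs HL" "W \<in> vecs HL"
    and t: "tends HL s U" "tends HL (\<lambda>n. P (s n)) W"
  shows "P U = W"
proof -
  obtain r where r: "strict_mono r" "AE x in M. (\<lambda>n. fibre_norm h x (rep (s (r n)) x - rep U x)) \<longlonglongrightarrow> 0"
    by (rule tends_AE_subseq[OF t(1) s v(1)])
  \<comment> \<open>The second subsequence is taken inside the first, so that the sections and their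
    projections converge along the same indices.\<close>
  have "tends HL (\<lambda>n. P (s (r n))) W"
    using LIMSEQ_subseq_LIMSEQ[OF t(2)[unfolded tends_def] r(1)] by (simp add: tends_def o_def)
  then obtain q where q: "strict_mono q" "AE x in M. (\<lambda>n. fibre_norm h x (rep (P (s (r (q n)))) x - rep W x)) \<longlonglongrightarrow> 0"
    by (rule tends_AE_subseq[OF _ P v(2)])
  have "AE x in M. \<forall>n. rep (P (s n)) x = fibre_proj K F j x (rep (s n) x)"
    unfolding AE_all_countable using rep_P[OF P] by blast
  with r(2) q(2) AE_posdef have "AE x in M. fibre_proj K F j x (rep U x) = rep W x"
  proof eventually_elim
    case (elim x)
    show ?case
    proof (rule fibre_proj_closed[OF ds j elim(3)])
      show "(\<lambda>n. fibre_norm h x (rep (s (r (q n))) x - rep U x)) \<longlonglongrightarrow> 0"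
        using LIMSEQ_subseq_LIMSEQ[OF elim(1) q(1)] by (simp add: o_def)
      show "(\<lambda>n. fibre_norm h x (fibre_proj K F j x (rep (s (r (q n))) x) - rep W x)) \<longlonglongrightarrow> 0"
        using elim(2,4) by simp
    qed (intro L0_fibre vecs_L0 s v)+
  qed
  then show ?thesis by (rule P_eqI[OF v(2)])
qed

text \<open>The pointwise condition becomes the fixed point equation of P, the form that
  \<open>top_iso_fixed_points\<close> handles.\<close>

lemma ker_in_eq:
  assumes k: "ker HL T \<subseteq> vecs HL"
  shows "ker_in B HL T (F j) = {U \<in> ker HL T. P U = U}"
proof -
  have "ae (atlas B) (\<lambda>x. rep U x \<in> F j x) \<longleftrightarrow> P U = U" if U: "U \<in> vecs HL" for U
  proof
    note f = L0_fibre[OF vecs_L0[OF U]]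
    {
      assume "ae (atlas B) (\<lambda>x. rep U x \<in> F j x)"
      then have "AE x in M. fibre_proj K F j x (rep U x) = rep U x"
        unfolding ae_iff by (simp only: fibre_proj_simps(5)[OF ds j f f])
      then show "P U = U" by (rule P_eqI[OF U])
    next
      assume PU: "P U = U"
      then have "AE x in M. rep U x = fibre_proj K F j x (rep U x)" using rep_P[of U] U by simp
      then have "AE x in M. fibre_proj K F j x (rep U x) = rep U x" by eventually_elim (rule sym)
      then show "ae (atlas B) (\<lambda>x. rep U x \<in> F j x)"
        unfolding ae_iff by (simp only: fibre_proj_simps(5)[OF ds j f f])
    }
  qed
  then show ?thesis unfolding ker_in_def using k by blast
qed

end

end

lemma (in equiv_hilb) relpow_same:
  assumes "k \<ge> 1" "self_adjoint_op H T"
  shows "ker K (T ^^ k) = ker H T" "cl K (Range (T ^^ k)) = cl H (Range T)"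
proof -
  interpret selfadj H T using assms(2) hilb_axioms by (simp add: selfadj_def selfadj_axioms_def)
  show "ker K (T ^^ k) = ker H T" using ker_relpow[OF assms(1)] by (simp add: ker_same)
  have "Range (T ^^ k) \<subseteq> vecs H" using lin_opD(2)[OF lin_pow[OF assms(1)]] by blast
  then show "cl K (Range (T ^^ k)) = cl H (Range T)"
    using cl_Range_relpow[OF assms(1)] cl_same by simp
qed

section \<open>The theorem for two mutually bounded pairs\<close>

theorem theorem2p8:
  fixes B :: "('m::{t2_space, second_countable_topology}, 'n::finite, 'k::real_or_complex,
                'r::finite, 'v::ab_group_add) vbundle"
    and \<mu> :: "nat \<Rightarrow> 'm set \<Rightarrow> ennreal"
    and h :: "nat \<Rightarrow> 'm \<Rightarrow> 'v \<Rightarrow> 'v \<Rightarrow> 'k"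
    and D :: "('m \<Rightarrow> 'v) \<Rightarrow> ('m \<Rightarrow> 'v) set"
  assumes "smooth_bundle B"
    and "\<And>i. i \<in> {1, 2} \<Longrightarrow> LECM (atlas B) (\<mu> i)"
    and "\<And>i. i \<in> {1, 2} \<Longrightarrow> RHM B (h i)"
    and "measures_mutually_bounded (atlas B) (\<mu> 1) (\<mu> 2)"
    and "metrics_mutually_bounded B (h 1) (h 2)"
    and "rough_diffop B D"
  shows
    "let H = (\<lambda>i. L2 B (\<mu> i) (h i)) in
       vecs (H 1) = vecs (H 2) \<and>
       (\<exists>C\<ge>1::real. \<forall>u\<in>vecs (H 1). nrm (H 1) u / C \<le> nrm (H 2) u \<and> nrm (H 2) u \<le> C * nrm (H 1) u) \<and>
       (\<forall>De. extension B (H 1) D De \<longleftrightarrow> extension B (H 2) D De) \<and>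
       (\<forall>De. extension B (H 1) D De \<longrightarrow>
          (closed_op (H 1) De \<and> nilpotent_op (H 1) De \<longleftrightarrow>
           closed_op (H 2) De \<and> nilpotent_op (H 2) De)) \<and>
       (\<forall>De. extension B (H 1) D De \<and> closed_op (H 1) De \<and> nilpotent_op (H 1) De \<longrightarrow>
         (let \<DD> = (\<lambda>i. dirac (H i) De) in
           \<comment> \<open>(i)\<close>
           (\<forall>i\<in>{1, 2}.
              self_adjoint_op (H i) (\<DD> i) \<and> densely_defined (H i) (\<DD> i) \<and> closed_op (H i) (\<DD> i) \<and>
              (\<forall>j\<in>{1, 2}. bisectorial (H j) (\<DD> i))) \<and>
           \<comment> \<open>(ii), (iii), (iv), for the topology given by either of the two norms\<close>
           (\<forall>n\<in>{1, 2}.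
             (\<forall>k\<ge>1. \<forall>i\<in>{1, 2}. ker (H n) (\<DD> i ^^ k) = ker (H n) (\<DD> i)) \<and>
             (\<forall>l\<ge>1. \<forall>i\<in>{1, 2}. cl (H n) (Range (\<DD> i ^^ l)) = cl (H n) (Range (\<DD> i))) \<and>
             (\<forall>k\<ge>1. \<forall>l\<ge>1.
                top_splitting (H n) (ker (H n) (\<DD> 1 ^^ k)) (cl (H n) (Range (\<DD> 1 ^^ l)))) \<and>
             (\<forall>k'\<ge>1. \<forall>l'\<ge>1.
                top_splitting (H n) (ker (H n) (\<DD> 2 ^^ k')) (cl (H n) (Range (\<DD> 1 ^^ l')))) \<and>
             (let \<Phi> = proj_along (H n) (ker (H n) (\<DD> 1)) (cl (H n) (Range (\<DD> 1)));
                  \<Psi> = proj_along (H n) (ker (H n) (\<DD> 2)) (cl (H n) (Range (\<DD> 1)))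
              in
                top_iso (H n) (ker (H n) (\<DD> 2)) (ker (H n) (\<DD> 1)) \<Phi> \<and>
                (\<forall>v\<in>ker (H n) (\<DD> 1). inv_into (ker (H n) (\<DD> 2)) \<Phi> v = \<Psi> v) \<and>
                (\<forall>K F. bundle_direct_sum B K F \<and>
                   (\<exists>k\<ge>1. \<forall>i\<in>{1, 2}. \<forall>j\<in>{1..K}. commutes_with (\<DD> i ^^ k) (bundle_proj B K F j)) \<longrightarrow>
                   (\<forall>j\<in>{1..K}.
                      top_iso (H n) (ker_in B (H n) (\<DD> 2) (F j)) (ker_in B (H n) (\<DD> 1) (F j)) \<Phi>))))))"
proof -
  let ?H = "\<lambda>i. L2 B (\<mu> i) (h i)"
  have l2: "l2_bundle B (\<mu> i) (h i)" if "i \<in> {1, 2}" for i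
    using assms(1-3) that by (simp add: l2_bundle_def vec_bundle_def l2_bundle_axioms_def)
  have hilb: "hilb (?H i)" if "i \<in> {1, 2}" for i by (rule l2_bundle.hilb_HL[OF l2[OF that]])
  have e12: "equiv_ip (?H 1) (?H 2)" by (rule equiv_ip_L2[OF l2 l2 assms(4,5)]) simp_all
  have E: "equiv_hilb (?H i) (?H j)" if "i \<in> {1, 2}" "j \<in> {1, 2}" for i j
  proof -
    have "equiv_ip (?H i) (?H j)" using that e12 equiv_ip_sym[OF e12] equiv_ip_refl by auto
    then show ?thesis
      using hilb[OF that(1)] hilb[OF that(2)] by (simp only: equiv_hilb_def equiv_hilb_axioms_def simp_thms)
  qed
  have in12: "1 \<in> {1, 2 :: nat}" "2 \<in> {1, 2 :: nat}" by simp_all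
  interpret E12: equiv_hilb "?H 1" "?H 2" by (rule E[OF in12])
  interpret E21: equiv_hilb "?H 2" "?H 1" by (rule E[OF in12(2,1)])
  have closed_nil: "closed_op (?H 1) De \<and> nilpotent_op (?H 1) De \<longleftrightarrow> closed_op (?H 2) De \<and> nilpotent_op (?H 2) De" for De
    using E12.closed_op_imp E21.closed_op_imp E12.nilpotent_op_same by blast
  have ext: "extension B (?H 1) D De \<longleftrightarrow> extension B (?H 2) D De" for De
    by (simp add: extension_def E12.lin_op_same)
  show ?thesis unfolding Let_def
  proof (intro conjI allI impI)
    show "vecs (?H 1) = vecs (?H 2)" "\<exists>C\<ge>1::real. \<forall>u\<in>vecs (?H 1). nrm (?H 1) u / C \<le> nrm (?H 2) u \<and> nrm (?H 2) u \<le> C * nrm (?H 1) u"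
      using e12 by (simp_all add: equiv_ip_def)
  next
    fix De
    assume De: "extension B (?H 1) D De \<and> closed_op (?H 1) De \<and> nilpotent_op (?H 1) De"
    let ?D = "\<lambda>i. dirac (?H i) De"
    have N: "nilpotent_closed (?H i) De" if i: "i \<in> {1, 2}" for i
    proof -
      have "extension B (?H i) D De" "closed_op (?H i) De \<and> nilpotent_op (?H i) De"
        using De i closed_nil ext by auto
      then show ?thesis
        using l2_bundle.extension_densely_defined[OF l2[OF i]] hilb[OF i]
        by (simp add: nilpotent_closed_def nilpotent_closed_axioms_def)
    qed
    have sa: "self_adjoint_op (?H i) (?D i)" if "i \<in> {1, 2}" for i
      by (rule nilpotent_closed.self_adjoint_dirac[OF N[OF that]])
    have S: "selfadj (?H i) (?D i)" if "i \<in> {1, 2}" for i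
      by (rule nilpotent_closed.selfadj_dirac[OF N[OF that]])
    have dd: "densely_defined (?H i) (?D i)" and cls: "closed_op (?H i) (?D i)" if "i \<in> {1, 2}" for i
      by (rule selfadj.dd[OF S[OF that]], rule selfadj.cls[OF S[OF that]])
    have bis: "bisectorial (?H j) (?D i)" if "i \<in> {1, 2}" "j \<in> {1, 2}" for i j
      by (rule equiv_hilb.bisectorial_selfadj[OF E[OF that] sa[OF that(1)]])
    have ker: "ker (?H n) T = ker (?H 1) T" if "n \<in> {1, 2}" for n T
      using equiv_hilb.ker_same[OF E[OF in12(1) that]] by simp
    have kerk: "ker (?H n) (?D i ^^ k) = ker (?H n) (?D i)"
      and clk: "cl (?H n) (Range (?D i ^^ k)) = cl (?H n) (Range (?D i))"
      if "n \<in> {1, 2}" "i \<in> {1, 2}" "k \<ge> 1" for n i k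
      using equiv_hilb.relpow_same[OF E[OF that(2,1)] _ sa[OF that(2)], of k]
        equiv_hilb.relpow_same[OF E[OF that(2,1)] _ sa[OF that(2)], of 1] that(3) by simp_all
    have cl: "cl (?H n) (Range (?D 1)) = cl (?H 1) (Range (?D 1))" if "n \<in> {1, 2}" for n
      using equiv_hilb.relpow_same(2)[OF E[OF in12(1) that] _ sa[OF in12(1)], of 1] by simp
    let ?Z = "cl (?H 1) (Range (?D 1))"
    \<comment> \<open>The first inner product is kept and the second slot of the lemma runs over
      both. For i = 1 this is the orthogonal splitting, for i = 2 the mixed one, and the complement
      is the same.\<close>
    have split1: "top_splitting (?H 1) (ker (?H 1) (?D i)) ?Z" if "i \<in> {1, 2}" for i
      by (rule equiv_hilb.dirac_splitting[OF E[OF in12(1) that] N[OF in12(1)]])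
    have split: "top_splitting (?H n) (ker (?H n) (?D i ^^ k)) (cl (?H n) (Range (?D 1 ^^ l)))"
      if n: "n \<in> {1, 2}" "i \<in> {1, 2}" "k \<ge> 1" "l \<ge> 1" for n i k l
      unfolding kerk[OF n(1-3)] clk[OF n(1) in12(1) n(4)]
      unfolding ker[OF n(1)] cl[OF n(1)]
      by (rule equiv_hilb.top_splitting_imp[OF E[OF in12(1) n(1)] split1[OF n(2)]])
    have pa: "proj_along (?H n) = proj_along (?H 1)" if "n \<in> {1, 2}" for n
      by (rule equiv_hilb.proj_along_same[OF E[OF in12(1) that]])
    note S1 = split1[OF in12(1)] and S2 = split1[OF in12(2)]
    have lk: "lin_subspace (?H 1) (ker (?H 1) (?D i))" if "i \<in> {1, 2}" for i
      using split1[OF that] by (simp add: top_splitting_def)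
    have iso: "top_iso (?H n) (ker (?H n) (?D 2)) (ker (?H n) (?D 1))
        (proj_along (?H n) (ker (?H n) (?D 1)) (cl (?H n) (Range (?D 1))))" if n: "n \<in> {1, 2}" for n
      unfolding ker[OF n] cl[OF n] pa[OF n]
      by (rule equiv_hilb.top_iso_imp[OF E[OF in12(1) n]], rule E12.top_iso_proj_along[OF S2 S1 lk[OF in12(2)] subset_refl lk[OF in12(1)] subset_refl])
         (rule E12.proj_along_inverse(2)[OF S2 S1], assumption, rule E12.proj_along_inverse(2)[OF S1 S2], assumption)
    have inv: "inv_into (ker (?H n) (?D 2)) (proj_along (?H n) (ker (?H n) (?D 1)) (cl (?H n) (Range (?D 1)))) v
        = proj_along (?H n) (ker (?H n) (?D 2)) (cl (?H n) (Range (?D 1))) v"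
      if n: "n \<in> {1, 2}" and v: "v \<in> ker (?H n) (?D 1)" for n v
    proof (rule inv_into_f_eq)
      show "inj_on (proj_along (?H n) (ker (?H n) (?D 1)) (cl (?H n) (Range (?D 1)))) (ker (?H n) (?D 2))"
        using iso[OF n] by (simp add: top_iso_def bij_betw_def)
      have v1: "v \<in> ker (?H 1) (?D 1)" using v ker[OF n] by simp
      show "proj_along (?H n) (ker (?H n) (?D 2)) (cl (?H n) (Range (?D 1))) v \<in> ker (?H n) (?D 2)"
        unfolding ker[OF n] cl[OF n] pa[OF n] by (rule E12.proj_along_inverse(2)[OF S1 S2 v1])
      show "proj_along (?H n) (ker (?H n) (?D 1)) (cl (?H n) (Range (?D 1)))
          (proj_along (?H n) (ker (?H n) (?D 2)) (cl (?H n) (Range (?D 1))) v) = v"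
        unfolding ker[OF n] cl[OF n] pa[OF n] by (rule E12.proj_along_inverse(1)[OF S1 S2 v1])
    qed
    have iv: "top_iso (?H n) (ker_in B (?H n) (?D 2) (F j)) (ker_in B (?H n) (?D 1) (F j))
        (proj_along (?H n) (ker (?H n) (?D 1)) (cl (?H n) (Range (?D 1))))"
      if n: "n \<in> {1, 2}" and F: "bundle_direct_sum B K F \<and>
          (\<exists>k\<ge>1. \<forall>i\<in>{1, 2}. \<forall>j\<in>{1..K}. commutes_with (?D i ^^ k) (bundle_proj B K F j))"
        and j: "j \<in> {1..K}" for n K F j
    proof -
      have ds: "bundle_direct_sum B K F" using F by blast
      obtain k where k: "k \<ge> 1" "\<forall>i\<in>{1, 2}. \<forall>j\<in>{1..K}. commutes_with (?D i ^^ k) (bundle_proj B K F j)"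
        using F by blast
      let ?P = "bundle_proj B K F j"
      have comm: "commutes_with (?D i ^^ k) ?P" if "i \<in> {1, 2}" for i using k(2) that j by blast
      note P_add = l2_bundle.P_add[OF l2 ds j] and P_scl = l2_bundle.P_scl[OF l2 ds j]
        and P_closed = l2_bundle.P_closed[OF l2 ds j]
      \<comment> \<open>Each pair has its own operator and resolvents, so the lemma is applied for
        both values of i. From i = 1 come the first kernel and the common complement, from i = 2 the
        second kernel.\<close>
      note pres = selfadj.commutes_with_preserves[OF S k(1) comm]
      have P_in: "?P u \<in> vecs (?H i)" if i: "i \<in> {1, 2}" and u: "u \<in> vecs (?H i)" for i u
        by (rule pres(1)[OF i i _ _ _ u]) (rule P_add[OF i] P_scl[OF i] P_closed[OF i]; assumption)+
      have P_ker: "?P u \<in> ker (?H i) (?D i)" if i: "i \<in> {1, 2}" and u: "u \<in> ker (?H i) (?D i)" for i u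
        by (rule pres(3)[OF i i _ _ _ u]) (rule P_add[OF i] P_scl[OF i] P_closed[OF i]; assumption)+
      have P_cl: "?P u \<in> cl (?H i) (Range (?D i))" if i: "i \<in> {1, 2}" and u: "u \<in> cl (?H i) (Range (?D i))" for i u
        by (rule pres(2)[OF i i _ _ _ u]) (rule P_add[OF i] P_scl[OF i] P_closed[OF i]; assumption)+
      have kv: "ker (?H 1) (?D i) \<subseteq> vecs (?H 1)" if "i \<in> {1, 2}" for i
        using lk[OF that] by (simp add: lin_subspace_def)
      have kin: "ker_in B (?H n) (?D i) (F j) = {u \<in> ker (?H 1) (?D i). ?P u = u}" if "i \<in> {1, 2}" for i
        using l2_bundle.ker_in_eq[OF l2[OF in12(1)] ds j kv[OF that]] ker[OF n] by (simp add: ker_in_def)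
      have P_ker1: "?P u \<in> ker (?H 1) (?D i)" if "i \<in> {1, 2}" "u \<in> ker (?H 1) (?D i)" for i u
        using P_ker[OF that(1)] that(2) ker[OF that(1)] by simp
      have "top_iso (?H 1) {u \<in> ker (?H 1) (?D 2). ?P u = u} {u \<in> ker (?H 1) (?D 1). ?P u = u}
          (proj_along (?H 1) (ker (?H 1) (?D 1)) ?Z)"
      proof (rule E12.top_iso_fixed_points[OF S2 S1])
        show "?P (add (?H 1) u v) = add (?H 1) (?P u) (?P v)" if "u \<in> vecs (?H 1)" "v \<in> vecs (?H 1)" for u v
          by (rule P_add[OF in12(1) that P_in[OF in12(1) that(1)] P_in[OF in12(1) that(2)]])
        show "?P (scl (?H 1) c u) = scl (?H 1) c (?P u)" if "u \<in> vecs (?H 1)" for c u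
          by (rule P_scl[OF in12(1) that P_in[OF in12(1) that]])
      qed (rule P_in[OF in12(1)] P_ker1[OF in12(2)] P_ker1[OF in12(1)] P_cl[OF in12(1)]; assumption)+
      then show ?thesis
        unfolding kin[OF in12(1)] kin[OF in12(2)] ker[OF n] cl[OF n] pa[OF n]
        by (rule equiv_hilb.top_iso_imp[OF E[OF in12(1) n]])
    qed
    show "(\<forall>i\<in>{1, 2}. self_adjoint_op (?H i) (?D i) \<and> densely_defined (?H i) (?D i) \<and> closed_op (?H i) (?D i) \<and>
        (\<forall>j\<in>{1, 2}. bisectorial (?H j) (?D i)))"
      by (intro ballI conjI sa dd cls bis)
    show "\<forall>n\<in>{1, 2}. (\<forall>k\<ge>1. \<forall>i\<in>{1, 2}. ker (?H n) (?D i ^^ k) = ker (?H n) (?D i)) \<and>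
       (\<forall>l\<ge>1. \<forall>i\<in>{1, 2}. cl (?H n) (Range (?D i ^^ l)) = cl (?H n) (Range (?D i))) \<and>
       (\<forall>k\<ge>1. \<forall>l\<ge>1. top_splitting (?H n) (ker (?H n) (?D 1 ^^ k)) (cl (?H n) (Range (?D 1 ^^ l)))) \<and>
       (\<forall>k'\<ge>1. \<forall>l'\<ge>1. top_splitting (?H n) (ker (?H n) (?D 2 ^^ k')) (cl (?H n) (Range (?D 1 ^^ l')))) \<and>
       top_iso (?H n) (ker (?H n) (?D 2)) (ker (?H n) (?D 1))
         (proj_along (?H n) (ker (?H n) (?D 1)) (cl (?H n) (Range (?D 1)))) \<and>
       (\<forall>v\<in>ker (?H n) (?D 1). inv_into (ker (?H n) (?D 2)) (proj_along (?H n) (ker (?H n) (?D 1)) (cl (?H n) (Range (?D 1)))) v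
         = proj_along (?H n) (ker (?H n) (?D 2)) (cl (?H n) (Range (?D 1))) v) \<and>
       (\<forall>K F. bundle_direct_sum B K F \<and>
          (\<exists>k\<ge>1. \<forall>i\<in>{1, 2}. \<forall>j\<in>{1..K}. commutes_with (?D i ^^ k) (bundle_proj B K F j)) \<longrightarrow>
          (\<forall>j\<in>{1..K}. top_iso (?H n) (ker_in B (?H n) (?D 2) (F j)) (ker_in B (?H n) (?D 1) (F j))
             (proj_along (?H n) (ker (?H n) (?D 1)) (cl (?H n) (Range (?D 1))))))"
      by (rule ballI, intro conjI allI impI ballI kerk clk split[OF _ in12(1)] split[OF _ in12(2)] iso inv iv)
        (assumption | erule conjunct1 conjunct2)+
  qed (use ext closed_nil in blast)+
qed

end
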